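(* Let $\Omega\subset\mathbb{H}^1$ be a bounded domain, $f\in L^2(\Omega)$, and let $A=[a_{ij}]_{i,j=1}^2:\mathbb{H}^1\to M_{2\times2}(\mathbb{R})$ have bounded, measurable, $Y$-periodic entries and satisfy, for some constants $\alpha,\beta>0$, $\|A(x)v\|\le\beta\|v\|$ and $\langle A(x)v,v\rangle\ge\alpha\|v\|^2$ for all $x\in\mathbb{H}^1$, $v\in\mathbb{R}^2$. For $\varepsilon>0$ put $A^\varepsilon(x)=A(\delta_{1/\varepsilon}(x))$ and let $u_\varepsilon\in H^1_{\mathbb{H}}(\Omega)$ be the unique solution of $$\int_\Omega A^\varepsilon\nabla_{\mathbb{H}}u_\varepsilon\cdot\nabla_{\mathbb{H}}\phi\,dx+\int_\Omega u_\varepsilon\phi\,dx=\int_\Omega f\phi\,dx\qquad\text{for all }\phi\in H^1_{\mathbb{H}}(\Omega),$$ i.e. the weak solution of $-\mathrm{div}_{\mathbb{H}}(A^\varepsilon\nabla_{\mathbb{H}}u_\varepsilon)+u_\varepsilon=f$ in $\Omega$ with the homogeneous Neumann condition on $\partial\Omega$. Then, as $\varepsilon\to0$, $$T^\varepsilon(u_\varepsilon)\to u\ \text{ strongly in }L^2(\Omega\times Y),\qquad T^\varepsilon(\nabla_{\mathbb{H}}u_\varepsilon)\rightharpoonup\nabla_{\mathbb{H}}u+\nabla_{\mathbb{H},y}u_1\ \text{ weakly in }(L^2(\Omega\times Y))^2,$$ where $u\in H^1_{\mathbb{H}}(\Omega)$ is independent of $y$, and $(u,u_1)\in H^1_{\mathbb{H}}(\Omega)\times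 L^2(\Omega;H^1_{\#,\mathbb{H}}(Y)/\mathbb{R})$ satisfies $$\int_{\Omega\times Y}A(y)\big(\nabla_{\mathbb{H}}u(x)+\nabla_{\mathbb{H},y}u_1(x,y)\big)\cdot\big(\nabla_{\mathbb{H}}\phi(x)+\nabla_{\mathbb{H},y}\phi_1(x,y)\big)\,dx\,dy+\int_{\Omega\times Y}u(x)\phi(x)\,dx\,dy=\int_{\Omega\times Y}f(x)\phi(x)\,dx\,dy$$ for all $(\phi,\phi_1)\in H^1_{\mathbb{H}}(\Omega)\times L^2(\Omega;H^1_{\#,\mathbb{H}}(Y)/\mathbb{R})$.
   Context: $\mathbb{H}^1$ is $\mathbb{R}^3$ with the group law $p\cdot q=(p_1+q_1,p_2+q_2,p_3+q_3+2(p_2q_1-p_1q_2))$, dilations $\delta_\lambda(x)=(\lambda x_1,\lambda x_2,\lambda^2x_3)$ for $\lambda>0$, and Lebesgue measure. The horizontal vector fields are $X_1=\partial_{x_1}+2x_2\partial_{x_3}$ and $X_2=\partial_{x_2}-2x_1\partial_{x_3}$; $\nabla_{\mathbb{H}}f=(X_1f,X_2f)$ and $\mathrm{div}_{\mathbb{H}}(\phi_1,\phi_2)=X_1\phi_1+X_2\phi_2$ (in the distributional sense). $\nabla_{\mathbb{H},y}=(Y_1,Y_2)$ is the same operator in the variable $y$: $Y_1=\partial_{y_1}+2y_2\partial_{y_3}$, $Y_2=\partial_{y_2}-2y_1\partial_{y_3}$. $H^1_{\mathbb{H}}(\Omega)=\{f\in L^2(\Omega): X_1f,X_2f\in L^2(\Omega)\}$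 with its natural Hilbert norm. $Y=[0,2)^3$. For $k\in\mathbb{Z}^3$, $2k=(2k_1,2k_2,2k_3)$. A function $f$ on $\mathbb{H}^1$ is $Y$-periodic if $f(2k\cdot x)=f(x)$ for all $k\in\mathbb{Z}^3$ and all $x$. $L^2_{\#,\mathbb{H}}(Y)$ is the space of $Y$-periodic functions with $f|_Y\in L^2(Y)$. $H^1_{\#,\mathbb{H}}(Y)$ is the space of $f\in L^2_{\#,\mathbb{H}}(Y)$ such that $X_1f,X_2f\in L^2(\delta_\lambda(Y))$ for all $\lambda>0$, normed by $\|f\|_{L^2(Y)}$ and $\|X_if\|_{L^2(Y)}$; $/\mathbb{R}$ denotes the quotient by constants. For $\varepsilon>0$ the sets $Y^\varepsilon_k=\delta_\varepsilon(2k\cdot Y)$, $k\in\mathbb{Z}^3$, tile $\mathbb{H}^1$ (they are disjoint and cover it). For $x\in\mathbb{H}^1$, $[\delta_{1/\varepsilon}x]_{\mathbb{H}}\in\mathbb{Z}^3$ is the unique $k$ with $x\in Y^\varepsilon_k$. Let $E_\varepsilon=\{k\in\mathbb{Z}^3:Y^\varepsilon_k\subset\Omega\}$, $\Omega_\varepsilon=\bigcup_{k\in E_\varepsilon}Y^\varepsilon_k$, $\Lambda_\varepsilon=\Omega\setminus\Omega_\varepsilon$. The unfolding of $\phi:\Omega\to\mathbb{R}$ is $T^\varepsilon(\phi):\Omega\times Y\to\mathbb{R}$, with $T^\varepsilon(\phi)(x,y)=\phi\big(\delta_\varepsilon(2[\delta_{1/\varepsilon}x]_{\mathbb{H}})\cdot\delta_\varepsilon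 y\big)$ for $(x,y)\in\Omega_\varepsilon\times Y$ and $T^\varepsilon(\phi)(x,y)=0$ for $(x,y)\in\Lambda_\varepsilon\times Y$; it acts componentwise on vector-valued functions. *)

theory Defs
  imports "HOL-Analysis.Analysis"
begin

definition hmul :: "real^3 \<Rightarrow> real^3 \<Rightarrow> real^3"  (infixl "\<odot>" 70) where
  "p \<odot> q = vector [p$1 + q$1, p$2 + q$2, p$3 + q$3 + 2 * (p$2 * q$1 - p$1 * q$2)]"

definition dil :: "real \<Rightarrow> real^3 \<Rightarrow> real^3" where
  "dil l x = vector [l * x$1, l * x$2, l\<^sup>2 * x$3]"

definition lat :: "int^3 \<Rightarrow> real^3" where
  "lat k = (\<chi> i. 2 * real_of_int (k$i))"

definition Ycell :: "(real^3) set" where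
  "Ycell = {y. \<forall>i. 0 \<le> y$i \<and> y$i < 2}"

definition Y_periodic :: "(real^3 \<Rightarrow> 'b) \<Rightarrow> bool" where
  "Y_periodic f \<longleftrightarrow> (\<forall>k x. f (lat k \<odot> x) = f x)"

definition pd :: "3 \<Rightarrow> (real^3 \<Rightarrow> real) \<Rightarrow> real^3 \<Rightarrow> real" where
  "pd i f x = frechet_derivative f (at x) (axis i 1)"

definition X1 :: "(real^3 \<Rightarrow> real) \<Rightarrow> real^3 \<Rightarrow> real" where
  "X1 f x = pd 1 f x + 2 * x$2 * pd 3 f x"

definition X2 :: "(real^3 \<Rightarrow> real) \<Rightarrow> real^3 \<Rightarrow> real" where
  "X2 f x = pd 2 f x - 2 * x$1 * pd 3 f x"

primrec Ck :: "nat \<Rightarrow> (real^3 \<Rightarrow> real) \<Rightarrow> bool" where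
  "Ck 0 f \<longleftrightarrow> continuous_on UNIV f"
| "Ck (Suc n) f \<longleftrightarrow> (\<forall>x. f differentiable (at x)) \<and> (\<forall>i. Ck n (pd i f))"

definition test_functions :: "(real^3) set \<Rightarrow> (real^3 \<Rightarrow> real) set" where
  "test_functions \<Omega> =
     {\<phi>. (\<forall>n. Ck n \<phi>) \<and> compact (closure {x. \<phi> x \<noteq> 0}) \<and> closure {x. \<phi> x \<noteq> 0} \<subseteq> \<Omega>}"

text \<open>The fields are divergence free for Lebesgue measure, so the distributional derivatives of
  \<^term>\<open>f\<close> are obtained by moving the field to the test function with a minus sign.\<close>

definition weak_hgrad :: "(real^3) set \<Rightarrow> (real^3 \<Rightarrow> real) \<Rightarrow> (real^3 \<Rightarrow> real^2) \<Rightarrow> bool" where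
  "weak_hgrad \<Omega> f G \<longleftrightarrow>
     (\<forall>K. compact K \<and> K \<subseteq> \<Omega> \<longrightarrow> f absolutely_integrable_on K \<and> G absolutely_integrable_on K) \<and>
     (\<forall>\<phi>\<in>test_functions \<Omega>.
        (LINT x|lebesgue_on \<Omega>. f x * X1 \<phi> x) = - (LINT x|lebesgue_on \<Omega>. G x $ 1 * \<phi> x) \<and>
        (LINT x|lebesgue_on \<Omega>. f x * X2 \<phi> x) = - (LINT x|lebesgue_on \<Omega>. G x $ 2 * \<phi> x))"

text \<open>A representative of the distributional horizontal gradient; for open \<^term>\<open>\<Omega>\<close> it is unique
  up to null sets.\<close>

definition hgrad :: "(real^3) set \<Rightarrow> (real^3 \<Rightarrow> real) \<Rightarrow> real^3 \<Rightarrow> real^2" where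
  "hgrad \<Omega> f = (SOME G. weak_hgrad \<Omega> f G)"

text \<open>Elements of all spaces are represented by functions, without identifying those that agree
  almost everywhere; values outside the domain are irrelevant.\<close>

definition L2 :: "'a::euclidean_space set \<Rightarrow> ('a \<Rightarrow> 'b::euclidean_space) set" where
  "L2 S = {f. f \<in> borel_measurable (lebesgue_on S) \<and>
              integrable (lebesgue_on S) (\<lambda>x. (norm (f x))\<^sup>2)}"

definition L2_norm :: "'a::euclidean_space set \<Rightarrow> ('a \<Rightarrow> 'b::euclidean_space) \<Rightarrow> real" where
  "L2_norm S f = sqrt (LINT x|lebesgue_on S. (norm (f x))\<^sup>2)"

definition L2_strong :: "'a::euclidean_space set \<Rightarrow> ('i \<Rightarrow> 'a \<Rightarrow> 'b::euclidean_space) \<Rightarrow>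
    ('a \<Rightarrow> 'b) \<Rightarrow> 'i filter \<Rightarrow> bool" where
  "L2_strong S f g F \<longleftrightarrow> (\<forall>\<^sub>F i in F. f i \<in> L2 S) \<and> g \<in> L2 S \<and>
     ((\<lambda>i. L2_norm S (\<lambda>x. f i x - g x)) \<longlongrightarrow> 0) F"

definition L2_weak :: "'a::euclidean_space set \<Rightarrow> ('i \<Rightarrow> 'a \<Rightarrow> 'b::euclidean_space) \<Rightarrow>
    ('a \<Rightarrow> 'b) \<Rightarrow> 'i filter \<Rightarrow> bool" where
  "L2_weak S f g F \<longleftrightarrow> (\<forall>\<^sub>F i in F. f i \<in> L2 S) \<and> g \<in> L2 S \<and>
     (\<forall>h\<in>L2 S. ((\<lambda>i. LINT x|lebesgue_on S. f i x \<bullet> h x) \<longlongrightarrow>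
                   (LINT x|lebesgue_on S. g x \<bullet> h x)) F)"

definition H1 :: "(real^3) set \<Rightarrow> (real^3 \<Rightarrow> real) set" where
  "H1 \<Omega> = {f \<in> L2 \<Omega>. \<exists>G. weak_hgrad \<Omega> f G \<and> G \<in> L2 \<Omega>}"

definition L2per :: "(real^3 \<Rightarrow> real) set" where
  "L2per = {f. Y_periodic f \<and> f \<in> L2 Ycell}"

definition H1per :: "(real^3 \<Rightarrow> real) set" where
  "H1per = {f \<in> L2per. \<exists>G. weak_hgrad UNIV f G \<and> (\<forall>l>0. G \<in> L2 (dil l ` Ycell))}"

definition H1per_norm :: "(real^3 \<Rightarrow> real) \<Rightarrow> real" where
  "H1per_norm f = sqrt ((L2_norm Ycell f)\<^sup>2 + (L2_norm Ycell (hgrad UNIV f))\<^sup>2)"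

text \<open>The norm on the quotient of \<^term>\<open>H1per\<close> by the constants, as a seminorm on representatives.\<close>

definition H1per_quot_norm :: "(real^3 \<Rightarrow> real) \<Rightarrow> real" where
  "H1per_quot_norm f = (INF c::real. H1per_norm (\<lambda>y. f y + c))"

text \<open>Square integrable functions in the sense of Bochner with values in the quotient of
  \<^term>\<open>H1per\<close> by the constants: almost everywhere limits of simple functions with square
  integrable norm. The representative \<^term>\<open>w x\<close> of the class at \<^term>\<open>x\<close> may be changed by a
  constant depending arbitrarily on \<^term>\<open>x\<close>; hence no joint measurability of \<^term>\<open>w\<close> is
  required.\<close>

definition L2_H1per_quot :: "(real^3) set \<Rightarrow> (real^3 \<Rightarrow> real^3 \<Rightarrow> real) set" where
  "L2_H1per_quot \<Omega> =
     {w. (\<forall>x\<in>\<Omega>. w x \<in> H1per) \<and>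
         (\<exists>s. (\<forall>n::nat. simple_function (lebesgue_on \<Omega>) (s n) \<and> (\<forall>x\<in>\<Omega>. s n x \<in> H1per)) \<and>
              (AE x in lebesgue_on \<Omega>.
                 (\<lambda>n. H1per_quot_norm (\<lambda>y. s n x y - w x y)) \<longlonglongrightarrow> 0)) \<and>
         (\<lambda>x. H1per_quot_norm (w x)) \<in> L2 \<Omega>}"

text \<open>For \<^term>\<open>w \<in> L2_H1per_quot \<Omega>\<close>, the map sending \<^term>\<open>x\<close> to the gradient of \<^term>\<open>w x\<close> is a
  Bochner function with values in the square integrable functions on \<^term>\<open>Ycell\<close>. As such it has
  a jointly measurable representative on \<^term>\<open>\<Omega> \<times> Ycell\<close>, unique up to null sets; choosing
  the gradient separately for each \<^term>\<open>x\<close> would not give a jointly measurable function.\<close>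

definition hgrad_y :: "(real^3) set \<Rightarrow> (real^3 \<Rightarrow> real^3 \<Rightarrow> real) \<Rightarrow> (real^3) \<times> (real^3) \<Rightarrow> real^2" where
  "hgrad_y \<Omega> w = (SOME G. G \<in> borel_measurable (lebesgue_on (\<Omega> \<times> Ycell)) \<and>
     (AE x in lebesgue_on \<Omega>. AE y in lebesgue_on Ycell. G (x, y) = hgrad UNIV (w x) y))"

definition cell :: "real \<Rightarrow> int^3 \<Rightarrow> (real^3) set" where
  "cell \<epsilon> k = dil \<epsilon> ` ((\<lambda>y. lat k \<odot> y) ` Ycell)"

definition cell_index :: "real \<Rightarrow> real^3 \<Rightarrow> int^3" where
  "cell_index \<epsilon> x = (THE k. x \<in> cell \<epsilon> k)"

definition inner_cells :: "(real^3) set \<Rightarrow> real \<Rightarrow> (int^3) set" where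
  "inner_cells \<Omega> \<epsilon> = {k. cell \<epsilon> k \<subseteq> \<Omega>}"

definition inner_region :: "(real^3) set \<Rightarrow> real \<Rightarrow> (real^3) set" where
  "inner_region \<Omega> \<epsilon> = (\<Union>k\<in>inner_cells \<Omega> \<epsilon>. cell \<epsilon> k)"

definition unfolding_op :: "(real^3) set \<Rightarrow> real \<Rightarrow> (real^3 \<Rightarrow> 'b::zero) \<Rightarrow>
    (real^3) \<times> (real^3) \<Rightarrow> 'b" where
  "unfolding_op \<Omega> \<epsilon> \<phi> = (\<lambda>(x, y). if x \<in> inner_region \<Omega> \<epsilon>
     then \<phi> (dil \<epsilon> (lat (cell_index \<epsilon> x)) \<odot> dil \<epsilon> y) else 0)"

end

theory Submission
  imports Defs "HOL-Library.Function_Algebras" "HOL-Computational_Algebra.Polynomial"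
begin

text \<open>No compactness is used. The limit pair solves a coercive problem on the closed space of fields
 \<open>\<nabla>u + \<Psi>\<close> whose part \<open>\<Psi>(x, \<cdot>)\<close> is a periodic gradient. Such a field and its flux \<open>A(\<nabla>u + \<Psi>)\<close> are
 approximated by finite sums of test functions times periodic fields; for the flux these are
 orthogonal to the periodic gradients. Rescaling the periodic factors gives \<open>V\<close> and \<open>W\<close> on the domain.
 A field orthogonal to periodic gradients acts on bounded gradients like its mean up to a null
 sequence, so testing the equation with a corrected difference bounds the energy of the gradient of
 the solution minus \<open>V\<close>. Unfolding is bounded on square integrable functions and maps \<open>V\<close> back
 to its approximant, which gives even strong convergence of the unfolded gradients.\<close>

text \<open>The boundary has no regularity, so extension operators and compact embeddings are out of
  reach. The first factors of the approximating tensors are therefore test functions: the rescaled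
  correctors built from \<open>\<psi> i\<close> and \<open>\<rho> i\<close> live in the interior and
  are admissible in the weak equation. The two approximants serve different pairings. The gradient
  factors of V have potentials, so V is, up to order \<epsilon>, a non-oscillating field plus the
  gradient of a corrector. The factors of W have no potential but are weakly divergence free, which
  lets the pairing of W with the unknown gradients pass to the limit. Strong convergence comes from
  expanding the energy of the difference: the tested equation makes everything quadratic in the
  unknown solutions cancel or move to the left with a good sign, and what remains is controlled by
  the accuracy of the approximants. Two facts about periodic functions carry the analysis: a
  Poincare inequality, which needs commutators to reach the vertical direction, and the vanishing
  mean of their gradients. The factors 8 and sqrt 8 come from the volume of the cell.\<close>

notation (input) LIMSEQ ("((_)/ ----> (_))" [60, 60] 60)
notation (input) scaleR (infixr "*R" 75)

abbreviation (input) bm :: "'a measure => ('a => 'b::topological_space) set" where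
 "bm M == borel_measurable M"

abbreviation LY :: "(real^3) measure" where
 "LY == lebesgue_on Ycell"

text \<open>With pointwise scaling, functions and pairs of functions form a real vector space, so
  that the abstract theory of \<open>semi_hilbert\<close> applies to sets of representatives
  directly.\<close>

instantiation "fun" :: (type, real_vector) real_vector
begin

definition scaleR_fun :: "real => ('a => 'b) => 'a => 'b" where
 "scaleR_fun c f = (%x. c *R f x)"

instance
 by standard (auto simp: scaleR_fun_def fun_eq_iff algebra_simps)

end

lemma scaleR_fun_apply [simp]: "(c *R f) x = c *R f x"
 by (simp add: scaleR_fun_def)

section \<open>The Lax--Milgram theorem\<close>

text \<open>The discriminant test, evaluated at the minimiser \<open>- b / c\<close>. For
  \<open>c = 0\<close> the polynomial is affine in \<open>t\<close>, and a nonzero slope would let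
  it reach -1; degenerate forms make this case necessary.\<close>

lemma quadratic_nonneg_imp:
 fixes a b c :: real
 assumes "!!t. 0 <= a + 2 * t * b + t^2 * c" "0 <= a" "0 <= c"
 shows "b^2 <= a * c"
proof (cases "c = 0")
 case True
 have "b = 0"
 proof (rule ccontr)
  assume "b ~= 0"
  hence "a + 2 * (-(a+1)/(2*b)) * b = -1" by (simp add: field_simps)
  with assms(1)[of "-(a+1)/(2*b)"] True show False by simp
 qed
 with True show ?thesis by simp
next
 case False
 with assms have c: "c > 0" by simp
 have "0 <= a + 2 * (-b/c) * b + (-b/c)^2 * c" by (rule assms)
 also have "... = a - b^2 / c" using c by (simp add: power2_eq_square field_simps)
 finally show ?thesis using c by (simp add: field_simps)
qed

text \<open>The form may be degenerate, so that it can be an integral over representatives of classes.\<close>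

locale semi_hilbert =
 fixes V :: "'v::real_vector set" and B :: "'v => 'v => real"
 assumes sub: "subspace V"
  and B_add: "!!x y z. x : V ==> y : V ==> z : V ==> B (x + y) z = B x z + B y z"
  and B_scale: "!!c x z. x : V ==> z : V ==> B (c *R x) z = c * B x z"
  and B_sym: "!!x y. x : V ==> y : V ==> B x y = B y x"
  and B_pos: "!!x. x : V ==> 0 <= B x x"
  and complete: "!!s. (!!n::nat. s n : V) ==>
    (!!e. e > 0 ==> \<exists>N. \<forall>m\<ge>N. \<forall>n\<ge>N. B (s m - s n) (s m - s n) < e) ==>
    \<exists>l\<in>V. (%n. B (s n - l) (s n - l)) ----> 0"
begin

definition nrm :: "'v => real" where "nrm x = sqrt (B x x)"

lemma V_add: "x : V ==> y : V ==> x + y : V"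
 and V_diff: "x : V ==> y : V ==> x - y : V"
 and V_scale: "x : V ==> c *R x : V"
 using sub by (auto simp: subspace_add subspace_diff subspace_scale)

lemma B_diff: "x : V ==> y : V ==> z : V ==> B (x - y) z = B x z - B y z"
 using B_add[of x "(-1) *R y" z] B_scale[of y z "-1"] V_scale[of y "-1"] by simp

lemma B_add2: "x : V ==> y : V ==> z : V ==> B z (x + y) = B z x + B z y"
 using B_add B_sym V_add by metis

lemma B_scale2: "x : V ==> z : V ==> B z (c *R x) = c * B z x"
 using B_scale B_sym V_scale by metis

lemma B_diff2: "x : V ==> y : V ==> z : V ==> B z (x - y) = B z x - B z y"
 using B_diff B_sym V_diff by metis

lemmas B_simps = B_add B_add2 B_scale B_scale2 B_diff B_diff2 V_add V_scale V_diff

lemma nrm_nonneg [simp]: "x : V ==> 0 <= nrm x"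
 by (simp add: nrm_def B_pos)

lemma nrm_sq: "x : V ==> (nrm x)^2 = B x x"
 by (simp add: nrm_def B_pos)

lemma CS: assumes "x : V" "y : V" shows "\<bar>B x y\<bar> <= nrm x * nrm y"
proof -
 have "(B x y)^2 <= B x x * B y y"
 proof (rule quadratic_nonneg_imp)
  fix t :: real
  have "0 <= B (x + t *R y) (x + t *R y)" using assms by (intro B_pos V_add V_scale)
  also have "... = B x x + 2 * t * B x y + t^2 * B y y"
   using assms by (simp add: B_simps power2_eq_square algebra_simps B_sym[of y x])
  finally show "0 <= B x x + 2 * t * B x y + t^2 * B y y" .
 qed (use assms B_pos in auto)
 hence "sqrt ((B x y)^2) <= sqrt (B x x * B y y)" by (rule real_sqrt_le_mono)
 thus ?thesis by (simp add: nrm_def real_sqrt_mult)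
qed

lemma nrm_triangle: assumes "x : V" "y : V" shows "nrm (x + y) <= nrm x + nrm y"
proof -
 have "(nrm (x + y))^2 = (nrm x)^2 + 2 * B x y + (nrm y)^2"
  using assms by (simp add: nrm_sq B_simps B_sym[of y x])
 also have "... <= (nrm x + nrm y)^2"
  using CS[OF assms] by (simp add: power2_eq_square algebra_simps)
 finally show ?thesis by (rule power2_le_imp_le) (simp add: assms)
qed

lemma nrm_scale: "x : V ==> nrm (c *R x) = \<bar>c\<bar> * nrm x"
proof -
 assume x: "x : V"
 have "B (c *R x) (c *R x) = c^2 * B x x" using x by (simp add: B_simps power2_eq_square)
 thus ?thesis by (simp add: nrm_def real_sqrt_mult)
qed

text \<open>Direct method: the energy \<open>J\<close> is bounded below by completing the square,
  minimising sequences are Cauchy by the parallelogram law, and the first variation vanishes at the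
  limit. The representing vector is determined only up to vectors of norm zero.\<close>

theorem riesz_representation:
 assumes L_add: "!!x y. x : V ==> y : V ==> L (x + y) = L x + L y"
  and L_scale: "!!c x. x : V ==> L (c *R x) = c * L x"
  and L_bound: "!!x. x : V ==> \<bar>L x\<bar> <= C * nrm x"
 shows "\<exists>u\<in>V. \<forall>v\<in>V. B u v = (L v :: real)"
proof -
 define J where "J v = B v v - 2 * L v" for v
 have V0: "0 : V" using sub by (rule subspace_0)
 have Jlow: "- C\<^sup>2 <= J v" if "v : V" for v
 proof -
  have "0 <= (nrm v - C)^2" by simp
  also have "... = B v v - 2 * (C * nrm v) + C^2" using that
   by (simp add: nrm_sq power2_diff)
  also have "... <= J v + C^2" using L_bound[OF that] by (simp add: J_def abs_le_iff)
  finally show ?thesis by simp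
 qed
 define m where "m = Inf (J ` V)"
 have bdd: "bdd_below (J ` V)" using Jlow by (auto intro!: bdd_belowI)
 have m_le: "m <= J v" if "v : V" for v unfolding m_def using that bdd by (intro cInf_lower) auto
 have "\<exists>v\<in>V. J v < m + 1 / (real n + 1)" for n :: nat
 proof -
  have "Inf (J ` V) < m + 1 / (real n + 1)" by (simp add: m_def)
  hence "\<exists>x\<in>J ` V. x < m + 1 / (real n + 1)"
   using V0 bdd by (subst (asm) cInf_less_iff) auto
  thus ?thesis by auto
 qed
 then obtain s where sV: "!!n. s n : V" and s: "!!n::nat. J (s n) < m + 1 / (real n + 1)" by metis
 \<comment> \<open>Parallelogram law: the midpoint has energy at least \<open>m\<close>, so two
   almost minimal points are close.\<close>
 have par: "B (s k - s n) (s k - s n) <= 2 / (real k + 1) + 2 / (real n + 1)" for k n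
 proof -
  have mid: "(1/2) *R (s k + s n) : V" using sV by (intro V_scale V_add)
  have "B (s k - s n) (s k - s n) = 2 * J (s k) + 2 * J (s n) - 4 * J ((1/2) *R (s k + s n))"
   using sV by (simp add: J_def B_simps L_add L_scale B_sym[of "s n" "s k"] algebra_simps)
  also have "... <= 2 / (real k + 1) + 2 / (real n + 1)"
   using m_le[OF mid] s[of k] s[of n] by simp
  finally show ?thesis .
 qed
 have "\<exists>l\<in>V. (%n. B (s n - l) (s n - l)) ----> 0"
 proof (rule complete[OF sV])
  fix e :: real assume e: "e > 0"
  obtain N :: nat where N: "4 / e < real N" using reals_Archimedean2 by blast
  have "B (s k - s n) (s k - s n) < e" if "k >= N" "n >= N" for k n
  proof -
   have "2 / (real j + 1) < e / 2" if "j >= N" for j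
   proof -
    have "4 / e < real j + 1" using N that by linarith
    thus ?thesis using e by (simp add: field_simps)
   qed
   thus ?thesis using par[of k n] that by (smt (verit) field_sum_of_halves)
  qed
  thus "\<exists>N. \<forall>m\<ge>N. \<forall>n\<ge>N. B (s m - s n) (s m - s n) < e" by blast
 qed
 then obtain l where lV: "l : V" and l: "(%n. B (s n - l) (s n - l)) ----> 0" by blast
 have "B l v = L v" if v: "v : V" for v
 proof -
  have "(%n. nrm (s n - l) * nrm v) ----> 0"
   using tendsto_mult_right[OF tendsto_real_sqrt[OF l], of "nrm v"] by (simp add: nrm_def)
  hence "(%n. B (s n - l) v) ----> 0"
   by (rule Lim_null_comparison[rotated]) (use CS sV lV v V_diff in auto)
  hence "(%n. B (s n) v - B l v) ----> 0" using sV lV v by (simp add: B_diff)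
  hence lim: "(%n. B (s n) v) ----> B l v" by (simp add: LIM_zero_cancel)
  \<comment> \<open>The inequality is proved at \<open>s n\<close>, where the infimum is attained up
    to \<open>1 / (n + 1)\<close>, and passes to the limit. A nonnegative quadratic in
    \<open>t\<close> without constant term has no linear term.\<close>
  have *: "0 <= 2 * t * (B l v - L v) + t^2 * B v v" for t
  proof (rule LIMSEQ_le[OF tendsto_const])
   show "(%n. 2 * t * (B (s n) v - L v) + t^2 * B v v + 1 / (real n + 1))
     ----> 2 * t * (B l v - L v) + t^2 * B v v"
    using tendsto_add[OF tendsto_add[OF tendsto_mult[OF tendsto_const[of "2*t"] tendsto_diff[OF lim tendsto_const[of "L v"]]] tendsto_const[of "t^2 * B v v"]] LIMSEQ_inverse_real_of_nat]
    by (simp add: inverse_eq_divide add.commute)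
   have "0 <= 2 * t * (B (s n) v - L v) + t^2 * B v v + 1 / (real n + 1)" for n
   proof -
    have "m <= J (s n + t *R v)" using sV v by (intro m_le V_add V_scale)
    also have "... = J (s n) + 2 * t * (B (s n) v - L v) + t^2 * B v v"
     using sV v by (simp add: J_def B_simps L_add L_scale B_sym[of v "s n"] power2_eq_square algebra_simps)
    finally show ?thesis using s[of n] by simp
   qed
   thus "\<exists>N. \<forall>n\<ge>N. 0 <= 2 * t * (B (s n) v - L v) + t^2 * B v v + 1 / (real n + 1)" by blast
  qed
  have "(B l v - L v)^2 <= 0 * B v v"
   by (rule quadratic_nonneg_imp) (use * B_pos v in "auto simp: algebra_simps")
  thus ?thesis by simp
 qed
 with lV show ?thesis by blast
qed

text \<open>\<open>a\<close> is not symmetric, so minimisation is applied to another form. If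
  \<open>A\<close> represents \<open>a\<close>, then \<open>nrm (A x)\<close> is comparable to
  \<open>nrm x\<close>, hence \<open>B (A x) (A y)\<close> is again a complete form. Representing
  \<open>a v l\<close> in it, where \<open>l\<close> represents \<open>L\<close>, gives
  \<open>u\<close> with \<open>A u - l\<close> orthogonal to the range of \<open>A\<close>, and
  coercivity annihilates this difference.\<close>

theorem lax_milgram:
 assumes a_add: "!!x y z. x : V ==> y : V ==> z : V ==> a (x + y) z = a x z + a y z"
  and a_scale: "!!c x z. x : V ==> z : V ==> a (c *R x) z = c * a x z"
  and a_add2: "!!x y z. x : V ==> y : V ==> z : V ==> a z (x + y) = a z x + a z y"
  and a_scale2: "!!c x z. x : V ==> z : V ==> a z (c *R x) = c * a z x"
  and a_bound: "!!x y. x : V ==> y : V ==> \<bar>a x y\<bar> <= M * (nrm x * nrm y)"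
  and a_coercive: "!!x. x : V ==> c0 * B x x <= a x x" and c0: "c0 > 0"
  and L_add: "!!x y. x : V ==> y : V ==> L (x + y) = L x + L y"
  and L_scale: "!!c x. x : V ==> L (c *R x) = c * L x"
  and L_bound: "!!x. x : V ==> \<bar>L x\<bar> <= C * nrm x"
 shows "\<exists>u\<in>V. \<forall>v\<in>V. a u v = (L v :: real)"
proof -
 have bound: "\<bar>a x y\<bar> <= \<bar>M\<bar> * (nrm x * nrm y)" if "x : V" "y : V" for x y
  using a_bound[OF that] that by (rule_tac order_trans) (auto intro!: mult_right_mono)
 have "\<forall>x. \<exists>r. x : V --> r : V & (\<forall>y\<in>V. B r y = a x y)"
 proof
  fix x
  show "\<exists>r. x : V --> r : V & (\<forall>y\<in>V. B r y = a x y)"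
   using riesz_representation[of "a x" "\<bar>M\<bar> * nrm x"] a_add2[of _ _ x] a_scale2[of _ x] bound[of x] by (auto simp: mult.assoc)
 qed
 from choice[OF this] obtain A where AV: "!!x. x : V ==> A x : V" and A: "!!x y. x : V ==> y : V ==> B (A x) y = a x y" by blast
 obtain l where l: "l : V" "!!v. v : V ==> B l v = L v" using riesz_representation[OF L_add L_scale L_bound] by blast
 \<comment> \<open>Cancels a common factor that may be zero, since \<open>nrm\<close> can vanish on
   nonzero vectors.\<close>
 have le: "s <= t" if "s * r <= t * r" "0 <= r" "r = 0 ==> s <= t" for r s t :: real
  using that by (cases "r = 0") (auto simp: mult_le_cancel_right)
 have n1: "nrm (A x) <= \<bar>M\<bar> * nrm x" if x: "x : V" for x
  by (rule le[of _ "nrm (A x)"])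
   (use bound[OF x AV[OF x]] A[OF x AV[OF x]] nrm_sq[OF AV[OF x]] x AV[OF x] in "auto simp: power2_eq_square mult_ac")
 have n2: "c0 * nrm x <= nrm (A x)" if x: "x : V" for x
  by (rule le[of _ "nrm x"])
   (use a_coercive[OF x] A[OF x x] CS[OF AV[OF x] x] nrm_sq[OF x] x AV[OF x] in "auto simp: power2_eq_square mult_ac")
 have up: "B (A x) (A x) <= M^2 * B x x" and lo: "c0^2 * B x x <= B (A x) (A x)" if x: "x : V" for x
  using power_mono[OF n1[OF x], of 2] power_mono[OF n2[OF x], of 2] x AV[OF x] c0 by (simp_all add: power_mult_distrib nrm_sq)
 interpret S: semi_hilbert V "%x y. B (A x) (A y)"
 proof
  fix s assume s: "!!n::nat. s n : V" and C: "!!e. e > 0 ==> \<exists>N. \<forall>m\<ge>N. \<forall>n\<ge>N. B (A (s m - s n)) (A (s m - s n)) < e"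
  have "\<exists>l\<in>V. (%n. B (s n - l) (s n - l)) ----> 0"
  proof (rule complete[OF s])
   fix e :: real assume "e > 0"
   hence "c0^2 * e > 0" using c0 by simp
   then obtain N where N: "!!m n. m >= N ==> n >= N ==> B (A (s m - s n)) (A (s m - s n)) < c0^2 * e" using C by blast
   have "B (s m - s n) (s m - s n) < e" if "m >= N" "n >= N" for m n
    using order_le_less_trans[OF lo[OF V_diff[OF s s]] N[OF that]] c0 by simp
   thus "\<exists>N. \<forall>m\<ge>N. \<forall>n\<ge>N. B (s m - s n) (s m - s n) < e" by blast
  qed
  then obtain l where l: "l : V" "(%n. B (s n - l) (s n - l)) ----> 0" by blast
  have "(%n. B (A (s n - l)) (A (s n - l))) ----> 0"
  proof (rule tendsto_sandwich[of "%_. 0"])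
   show "(%n. M^2 * B (s n - l) (s n - l)) ----> 0" using tendsto_mult_left[OF l(2), of "M^2"] by simp
  qed (use up B_pos AV V_diff s l in auto)
  with l(1) show "\<exists>l\<in>V. (%n. B (A (s n - l)) (A (s n - l))) ----> 0" by blast
 next
  show "B (A x) (A y) = B (A y) (A x)" if "x : V" "y : V" for x y by (rule B_sym[OF AV[OF that(1)] AV[OF that(2)]])
  show "0 <= B (A x) (A x)" if "x : V" for x by (rule B_pos[OF AV[OF that]])
 qed (use sub in "auto simp: A AV V_add V_scale a_add a_scale")
 have "\<exists>u\<in>V. \<forall>v\<in>V. B (A u) (A v) = a v l"
 proof (rule S.riesz_representation[where C = "\<bar>M\<bar> * nrm l / c0"])
  fix v assume v: "v : V"
  have "\<bar>a v l\<bar> <= \<bar>M\<bar> * nrm l / c0 * (c0 * nrm v)" using bound[OF v l(1)] c0 by (simp add: mult_ac)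
  also have "... <= \<bar>M\<bar> * nrm l / c0 * S.nrm v"
   using n2[OF v] c0 l(1) unfolding S.nrm_def nrm_def by (intro mult_left_mono) (auto simp: B_pos)
  finally show "\<bar>a v l\<bar> <= \<bar>M\<bar> * nrm l / c0 * S.nrm v" .
 qed (use a_add a_scale l(1) in auto)
 then obtain u where u: "u : V" "!!v. v : V ==> B (A u) (A v) = a v l" by blast
 define w where "w = A u - l"
 have w: "w : V" using u l AV V_diff by (simp add: w_def)
 have "a w w = B (A w) (A u) - B (A w) l" unfolding w_def[symmetric] using A[OF w w] B_diff2[OF AV[OF u(1)] l(1) AV[OF w]] by (simp add: w_def)
 also have "... = 0" using u(2)[OF w] A[OF w l(1)] B_sym[OF AV[OF u(1)] AV[OF w]] by simp
 finally have "nrm w = 0" using a_coercive[OF w] B_pos[OF w] c0 by (simp add: nrm_def mult_le_0_iff)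
 hence "B w v = 0" if "v : V" for v using CS[OF w that] by simp
 hence "a u v = L v" if "v : V" for v
  using that A[OF u(1) that] l(2)[OF that] B_diff[OF AV[OF u(1)] l(1) that] by (simp add: w_def)
 with u(1) show ?thesis by blast
qed

end

section \<open>Square integrable functions\<close>

text \<open>\<open>L2\<close> for an arbitrary measure, so that one set of lemmas serves the domain,
  the cell, their product and the whole group.\<close>

definition sq_int :: "'a measure => ('a => 'b::euclidean_space) set" where
 "sq_int M = {f. f : bm M & integrable M (%x. (norm (f x))^2)}"

definition sq_norm :: "'a measure => ('a => 'b::euclidean_space) => real" where
 "sq_norm M f = sqrt (LINT x|M. (norm (f x))^2)"

lemma L2_eq: "L2 S = sq_int (lebesgue_on S)" and L2_norm_eq: "L2_norm S = sq_norm (lebesgue_on S)"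
 by (auto simp: L2_def sq_int_def L2_norm_def sq_norm_def fun_eq_iff)

lemma sq_intD [measurable_dest]: "f : sq_int M ==> f : bm M"
 by (simp add: sq_int_def)

lemma sq_int_norm: "f : sq_int M ==> integrable M (%x. (norm (f x))^2)"
 by (simp add: sq_int_def)

lemma sq_intI: "f : bm M ==> integrable M (%x. (norm (f x))^2) ==> f : sq_int M"
 by (simp add: sq_int_def)

lemma sq_norm_nonneg [simp]: "0 <= sq_norm M f"
 by (simp add: sq_norm_def)

lemma sq_norm_sq: "(sq_norm M f)^2 = (LINT x|M. (norm (f x))^2)"
 by (simp add: sq_norm_def)

lemma norm_sum_sq_le: "(norm (x + y :: 'b::euclidean_space))^2 <= 2 * (norm x)^2 + 2 * (norm y)^2"
proof -
 have "(norm (x + y))^2 <= (norm x + norm y)^2" by (intro power_mono norm_triangle_ineq) simp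
 also have "... <= 2 * (norm x)^2 + 2 * (norm y)^2"
  using sum_squares_bound[of "norm x" "norm y"] by (simp add: power2_sum)
 finally show ?thesis .
qed

lemma sq_int_dominated:
 assumes "f : sq_int M" "g : bm M" "AE x in M. norm (g x) <= C * norm (f x)"
 shows "g : sq_int M"
proof (rule sq_intI[OF assms(2)], rule Bochner_Integration.integrable_bound)
 show "integrable M (%x. C^2 * (norm (f x))^2)" using sq_int_norm[OF assms(1)] by simp
 show "(%x. (norm (g x))^2) : bm M" using assms(2) by measurable
 show "AE x in M. norm ((norm (g x))^2) <= norm (C^2 * (norm (f x))^2)"
  using assms(3) by eventually_elim (auto simp: power_mult_distrib[symmetric] intro!: power_mono)
qed

lemma sq_int_add: assumes "f : sq_int M" "g : sq_int M" shows "(%x. f x + g x) : sq_int M"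
proof (rule sq_intI, use assms in measurable, rule Bochner_Integration.integrable_bound)
 show "integrable M (%x. 2 * (norm (f x))^2 + 2 * (norm (g x))^2)"
  using assms by (auto simp: sq_int_norm)
 show "(%x. (norm (f x + g x))^2) : bm M" using assms by measurable
 show "AE x in M. norm ((norm (f x + g x))^2) <= norm (2 * (norm (f x))^2 + 2 * (norm (g x))^2)"
  using norm_sum_sq_le by (intro always_eventually allI) (simp add: order_trans[OF norm_sum_sq_le])
qed

lemma sq_int_zero [simp]: "(%x. 0) : sq_int M"
 by (simp add: sq_int_def)

lemma sq_int_blinear:
 assumes "f : sq_int M" "bounded_linear L" shows "(%x. L (f x)) : sq_int M"
proof -
 obtain K where "!!x. norm (L x) <= norm x * K" using bounded_linear.bounded[OF assms(2)] by blast
 moreover have "(%x. L (f x)) : bm M"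
  using assms borel_measurable_continuous_onI[OF linear_continuous_on[OF assms(2)]]
  by (auto intro: measurable_compose[OF sq_intD])
 ultimately show ?thesis
  by (intro sq_int_dominated[OF assms(1), where C=K]) (auto simp: mult.commute)
qed

lemma sq_int_scale: "f : sq_int M ==> (%x. c *R f x) : sq_int M"
 by (rule sq_int_blinear[OF _ bounded_linear_scaleR_right])

lemma sq_int_cmult: "f : sq_int M ==> (%x. c * f x :: real) : sq_int M"
 using sq_int_scale[of f M c] by simp

lemma sq_int_uminus: "f : sq_int M ==> (%x. - f x) : sq_int M"
 using sq_int_scale[of f M "-1"] by simp

lemma sq_int_diff: "f : sq_int M ==> g : sq_int M ==> (%x. f x - g x) : sq_int M"
 using sq_int_add[OF _ sq_int_uminus, of f M g] by simp

lemma sq_int_sum: "(!!i. i : I ==> f i : sq_int M) ==> (%x. \<Sum>i\<in>I. f i x) : sq_int M"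
 by (induction I rule: infinite_finite_induct) (auto intro!: sq_int_add)

lemma sq_int_component: "f : sq_int M ==> (%x. f x $ i) : sq_int M" for f :: "'a => real^'n"
 by (rule sq_int_blinear[OF _ bounded_linear_vec_nth])

lemma sq_int_bounded_mult:
 assumes "f : sq_int M" "g : bm M" "AE x in M. \<bar>g x\<bar> <= C"
 shows "(%x. g x *R f x) : sq_int M"
 using assms by (intro sq_int_dominated[OF assms(1), where C=C]) (auto elim!: eventually_mono intro!: mult_right_mono)

lemma sq_int_const: "finite_measure M ==> (%x. c) : sq_int M"
 by (auto simp: sq_int_def finite_measure.integrable_const)

lemma sq_int_bounded:
 assumes "finite_measure M" "g : bm M" "AE x in M. norm (g x) <= C"
 shows "g : sq_int M"
 using assms by (intro sq_int_dominated[OF sq_int_const[OF assms(1), of "1::real"], where C=C]) auto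

lemma sq_int_cong_AE:
 assumes "f : sq_int M" "g : bm M" "AE x in M. f x = g x"
 shows "g : sq_int M"
 using assms by (intro sq_int_dominated[OF assms(1), where C=1]) auto

lemma sq_int_inner:
 assumes "f : sq_int M" "g : sq_int M" shows "integrable M (%x. f x \<bullet> g x)"
proof (rule Bochner_Integration.integrable_bound)
 show "integrable M (%x. (norm (f x))^2 + (norm (g x))^2)" using assms by (auto simp: sq_int_norm)
 show "(%x. f x \<bullet> g x) : bm M" using assms by measurable
 have "norm (a \<bullet> b) <= norm ((norm a)^2 + (norm b)^2)" for a b :: 'b
 proof -
  have "\<bar>a \<bullet> b\<bar> <= norm a * norm b" by (rule Cauchy_Schwarz_ineq2)
  also have "2 * ... <= (norm a)^2 + (norm b)^2" using sum_squares_bound[of "norm a" "norm b"] by simp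
  finally show ?thesis by (smt (verit) real_norm_def norm_ge_zero zero_le_power2)
 qed
 thus "AE x in M. norm (f x \<bullet> g x) <= norm ((norm (f x))^2 + (norm (g x))^2)" by simp
qed

lemma sq_int_mult: "f : sq_int M ==> g : sq_int M ==> integrable M (%x. f x * g x :: real)"
 using sq_int_inner[of f M g] by simp

lemma sq_int_integrable: "finite_measure M ==> f : sq_int M ==> integrable M f"
proof -
 assume M: "finite_measure M" and f: "f : sq_int M"
 have "integrable M (%x. norm (f x) \<bullet> 1)"
  by (rule sq_int_inner[OF _ sq_int_const[OF M]], rule sq_int_dominated[OF f, where C=1]) (use f in auto)
 thus ?thesis using f by (simp add: integrable_norm_iff sq_intD)
qed

lemma sq_inner_CS:
 assumes f: "f : sq_int M" and g: "g : sq_int M"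
 shows "\<bar>LINT x|M. f x \<bullet> g x\<bar> <= sq_norm M f * sq_norm M g"
proof -
 note i = sq_int_inner[OF f g] sq_int_inner[OF g f] sq_int_inner[OF f f] sq_int_inner[OF g g]
 have "(LINT x|M. f x \<bullet> g x)^2 <= (LINT x|M. f x \<bullet> f x) * (LINT x|M. g x \<bullet> g x)"
 proof -
  have "0 <= (LINT x|M. f x \<bullet> f x) + 2 * t * (LINT x|M. f x \<bullet> g x) + t^2 * (LINT x|M. g x \<bullet> g x)" for t
  proof -
   have "0 <= (LINT x|M. (f x + t *R g x) \<bullet> (f x + t *R g x))" by (intro integral_nonneg_AE) simp
   also have "... = (LINT x|M. f x \<bullet> f x + 2 * t * (f x \<bullet> g x) + t^2 * (g x \<bullet> g x))"
    by (intro Bochner_Integration.integral_cong refl) (simp add: inner_simps inner_commute power2_eq_square algebra_simps)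
   also have "... = (LINT x|M. f x \<bullet> f x) + 2 * t * (LINT x|M. f x \<bullet> g x) + t^2 * (LINT x|M. g x \<bullet> g x)"
    using i by simp
   finally show ?thesis .
  qed
  thus ?thesis
   by (rule quadratic_nonneg_imp) (auto intro!: integral_nonneg_AE)
 qed
 hence "sqrt ((LINT x|M. f x \<bullet> g x)^2) <= sqrt ((LINT x|M. f x \<bullet> f x) * (LINT x|M. g x \<bullet> g x))"
  by (rule real_sqrt_le_mono)
 thus ?thesis by (simp add: sq_norm_def real_sqrt_mult dot_square_norm)
qed

lemma sq_norm_triangle:
 assumes f: "f : sq_int M" and g: "g : sq_int M"
 shows "sq_norm M (%x. f x + g x) <= sq_norm M f + sq_norm M g"
proof (rule power2_le_imp_le)
 note i = sq_int_inner[OF f g] sq_int_inner[OF g f] sq_int_inner[OF f f] sq_int_inner[OF g g]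
 have "(sq_norm M (%x. f x + g x))^2 = (LINT x|M. (f x \<bullet> f x + 2 * (f x \<bullet> g x)) + g x \<bullet> g x)"
  unfolding sq_norm_sq
  by (intro Bochner_Integration.integral_cong refl) (simp add: power2_norm_eq_inner inner_simps inner_commute)
 also have "... = (sq_norm M f)^2 + 2 * (LINT x|M. f x \<bullet> g x) + (sq_norm M g)^2"
  unfolding sq_norm_sq using i by (simp add: power2_norm_eq_inner)
 also have "... <= (sq_norm M f + sq_norm M g)^2"
  using sq_inner_CS[OF f g] by (simp add: power2_sum)
 finally show "(sq_norm M (%x. f x + g x))^2 <= (sq_norm M f + sq_norm M g)^2" .
qed simp

lemma sq_norm_scale: "sq_norm M (%x. c *R f x) = \<bar>c\<bar> * sq_norm M f"
 by (simp add: sq_norm_def power_mult_distrib real_sqrt_mult)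

lemma sq_norm_minus: "sq_norm M (%x. - f x) = sq_norm M f"
 by (simp add: sq_norm_def)

lemma sq_norm_commute: "sq_norm M (%x. f x - g x) = sq_norm M (%x. g x - f x)"
 by (simp add: sq_norm_def norm_minus_commute)

lemma sq_norm_triangle_diff:
 assumes "f : sq_int M" "g : sq_int M" "h : sq_int M"
 shows "sq_norm M (%x. f x - h x) <= sq_norm M (%x. f x - g x) + sq_norm M (%x. g x - h x)"
 using sq_norm_triangle[OF sq_int_diff[OF assms(1,2)] sq_int_diff[OF assms(2,3)]] by simp

lemma sq_norm_triangle_le:
 assumes "f : sq_int M" "g : sq_int M"
 shows "sq_norm M f <= sq_norm M (%x. f x - g x) + sq_norm M g"
 using sq_norm_triangle[OF sq_int_diff[OF assms] assms(2)] by simp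

lemma sq_norm_sum_le:
 assumes "finite I" "!!i. i : I ==> f i : sq_int M"
 shows "sq_norm M (%x. \<Sum>i\<in>I. f i x) <= (\<Sum>i\<in>I. sq_norm M (f i))"
 using assms
proof (induction I)
 case empty thus ?case by (simp add: sq_norm_def)
next
 case (insert i I)
 have "sq_norm M (%x. f i x + (\<Sum>i\<in>I. f i x)) <= sq_norm M (f i) + sq_norm M (%x. \<Sum>i\<in>I. f i x)"
  using insert by (intro sq_norm_triangle sq_int_sum) auto
 with insert show ?case by auto
qed

lemma sq_norm_cong_AE:
 assumes "f : bm M" "g : bm M" "AE x in M. f x = g x"
 shows "sq_norm M f = sq_norm M g"
proof -
 have "(LINT x|M. (norm (f x))^2) = (LINT x|M. (norm (g x))^2)"
  using assms by (intro integral_cong_AE) (auto elim!: eventually_mono)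
 thus ?thesis by (simp add: sq_norm_def)
qed

lemma sq_norm_mono:
 assumes f: "f : sq_int M" and g: "g : bm M" and le: "AE x in M. norm (g x) <= C * norm (f x)"
  and C: "0 <= C"
 shows "sq_norm M g <= C * sq_norm M f"
proof -
 have gi: "g : sq_int M" by (rule sq_int_dominated[OF f g le])
 have "(LINT x|M. (norm (g x))^2) <= (LINT x|M. C^2 * (norm (f x))^2)"
 proof (rule integral_mono_AE)
  show "AE x in M. (norm (g x))^2 <= C^2 * (norm (f x))^2"
   using le by eventually_elim (auto simp: power_mult_distrib[symmetric] intro!: power_mono)
 qed (use sq_int_norm[OF f] sq_int_norm[OF gi] in auto)
 also have "... = C^2 * (LINT x|M. (norm (f x))^2)" by simp
 finally have "sqrt (LINT x|M. (norm (g x))^2) <= sqrt (C^2 * (LINT x|M. (norm (f x))^2))"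
  by (rule real_sqrt_le_mono)
 thus ?thesis using C by (simp add: sq_norm_def real_sqrt_mult)
qed

lemma sq_norm_zero_AE:
 assumes f: "f : sq_int M" and "sq_norm M f = 0" shows "AE x in M. f x = 0"
proof -
 have "AE x in M. (norm (f x))^2 = 0"
  using assms by (subst integral_nonneg_eq_0_iff_AE[symmetric]) (auto simp: sq_norm_def sq_int_norm)
 thus ?thesis by simp
qed

text \<open>Stated with the nonnegative integral, which exists without integrability: this is how
  Fubini and changes of variables yield integrability and the bound together.\<close>

lemma sq_norm_le_nn:
 assumes f: "f : bm M" and le: "(\<integral>\<^sup>+x. ennreal ((norm (f x))^2) \<partial>M) <= ennreal (C^2)" and C: "0 <= C"
 shows "f : sq_int M" "sq_norm M f <= C"
proof -
 have "integrable M (%x. (norm (f x))^2)"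
  using f le by (intro integrableI_bounded) (auto intro: le_less_trans)
 thus fi: "f : sq_int M" using f by (simp add: sq_int_def)
 have "ennreal (LINT x|M. (norm (f x))^2) <= ennreal (C^2)"
  using le by (subst nn_integral_eq_integral[symmetric]) (auto simp: sq_int_norm[OF fi])
 hence "(sq_norm M f)^2 <= C^2" by (simp add: sq_norm_sq)
 thus "sq_norm M f <= C" using C by (rule power2_le_imp_le)
qed

lemma nn_integral_sq_norm:
 "f : sq_int M ==> (\<integral>\<^sup>+x. ennreal ((norm (f x))^2) \<partial>M) = ennreal ((sq_norm M f)^2)"
 by (subst nn_integral_eq_integral) (auto simp: sq_int_norm sq_norm_sq)

lemma sq_norm_integral_le:
 assumes M: "finite_measure M" and f: "f : sq_int M"
 shows "(LINT x|M. norm (f x)) <= sqrt (measure M (space M)) * sq_norm M f"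
proof -
 have nf: "(%x. norm (f x)) : sq_int M" by (rule sq_int_dominated[OF f, where C=1]) (use f in auto)
 have "(LINT x|M. norm (f x) \<bullet> 1) <= sq_norm M (%x. norm (f x)) * sq_norm M (%x. 1::real)"
  using sq_inner_CS[OF nf sq_int_const[OF M, of 1]] by simp
 thus ?thesis by (simp add: sq_norm_def mult.commute)
qed

text \<open>Riesz-Fischer. On a finite measure the sequence is also Cauchy in L1, so a subsequence
  converges almost everywhere; Fatou, applied to the distances from \<open>f n\<close> to that
  subsequence, bounds the distance to its limit.\<close>

lemma sq_int_complete:
 fixes f :: "nat => 'a => 'b::euclidean_space"
 assumes M: "finite_measure M" and f: "!!n. f n : sq_int M"
  and Cauchy: "!!e. e > 0 ==> \<exists>N. \<forall>m\<ge>N. \<forall>n\<ge>N. sq_norm M (%x. f m x - f n x) < e"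
 shows "\<exists>g\<in>sq_int M. (%n. sq_norm M (%x. f n x - g x)) ----> 0"
proof -
 note [measurable] = sq_intD[OF f]
 \<comment> \<open>The added 1 keeps \<open>K\<close> positive when the whole space is null.\<close>
 define K where "K = sqrt (measure M (space M)) + 1"
 have K: "K > 0" by (simp add: K_def add_nonneg_pos)
 have L1: "\<exists>N. \<forall>i\<ge>N. \<forall>j\<ge>N. (LINT x|M. norm (f i x - f j x)) < e" if e: "e > 0" for e
 proof -
  have "e / K > 0" using e K by simp
  then obtain N where N: "!!m n. m >= N ==> n >= N ==> sq_norm M (%x. f m x - f n x) < e / K" using Cauchy by meson
  have "(LINT x|M. norm (f i x - f j x)) < e" if "i >= N" "j >= N" for i j
  proof -
   have "(LINT x|M. norm (f i x - f j x)) <= sqrt (measure M (space M)) * sq_norm M (%x. f i x - f j x)"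
    by (intro sq_norm_integral_le M sq_int_diff f)
   also have "... <= K * sq_norm M (%x. f i x - f j x)" by (intro mult_right_mono) (auto simp: K_def)
   also have "... < e" using N[OF that] K by (simp add: field_simps)
   finally show ?thesis .
  qed
  thus ?thesis by blast
 qed
 obtain r where r: "strict_mono r" and C: "AE x in M. Cauchy (%k. f (r k) x)"
  using cauchy_L1_AE_cauchy_subseq[of M f, OF sq_int_integrable[OF M f] L1] by blast
 define h where "h x = lim (%k. f (r k) x)" for x
 have hm [measurable]: "h : bm M" unfolding h_def by measurable
 have lim: "AE x in M. (%k. f (r k) x) ----> h x"
  using C by eventually_elim (simp add: h_def Cauchy_convergent_iff convergent_LIMSEQ_iff)
 have dist: "(%x. f n x - h x) : sq_int M & sq_norm M (%x. f n x - h x) <= e"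
  if e: "e > 0" and N: "\<forall>m\<ge>N. \<forall>n\<ge>N. sq_norm M (%x. f m x - f n x) < e" and n: "n >= N" for e N n
 proof -
  have "(\<integral>\<^sup>+x. ennreal ((norm (f n x - h x))^2) \<partial>M) = (\<integral>\<^sup>+x. liminf (%j. ennreal ((norm (f n x - f (r j) x))^2)) \<partial>M)"
  proof (rule nn_integral_cong_AE, use lim in eventually_elim)
   case (elim x)
   have "(%j. ennreal ((norm (f n x - f (r j) x))^2)) ----> ennreal ((norm (f n x - h x))^2)"
    by (intro tendsto_intros elim)
   thus ?case by (rule lim_imp_Liminf[OF trivial_limit_sequentially, symmetric])
  qed
  also have "... <= liminf (%j. \<integral>\<^sup>+x. ennreal ((norm (f n x - f (r j) x))^2) \<partial>M)"
   by (intro nn_integral_liminf) measurable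
  also have "... <= ennreal (e^2)"
  proof (rule Liminf_le)
   show "\<forall>\<^sub>F j in sequentially. (\<integral>\<^sup>+x. ennreal ((norm (f n x - f (r j) x))^2) \<partial>M) <= ennreal (e^2)"
    unfolding eventually_sequentially
   proof (intro exI[of _ N] allI impI)
    fix j assume "N <= j"
    hence "sq_norm M (%x. f n x - f (r j) x) < e" using N n seq_suble[OF r, of j] by (meson order_trans)
    hence "(sq_norm M (%x. f n x - f (r j) x))^2 <= e^2" by (intro power_mono) auto
    thus "(\<integral>\<^sup>+x. ennreal ((norm (f n x - f (r j) x))^2) \<partial>M) <= ennreal (e^2)"
     by (simp add: nn_integral_sq_norm sq_int_diff f)
   qed
  qed simp
  finally have *: "(\<integral>\<^sup>+x. ennreal ((norm (f n x - h x))^2) \<partial>M) <= ennreal (e^2)" .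
  show ?thesis using sq_norm_le_nn[OF _ *] e by simp
 qed
 obtain N where "\<forall>m\<ge>N. \<forall>n\<ge>N. sq_norm M (%x. f m x - f n x) < 1" using Cauchy[of 1] by auto
 from sq_int_diff[OF f[of N] conjunct1[OF dist[OF _ this order_refl]]] have h: "h : sq_int M" by simp
 have "(%n. sq_norm M (%x. f n x - h x)) ----> 0"
 proof (rule LIMSEQ_I)
  fix e :: real assume "e > 0"
  hence e: "e/2 > 0" by simp
  then obtain N where N: "\<forall>m\<ge>N. \<forall>n\<ge>N. sq_norm M (%x. f m x - f n x) < e/2" using Cauchy by blast
  have "norm (sq_norm M (%x. f n x - h x) - 0) < e" if "n >= N" for n
   using dist[OF e N that] e by simp
  thus "\<exists>no. \<forall>n\<ge>no. norm (sq_norm M (%x. f n x - h x) - 0) < e" by blast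
 qed
 with h show ?thesis by blast
qed

lemma sq_inner_tendsto:
 assumes f: "!!n. f n : sq_int M" and g: "g : sq_int M" and h: "h : sq_int M"
  and lim: "((%n. sq_norm M (%x. f n x - g x)) \<longlongrightarrow> 0) F"
 shows "((%n. LINT x|M. f n x \<bullet> h x) \<longlongrightarrow> (LINT x|M. g x \<bullet> h x)) F"
proof (rule LIM_zero_cancel, rule Lim_null_comparison)
 have "norm ((LINT x|M. f n x \<bullet> h x) - (LINT x|M. g x \<bullet> h x)) <= sq_norm M (%x. f n x - g x) * sq_norm M h" for n
 proof -
  have "(LINT x|M. f n x \<bullet> h x) - (LINT x|M. g x \<bullet> h x) = (LINT x|M. (f n x - g x) \<bullet> h x)"
   by (simp add: inner_diff_left sq_int_inner f g h)
  thus ?thesis using sq_inner_CS[OF sq_int_diff[OF f g] h] by simp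
 qed
 thus "\<forall>\<^sub>F n in F. norm ((LINT x|M. f n x \<bullet> h x) - (LINT x|M. g x \<bullet> h x)) <= sq_norm M (%x. f n x - g x) * sq_norm M h"
  by simp
 show "((%n. sq_norm M (%x. f n x - g x) * sq_norm M h) \<longlongrightarrow> 0) F"
  using tendsto_mult_right[OF lim, of "sq_norm M h"] by simp
qed

lemma sq_norm_tendsto_DCT:
 fixes f :: "nat => 'a => 'b::euclidean_space"
 assumes [measurable]: "!!n. f n : bm M" "g : bm M" and w: "w : sq_int M"
  and bound: "!!n. AE x in M. norm (f n x - g x) <= C * norm (w x)"
  and lim: "AE x in M. (%n. f n x) ----> g x"
 shows "(%n. sq_norm M (%x. f n x - g x)) ----> 0"
proof -
 have "(%n. LINT x|M. (norm (f n x - g x))^2) ----> (LINT x|M. 0)"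
 proof (rule integral_dominated_convergence[where w = "%x. C^2 * (norm (w x))^2"])
  show "AE x in M. (%n. (norm (f n x - g x))^2) ----> 0"
   using lim
  proof eventually_elim
   case (elim x)
   have "(%n. (norm (f n x - g x))^2) ----> (norm (g x - g x))^2" by (intro tendsto_intros elim)
   thus ?case by simp
  qed
  show "AE x in M. norm ((norm (f n x - g x))^2) <= C^2 * (norm (w x))^2" for n
   using bound[of n] by eventually_elim (auto simp: power_mult_distrib[symmetric] intro!: power_mono)
 qed (use sq_int_norm[OF w] in auto)
 from tendsto_real_sqrt[OF this] show ?thesis by (simp add: sq_norm_def)
qed

section \<open>The Heisenberg group and its lattice\<close>

lemma vec3_eq_iff: "x = y \<longleftrightarrow> x$1 = y$1 & x$2 = y$2 & x$3 = y$3" for x y :: "'a^3"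
 by (simp add: vec_eq_iff forall_3)

lemma hmul_nth [simp]: "(p \<odot> q)$1 = p$1 + q$1" "(p \<odot> q)$2 = p$2 + q$2"
  "(p \<odot> q)$3 = p$3 + q$3 + 2 * (p$2 * q$1 - p$1 * q$2)"
 by (simp_all add: hmul_def)

lemma dil_nth [simp]: "(dil l x)$1 = l * x$1" "(dil l x)$2 = l * x$2" "(dil l x)$3 = l^2 * x$3"
 by (simp_all add: dil_def)

lemma lat_nth [simp]: "lat k $ i = 2 * real_of_int (k$i)"
 by (simp add: lat_def)

lemma hmul_assoc: "(p \<odot> q) \<odot> r = p \<odot> (q \<odot> r)"
 by (simp add: vec3_eq_iff algebra_simps)

lemma hmul_0 [simp]: "0 \<odot> p = p" "p \<odot> 0 = p"
 by (simp_all add: vec3_eq_iff)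

lemma hmul_minus [simp]: "(- p) \<odot> p = 0" "p \<odot> (- p) = 0"
 by (simp_all add: vec3_eq_iff)

lemma hmul_cancel [simp]: "(- p) \<odot> (p \<odot> q) = q" "p \<odot> ((- p) \<odot> q) = q"
  "(q \<odot> p) \<odot> (- p) = q" "(q \<odot> (- p)) \<odot> p = q"
 by (simp_all add: hmul_assoc) (simp_all add: hmul_assoc[symmetric])

lemma dil_hmul: "dil l (p \<odot> q) = dil l p \<odot> dil l q"
 by (simp add: vec3_eq_iff algebra_simps power2_eq_square)

lemma dil_dil: "dil l (dil m x) = dil (l * m) x"
 by (simp add: vec3_eq_iff power_mult_distrib)

lemma dil_1 [simp]: "dil 1 x = x"
 by (simp add: vec3_eq_iff)

lemma dil_inv [simp]: "l ~= 0 ==> dil (1/l) (dil l x) = x" "l ~= 0 ==> dil l (dil (1/l) x) = x"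
 by (simp_all add: dil_dil)

text \<open>The bracket term of two lattice points is \<open>8 * (k$2 * l$1 - k$1 * l$2)\<close>, an
  even integer, so the points \<open>lat k\<close> are closed under multiplication.\<close>

lemma lat_mult: "\<exists>m. lat k \<odot> lat l = lat m"
 by (rule exI[of _ "vector [k$1 + l$1, k$2 + l$2, k$3 + l$3 + 4 * (k$2 * l$1 - k$1 * l$2)]"])
   (simp add: vec3_eq_iff)

lemma lat_uminus: "- lat k = lat (- k)"
 by (simp add: vec3_eq_iff)

lemma lat_inj: "lat k = lat l \<longleftrightarrow> k = l"
 by (simp add: vec3_eq_iff)

lemma Ycell_iff: "y : Ycell \<longleftrightarrow> 0 <= y$1 & y$1 < 2 & 0 <= y$2 & y$2 < 2 & 0 <= y$3 & y$3 < 2"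
 by (auto simp: Ycell_def forall_3)

text \<open>Left translation by \<open>lat k\<close> moves the first two coordinates by even
  integers, so their indices are read off first. The shear \<open>4 * (b * y$1 - a * y$2)\<close>
  that it adds to the third coordinate of the remainder \<open>y\<close> is then known and is
  subtracted before the last floor. This explicit formula gives existence and uniqueness in the
  tiling at once.\<close>

definition lidx :: "real^3 => int^3" where
 "lidx x = (let a = \<lfloor>x$1/2\<rfloor>; b = \<lfloor>x$2/2\<rfloor> in
   vector [a, b, \<lfloor>(x$3 - 4 * (b * (x$1 - 2*a) - a * (x$2 - 2*b))) / 2\<rfloor>])"

definition lrep :: "real^3 => real^3" where
 "lrep x = (- lat (lidx x)) \<odot> x"

lemma lat_lrep [simp]: "lat (lidx x) \<odot> lrep x = x"
 by (simp add: lrep_def)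

lemma frac_bounds: "0 <= x - 2 * of_int \<lfloor>x/2\<rfloor>" "x - 2 * of_int \<lfloor>x/2\<rfloor> < 2" for x :: real
 using of_int_floor_le[of "x/2"] real_of_int_floor_add_one_gt[of "x/2"] by linarith+

lemma lrep_Ycell [simp]: "lrep x : Ycell"
proof -
 let ?a = "real_of_int \<lfloor>x$1/2\<rfloor>" and ?b = "real_of_int \<lfloor>x$2/2\<rfloor>"
 let ?z = "x$3 - 4 * (?b * (x$1 - 2 * ?a) - ?a * (x$2 - 2 * ?b))"
 have "lrep x $ 1 = x$1 - 2 * ?a" "lrep x $ 2 = x$2 - 2 * ?b" "lrep x $ 3 = ?z - 2 * of_int \<lfloor>?z/2\<rfloor>"
  by (simp_all add: lrep_def lidx_def Let_def algebra_simps)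
 thus ?thesis unfolding Ycell_iff using frac_bounds by simp
qed

lemma lidx_lat: assumes "y : Ycell" shows "lidx (lat k \<odot> y) = k"
proof -
 have f: "\<lfloor>(2 * of_int n + z) / 2\<rfloor> = n" if "0 <= z" "z < 2" for n and z :: real
  using that by (intro floor_unique) auto
 note y = assms[unfolded Ycell_iff]
 have 1: "\<lfloor>(lat k \<odot> y)$1/2\<rfloor> = k$1" "\<lfloor>(lat k \<odot> y)$2/2\<rfloor> = k$2" using y by (simp_all add: f)
 have "lidx (lat k \<odot> y) $ 3 = \<lfloor>(2 * of_int (k$3) + y$3) / 2\<rfloor>"
  unfolding lidx_def Let_def 1 by (simp add: algebra_simps)
 hence "lidx (lat k \<odot> y) $ 3 = k$3" using y f[of "y$3" "k$3"] by simp
 moreover have "lidx (lat k \<odot> y) $ 1 = k$1" "lidx (lat k \<odot> y) $ 2 = k$2"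
  unfolding lidx_def Let_def 1 by simp_all
 ultimately show ?thesis by (simp add: vec3_eq_iff)
qed

lemma lrep_lat: "y : Ycell ==> lrep (lat k \<odot> y) = y"
 by (simp add: lrep_def lidx_lat)

lemma lat_Ycell_unique: "(- lat k) \<odot> x : Ycell \<longleftrightarrow> k = lidx x"
proof
 assume "(- lat k) \<odot> x : Ycell"
 from lidx_lat[OF this, of k] show "k = lidx x" by simp
next
 assume "k = lidx x" thus "(- lat k) \<odot> x : Ycell"
  using lrep_Ycell[of x] by (simp add: lrep_def)
qed

lemma lrep_lat_hmul: "lrep (lat k \<odot> x) = lrep x"
proof -
 obtain m where "lat k \<odot> lat (lidx x) = lat m" using lat_mult by blast
 hence "lat k \<odot> x = lat m \<odot> lrep x" by (metis hmul_assoc lat_lrep)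
 thus ?thesis by (simp add: lrep_lat)
qed

lemma lrep_id: "y : Ycell ==> lrep y = y"
 using lrep_lat[of y 0] by (simp add: lat_def zero_vec_def[symmetric])

lemma Y_periodic_lrep: "Y_periodic f ==> f (lrep x) = f x"
 unfolding Y_periodic_def by (metis lat_lrep)

lemma Y_periodicI_lrep: "Y_periodic (%x. f (lrep x))"
 by (simp add: Y_periodic_def lrep_lat_hmul)

lemma Y_periodicD: "Y_periodic f ==> f (lat k \<odot> x) = f x"
 by (simp add: Y_periodic_def)

lemma tile_iff: "x : (%y. lat k \<odot> y) ` Ycell \<longleftrightarrow> lidx x = k"
proof
 assume "x : (%y. lat k \<odot> y) ` Ycell" thus "lidx x = k" by (auto simp: lidx_lat)
next
 assume "lidx x = k" thus "x : (%y. lat k \<odot> y) ` Ycell"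
  by (intro image_eqI[of _ _ "lrep x"]) auto
qed

lemma cell_iff: assumes "e > 0" shows "x : cell e k \<longleftrightarrow> lidx (dil (1/e) x) = k"
proof -
 have "x : cell e k \<longleftrightarrow> dil (1/e) x : (%y. lat k \<odot> y) ` Ycell"
  unfolding cell_def using assms by (metis (no_types, lifting) dil_inv image_iff less_irrefl)
 thus ?thesis by (simp add: tile_iff)
qed

lemma cell_index_eq: "e > 0 ==> cell_index e x = lidx (dil (1/e) x)"
 unfolding cell_index_def by (rule the_equality) (auto simp: cell_iff)

lemma finite_int_vec: "finite {k::int^3. \<forall>i. \<bar>k$i\<bar> <= N}"
proof -
 have "{k::int^3. \<forall>i. \<bar>k$i\<bar> <= N} <= (%(a,b,c). vector [a,b,c]) ` ({-N..N} \<times> {-N..N} \<times> {-N..N})"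
 proof
  fix k :: "int^3" assume "k : {k::int^3. \<forall>i. \<bar>k$i\<bar> <= N}"
  hence "\<forall>i. \<bar>k$i\<bar> <= N" by simp
  hence k: "k$1 : {-N..N}" "k$2 : {-N..N}" "k$3 : {-N..N}" by (auto simp: abs_le_iff minus_le_iff)
  have "k = vector [k$1,k$2,k$3]" by (simp add: vec3_eq_iff)
  with k show "k : (%(a,b,c). vector [a,b,c]) ` ({-N..N} \<times> {-N..N} \<times> {-N..N})"
   by (intro image_eqI[of _ _ "(k$1,k$2,k$3)"]) auto
 qed
 thus ?thesis by (rule finite_subset) auto
qed

lemma abs_floor_le: "\<bar>of_int \<lfloor>x\<rfloor>\<bar> <= \<bar>x\<bar> + (1::real)"
 by linarith

text \<open>The vertical index is bounded last, because the shear in the third coordinate grows with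
  the horizontal indices. The number \<open>N\<close> is a generous common bound for the three
  estimates.\<close>

lemma finite_lidx: assumes "bounded S" shows "finite (lidx ` S)"
proof -
 obtain R where R: "!!x. x : S ==> norm x <= R" using assms bounded_iff by blast
 define N where "N = \<lceil>2 * \<bar>R\<bar> + 20 * (\<bar>R\<bar> + 2) + 2\<rceil>"
 have "lidx ` S <= {k. \<forall>i. \<bar>k$i\<bar> <= N}"
 proof (clarsimp simp: forall_3)
  fix x assume "x : S"
  hence x: "\<bar>x$i\<bar> <= \<bar>R\<bar>" for i using R[of x] component_le_norm_cart[of x i] by auto
  let ?a = "lidx x $ 1" and ?b = "lidx x $ 2" and ?c = "lidx x $ 3"
  have a: "\<bar>real_of_int ?a\<bar> <= \<bar>R\<bar> + 1" and b: "\<bar>real_of_int ?b\<bar> <= \<bar>R\<bar> + 1"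
   using abs_floor_le[of "x$1/2"] abs_floor_le[of "x$2/2"] x[of 1] x[of 2]
   unfolding lidx_def Let_def vector_3 by linarith+
  have eq: "x = lat (lidx x) \<odot> lrep x" by simp
  let ?y = "lrep x"
  have y: "0 <= ?y$1" "?y$1 < 2" "0 <= ?y$2" "?y$2 < 2" "0 <= ?y$3" "?y$3 < 2"
   using lrep_Ycell[of x] by (auto simp: Ycell_iff)
  have "x$3 = (lat (lidx x) \<odot> lrep x) $ 3" by simp
  hence "2 * real_of_int ?c = x$3 - ?y$3 - 4 * (real_of_int ?b * ?y$1 - real_of_int ?a * ?y$2)"
   by (simp del: lat_lrep)
  moreover have "\<bar>real_of_int ?b * ?y$1\<bar> <= (\<bar>R\<bar> + 1) * 2" "\<bar>real_of_int ?a * ?y$2\<bar> <= (\<bar>R\<bar> + 1) * 2"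
   unfolding abs_mult using a b y by (auto intro!: mult_mono simp del: distrib_right_numeral)
  moreover have "2 * \<bar>r\<bar> <= \<bar>R\<bar> + 2 + 4 * (4 * (\<bar>R\<bar> + 1))"
   if "2 * r = x$3 - ?y$3 - 4 * (p - q)" "\<bar>p\<bar> <= (\<bar>R\<bar> + 1) * 2" "\<bar>q\<bar> <= (\<bar>R\<bar> + 1) * 2" for p q r
   using that x[of 3] y(5,6) by (smt (verit))
  ultimately have c: "2 * \<bar>real_of_int ?c\<bar> <= \<bar>R\<bar> + 2 + 4 * (4 * (\<bar>R\<bar> + 1))"
   by blast
  have "2 * \<bar>R\<bar> + 20 * (\<bar>R\<bar> + 2) + 2 <= real_of_int N" by (simp add: N_def)
  hence "real_of_int \<bar>?a\<bar> <= real_of_int N" "real_of_int \<bar>?b\<bar> <= real_of_int N" "real_of_int \<bar>?c\<bar> <= real_of_int N"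
   using a b c by auto
  thus "\<bar>?a\<bar> <= N & \<bar>?b\<bar> <= N & \<bar>?c\<bar> <= N" by (simp only: of_int_le_iff)
 qed
 thus ?thesis using finite_int_vec finite_subset by blast
qed

section \<open>Changes of variables\<close>

text \<open>Continuous maps whose push-forward of Lebesgue measure is a constant multiple of it. For
  an affine bijection the constant is the modulus of the determinant of the inverse;
  \<open>dil l\<close> gives \<open>1 / l^4\<close>, where 4 is the homogeneous dimension of the
  group.\<close>

definition volmap :: "real => (real^3 => real^3) => bool" where
 "volmap c T \<longleftrightarrow> 0 < c & continuous_on UNIV T & distr lborel lborel T = density lborel (%_. ennreal c)"

text \<open>Preimages of boxes under \<open>T\<close> are images under its inverse \<open>S\<close>,
  hence translates of linear images whose volume is given by the determinant. Agreement on boxes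
  determines the measure.\<close>

lemma volmap_affine:
 fixes T S g :: "real^3 => real^3"
 assumes TS: "!!x. T (S x) = x" "!!x. S (T x) = x" and T: "continuous_on UNIV T"
  and S: "!!x. S x = b + g x" and g: "linear g" and det: "\<bar>det (matrix g)\<bar> = c" and c: "c > 0"
 shows "volmap c T"
proof -
 have [measurable]: "T : bm borel" using T by (rule borel_measurable_continuous_onI)
 have "lborel = density (distr lborel borel T) (%_. ennreal (1/c))"
 proof (rule lborel_eqI)
  fix l u :: "real^3" assume le: "!!b. b : Basis ==> l \<bullet> b <= u \<bullet> b"
  have pre: "T -` box l u = (+) b ` g ` box l u"
  proof -
   have "T -` box l u = S ` box l u" using TS by (auto simp: image_iff) metis
   also have "... = (+) b ` g ` box l u" by (auto simp: S)
   finally show ?thesis .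
  qed
  have lm: "g ` box l u : lmeasurable" by (rule measurable_linear_image[OF g]) simp
  have "emeasure lborel (T -` box l u) = emeasure lebesgue (T -` box l u)"

   using measurable_sets[of T borel borel "box l u"] by simp
  also have "... = emeasure lebesgue (g ` box l u)"
   unfolding pre using lm
   by (metis emeasure_eq_measure2 fmeasurableD2 ennreal_eq_0_iff measurable_translation measure_translation emeasure_eq_ennreal_measure fmeasurable_def mem_Collect_eq less_top)
  also have "... = ennreal (c * measure lebesgue (box l u))"
   using lm det by (simp add: emeasure_eq_measure2 measure_linear_image[OF g] fmeasurableD2 emeasure_eq_ennreal_measure)
  finally have e: "emeasure lborel (T -` box l u) = ennreal (c * measure lebesgue (box l u))" .
  have "emeasure (density (distr lborel borel T) (%_. ennreal (1/c))) (box l u) = ennreal (1/c) * emeasure lborel (T -` box l u)"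
   by (simp add: emeasure_density_const emeasure_distr)
  also have "... = ennreal (measure lebesgue (box l u))"
   unfolding e using c by (simp add: ennreal_mult[symmetric])
  also have "... = (\<Prod>b\<in>Basis. (u - l) \<bullet> b)"
   using le by (simp add: measure_lborel_box_eq)
  finally show "emeasure (density (distr lborel borel T) (%_. ennreal (1/c))) (box l u) = (\<Prod>b\<in>Basis. (u - l) \<bullet> b)" .
 qed simp
 hence "density lborel (%_. ennreal c) = density (density (distr lborel borel T) (%_. ennreal (1/c))) (%_. ennreal c)"
  by simp
 also have "... = density (distr lborel borel T) (%_. ennreal (1/c) * ennreal c)"
  by (subst density_density_eq) auto
 also have "... = distr lborel lborel T"
  using c by (simp add: ennreal_mult[symmetric] density_1 cong: distr_cong)
 finally show ?thesis using c T by (simp add: volmap_def)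
qed

section \<open>Integrals and null sets under maps that scale the volume\<close>

context
 fixes c T assumes V: "volmap c T"
begin

lemma volmap_pos: "0 < c" using V by (simp add: volmap_def)

lemma volmap_borel [measurable]: "T : bm borel"
 using V by (auto simp: volmap_def intro: borel_measurable_continuous_onI)

lemma volmap_distr: "distr lebesgue lborel T = density lborel (%_. ennreal c)"
 using V by (simp add: distr_completion volmap_def)

lemma volmap_null: "null_sets (distr lebesgue lborel T) = null_sets lborel"
 using volmap_pos
 by (auto simp: volmap_distr null_sets_def emeasure_density_const)

text \<open>Continuity only yields Borel measurability. For the completed measure preimages of null
  sets must be null as well, which holds because the push-forward has a positive constant
  density.\<close>

lemma volmap_lebesgue: "T : lebesgue \<rightarrow>\<^sub>M lebesgue"
proof -
 show ?thesis
  by (rule completion.measurable_completion2) (auto simp: volmap_null intro: measurable_completion)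
qed

lemma volmap_distr_lebesgue: "distr lebesgue lebesgue T = density lebesgue (%_. ennreal c)"
proof -
 have "distr lebesgue lebesgue T = completion (distr lebesgue lborel T)"
  by (rule completion.completion_distr_eq[symmetric]) (auto simp: volmap_null intro: measurable_completion)
 also have "... = density lebesgue (%_. ennreal c)"
  unfolding volmap_distr using volmap_pos by (intro completion_density_eq) auto
 finally show ?thesis .
qed

lemma volmap_measurable: "g : lebesgue \<rightarrow>\<^sub>M N ==> (%x. g (T x)) : lebesgue \<rightarrow>\<^sub>M N"
 by (rule measurable_compose[OF volmap_lebesgue])

lemma volmap_nn_integral:
 assumes "g : bm lebesgue"
 shows "(\<integral>\<^sup>+x. g (T x) \<partial>lebesgue) = ennreal c * (\<integral>\<^sup>+x. g x \<partial>lebesgue)"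
proof -
 have "(\<integral>\<^sup>+x. g (T x) \<partial>lebesgue) = (\<integral>\<^sup>+x. g x \<partial>distr lebesgue lebesgue T)"
  using assms by (subst nn_integral_distr[OF volmap_lebesgue]) auto
 also have "... = ennreal c * (\<integral>\<^sup>+x. g x \<partial>lebesgue)"
  unfolding volmap_distr_lebesgue using assms by (simp add: nn_integral_density nn_integral_cmult)
 finally show ?thesis .
qed

lemma volmap_integrable:
 fixes g :: "real^3 => 'b::{banach, second_countable_topology}"
 assumes "integrable lebesgue g" shows "integrable lebesgue (%x. g (T x))"
proof -
 have "integrable (density lebesgue (%_. ennreal c)) g"
  using assms volmap_pos by (subst integrable_density) (auto intro!: borel_measurable_integrable)
 thus ?thesis
  using assms by (subst (asm) volmap_distr_lebesgue[symmetric], subst (asm) integrable_distr_eq[OF volmap_lebesgue]) auto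
qed

lemma volmap_integral:
 fixes g :: "real^3 => 'b::{banach, second_countable_topology}"
 assumes "g : bm lebesgue" shows "(LINT x|lebesgue. g (T x)) = c *R (LINT x|lebesgue. g x)"
proof -
 have "(LINT x|lebesgue. g (T x)) = (LINT x|distr lebesgue lebesgue T. g x)"
  using assms by (subst integral_distr[OF volmap_lebesgue]) auto
 also have "... = c *R (LINT x|lebesgue. g x)"
  unfolding volmap_distr_lebesgue using assms volmap_pos by (subst integral_density) auto
 finally show ?thesis .
qed

lemma volmap_AE: assumes "AE x in lebesgue. P x" shows "AE x in lebesgue. P (T x)"
proof -
 have "AE x in density lebesgue (%_. ennreal c). P x" using assms by (subst AE_density) auto
 thus ?thesis unfolding volmap_distr_lebesgue[symmetric] by (rule AE_distrD[OF volmap_lebesgue])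
qed

end

lemma axis3_nth [simp]: "(axis 1 1 :: real^3)$1 = 1" "(axis 1 1 :: real^3)$2 = 0" "(axis 1 1 :: real^3)$3 = 0"
  "(axis 2 1 :: real^3)$1 = 0" "(axis 2 1 :: real^3)$2 = 1" "(axis 2 1 :: real^3)$3 = 0"
  "(axis 3 1 :: real^3)$1 = 0" "(axis 3 1 :: real^3)$2 = 0" "(axis 3 1 :: real^3)$3 = 1"
 by (simp_all add: axis_def)

lemma continuous_vector3 [continuous_intros]:
 fixes f g h :: "'a::topological_space => real"
 assumes "continuous_on S f" "continuous_on S g" "continuous_on S h"
 shows "continuous_on S (%x. vector [f x, g x, h x] :: real^3)"
proof -
 have "(%x. vector [f x, g x, h x] :: real^3) = (%x. f x *R axis 1 1 + g x *R axis 2 1 + h x *R axis 3 1)"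
  by (simp add: fun_eq_iff vec3_eq_iff)
 thus ?thesis by (simp only:) (intro continuous_intros assms)
qed

lemma continuous_hmul [continuous_intros]:
 assumes "continuous_on S f" "continuous_on S g"
 shows "continuous_on S (%x. f x \<odot> g x)"
 unfolding hmul_def by (intro continuous_intros assms)

lemma continuous_dil [continuous_intros]:
 assumes "continuous_on S f" "continuous_on S g"
 shows "continuous_on S (%x. dil (f x) (g x))"
 unfolding dil_def by (intro continuous_intros assms)

lemma matrix3: "matrix f $ i $ j = f (axis j 1) $ i" for f :: "real^3 => real^3"
 by (simp add: matrix_def)

lemma volmap_left: "volmap 1 (%x. p \<odot> x)"
proof (rule volmap_affine[where S = "%x. (-p) \<odot> x" and b = "-p"
   and g = "%x. vector [x$1, x$2, x$3 + 2 * (- (p$2) * x$1 + p$1 * x$2)]"])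
 let ?g = "%x::real^3. vector [x$1, x$2, x$3 + 2 * (- (p$2) * x$1 + p$1 * x$2)] :: real^3"
 show "linear ?g" by (rule linearI) (simp_all add: vec3_eq_iff algebra_simps)
 show "\<bar>det (matrix ?g)\<bar> = 1" by (simp add: det_3 matrix3)
qed (auto simp: vec3_eq_iff intro!: continuous_intros)

lemma volmap_right: "volmap 1 (%x. x \<odot> p)"
proof (rule volmap_affine[where S = "%x. x \<odot> (-p)" and b = "-p"
   and g = "%x. vector [x$1, x$2, x$3 + 2 * (- (x$2) * p$1 + x$1 * p$2)]"])
 let ?g = "%x::real^3. vector [x$1, x$2, x$3 + 2 * (- (x$2) * p$1 + x$1 * p$2)] :: real^3"
 show "linear ?g" by (rule linearI) (simp_all add: vec3_eq_iff algebra_simps)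
 show "\<bar>det (matrix ?g)\<bar> = 1" by (simp add: det_3 matrix3)
qed (auto simp: vec3_eq_iff intro!: continuous_intros)

lemma volmap_dil: assumes "l > 0" shows "volmap (1 / l^4) (dil l)"
proof (rule volmap_affine[where S = "dil (1/l)" and b = 0 and g = "dil (1/l)"])
 show "linear (dil (1/l))" by (rule linearI) (simp_all add: vec3_eq_iff algebra_simps)
 have "det (matrix (dil (1/l))) = (1/l) * (1/l) * (1/l)^2" by (simp add: det_3 matrix3)
 also have "... = 1 / l^4" by (simp add: power2_eq_square eval_nat_numeral)
 finally show "\<bar>det (matrix (dil (1/l)))\<bar> = 1 / l^4" using assms by simp
 show "continuous_on UNIV (dil l)" by (intro continuous_intros continuous_on_id)
qed (use assms in auto)

section \<open>Lebesgue measurable functions on products\<close>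

lemma lebesgue_measurable_AE:
 fixes f g :: "'a::euclidean_space => 'b::topological_space"
 assumes f: "f : bm lebesgue" and eq: "AE x in lebesgue. f x = g x"
 shows "g : bm lebesgue"
proof (rule measurableI)
 fix A :: "'b set" assume "A : sets borel"
 hence "f -` A \<inter> space lebesgue : sets lebesgue" by (rule measurable_sets[OF f])
 thus "g -` A \<inter> space lebesgue : sets lebesgue"
  by (rule completion.in_sets_AE[rotated]) (use eq in "auto elim!: eventually_mono")
qed simp

lemma lebesgue_on_measurable_AE:
 fixes f g :: "'a::euclidean_space => 'b::euclidean_space"
 assumes S: "S : sets lebesgue" and f: "f : bm (lebesgue_on S)"
  and eq: "AE x in lebesgue_on S. f x = g x"
 shows "g : bm (lebesgue_on S)"
proof -
 have "(%x. if x : S then f x else 0) : bm lebesgue"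
  using f S by (simp add: borel_measurable_if)
 moreover have "AE x in lebesgue. (if x : S then f x else 0) = (if x : S then g x else 0)"
  using eq S by (subst (asm) AE_restrict_space_iff) (auto elim!: eventually_mono)
 ultimately have "(%x. if x : S then g x else 0) : bm lebesgue"
  by (rule lebesgue_measurable_AE)
 thus ?thesis using S by (simp add: borel_measurable_if)
qed

text \<open>Lebesgue measurability is fragile under sections and compositions. The arguments on
  products replace a function by a Borel one that agrees almost everywhere and carry the conclusion
  back.\<close>

lemma borel_representative:
 fixes f :: "'a::euclidean_space => 'b::euclidean_space"
 assumes S: "S : sets lebesgue" and f: "f : bm (lebesgue_on S)"
 shows "\<exists>f'\<in>bm borel. AE x in lebesgue_on S. f x = f' x"
proof -
 let ?g = "%x. if x : S then f x else 0"
 have g: "?g : bm lebesgue" using f S by (simp add: borel_measurable_if)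
 have "\<exists>h\<in>bm lborel. AE x in lborel. ?g x \<bullet> b = h x" for b
  by (rule completion_ex_borel_measurable_real) (use g in measurable)
 then obtain h where h [measurable]: "!!b. h b : bm lborel" and eq: "!!b. AE x in lborel. ?g x \<bullet> b = h b x" by metis
 define f' where "f' x = (\<Sum>b\<in>Basis. h b x *R b)" for x
 have "f' : bm borel" unfolding f'_def using h by measurable
 moreover have "AE x in lborel. \<forall>b\<in>Basis. ?g x \<bullet> b = h b x"
  using eq by (intro AE_finite_allI) auto
 hence "AE x in lborel. ?g x = f' x"
 proof eventually_elim
  case (elim x)
  hence "f' x = (\<Sum>b\<in>Basis. (?g x \<bullet> b) *R b)" unfolding f'_def by (intro sum.cong) auto
  thus ?case by (simp only: euclidean_representation)
 qed
 hence "AE x in lebesgue. ?g x = f' x" by (rule AE_completion)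
 hence "AE x in lebesgue_on S. f x = f' x"
  using S by (subst AE_restrict_space_iff) (auto elim!: eventually_mono split: if_splits)
 ultimately show ?thesis by blast
qed

lemma AE_lebesgue_on: "S : sets lebesgue ==> (AE x in lebesgue_on S. P x) \<longleftrightarrow> (AE x in lebesgue. x : S --> P x)"
 by (simp add: AE_restrict_space_iff)

lemma AE_lebesgue_lborel: "(AE x in lebesgue. P x) \<longleftrightarrow> (AE x in lborel. P x)"
 by (rule AE_completion_iff)

context
 fixes S :: "'a::euclidean_space set" and T :: "'b::euclidean_space set"
 assumes S [measurable]: "S : sets borel" and T [measurable]: "T : sets borel"
begin

lemma prod_borel: "S \<times> T : sets borel"
 using S T by (simp add: borel_prod[symmetric])

lemma lebesgue_sets: "S : sets lebesgue" "T : sets lebesgue" "S \<times> T : sets lebesgue"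
 using S T prod_borel by auto

lemma AE_prod_sections:
 assumes "AE p in lebesgue_on (S \<times> T). P p"
 shows "AE x in lebesgue_on S. AE y in lebesgue_on T. P (x, y)"
proof -
 have "AE p in lborel. p : S \<times> T --> P p"
  using assms by (simp add: AE_lebesgue_on lebesgue_sets AE_lebesgue_lborel)
 hence "AE p in lborel \<Otimes>\<^sub>M lborel. p : S \<times> T --> P p" by (subst lborel_prod)
 from lborel_pair.AE_pair[OF this] have "AE x in lborel. AE y in lborel. (x, y) : S \<times> T --> P (x, y)" .
 thus ?thesis
  unfolding AE_lebesgue_on[OF lebesgue_sets(1)] AE_lebesgue_on[OF lebesgue_sets(2)] AE_lebesgue_lborel
  by eventually_elim auto
qed

text \<open>If \<open>f\<close> agrees with a Borel function off a null set \<open>N\<close>, the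
  pullbacks agree off \<open>N \<times> UNIV\<close>, which is null in the product.\<close>

lemma measurable_fst_lebesgue:
 fixes f :: "'a => 'c::euclidean_space"
 assumes "f : bm (lebesgue_on S)"
 shows "(%p. f (fst p)) : bm (lebesgue_on (S \<times> T))"
proof -
 obtain f' where f'[measurable]: "f' : bm borel" and eq: "AE x in lebesgue_on S. f x = f' x"
  using borel_representative[OF lebesgue_sets(1) assms] by blast
 have "AE x in lborel. x : S --> f x = f' x"
  using eq by (simp add: AE_lebesgue_on lebesgue_sets AE_lebesgue_lborel)
 then obtain N where N: "N : null_sets lborel" "{x. \<not> (x : S --> f x = f' x)} <= N"
  by (auto simp: eventually_ae_filter)
 have "N \<times> UNIV : null_sets (lborel \<Otimes>\<^sub>M (lborel :: 'b measure))"
  using lborel.emeasure_pair_measure_Times[of N lborel "UNIV :: 'b set"] N(1)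
  by (intro null_setsI) (auto simp: null_setsD1 null_setsD2)
 hence "AE p in lborel. p ~: N \<times> (UNIV :: 'b set)" by (simp add: lborel_prod AE_not_in)
 hence ae: "AE p in lebesgue_on (S \<times> T). f' (fst p) = f (fst p)"
  unfolding AE_lebesgue_on[OF lebesgue_sets(3)] AE_lebesgue_lborel
  using N(2) by (auto elim!: eventually_mono)
 have "(%p. f' (fst p)) : bm (borel :: ('a \<times> 'b) measure)"
  by (subst borel_prod[symmetric]) measurable
 hence "(%p. f' (fst p)) : bm (lebesgue_on (S \<times> T))"
  by (intro measurable_restrict_space1 measurable_completion) simp
 note m = this
 show ?thesis by (rule lebesgue_on_measurable_AE[OF lebesgue_sets(3) m ae])
qed

lemma measurable_snd_lebesgue:
 fixes f :: "'b => 'c::euclidean_space"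
 assumes "f : bm (lebesgue_on T)"
 shows "(%p. f (snd p)) : bm (lebesgue_on (S \<times> T))"
proof -
 obtain f' where f'[measurable]: "f' : bm borel" and eq: "AE x in lebesgue_on T. f x = f' x"
  using borel_representative[OF lebesgue_sets(2) assms] by blast
 have "AE x in lborel. x : T --> f x = f' x"
  using eq by (simp add: AE_lebesgue_on lebesgue_sets AE_lebesgue_lborel)
 then obtain N where N: "N : null_sets lborel" "{x. \<not> (x : T --> f x = f' x)} <= N"
  by (auto simp: eventually_ae_filter)
 have "UNIV \<times> N : null_sets ((lborel :: 'a measure) \<Otimes>\<^sub>M lborel)"
  using lborel.emeasure_pair_measure_Times[of "UNIV :: 'a set" lborel N] N(1)
  by (intro null_setsI) (auto simp: null_setsD1 null_setsD2)
 hence "AE p in lborel. p ~: (UNIV :: 'a set) \<times> N" by (simp add: lborel_prod AE_not_in)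
 hence ae: "AE p in lebesgue_on (S \<times> T). f' (snd p) = f (snd p)"
  unfolding AE_lebesgue_on[OF lebesgue_sets(3)] AE_lebesgue_lborel
  using N(2) by (auto elim!: eventually_mono)
 have "(%p. f' (snd p)) : bm (borel :: ('a \<times> 'b) measure)"
  by (subst borel_prod[symmetric]) measurable
 hence "(%p. f' (snd p)) : bm (lebesgue_on (S \<times> T))"
  by (intro measurable_restrict_space1 measurable_completion) simp
 note m = this
 show ?thesis by (rule lebesgue_on_measurable_AE[OF lebesgue_sets(3) m ae])
qed

text \<open>Lebesgue measure on the product is the completion of the product of the Borel-Lebesgue
  measures. Fubini is applied to a Borel representative there, and sections of \<open>h\<close>
  itself are measurable only for almost every \<open>x\<close>.\<close>

lemma fubini_lebesgue_nn:
 fixes h :: "'a \<times> 'b => real"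
 assumes h: "h : bm (lebesgue_on (S \<times> T))"
 shows "AE x in lebesgue_on S. (%y. h (x, y)) : bm (lebesgue_on T)"
  and "(%x. \<integral>\<^sup>+y. ennreal (h (x, y)) \<partial>lebesgue_on T) : bm (lebesgue_on S)"
  and "(\<integral>\<^sup>+p. ennreal (h p) \<partial>lebesgue_on (S \<times> T)) = (\<integral>\<^sup>+x. \<integral>\<^sup>+y. ennreal (h (x, y)) \<partial>lebesgue_on T \<partial>lebesgue_on S)"
proof -
 obtain h' where h'[measurable]: "h' : bm borel" and eq: "AE x in lebesgue_on (S \<times> T). h x = h' x"
  using borel_representative[OF lebesgue_sets(3) h] by blast
 have [measurable]: "h' : bm (borel \<Otimes>\<^sub>M borel)" by (simp add: borel_prod)
 note sec = AE_prod_sections[OF eq]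
 have m: "(%y. h' (x, y)) : bm (lebesgue_on T)" for x
  by (intro measurable_restrict_space1 measurable_completion) simp
 show "AE x in lebesgue_on S. (%y. h (x, y)) : bm (lebesgue_on T)"
  using sec
 proof eventually_elim
  case (elim x)
  hence "AE y in lebesgue_on T. h' (x, y) = h (x, y)" by eventually_elim simp
  thus ?case by (rule lebesgue_on_measurable_AE[OF lebesgue_sets(2) m])
 qed
 define I where "I x = (\<integral>\<^sup>+y. ennreal (h' (x, y)) * indicator T y \<partial>lborel)" for x
 have I [measurable]: "I : bm borel"
  unfolding I_def using lborel.borel_measurable_nn_integral[of "%x y. ennreal (h' (x, y)) * indicator T y" borel] by simp
 have Ieq: "I x = (\<integral>\<^sup>+y. ennreal (h' (x, y)) \<partial>lebesgue_on T)" for x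
  unfolding I_def by (simp add: nn_integral_restrict_space lebesgue_sets nn_integral_completion)
 have J: "AE x in lebesgue_on S. I x = (\<integral>\<^sup>+y. ennreal (h (x, y)) \<partial>lebesgue_on T)"
  using sec by eventually_elim (auto simp: Ieq intro!: nn_integral_cong_AE elim!: eventually_mono)
 have "AE x in lebesgue. (if x : S then I x else 0) = (if x : S then (\<integral>\<^sup>+y. ennreal (h (x, y)) \<partial>lebesgue_on T) else 0)"
  using J by (subst (asm) AE_lebesgue_on[OF lebesgue_sets(1)]) (auto elim!: eventually_mono)
 moreover have "(%x. if x : S then I x else 0) : bm lebesgue"
  by (intro measurable_completion) simp
 ultimately have "(%x. if x : S then (\<integral>\<^sup>+y. ennreal (h (x, y)) \<partial>lebesgue_on T) else 0) : bm lebesgue"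
  by (rule lebesgue_measurable_AE[rotated])
 thus "(%x. \<integral>\<^sup>+y. ennreal (h (x, y)) \<partial>lebesgue_on T) : bm (lebesgue_on S)"
  by (rule measurable_cong[THEN iffD1, rotated, OF measurable_restrict_space1]) auto
 have "(\<integral>\<^sup>+p. ennreal (h p) \<partial>lebesgue_on (S \<times> T)) = (\<integral>\<^sup>+p. ennreal (h' p) \<partial>lebesgue_on (S \<times> T))"
  using eq by (intro nn_integral_cong_AE) (auto elim!: eventually_mono)
 also have "... = (\<integral>\<^sup>+p. ennreal (h' p) * indicator (S \<times> T) p \<partial>(lborel \<Otimes>\<^sub>M lborel))"
  by (simp add: nn_integral_restrict_space lebesgue_sets nn_integral_completion lborel_prod)
 also have "... = (\<integral>\<^sup>+x. \<integral>\<^sup>+y. ennreal (h' (x, y)) * indicator (S \<times> T) (x, y) \<partial>lborel \<partial>lborel)"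
  by (intro lborel.nn_integral_fst[symmetric]) simp
 also have "... = (\<integral>\<^sup>+x. I x * indicator S x \<partial>lborel)"
  unfolding I_def by (intro nn_integral_cong) (auto simp: indicator_def)
 also have "... = (\<integral>\<^sup>+x. I x \<partial>lebesgue_on S)"
  by (simp add: nn_integral_restrict_space lebesgue_sets nn_integral_completion)
 also have "... = (\<integral>\<^sup>+x. \<integral>\<^sup>+y. ennreal (h (x, y)) \<partial>lebesgue_on T \<partial>lebesgue_on S)"
  using J by (intro nn_integral_cong_AE) (auto elim!: eventually_mono)
 finally show "(\<integral>\<^sup>+p. ennreal (h p) \<partial>lebesgue_on (S \<times> T)) = ..." .
qed

lemma fubini_lebesgue:
 fixes h :: "'a \<times> 'b => 'c::euclidean_space"
 assumes h: "integrable (lebesgue_on (S \<times> T)) h"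
 shows "AE x in lebesgue_on S. integrable (lebesgue_on T) (%y. h (x, y))"
  and "integrable (lebesgue_on S) (%x. LINT y|lebesgue_on T. h (x, y))"
  and "(LINT p|lebesgue_on (S \<times> T). h p) = (LINT x|lebesgue_on S. LINT y|lebesgue_on T. h (x, y))"
proof -
 obtain h' where h'[measurable]: "h' : bm borel" and eq: "AE x in lebesgue_on (S \<times> T). h x = h' x"
  using borel_representative[OF lebesgue_sets(3) borel_measurable_integrable[OF h]] by blast
 have [measurable]: "h' : bm (borel \<Otimes>\<^sub>M borel)" by (simp add: borel_prod)
 note sec = AE_prod_sections[OF eq]
 have m: "(%y. h' (x, y)) : bm (lebesgue_on T)" for x
  by (intro measurable_restrict_space1 measurable_completion) simp
 have m2: "h' : bm (lebesgue_on (S \<times> T))"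
  by (intro measurable_restrict_space1 measurable_completion) simp
 define g where "g p = indicator (S \<times> T) p *R h' p" for p
 have gm [measurable]: "g : bm (borel \<Otimes>\<^sub>M borel)" unfolding g_def by measurable
 have "integrable (lebesgue_on (S \<times> T)) h'"
  using h eq m2 by (subst integrable_cong_AE[of _ _ h]) (auto elim!: eventually_mono)
 hence "integrable lebesgue g"
  unfolding g_def by (simp add: integrable_restrict_space lebesgue_sets)
 hence g: "integrable (lborel \<Otimes>\<^sub>M lborel) g"
  using gm by (simp add: integrable_completion lborel_prod borel_prod)
 define I where "I x = (LINT y|lborel. g (x, y))" for x
 have I [measurable]: "I : bm borel"
  unfolding I_def using lborel.borel_measurable_lebesgue_integral[of "%x y. g (x, y)" borel] by simp
 have gx: "g (x, y) = indicator T y *R h' (x, y)" if "x : S" for x y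
  using that by (auto simp: g_def indicator_def)
 have Ieq: "I x = (LINT y|lebesgue_on T. h' (x, y))" if "x : S" for x
  unfolding I_def gx[OF that] by (simp add: integral_restrict_space lebesgue_sets integral_completion)
 have AEi: "AE x in lebesgue_on S. integrable (lebesgue_on T) (%y. h' (x, y))"
 proof -
  have "AE x in lborel. integrable lborel (%y. g (x, y))" by (rule lborel_pair.AE_integrable_fst'[OF g])
  thus ?thesis unfolding AE_lebesgue_on[OF lebesgue_sets(1)] AE_lebesgue_lborel
   by eventually_elim (auto simp: gx integrable_restrict_space lebesgue_sets integrable_completion)
 qed
 show "AE x in lebesgue_on S. integrable (lebesgue_on T) (%y. h (x, y))"
  using AEi sec
 proof eventually_elim
  case (elim x)
  have e: "AE y in lebesgue_on T. h' (x, y) = h (x, y)" using elim(2) by eventually_elim simp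
  have "(%y. h (x, y)) : bm (lebesgue_on T)"
   by (rule lebesgue_on_measurable_AE[OF lebesgue_sets(2) m e])
  thus ?case using elim(1) e m by (subst integrable_cong_AE[of _ _ "%y. h' (x, y)"]) (auto elim!: eventually_mono)
 qed
 have J: "AE x in lebesgue_on S. I x = (LINT y|lebesgue_on T. h (x, y))"
 proof -
  have "AE x in lebesgue_on S. x : S" by (rule AE_I2) simp
  thus ?thesis using sec
  proof eventually_elim
   case (elim x)
   have e: "AE y in lebesgue_on T. h' (x, y) = h (x, y)" using elim(2) by eventually_elim simp
   hence "(%y. h (x, y)) : bm (lebesgue_on T)"
    by (rule lebesgue_on_measurable_AE[OF lebesgue_sets(2) m])
   thus ?case using m e by (auto simp: Ieq elim(1) intro!: integral_cong_AE)
  qed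
 qed
 have Im: "I : bm (lebesgue_on S)"
  by (intro measurable_restrict_space1 measurable_completion) simp
 have Jm: "(%x. LINT y|lebesgue_on T. h (x, y)) : bm (lebesgue_on S)"
  by (rule lebesgue_on_measurable_AE[OF lebesgue_sets(1) Im J])
 have zero: "I x = 0" if "x ~: S" for x using that by (simp add: I_def g_def)
 have "integrable lborel I" unfolding I_def by (rule lborel_pair.integrable_fst'[OF g])
 moreover have "(%x. indicator S x *R I x) = I" using zero by (auto simp: fun_eq_iff indicator_def)
 ultimately have "integrable (lebesgue_on S) I"
  by (simp add: integrable_restrict_space lebesgue_sets integrable_completion)
 thus "integrable (lebesgue_on S) (%x. LINT y|lebesgue_on T. h (x, y))"
  using J Jm Im by (subst integrable_cong_AE[of _ _ I]) (auto elim!: eventually_mono)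
 have "(LINT p|lebesgue_on (S \<times> T). h p) = (LINT p|lebesgue_on (S \<times> T). h' p)"
  using eq h m2 by (intro integral_cong_AE) auto
 also have "... = integral\<^sup>L (lborel \<Otimes>\<^sub>M lborel) g"
 proof -
  have "g : bm lborel" using gm by (simp add: borel_prod)
  hence "integral\<^sup>L lebesgue g = integral\<^sup>L lborel g" by (rule integral_completion)
  thus ?thesis by (simp add: integral_restrict_space lebesgue_sets lborel_prod g_def[symmetric])
 qed
 also have "... = (LINT x|lborel. I x)"
  unfolding I_def by (rule lborel_pair.integral_fst'[OF g, symmetric])
 also have "... = (LINT x|lebesgue_on S. I x)"
  using zero by (simp add: integral_restrict_space lebesgue_sets integral_completion)
    (auto intro!: Bochner_Integration.integral_cong simp: indicator_def)
 also have "... = (LINT x|lebesgue_on S. LINT y|lebesgue_on T. h (x, y))"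
  using J Im Jm by (intro integral_cong_AE) auto
 finally show "(LINT p|lebesgue_on (S \<times> T). h p) = ..." .
qed

text \<open>Equality on almost all sections says nothing about the product unless the set of points
  in question is measurable. Joint measurability allows integrating \<open>norm (f p - g p)\<close>
  section by section.\<close>

lemma AE_prodI:
 fixes f g :: "'a \<times> 'b => 'c::euclidean_space"
 assumes f: "f : bm (lebesgue_on (S \<times> T))" and g: "g : bm (lebesgue_on (S \<times> T))"
  and eq: "AE x in lebesgue_on S. AE y in lebesgue_on T. f (x, y) = g (x, y)"
 shows "AE p in lebesgue_on (S \<times> T). f p = g p"
proof -
 have m: "(%p. norm (f p - g p)) : bm (lebesgue_on (S \<times> T))" using f g by measurable
 have "(\<integral>\<^sup>+p. ennreal (norm (f p - g p)) \<partial>lebesgue_on (S \<times> T)) =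
   (\<integral>\<^sup>+x. \<integral>\<^sup>+y. ennreal (norm (f (x, y) - g (x, y))) \<partial>lebesgue_on T \<partial>lebesgue_on S)"
  by (rule fubini_lebesgue_nn(3)[OF m])
 also have "... = (\<integral>\<^sup>+x. 0 \<partial>lebesgue_on S)"
 proof (rule nn_integral_cong_AE, use eq in eventually_elim)
  case (elim x)
  hence "AE y in lebesgue_on T. ennreal (norm (f (x, y) - g (x, y))) = 0" by eventually_elim simp
  hence "(\<integral>\<^sup>+y. ennreal (norm (f (x, y) - g (x, y))) \<partial>lebesgue_on T) = (\<integral>\<^sup>+y. 0 \<partial>lebesgue_on T)"
   by (rule nn_integral_cong_AE)
  thus ?case by simp
 qed
 finally have "(\<integral>\<^sup>+p. ennreal (norm (f p - g p)) \<partial>lebesgue_on (S \<times> T)) = 0" by simp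
 thus ?thesis using m by (subst (asm) nn_integral_0_iff_AE) auto
qed

lemma sq_int_sections:
 fixes h :: "'a \<times> 'b => 'c::euclidean_space"
 assumes h: "h : sq_int (lebesgue_on (S \<times> T))"
 shows "AE x in lebesgue_on S. (%y. h (x, y)) : sq_int (lebesgue_on T)"
  and "integrable (lebesgue_on S) (%x. (sq_norm (lebesgue_on T) (%y. h (x, y)))^2)"
  and "(sq_norm (lebesgue_on (S \<times> T)) h)^2 = (LINT x|lebesgue_on S. (sq_norm (lebesgue_on T) (%y. h (x, y)))^2)"
proof -
 obtain h' where h'[measurable]: "h' : bm borel" and eq: "AE x in lebesgue_on (S \<times> T). h x = h' x"
  using borel_representative[OF lebesgue_sets(3) sq_intD[OF h]] by blast
 have [measurable]: "h' : bm (borel \<Otimes>\<^sub>M borel)" by (simp add: borel_prod)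
 have m: "(%y. h' (x, y)) : bm (lebesgue_on T)" for x
  by (intro measurable_restrict_space1 measurable_completion) simp
 have "AE x in lebesgue_on S. (%y. h (x, y)) : bm (lebesgue_on T)"
  using AE_prod_sections[OF eq]
 proof eventually_elim
  case (elim x)
  have "AE y in lebesgue_on T. h' (x, y) = h (x, y)" using elim by eventually_elim simp
  thus ?case by (rule lebesgue_on_measurable_AE[OF lebesgue_sets(2) m])
 qed
 thus "AE x in lebesgue_on S. (%y. h (x, y)) : sq_int (lebesgue_on T)"
  using fubini_lebesgue(1)[OF sq_int_norm[OF h]] by eventually_elim (simp add: sq_int_def)
 show "integrable (lebesgue_on S) (%x. (sq_norm (lebesgue_on T) (%y. h (x, y)))^2)"
  using fubini_lebesgue(2)[OF sq_int_norm[OF h]] by (simp add: sq_norm_sq)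
 show "(sq_norm (lebesgue_on (S \<times> T)) h)^2 = (LINT x|lebesgue_on S. (sq_norm (lebesgue_on T) (%y. h (x, y)))^2)"
  using fubini_lebesgue(3)[OF sq_int_norm[OF h]] by (simp add: sq_norm_sq)
qed

lemma sq_int_tensor:
 fixes p :: "'a => real" and q :: "'b => 'c::euclidean_space"
 assumes p: "p : sq_int (lebesgue_on S)" and q: "q : sq_int (lebesgue_on T)"
 shows "(%z. p (fst z) *R q (snd z)) : sq_int (lebesgue_on (S \<times> T))"
  and "sq_norm (lebesgue_on (S \<times> T)) (%z. p (fst z) *R q (snd z)) = sq_norm (lebesgue_on S) p * sq_norm (lebesgue_on T) q"
proof -
 let ?h = "%z. p (fst z) *R q (snd z)"
 have m: "?h : bm (lebesgue_on (S \<times> T))"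
  by (intro borel_measurable_scaleR measurable_fst_lebesgue measurable_snd_lebesgue sq_intD p q)
 have pn: "(\<integral>\<^sup>+x. ennreal ((p x)^2) \<partial>lebesgue_on S) = ennreal ((sq_norm (lebesgue_on S) p)^2)"
  using nn_integral_sq_norm[OF p] by simp
 have "(\<integral>\<^sup>+z. ennreal ((norm (?h z))^2) \<partial>lebesgue_on (S \<times> T)) =
   (\<integral>\<^sup>+x. \<integral>\<^sup>+y. ennreal ((norm (?h (x, y)))^2) \<partial>lebesgue_on T \<partial>lebesgue_on S)"
  by (rule fubini_lebesgue_nn(3)) (use m in measurable)
 also have "... = (\<integral>\<^sup>+x. ennreal ((p x)^2) * ennreal ((sq_norm (lebesgue_on T) q)^2) \<partial>lebesgue_on S)"
  using q by (simp add: power_mult_distrib ennreal_mult nn_integral_cmult nn_integral_sq_norm sq_intD)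
 also have "... = ennreal ((sq_norm (lebesgue_on S) p * sq_norm (lebesgue_on T) q)^2)"
  using p by (simp add: nn_integral_multc pn ennreal_mult power_mult_distrib sq_intD)
 finally have e: "(\<integral>\<^sup>+z. ennreal ((norm (?h z))^2) \<partial>lebesgue_on (S \<times> T)) = ennreal ((sq_norm (lebesgue_on S) p * sq_norm (lebesgue_on T) q)^2)" .
 show h: "?h : sq_int (lebesgue_on (S \<times> T))" by (rule sq_norm_le_nn(1)[OF m]) (use e in auto)
 have "ennreal ((sq_norm (lebesgue_on (S \<times> T)) ?h)^2) = ennreal ((sq_norm (lebesgue_on S) p * sq_norm (lebesgue_on T) q)^2)"
  using e nn_integral_sq_norm[OF h] by simp
 thus "sq_norm (lebesgue_on (S \<times> T)) ?h = sq_norm (lebesgue_on S) p * sq_norm (lebesgue_on T) q"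
  by (simp add: power2_eq_iff_nonneg)
qed

end

section \<open>Integration over the fundamental cell\<close>

text \<open>Dominated convergence is a statement about sequences. The bound \<open>X i <= 1\<close>
  is what makes estimates such as \<open>unf_near\<close> uniform along the sequence.\<close>

lemma at_right_0_seqI:
 fixes f :: "real => 'b::topological_space"
 assumes "!!X. (!!i::nat. 0 < X i & X i <= 1) ==> X ----> 0 ==> (%i. f (X i)) ----> l"
 shows "(f \<longlongrightarrow> l) (at_right 0)"
proof (subst tendsto_at_iff_sequentially, intro allI impI)
 fix X :: "nat => real" assume X: "\<forall>i. X i : {0<..} - {0}" and lim: "X ----> 0"
 hence "\<forall>\<^sub>F i in sequentially. X i < 1" by (intro order_tendstoD) auto
 then obtain N where N: "!!i. i >= N ==> X i < 1" by (auto simp: eventually_sequentially)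
 have "(%i. f (X (i + N))) ----> l"
 proof (rule assms)
  show "0 < X (i + N) & X (i + N) <= 1" for i using X N[of "i + N"] by (auto intro: less_imp_le)
  show "(%i. X (i + N)) ----> 0" using lim by (rule LIMSEQ_ignore_initial_segment)
 qed
 thus "(f \<circ> X) ----> l" by (simp add: o_def LIMSEQ_offset)
qed

lemma Ycell_borel [measurable]: "Ycell : sets borel"
proof -
 have "Ycell = (\<Inter>i. {y::real^3. 0 <= y$i} \<inter> {y. y$i < 2})" by (auto simp: Ycell_def)
 moreover have "{y::real^3. 0 <= y$i} \<inter> {y. y$i < 2} : sets borel" for i
  by (intro sets.Int borel_closed borel_open closed_Collect_le open_Collect_less continuous_intros)
 ultimately show ?thesis by (metis (no_types, lifting) UNIV_not_empty finite_class.finite_UNIV image_iff sets.finite_INT)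
qed

lemma Ycell_lebesgue [measurable, simp]: "Ycell : sets lebesgue"
 by (simp add: Ycell_borel)

lemma Ycell_subset: "Ycell <= cbox 0 (vec 2)"
 by (auto simp: Ycell_def mem_box_cart less_imp_le)

lemma bounded_Ycell: "bounded Ycell"
 by (rule bounded_subset[OF bounded_cbox Ycell_subset])

lemma emeasure_Ycell: "emeasure lebesgue Ycell = 8"
proof (rule antisym)
 have ne: "cbox 0 (vec 2 :: real^3) ~= {}" by (simp add: interval_ne_empty_cart)
 have c: "measure lborel (cbox 0 (vec 2 :: real^3)) = 8"
  by (subst content_cbox_cart[OF ne]) simp
 have e: "emeasure lborel (cbox 0 (vec 2 :: real^3)) = 8"
  using emeasure_eq_ennreal_measure[of lborel "cbox 0 (vec 2 :: real^3)"] emeasure_lborel_cbox_finite[of 0 "vec 2 :: real^3"]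
  by (simp add: c less_top)
 have "emeasure lebesgue Ycell <= emeasure lebesgue (cbox 0 (vec 2 :: real^3))"
  by (rule emeasure_mono[OF Ycell_subset]) simp
 thus "emeasure lebesgue Ycell <= 8" using e by simp
 have "emeasure lborel (box 0 (vec 2 :: real^3)) = emeasure lborel (cbox 0 (vec 2 :: real^3))"
  by (simp add: emeasure_lborel_box_eq emeasure_lborel_cbox_eq)
 hence "8 = emeasure lebesgue (box 0 (vec 2 :: real^3))" using e by simp
 also have "... <= emeasure lebesgue Ycell"
  by (rule emeasure_mono) (auto simp: Ycell_def mem_box_cart intro: less_imp_le)
 finally show "8 <= emeasure lebesgue Ycell" .
qed

lemma finite_measure_lebesgue_on:
 assumes "S : sets lebesgue" "bounded S" shows "finite_measure (lebesgue_on S)"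
proof
 have "emeasure lebesgue S < \<infinity>"
  using bounded_set_imp_lmeasurable[OF assms(2,1)] unfolding fmeasurable_def by auto
 thus "emeasure (lebesgue_on S) (space (lebesgue_on S)) ~= \<infinity>"
  using assms by (auto simp: emeasure_restrict_space)
qed

lemma finite_Ycell: "finite_measure LY"
 by (simp add: finite_measure_lebesgue_on bounded_Ycell)

lemma measure_Ycell: "measure LY Ycell = 8"
 by (simp add: measure_def emeasure_restrict_space emeasure_Ycell)

lemma integral_const_Ycell: "(LINT y|LY. c) = 8 *R (c :: 'b::{banach, second_countable_topology})"
 by (simp add: measure_Ycell)

lemma lebesgue_borelI: "f : bm borel ==> f : lebesgue \<rightarrow>\<^sub>M borel"
 by (intro measurable_completion) simp

lemma borel_measurable_vec_nth [measurable (raw)]: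
 "f : bm M ==> (%x. f x $ i :: real) : bm M" for f :: "'a => real^'n"
 by (rule measurable_compose[OF _ borel_measurable_continuous_onI]) (auto intro!: continuous_intros)

lemma borel_measurable_vector3 [measurable (raw)]:
 assumes "f : bm M" "g : bm M" "h : bm M"
 shows "(%x. vector [f x, g x, h x] :: real^3) : bm M"
proof -
 have "(%x. vector [f x, g x, h x] :: real^3) = (%x. f x *R axis 1 1 + g x *R axis 2 1 + h x *R axis 3 1)"
  by (simp add: fun_eq_iff vec3_eq_iff)
 thus ?thesis using assms by simp
qed

lemma borel_measurable_hmul [measurable (raw)]:
 assumes "f : bm M" "g : bm M"
 shows "(%x. f x \<odot> g x) : bm M"
 unfolding hmul_def using assms by measurable

lemma borel_measurable_dil [measurable (raw)]:
 assumes "g : bm M" shows "(%x. dil l (g x)) : bm M"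
 unfolding dil_def using assms by measurable

lemma lidx_measurable [measurable]: "lidx : borel \<rightarrow>\<^sub>M count_space UNIV"
proof (subst measurable_count_space_eq2_countable, safe)
 fix k :: "int^3"
 have "lidx -` {k} \<inter> space borel = {x. (- lat k) \<odot> x : Ycell}" by (auto simp: lat_Ycell_unique)
 also have "... : sets borel" by measurable
 finally show "lidx -` {k} \<inter> space borel : sets borel" .
qed auto

lemma lat_measurable [measurable]: "lat : count_space UNIV \<rightarrow>\<^sub>M borel"
 by simp

lemma lrep_measurable [measurable]: "lrep : bm borel"
 unfolding lrep_def[abs_def] lat_uminus by measurable

definition zenum :: "nat => int^3" where "zenum = from_nat_into UNIV"

lemma bij_zenum: "bij zenum"
proof -
 have "inj (%n::int. vector [n,0,0] :: int^3)" by (rule injI) (simp add: vec3_eq_iff)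
 hence "infinite (range (%n::int. vector [n,0,0] :: int^3))" by (simp add: finite_image_iff)
 hence "infinite (UNIV :: (int^3) set)" using finite_subset subset_UNIV by blast
 thus ?thesis unfolding zenum_def by (intro bij_betw_from_nat_into) auto
qed

lemma suminf_lidx: "(\<Sum>n. f (zenum n) * indicator Ycell ((- lat (zenum n)) \<odot> x)) = (f (lidx x) :: ennreal)"
proof -
 obtain m where m: "zenum m = lidx x" using bij_zenum by (metis bij_pointE)
 have "f (zenum n) * indicator Ycell ((- lat (zenum n)) \<odot> x) = (if n = m then f (lidx x) else 0)" for n
  using bij_zenum m by (auto simp: indicator_def lat_Ycell_unique bij_def inj_def)
 thus ?thesis by (subst suminf_finite[of "{m}"]) auto
qed

lemma tile_nn_integral:
 fixes g :: "real^3 => ennreal"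
 assumes g: "g : bm lebesgue"
 shows "(\<integral>\<^sup>+x. g x \<partial>lebesgue) = (\<Sum>n. \<integral>\<^sup>+y. g (lat (zenum n) \<odot> y) * indicator Ycell y \<partial>lebesgue)"
proof -
 have m: "(%x. g x * indicator Ycell ((- lat k) \<odot> x)) : bm lebesgue" for k
  using g volmap_measurable[OF volmap_left, of "indicator Ycell :: _ => ennreal" borel "- lat k"] by simp
 have "(\<integral>\<^sup>+x. g x \<partial>lebesgue) = (\<integral>\<^sup>+x. (\<Sum>n. g x * indicator Ycell ((- lat (zenum n)) \<odot> x)) \<partial>lebesgue)"
  using suminf_lidx[of "%_. g x" for x] by (intro nn_integral_cong) simp
 also have "... = (\<Sum>n. \<integral>\<^sup>+x. g x * indicator Ycell ((- lat (zenum n)) \<odot> x) \<partial>lebesgue)"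
  using m by (intro nn_integral_suminf)
 also have "... = (\<Sum>n. \<integral>\<^sup>+y. g (lat (zenum n) \<odot> y) * indicator Ycell y \<partial>lebesgue)"
  using volmap_nn_integral[OF volmap_left m, of "lat k" k for k] by simp
 finally show ?thesis .
qed

text \<open>The exceptional set in the cell has countably many lattice translates, and all of them
  are null.\<close>

lemma AE_lrep:
 assumes "AE y in LY. P y" shows "AE x in lebesgue. P (lrep x)"
proof -
 have "AE y in lebesgue. y : Ycell --> P y" using assms by (simp add: AE_lebesgue_on)
 hence "AE x in lebesgue. (- lat k) \<odot> x : Ycell --> P ((- lat k) \<odot> x)" for k
  by (rule volmap_AE[OF volmap_left])
 hence "AE x in lebesgue. \<forall>k. (- lat k) \<odot> x : Ycell --> P ((- lat k) \<odot> x)"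
  by (simp add: AE_all_countable)
 thus ?thesis
 proof eventually_elim
  case (elim x)
  thus ?case using lrep_Ycell[of x] by (auto simp: lrep_def)
 qed
qed

lemma lrep_measurable_lebesgue:
 fixes w :: "real^3 => 'b::euclidean_space"
 assumes "w : bm LY"
 shows "(%x. w (lrep x)) : bm lebesgue"
proof -
 obtain w' where w'[measurable]: "w' : bm borel" and eq: "AE y in LY. w y = w' y"
  using borel_representative[OF Ycell_lebesgue assms] by blast
 have "AE x in lebesgue. w' (lrep x) = w (lrep x)" using AE_lrep[OF eq] by eventually_elim simp
 moreover have "(%x. w' (lrep x)) : bm lebesgue" by (rule lebesgue_borelI) measurable
 ultimately show ?thesis by (rule lebesgue_measurable_AE[rotated])
qed

lemma periodic_measurable:
 fixes w :: "real^3 => 'b::euclidean_space"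
 assumes "Y_periodic w" "w : bm LY"
 shows "w : bm lebesgue"
 using lrep_measurable_lebesgue[OF assms(2)] by (simp add: Y_periodic_lrep[OF assms(1)])

text \<open>Periodicity refers to left translations by the lattice, which commute with right
  translation by any \<open>g\<close>. Right translation turns the cell into another fundamental
  domain, whose pieces are moved back to the cell by left lattice translations. The flows of the
  horizontal fields are right translations, so this is the invariance used in the Poincare
  inequality.\<close>

lemma nn_integral_right_translate:
 fixes P :: "real^3 => ennreal"
 assumes P: "P : bm lebesgue" and per: "Y_periodic P"
 shows "(\<integral>\<^sup>+y. P (y \<odot> g) \<partial>LY) = (\<integral>\<^sup>+y. P y \<partial>LY)"
proof -
 have iY: "(indicator Ycell :: _ => ennreal) : bm lebesgue" by simp
 have m: "(%x. P x * indicator Ycell (x \<odot> - g)) : bm lebesgue"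
  using P volmap_measurable[OF volmap_right iY, of "- g"] by simp
 have m2: "(%y. P y * indicator Ycell (lat k \<odot> y \<odot> - g) * indicator Ycell y) : bm lebesgue" for k
  using P volmap_measurable[OF volmap_left volmap_measurable[OF volmap_right iY, of "- g"], of "lat k"] by simp
 have "(\<integral>\<^sup>+y. P (y \<odot> g) \<partial>LY) = (\<integral>\<^sup>+y. P (y \<odot> g) * indicator Ycell (y \<odot> g \<odot> - g) \<partial>lebesgue)"
  by (simp add: nn_integral_restrict_space)
 also have "... = (\<integral>\<^sup>+x. P x * indicator Ycell (x \<odot> - g) \<partial>lebesgue)"
  using volmap_nn_integral[OF volmap_right m, of g] by simp
 also have "... = (\<Sum>n. \<integral>\<^sup>+y. P y * indicator Ycell (lat (zenum n) \<odot> y \<odot> - g) * indicator Ycell y \<partial>lebesgue)"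
  by (subst tile_nn_integral[OF m]) (simp add: Y_periodicD[OF per])
 also have "... = (\<integral>\<^sup>+y. (\<Sum>n. P y * indicator Ycell (lat (zenum n) \<odot> y \<odot> - g) * indicator Ycell y) \<partial>lebesgue)"
  using m2 by (intro nn_integral_suminf[symmetric])
 also have "... = (\<integral>\<^sup>+y. P y * indicator Ycell y \<partial>lebesgue)"
 proof (intro nn_integral_cong)
  fix y :: "real^3"
  let ?z = "y \<odot> - g"
  \<comment> \<open>Exactly one left lattice translate of \<open>y \<odot> - g\<close> lies in the
    cell, so the sum over the tiles has a single nonzero term.\<close>
  obtain m where m: "zenum m = - lidx ?z" using bij_zenum by (metis bij_pointE)
  have "indicator Ycell (lat (zenum n) \<odot> y \<odot> - g) = (if n = m then 1 else 0 :: ennreal)" for n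
  proof -
   have "lat (zenum n) \<odot> y \<odot> - g = (- lat (- zenum n)) \<odot> ?z" by (simp add: hmul_assoc lat_uminus)
   hence "lat (zenum n) \<odot> y \<odot> - g : Ycell \<longleftrightarrow> - zenum n = lidx ?z" by (simp add: lat_Ycell_unique)
   also have "... \<longleftrightarrow> n = m" using m bij_zenum by (metis add.inverse_inverse bij_def injD)
   finally show ?thesis by (auto simp: indicator_def)
  qed
  hence "(\<Sum>n. P y * indicator Ycell (lat (zenum n) \<odot> y \<odot> - g) * indicator Ycell y) = (\<Sum>n. if n = m then P y * indicator Ycell y else 0)"
   by (intro suminf_cong) simp
  thus "(\<Sum>n. P y * indicator Ycell (lat (zenum n) \<odot> y \<odot> - g) * indicator Ycell y) = P y * indicator Ycell y"
   by (subst (asm) suminf_finite[of "{m}"]) auto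
 qed
 also have "... = (\<integral>\<^sup>+y. P y \<partial>LY)"
  by (simp add: nn_integral_restrict_space)
 finally show ?thesis .
qed

text \<open>\<open>S\<close> is covered by the finitely many tiles it meets, and \<open>P\<close>
  has the same integral over each of them.\<close>

lemma nn_integral_periodic_bounded:
 fixes P :: "real^3 => ennreal"
 assumes P: "P : bm lebesgue" and per: "Y_periodic P" and S: "bounded S" "S : sets lebesgue"
 shows "(\<integral>\<^sup>+x. P x \<partial>lebesgue_on S) <= of_nat (card (lidx ` S)) * (\<integral>\<^sup>+y. P y \<partial>LY)"
proof -
 have fin: "finite (lidx ` S)" by (rule finite_lidx[OF S(1)])
 have iY: "(indicator Ycell :: _ => ennreal) : bm lebesgue" by simp
 have m: "(%x. P x * indicator Ycell ((- lat k) \<odot> x)) : bm lebesgue" for k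
  using P volmap_measurable[OF volmap_left iY, of "- lat k"] by simp
 have "(\<integral>\<^sup>+x. P x \<partial>lebesgue_on S) = (\<integral>\<^sup>+x. P x * indicator S x \<partial>lebesgue)"
  using S by (simp add: nn_integral_restrict_space)
 also have "... <= (\<integral>\<^sup>+x. (\<Sum>k\<in>lidx ` S. P x * indicator Ycell ((- lat k) \<odot> x)) \<partial>lebesgue)"
 proof (intro nn_integral_mono)
  fix x
  show "P x * indicator S x <= (\<Sum>k\<in>lidx ` S. P x * indicator Ycell ((- lat k) \<odot> x))"
  proof (cases "x : S")
   case True
   have "P x * indicator Ycell ((- lat (lidx x)) \<odot> x) <= (\<Sum>k\<in>lidx ` S. P x * indicator Ycell ((- lat k) \<odot> x))"
    using True fin by (intro member_le_sum) auto
   thus ?thesis using True lat_Ycell_unique[of "lidx x" x] by simp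
  qed simp
 qed
 also have "... = (\<Sum>k\<in>lidx ` S. \<integral>\<^sup>+x. P x * indicator Ycell ((- lat k) \<odot> x) \<partial>lebesgue)"
  using m by (intro nn_integral_sum)
 also have "... = (\<Sum>k\<in>lidx ` S. \<integral>\<^sup>+y. P y \<partial>LY)"
 proof (intro sum.cong refl)
  fix k
  have "(\<integral>\<^sup>+x. P x * indicator Ycell ((- lat k) \<odot> x) \<partial>lebesgue) = (\<integral>\<^sup>+y. P (lat k \<odot> y) * indicator Ycell y \<partial>lebesgue)"
   using volmap_nn_integral[OF volmap_left m, of "lat k" k] by simp
  thus "(\<integral>\<^sup>+x. P x * indicator Ycell ((- lat k) \<odot> x) \<partial>lebesgue) = (\<integral>\<^sup>+y. P y \<partial>LY)"
   by (simp add: Y_periodicD[OF per] nn_integral_restrict_space)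
 qed
 finally show ?thesis by simp
qed

lemma periodic_integrable:
 fixes p :: "real^3 => 'b::euclidean_space"
 assumes per: "Y_periodic p" and p: "integrable LY p" and S: "bounded S" "S : sets lebesgue"
 shows "integrable (lebesgue_on S) p"
proof (rule integrableI_bounded)
 have m: "p : bm lebesgue" by (rule periodic_measurable[OF per borel_measurable_integrable[OF p]])
 thus "p : bm (lebesgue_on S)" by (rule measurable_restrict_space1)
 have "(\<integral>\<^sup>+x. ennreal (norm (p x)) \<partial>lebesgue_on S) <= of_nat (card (lidx ` S)) * (\<integral>\<^sup>+y. ennreal (norm (p y)) \<partial>LY)"
  using m per by (intro nn_integral_periodic_bounded S) (auto simp: Y_periodic_def)
 also have "... < \<infinity>" using p by (simp add: integrable_iff_bounded ennreal_mult_less_top of_nat_less_top)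
 finally show "(\<integral>\<^sup>+x. ennreal (norm (p x)) \<partial>lebesgue_on S) < \<infinity>" .
qed

lemma periodic_sq_int:
 fixes p :: "real^3 => 'b::euclidean_space"
 assumes per: "Y_periodic p" and p: "p : sq_int LY" and S: "bounded S" "S : sets lebesgue"
 shows "p : sq_int (lebesgue_on S)"
proof (rule sq_intI)
 show "p : bm (lebesgue_on S)"
  by (intro measurable_restrict_space1 periodic_measurable[OF per sq_intD[OF p]])
 show "integrable (lebesgue_on S) (%x. (norm (p x))^2)"
  using per by (intro periodic_integrable[OF _ sq_int_norm[OF p] S]) (auto simp: Y_periodic_def)
qed

lemma integral_tiles:
 fixes h :: "real^3 => 'b::euclidean_space"
 assumes h: "integrable lebesgue h" and F: "finite F" "!!x. h x ~= 0 ==> lidx x : F"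
 shows "!!k. integrable LY (%y. h (lat k \<odot> y))"
  and "(LINT x|lebesgue. h x) = (\<Sum>k\<in>F. (LINT y|LY. h (lat k \<odot> y)))"
proof -
 have iY: "(indicator Ycell :: _ => real) : bm lebesgue" by simp
 let ?h = "%k x. indicator Ycell ((- lat k) \<odot> x) *R h x"
 have m: "?h k : bm lebesgue" for k
  using h volmap_measurable[OF volmap_left iY, of "- lat k"] by (auto intro!: borel_measurable_scaleR)
 have i: "integrable lebesgue (?h k)" for k
  by (rule Bochner_Integration.integrable_bound[OF h m]) (auto simp: indicator_def)
 show *: "integrable LY (%y. h (lat k \<odot> y))" for k
  using volmap_integrable[OF volmap_left[of "lat k"] i[of k]] by (simp add: integrable_restrict_space)
 have "(LINT x|lebesgue. h x) = (LINT x|lebesgue. (\<Sum>k\<in>F. ?h k x))"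
 proof (intro Bochner_Integration.integral_cong refl)
  fix x
  have "?h k x = (if k = lidx x then h x else 0)" for k by (auto simp: indicator_def lat_Ycell_unique)
  hence "(\<Sum>k\<in>F. ?h k x) = (\<Sum>k\<in>F. if k = lidx x then h x else 0)" by (intro sum.cong) auto
  also have "... = (if lidx x : F then h x else 0)" using F(1) by simp
  finally show "h x = (\<Sum>k\<in>F. ?h k x)" using F(2)[of x] by auto
 qed
 also have "... = (\<Sum>k\<in>F. (LINT x|lebesgue. ?h k x))" using i by (rule Bochner_Integration.integral_sum)
 also have "... = (\<Sum>k\<in>F. (LINT y|LY. h (lat k \<odot> y)))"
 proof (intro sum.cong refl)
  show "(LINT x|lebesgue. ?h k x) = (LINT y|LY. h (lat k \<odot> y))" for k
   using volmap_integral[OF volmap_left[of "lat k"] m[of k]] by (simp add: integral_restrict_space)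
 qed
 finally show "(LINT x|lebesgue. h x) = (\<Sum>k\<in>F. (LINT y|LY. h (lat k \<odot> y)))" .
qed

section \<open>Periodic unfolding\<close>

definition unf :: "real => (real^3) \<times> (real^3) => real^3" where
 "unf \<epsilon> p = dil \<epsilon> (lat (lidx (dil (1/\<epsilon>) (fst p))) \<odot> snd p)"

lemma unf_measurable_borel [measurable]: "unf e : bm borel"
proof -
 have "unf e : bm (borel \<Otimes>\<^sub>M borel)" unfolding unf_def[abs_def] by measurable
 thus ?thesis by (simp add: borel_prod)
qed

lemma unfolding_op_eq:
 assumes "e > 0"
 shows "unfolding_op E e h p = (if fst p : inner_region E e then h (unf e p) else 0)"
 using assms by (cases p) (simp add: unfolding_op_def unf_def cell_index_eq dil_hmul)

lemma inner_region_iff: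
 assumes "e > 0" shows "x : inner_region E e \<longleftrightarrow> lidx (dil (1/e) x) : inner_cells E e"
 using assms by (simp add: inner_region_def cell_iff)

lemma inner_region_subset: "inner_region E e <= E"
 by (auto simp: inner_region_def inner_cells_def)

lemma lidx_region_borel: "{x. lidx (dil (1/e) x) : J} : sets borel"
proof -
 have "(%x. lidx (dil (1/e) x)) : borel \<rightarrow>\<^sub>M count_space UNIV" by measurable
 from measurable_sets[OF this, of J] show ?thesis by (simp add: vimage_def)
qed

lemma inner_region_borel: "e > 0 ==> inner_region E e : sets borel"
proof -
 assume "e > 0"
 hence "inner_region E e = {x. lidx (dil (1/e) x) : inner_cells E e}" by (auto simp: inner_region_iff)
 thus ?thesis by (simp add: lidx_region_borel)
qed

context
 fixes \<epsilon> :: real and J :: "(int^3) set" and R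
 assumes \<epsilon>: "\<epsilon> > 0" and R: "R = {x. lidx (dil (1/\<epsilon>) x) : J}"
begin

lemma R_borel: "R : sets borel" using lidx_region_borel R by simp

lemma RY_lebesgue: "R \<times> Ycell : sets lebesgue"
 by (rule lebesgue_sets(3)[OF R_borel Ycell_borel])

text \<open>For \<open>x\<close> in a tile of scale \<epsilon> the image depends only on the tile
  and on \<open>y\<close>. Thus \<open>x\<close> contributes the volume
  \<open>8 * \<epsilon>^4\<close> of the tile, while \<open>y\<close> fills the tile with density
  \<open>1 / \<epsilon>^4\<close>; the product of the two is the density 8. The set \<open>R\<close>
  is any union of tiles: the inner region for the unfolding operator, everything for
  \<open>averaging\<close>.\<close>

lemma unf_distr:
 "distr (lebesgue_on (R \<times> Ycell)) borel (unf \<epsilon>) = density lborel (%x. 8 * indicator R x)"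
proof (rule measure_eqI)
 fix A assume "A : sets (distr (lebesgue_on (R \<times> Ycell)) borel (unf \<epsilon>))"
 hence A [measurable]: "A : sets borel" by simp
 \<comment> \<open>The volume, in the variable \<open>y\<close>, of the part of tile
   \<open>k\<close> that lies in \<open>A\<close>. Both measures of \<open>A\<close> become
   multiples of the sum of \<open>H\<close> over \<open>J\<close>.\<close>
 define H :: "int^3 => ennreal" where "H k = (\<integral>\<^sup>+y. indicator A (dil \<epsilon> (lat k \<odot> y)) * indicator Ycell y \<partial>lebesgue)" for k
 have mu: "unf \<epsilon> : bm (lebesgue_on (R \<times> Ycell))"
  by (intro measurable_restrict_space1 lebesgue_borelI) measurable
 have "emeasure (distr (lebesgue_on (R \<times> Ycell)) borel (unf \<epsilon>)) A
   = (\<integral>\<^sup>+p. indicator A p \<partial>distr (lebesgue_on (R \<times> Ycell)) borel (unf \<epsilon>))" by simp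
 also have "... = (\<integral>\<^sup>+p. ennreal (indicat_real A (unf \<epsilon> p)) \<partial>lebesgue_on (R \<times> Ycell))"
  using mu by (subst nn_integral_distr) (auto simp: ennreal_indicator)
 also have "... = (\<integral>\<^sup>+x. \<integral>\<^sup>+y. ennreal (indicat_real A (unf \<epsilon> (x, y))) \<partial>LY \<partial>lebesgue_on R)"
  by (rule fubini_lebesgue_nn(3)[OF R_borel Ycell_borel], rule measurable_compose[OF mu]) simp
 also have "... = (\<integral>\<^sup>+x. H (lidx (dil (1/\<epsilon>) x)) * indicator R x \<partial>lebesgue)"
  using R_borel by (simp add: nn_integral_restrict_space H_def unf_def ennreal_indicator)
 also have "... = (\<integral>\<^sup>+x. (%z. H (lidx z) * indicator J (lidx z)) (dil (1/\<epsilon>) x) \<partial>lebesgue)"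
  by (intro nn_integral_cong) (auto simp: R indicator_def)
 also have "... = ennreal (\<epsilon>^4) * (\<integral>\<^sup>+z. H (lidx z) * indicator J (lidx z) \<partial>lebesgue)"
  using \<epsilon> by (subst volmap_nn_integral[OF volmap_dil]) (auto simp: power_one_over intro!: lebesgue_borelI)
 also have "(\<integral>\<^sup>+z. H (lidx z) * indicator J (lidx z) \<partial>lebesgue)
   = (\<Sum>n. \<integral>\<^sup>+y. H (lidx (lat (zenum n) \<odot> y)) * indicator J (lidx (lat (zenum n) \<odot> y)) * indicator Ycell y \<partial>lebesgue)"
  by (rule tile_nn_integral) (intro lebesgue_borelI, measurable)
 also have "... = (\<Sum>n. \<integral>\<^sup>+y. H (zenum n) * indicator J (zenum n) * indicator Ycell y \<partial>lebesgue)"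
  by (intro suminf_cong nn_integral_cong) (auto simp: indicator_def lidx_lat)
 also have "... = (\<Sum>n. H (zenum n) * indicator J (zenum n) * 8)"
  by (intro suminf_cong) (subst nn_integral_cmult_indicator, auto simp: emeasure_Ycell simp del: emeasure_completion)
 also have "... = 8 * (\<Sum>n. H (zenum n) * indicator J (zenum n))"
  by (simp add: mult.commute)
 finally have 1: "emeasure (distr (lebesgue_on (R \<times> Ycell)) borel (unf \<epsilon>)) A =
   ennreal (\<epsilon>^4) * (8 * (\<Sum>n. H (zenum n) * indicator J (zenum n)))" .
 have "(\<integral>\<^sup>+x. indicator A x * indicator R x \<partial>lebesgue) = (\<integral>\<^sup>+x. (%z. indicator A (dil \<epsilon> z) * indicator J (lidx z)) (dil (1/\<epsilon>) x) \<partial>lebesgue)"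
  using \<epsilon> by (intro nn_integral_cong) (auto simp: R indicator_def)
 also have "... = ennreal (\<epsilon>^4) * (\<integral>\<^sup>+z. indicator A (dil \<epsilon> z) * indicator J (lidx z) \<partial>lebesgue)"
  using \<epsilon> by (subst volmap_nn_integral[OF volmap_dil]) (auto simp: power_one_over intro!: lebesgue_borelI)
 also have "(\<integral>\<^sup>+z. indicator A (dil \<epsilon> z) * indicator J (lidx z) \<partial>lebesgue)
   = (\<Sum>n. \<integral>\<^sup>+y. indicator A (dil \<epsilon> (lat (zenum n) \<odot> y)) * indicator J (lidx (lat (zenum n) \<odot> y)) * indicator Ycell y \<partial>lebesgue)"
  by (rule tile_nn_integral) (intro lebesgue_borelI, measurable)
 also have "... = (\<Sum>n. \<integral>\<^sup>+y. indicator J (zenum n) * (indicator A (dil \<epsilon> (lat (zenum n) \<odot> y)) * indicator Ycell y) \<partial>lebesgue)"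
  by (intro suminf_cong nn_integral_cong) (auto simp: indicator_def lidx_lat)
 also have "... = (\<Sum>n. H (zenum n) * indicator J (zenum n))"
  unfolding H_def by (intro suminf_cong, subst nn_integral_cmult) (auto simp: mult.commute intro!: lebesgue_borelI)
 finally have 2: "(\<integral>\<^sup>+x. indicator A x * indicator R x \<partial>lebesgue) = ennreal (\<epsilon>^4) * (\<Sum>n. H (zenum n) * indicator J (zenum n))" .
 have "emeasure (density lborel (%x. 8 * indicator R x)) A = (\<integral>\<^sup>+x. 8 * (indicator A x * indicator R x) \<partial>lborel)"
  using R_borel by (subst emeasure_density) (auto simp: ac_simps)
 also have "... = 8 * (\<integral>\<^sup>+x. indicator A x * indicator R x \<partial>lebesgue)"
  using R_borel by (simp add: nn_integral_cmult nn_integral_completion)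
 finally show "emeasure (distr (lebesgue_on (R \<times> Ycell)) borel (unf \<epsilon>)) A = emeasure (density lborel (%x. 8 * indicator R x)) A"
  unfolding 1 2 by (simp add: ac_simps)
qed simp

text \<open>The image of the product measure has a density, so null sets pull back to null sets.
  Hence unfolding respects equality almost everywhere and Borel representatives may be used.\<close>

lemma unf_AE:
 assumes "AE x in lebesgue_on R. P x"
 shows "AE p in lebesgue_on (R \<times> Ycell). P (unf \<epsilon> p)"
proof -
 have mu: "unf \<epsilon> : bm (lebesgue_on (R \<times> Ycell))"
  by (intro measurable_restrict_space1 lebesgue_borelI) measurable
 have "AE x in lborel. x : R --> P x"
  using assms R_borel by (simp add: AE_lebesgue_on AE_lebesgue_lborel)
 hence "AE x in density lborel (%x. 8 * indicator R x). P x"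
  using R_borel by (subst AE_density) (auto elim!: eventually_mono simp: indicator_def split: if_splits)
 thus ?thesis unfolding unf_distr[symmetric] by (rule AE_distrD[OF mu])
qed

lemma unf_measurable:
 fixes h :: "real^3 => 'b::euclidean_space"
 assumes h: "h : bm (lebesgue_on R)"
 shows "(%p. h (unf \<epsilon> p)) : bm (lebesgue_on (R \<times> Ycell))"
proof -
 obtain h' where h'[measurable]: "h' : bm borel" and eq: "AE x in lebesgue_on R. h x = h' x"
  using borel_representative[OF _ h] R_borel by auto
 have "AE p in lebesgue_on (R \<times> Ycell). h' (unf \<epsilon> p) = h (unf \<epsilon> p)"
  using unf_AE[OF eq] by eventually_elim simp
 moreover have "(%p. h' (unf \<epsilon> p)) : bm (lebesgue_on (R \<times> Ycell))"
  by (intro measurable_restrict_space1 lebesgue_borelI) measurable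
 ultimately show ?thesis by (rule lebesgue_on_measurable_AE[OF RY_lebesgue, rotated])
qed

lemma unf_nn_integral:
 fixes h :: "real^3 => real"
 assumes h: "h : bm (lebesgue_on R)"
 shows "(\<integral>\<^sup>+p. ennreal (h (unf \<epsilon> p)) \<partial>lebesgue_on (R \<times> Ycell)) = 8 * (\<integral>\<^sup>+x. ennreal (h x) \<partial>lebesgue_on R)"
proof -
 have mu: "unf \<epsilon> : bm (lebesgue_on (R \<times> Ycell))"
  by (intro measurable_restrict_space1 lebesgue_borelI) measurable
 obtain h' where h'[measurable]: "h' : bm borel" and eq: "AE x in lebesgue_on R. h x = h' x"
  using borel_representative[OF _ h] R_borel by auto
 have "(\<integral>\<^sup>+p. ennreal (h (unf \<epsilon> p)) \<partial>lebesgue_on (R \<times> Ycell)) = (\<integral>\<^sup>+p. ennreal (h' (unf \<epsilon> p)) \<partial>lebesgue_on (R \<times> Ycell))"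
  using unf_AE[OF eq] by (intro nn_integral_cong_AE) (auto elim!: eventually_mono)
 also have "... = (\<integral>\<^sup>+x. ennreal (h' x) \<partial>density lborel (%x. 8 * indicator R x))"
  using mu by (subst unf_distr[symmetric], subst nn_integral_distr) auto
 also have "... = (\<integral>\<^sup>+x. 8 * (ennreal (h' x) * indicator R x) \<partial>lborel)"
  using R_borel by (subst nn_integral_density) (auto simp: ac_simps)
 also have "... = 8 * (\<integral>\<^sup>+x. ennreal (h' x) \<partial>lebesgue_on R)"
  using R_borel by (simp add: nn_integral_cmult nn_integral_restrict_space nn_integral_completion)
 also have "(\<integral>\<^sup>+x. ennreal (h' x) \<partial>lebesgue_on R) = (\<integral>\<^sup>+x. ennreal (h x) \<partial>lebesgue_on R)"
  using eq by (intro nn_integral_cong_AE) (auto elim!: eventually_mono)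
 finally show ?thesis .
qed

lemma unf_integral:
 fixes h :: "real^3 => real"
 assumes h: "h : bm (lebesgue_on R)"
 shows "(LINT p|lebesgue_on (R \<times> Ycell). h (unf \<epsilon> p)) = 8 * (LINT x|lebesgue_on R. h x)"
proof -
 have mu: "unf \<epsilon> : bm (lebesgue_on (R \<times> Ycell))"
  by (intro measurable_restrict_space1 lebesgue_borelI) measurable
 obtain h' where h'[measurable]: "h' : bm borel" and eq: "AE x in lebesgue_on R. h x = h' x"
  using borel_representative[OF _ h] R_borel by auto
 have h'm: "h' : bm (lebesgue_on R)"
  by (intro measurable_restrict_space1 lebesgue_borelI) measurable
 have "(LINT p|lebesgue_on (R \<times> Ycell). h (unf \<epsilon> p)) = (LINT p|lebesgue_on (R \<times> Ycell). h' (unf \<epsilon> p))"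
  using unf_AE[OF eq] by (intro integral_cong_AE unf_measurable h h'm) auto
 also have "... = (LINT x|density lborel (%x. ennreal (8 * indicat_real R x)). h' x)"
 proof -
  have "(%x. ennreal (8 * indicat_real R x)) = (%x. 8 * indicator R x)"
   by (auto simp: fun_eq_iff indicator_def)
  thus ?thesis using mu by (simp only:, subst unf_distr[symmetric], subst integral_distr) auto
 qed
 also have "... = (LINT x|lborel. (8 * indicat_real R x) *R h' x)"
  using R_borel by (intro integral_density) auto
 also have "... = 8 * (LINT x|lborel. indicat_real R x *R h' x)"
  by (subst integral_mult_right_zero[symmetric]) (simp add: mult.assoc)
 also have "(LINT x|lborel. indicat_real R x *R h' x) = (LINT x|lebesgue_on R. h' x)"
  using R_borel by (simp add: integral_restrict_space integral_completion)
 also have "... = (LINT x|lebesgue_on R. h x)"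
  using eq by (intro integral_cong_AE h h'm) auto
 finally show ?thesis .
qed

end

text \<open>The constant is the square root of the volume of the cell. Only the part of
  \<open>g\<close> outside the inner region, which is unfolded to zero, is lost in the
  inequality.\<close>

lemma unfolding_sq_int:
 fixes g :: "real^3 => 'b::euclidean_space"
 assumes e: "e > 0" and E: "E : sets borel" and g: "g : sq_int (lebesgue_on E)"
 shows "unfolding_op E e g : sq_int (lebesgue_on (E \<times> Ycell))"
  and "sq_norm (lebesgue_on (E \<times> Ycell)) (unfolding_op E e g) <= sqrt 8 * sq_norm (lebesgue_on E) g"
proof -
 let ?R = "inner_region E e"
 have R: "?R = {x. lidx (dil (1/e) x) : inner_cells E e}"
  using inner_region_iff[OF e] by auto
 note Rb = inner_region_borel[OF e, of E]
 have RS: "?R \<times> Ycell : sets lebesgue" "E \<times> Ycell : sets lebesgue" "?R : sets lebesgue" "E : sets lebesgue"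
  using lebesgue_sets[OF Rb Ycell_borel] lebesgue_sets[OF E Ycell_borel] by auto
 have sub: "?R \<times> Ycell <= E \<times> Ycell" using inner_region_subset by blast
 have subR: "x : E" if "x : ?R" for x using inner_region_subset that by blast
 have gR: "g : bm (lebesgue_on ?R)"
  using sq_intD[OF g] inner_region_subset RS by (metis measurable_restrict_mono)
 have eq: "unfolding_op E e g = (%p. if fst p : ?R then g (unf e p) else 0)"
  by (simp add: fun_eq_iff unfolding_op_eq[OF e])
 have ifeq: "(%p. if p : E \<times> Ycell then unfolding_op E e g p else 0) = (%p. if p : ?R \<times> Ycell then g (unf e p) else 0)"
  unfolding eq using inner_region_subset by (auto simp: fun_eq_iff)
 have m: "unfolding_op E e g : bm (lebesgue_on (E \<times> Ycell))"
  using unf_measurable[OF e R gR]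
  by (subst borel_measurable_if[OF RS(2), symmetric]) (simp add: ifeq borel_measurable_if RS)
 have "(\<integral>\<^sup>+p. ennreal ((norm (unfolding_op E e g p))^2) \<partial>lebesgue_on (E \<times> Ycell))
   = (\<integral>\<^sup>+p. ennreal ((norm (g (unf e p)))^2) \<partial>lebesgue_on (?R \<times> Ycell))"
  using RS by (auto simp: nn_integral_restrict_space eq subR intro!: nn_integral_cong split: split_indicator)
 also have "... = 8 * (\<integral>\<^sup>+x. ennreal ((norm (g x))^2) \<partial>lebesgue_on ?R)"
  by (rule unf_nn_integral[OF e R]) (use gR in measurable)
 also have "... <= 8 * (\<integral>\<^sup>+x. ennreal ((norm (g x))^2) \<partial>lebesgue_on E)"
  using RS
  by (intro mult_left_mono) (auto simp: nn_integral_restrict_space subR intro!: nn_integral_mono split: split_indicator)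
 also have "... = ennreal ((sqrt 8 * sq_norm (lebesgue_on E) g)^2)"
  by (simp add: nn_integral_sq_norm[OF g] power_mult_distrib ennreal_mult)
 finally have *: "(\<integral>\<^sup>+p. ennreal ((norm (unfolding_op E e g p))^2) \<partial>lebesgue_on (E \<times> Ycell)) <= ..." .
 show "unfolding_op E e g : sq_int (lebesgue_on (E \<times> Ycell))"
  and "sq_norm (lebesgue_on (E \<times> Ycell)) (unfolding_op E e g) <= sqrt 8 * sq_norm (lebesgue_on E) g"
  using sq_norm_le_nn[OF m *] by auto
qed

section \<open>Small tiles, and the convergence of unfolded continuous functions\<close>

lemma norm3_le: "norm x <= \<bar>x$1\<bar> + \<bar>x$2\<bar> + \<bar>x$3\<bar>" for x :: "real^3"
 using norm_le_l1_cart[of x] by (simp add: sum_3)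

text \<open>In the third coordinate the shear multiplies the displacement by \<open>r^2\<close>
  times the horizontal lattice coordinates. One factor \<open>r\<close> makes these comparable to
  the position \<open>b\<close>, so the diameter of a tile is of order \<open>r\<close> with a
  constant that grows linearly in the position. The proof yields \<open>22 + 8 * norm b\<close>,
  which is rounded up.\<close>

lemma cell_diameter:
 assumes r: "0 < r" "r <= 1" and y: "y : Ycell" "y' : Ycell"
  and a: "a = dil r (lat k \<odot> y)" and b: "b = dil r (lat k \<odot> y')"
 shows "norm (a - b) <= r * (30 + 16 * norm b)"
proof -
 note y = y[unfolded Ycell_iff]
 \<comment> \<open>These are the horizontal coordinates of \<open>b\<close> up to the terms
   \<open>r * y'$1\<close> and \<open>r * y'$2\<close>, which are at most 2.\<close>
 define K1 K2 where K: "K1 = r * (2 * real_of_int (k$1))" "K2 = r * (2 * real_of_int (k$2))"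
 have nb: "\<bar>b$1\<bar> <= norm b" "\<bar>b$2\<bar> <= norm b" by (rule component_le_norm_cart)+
 have ey: "0 <= r * y'$1" "r * y'$1 <= 2" "0 <= r * y'$2" "r * y'$2 <= 2"
  using r y mult_mono[of r 1 "y'$1" 2] mult_mono[of r 1 "y'$2" 2] by auto
 have K1: "\<bar>K1\<bar> <= norm b + 2" using nb(1) ey unfolding b K by (simp add: algebra_simps)
 have K2: "\<bar>K2\<bar> <= norm b + 2" using nb(2) ey unfolding b K by (simp add: algebra_simps)
 have d: "\<bar>y$i - y'$i\<bar> <= 2" for i using y by (cases rule: exhaust_3[of i, THEN disjE]) auto
 have 1: "\<bar>(a - b)$1\<bar> <= r * 2"
 proof -
  have "(a - b)$1 = r * (y$1 - y'$1)" unfolding a b by (simp add: algebra_simps)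
  thus ?thesis using d[of 1] r by (simp add: abs_mult)
 qed
 have 2: "\<bar>(a - b)$2\<bar> <= r * 2"
 proof -
  have "(a - b)$2 = r * (y$2 - y'$2)" unfolding a b by (simp add: algebra_simps)
  thus ?thesis using d[of 2] r by (simp add: abs_mult)
 qed
 have 3: "\<bar>(a - b)$3\<bar> <= r * (2 + 2 * ((norm b + 2) * 2 + (norm b + 2) * 2))"
 proof -
  have e: "(a - b)$3 = r * (r * (y$3 - y'$3) + 2 * (K2 * (y$1 - y'$1) - K1 * (y$2 - y'$2)))"
   unfolding a b K by (simp add: algebra_simps power2_eq_square)
  have t1: "\<bar>r * (y$3 - y'$3)\<bar> <= 2" unfolding abs_mult using r d[of 3] mult_mono[of r 1 "\<bar>y$3-y'$3\<bar>" 2] by simp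
  have t2: "\<bar>K2 * (y$1 - y'$1)\<bar> <= (norm b + 2) * 2" unfolding abs_mult by (intro mult_mono K2 d) auto
  have t3: "\<bar>K1 * (y$2 - y'$2)\<bar> <= (norm b + 2) * 2" unfolding abs_mult by (intro mult_mono K1 d) auto
  have arg: "\<bar>a + 2 * (b - c)\<bar> <= 2 + 2 * (w + w)" if "\<bar>a\<bar> <= 2" "\<bar>b\<bar> <= w" "\<bar>c\<bar> <= w" for a b c w :: real
   using that by (simp add: abs_le_iff)
  have "\<bar>r * (y$3 - y'$3) + 2 * (K2 * (y$1 - y'$1) - K1 * (y$2 - y'$2))\<bar> <= 2 + 2 * ((norm b + 2) * 2 + (norm b + 2) * 2)"
   by (rule arg) (use t1 t2 t3 in auto)
  thus ?thesis unfolding e abs_mult using r by (intro mult_mono) auto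
 qed
 have "norm (a - b) <= r * 2 + r * 2 + r * (2 + 2 * ((norm b + 2) * 2 + (norm b + 2) * 2))"
  using norm3_le[of "a - b"] 1 2 3 by linarith
 also have "... = r * (22 + 8 * norm b)" by (simp add: algebra_simps)
 also have "... <= r * (30 + 16 * norm b)" using r by (intro mult_left_mono) auto
 finally show ?thesis .
qed

text \<open>The first bound gives pointwise convergence at a fixed \<open>x\<close>. The second one
  confines \<open>x\<close> when only its image is known to be bounded, which
  \<open>averaging\<close> needs for domination.\<close>

lemma unf_near:
 assumes e: "0 < e" "e <= 1" and y: "y : Ycell"
 shows "norm (unf e (x, y) - x) <= e * (30 + 16 * norm x)"
  and "norm (unf e (x, y) - x) <= e * (30 + 16 * norm (unf e (x, y)))"
proof -
 have x: "x = dil e (lat (lidx (dil (1/e) x)) \<odot> lrep (dil (1/e) x))" using e by simp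
 have u: "unf e (x, y) = dil e (lat (lidx (dil (1/e) x)) \<odot> y)" by (simp add: unf_def)
 show "norm (unf e (x, y) - x) <= e * (30 + 16 * norm x)"
  by (rule cell_diameter[OF e y lrep_Ycell u x])
 show "norm (unf e (x, y) - x) <= e * (30 + 16 * norm (unf e (x, y)))"
  using cell_diameter[OF e lrep_Ycell y x u] by (simp add: norm_minus_commute)
qed

lemma unf_tendsto:
 assumes X: "!!i::nat. 0 < X i & X i <= 1" "X ----> 0" and y: "y : Ycell"
 shows "(%i. unf (X i) (x, y)) ----> x"
proof (rule LIM_zero_cancel, rule Lim_null_comparison)
 show "\<forall>\<^sub>F i in sequentially. norm (unf (X i) (x, y) - x) <= X i * (30 + 16 * norm x)"
  using unf_near(1) X(1) y by (intro always_eventually allI) blast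
 show "(%i. X i * (30 + 16 * norm x)) ----> 0"
  using tendsto_mult_left_zero[OF X(2)] .
qed

text \<open>The whole tile around \<open>x\<close> shrinks to \<open>x\<close> and finally fits into
  a ball contained in \<open>E\<close>.\<close>

lemma eventually_inner_region:
 assumes E: "open E" and x: "x : E" and X: "!!i::nat. 0 < X i & X i <= 1" "X ----> 0"
 shows "\<forall>\<^sub>F i in sequentially. x : inner_region E (X i)"
proof -
 obtain r where r: "r > 0" "ball x r <= E" using E x openE by blast
 have "(%i. X i * (30 + 16 * norm x)) ----> 0" using tendsto_mult_left_zero[OF X(2)] .
 hence "\<forall>\<^sub>F i in sequentially. X i * (30 + 16 * norm x) < r" using r by (intro order_tendstoD) auto
 thus ?thesis
 proof eventually_elim
  case (elim i)
  have pos: "X i > 0" using X(1) by blast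
  have "z : E" if z: "z : cell (X i) (lidx (dil (1/X i) x))" for z
  proof -
   have "lidx (dil (1/X i) z) = lidx (dil (1/X i) x)" using z pos by (simp add: cell_iff)
   hence "z = dil (X i) (lat (lidx (dil (1/X i) x)) \<odot> lrep (dil (1/X i) z))"
    using pos by (metis dil_inv(2) lat_lrep less_irrefl)
   hence "z = unf (X i) (x, lrep (dil (1/X i) z))" by (simp add: unf_def)
   hence "norm (z - x) <= X i * (30 + 16 * norm x)"
    using unf_near(1)[of "X i" "lrep (dil (1/X i) z)" x] X(1)[of i] by simp
   hence "z : ball x r" using elim by (simp add: dist_norm norm_minus_commute)
   thus ?thesis using r by blast
  qed
  thus ?case using pos by (auto simp: inner_region_iff inner_cells_def)
 qed
qed

text \<open>Only the slow factor is unfolded here; a periodic factor evaluated at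
  \<open>x / \<epsilon>\<close> unfolds exactly to a function of \<open>y\<close>. Since
  \<open>Q\<close> is merely square integrable, domination uses the bound on \<open>r\<close> times
  \<open>Q\<close>.\<close>

lemma unfolding_tendsto:
 fixes r :: "real^3 => real" and Q :: "real^3 => 'b::euclidean_space"
 assumes E: "open E" "bounded E" and r: "continuous_on UNIV r" "!!x. \<bar>r x\<bar> <= C"
  and Q: "Q : sq_int LY"
  and X: "!!i::nat. 0 < X i & X i <= 1" "X ----> 0"
 shows "(%i. sq_norm (lebesgue_on (E \<times> Ycell))
   (%p. unfolding_op E (X i) r p *R Q (snd p) - r (fst p) *R Q (snd p))) ----> 0"
proof -
 have Eb: "E : sets borel" using E by simp
 have fin: "finite_measure (lebesgue_on E)" using E by (intro finite_measure_lebesgue_on) auto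
 have rm: "r : bm (lebesgue_on E)"
  by (intro measurable_restrict_space1 lebesgue_borelI borel_measurable_continuous_onI r)
 have rs: "r : sq_int (lebesgue_on E)" using r by (intro sq_int_bounded[OF fin rm, of C]) auto
 have C: "0 <= C" using r(2)[of 0] by linarith
 have Tm: "unfolding_op E (X i) r : bm (lebesgue_on (E \<times> Ycell))" for i
  by (rule sq_intD, rule unfolding_sq_int(1)[OF _ Eb rs]) (use X(1) in blast)
 have Qm: "(%p. Q (snd p)) : bm (lebesgue_on (E \<times> Ycell))"
  by (rule measurable_snd_lebesgue[OF Eb Ycell_borel sq_intD[OF Q]])
 have pm: "(%p. r (fst p)) : bm (lebesgue_on (E \<times> Ycell))"
  by (rule measurable_fst_lebesgue[OF Eb Ycell_borel rm])
 have w: "(%p. 1 *R Q (snd p)) : sq_int (lebesgue_on (E \<times> Ycell))"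
  by (rule sq_int_tensor(1)[OF Eb Ycell_borel sq_int_const[OF fin] Q])
 have T: "\<bar>unfolding_op E (X i) r p\<bar> <= C" for i p
  using X(1)[of i] r(2) C by (simp add: unfolding_op_eq)
 show ?thesis
 proof (rule sq_norm_tendsto_DCT[OF _ _ w, of _ _ "2 * C"])
  show "AE p in lebesgue_on (E \<times> Ycell). norm (unfolding_op E (X i) r p *R Q (snd p) - r (fst p) *R Q (snd p))
    <= 2 * C * norm (1 *R Q (snd p))" for i
  proof (rule AE_I2)
   fix p
   have "\<bar>unfolding_op E (X i) r p - r (fst p)\<bar> <= 2 * C" using T[of i p] r(2)[of "fst p"] by linarith
   thus "norm (unfolding_op E (X i) r p *R Q (snd p) - r (fst p) *R Q (snd p)) <= 2 * C * norm (1 *R Q (snd p))"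
    by (simp add: scaleR_diff_left[symmetric] mult_right_mono)
  qed
  show "AE p in lebesgue_on (E \<times> Ycell). (%i. unfolding_op E (X i) r p *R Q (snd p)) ----> r (fst p) *R Q (snd p)"
  proof (rule AE_I2)
   fix p assume "p : space (lebesgue_on (E \<times> Ycell))"
   then obtain x y where p: "p = (x, y)" "x : E" "y : Ycell" by auto
   have "(%i. r (unf (X i) (x, y))) ----> r x"
    using r(1) unf_tendsto[OF X p(3)] by (intro continuous_on_tendsto_compose[OF r(1)]) auto
   moreover have "\<forall>\<^sub>F i in sequentially. r (unf (X i) (x, y)) = unfolding_op E (X i) r p"
    using eventually_inner_region[OF E(1) p(2) X] by eventually_elim (use X(1) in "simp add: unfolding_op_eq p")
   ultimately have "(%i. unfolding_op E (X i) r p) ----> r (fst p)"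
    using p by (auto intro: Lim_transform_eventually)
   thus "(%i. unfolding_op E (X i) r p *R Q (snd p)) ----> r (fst p) *R Q (snd p)"
    by (intro tendsto_intros)
  qed
 qed (use Tm Qm pm in "auto intro!: borel_measurable_scaleR")
qed

text \<open>Unfolding over the whole group separates the scales: the periodic factor becomes
  \<open>p y\<close> exactly, while \<open>g\<close> at the unfolded point tends to
  \<open>g x\<close> by continuity. Dividing by 8 undoes the volume of the cell.\<close>

theorem averaging:
 fixes g p :: "real^3 => real"
 assumes g: "continuous_on UNIV g" "compact K" "!!x. x ~: K ==> g x = 0"
  and p: "Y_periodic p" "integrable LY p"
 shows "((%r. LINT x|lebesgue. g x * p (dil (1/r) x)) \<longlongrightarrow> (LINT x|lebesgue. g x) * (LINT y|LY. p y) / 8) (at_right 0)"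
proof (rule at_right_0_seqI)
 fix X :: "nat => real" assume X: "!!i. 0 < X i & X i <= 1" "X ----> 0"
 have pm: "p : bm lebesgue" by (rule periodic_measurable[OF p(1) borel_measurable_integrable[OF p(2)]])
 have gm: "g : bm lebesgue" by (intro lebesgue_borelI borel_measurable_continuous_onI g)
 have "compact (g ` K)" using g by (intro compact_continuous_image) (auto intro: continuous_on_subset)
 then obtain C where C: "!!x. x : K ==> \<bar>g x\<bar> <= C" using compact_imp_bounded bounded_iff by (metis imageI real_norm_def)
 have C': "\<bar>g x\<bar> <= \<bar>C\<bar>" for x using C[of x] g(3)[of x] by (cases "x : K") auto
 obtain R where R: "!!x. x : K ==> norm x <= R" using compact_imp_bounded[OF g(2)] bounded_iff by blast
 \<comment> \<open>Contains every \<open>x\<close> whose tile meets \<open>K\<close> at some scale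
   at most 1, so that the dominating function is integrable.\<close>
 define B where "B = cball (0::real^3) (R + (30 + 16 * R))"
 have inB: "x : B" if "y : Ycell" "unf (X i) (x, y) : K" for i x y
 proof -
  have n: "norm (unf (X i) (x, y)) <= R" using R that by blast
  have "norm (unf (X i) (x, y) - x) <= X i * (30 + 16 * norm (unf (X i) (x, y)))"
   using unf_near(2)[OF _ _ that(1)] X(1) by blast
  also have "... <= 1 * (30 + 16 * R)" using X(1)[of i] n by (intro mult_mono) (auto intro: order_trans[OF norm_ge_zero])
  finally have "norm x <= R + (30 + 16 * R)" using n norm_triangle_ineq4[of "unf (X i) (x, y)" "unf (X i) (x, y) - x"] by simp
  thus ?thesis by (simp add: B_def)
 qed
 have U: "(UNIV :: (real^3) set) : sets borel" by simp
 have UY: "(UNIV :: (real^3) set) \<times> Ycell : sets lebesgue" by (rule lebesgue_sets(3)[OF U Ycell_borel])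
 let ?M = "lebesgue_on ((UNIV :: (real^3) set) \<times> Ycell)"
 have pp: "p (dil (1/X i) (unf (X i) (x, y))) = p y" if "y : Ycell" for i x y
 proof -
  have "X i ~= 0" using X(1)[of i] by simp
  thus ?thesis by (simp add: unf_def Y_periodicD[OF p(1)])
 qed
 have gp: "(%x. g x * p (dil (1/X i) x)) : bm (lebesgue_on UNIV)" for i
 proof -
  have "(%x. p (dil (1/X i) x)) : bm lebesgue"
   using X(1)[of i] by (intro volmap_measurable[OF volmap_dil] pm) simp
  thus ?thesis using gm by (simp add: lebesgue_on_UNIV_eq)
 qed
 have U1: "UNIV = {x. lidx (dil (1 / X i) x) : UNIV}" for i by simp
 have e: "8 * (LINT x|lebesgue. g x * p (dil (1/X i) x)) = (LINT z|?M. g (unf (X i) z) * p (snd z))" for i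
 proof -
  have "(LINT z|?M. g (unf (X i) z) * p (dil (1/X i) (unf (X i) z))) = 8 * (LINT x|lebesgue_on UNIV. g x * p (dil (1/X i) x))"
   using X(1)[of i] by (intro unf_integral[OF _ U1 gp]) simp
  moreover have "(LINT z|?M. g (unf (X i) z) * p (dil (1/X i) (unf (X i) z))) = (LINT z|?M. g (unf (X i) z) * p (snd z))"
   by (intro Bochner_Integration.integral_cong refl) (auto simp: pp)
  ultimately show ?thesis by (simp add: lebesgue_on_UNIV_eq)
 qed
 have psm: "(%z. p (snd z)) : bm ?M"
  by (rule measurable_snd_lebesgue[OF U Ycell_borel borel_measurable_integrable[OF p(2)]])
 have gsm: "(%z. g (fst z)) : bm ?M"
  by (rule measurable_fst_lebesgue[OF U Ycell_borel]) (use gm in "simp add: lebesgue_on_UNIV_eq")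
 have Bm: "(indicator B :: _ => real) : bm (lebesgue_on UNIV)" by (intro measurable_restrict_space1 borel_measurable_indicator) (simp add: B_def)
 have BM: "(%z. indicator B (fst z) :: real) : bm ?M"
  by (rule measurable_fst_lebesgue[OF U Ycell_borel Bm])
 have prod: "integrable ?M (%z. a (fst z) * p (snd z)) \<and>
   (LINT z|?M. a (fst z) * p (snd z)) = (LINT x|lebesgue. a x) * (LINT y|LY. p y)"
  if a: "integrable lebesgue a" for a :: "real^3 => real"
 proof -
  have am: "(%z. a (fst z)) : bm ?M"
   by (rule measurable_fst_lebesgue[OF U Ycell_borel]) (use a in "simp add: lebesgue_on_UNIV_eq borel_measurable_integrable")
  have i: "integrable ?M (%z. a (fst z) * p (snd z))"
  proof (rule integrableI_bounded)
   show m: "(%z. a (fst z) * p (snd z)) : bm ?M" using am psm by measurable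
   have "(\<integral>\<^sup>+z. ennreal (norm (a (fst z) * p (snd z))) \<partial>?M) = (\<integral>\<^sup>+x. \<integral>\<^sup>+y. ennreal (norm (a (fst (x,y)) * p (snd (x,y)))) \<partial>LY \<partial>lebesgue_on UNIV)"
    by (rule fubini_lebesgue_nn(3)[OF U Ycell_borel]) (use m in measurable)
   also have "... = (\<integral>\<^sup>+x. ennreal \<bar>a x\<bar> \<partial>lebesgue) * (\<integral>\<^sup>+y. ennreal \<bar>p y\<bar> \<partial>LY)"
    using a p(2) by (simp add: abs_mult ennreal_mult nn_integral_cmult nn_integral_multc borel_measurable_integrable lebesgue_on_UNIV_eq)
   also have "... < \<infinity>" using a p(2) by (simp add: integrable_iff_bounded ennreal_mult_less_top)
   finally show "(\<integral>\<^sup>+z. ennreal (norm (a (fst z) * p (snd z))) \<partial>?M) < \<infinity>" .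
  qed
  have "(LINT z|?M. a (fst z) * p (snd z)) = (LINT x|lebesgue_on UNIV. LINT y|LY. a (fst (x,y)) * p (snd (x,y)))"
   by (rule fubini_lebesgue(3)[OF U Ycell_borel i])
  thus ?thesis using i by (simp add: lebesgue_on_UNIV_eq)
 qed
 have gi: "integrable lebesgue g"
 proof (rule Bochner_Integration.integrable_bound[OF _ gm])
  show "integrable lebesgue (%x. \<bar>C\<bar> * indicat_real K x)"
   using lmeasurable_compact[OF g(2)] by (intro integrable_mult_right) (auto simp: fmeasurable_def)
  show "AE x in lebesgue. norm (g x) <= norm (\<bar>C\<bar> * indicat_real K x)"
   using C' g(3) by (intro AE_I2) (auto simp: indicator_def)
 qed
 have Bi: "integrable lebesgue (indicat_real B)"
  using lmeasurable_cball[of 0 "R + (30 + 16 * R)"] unfolding B_def fmeasurable_def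
  by (intro integrable_real_indicator) auto
 have "(%i. LINT z|?M. g (unf (X i) z) * p (snd z)) ----> (LINT z|?M. g (fst z) * p (snd z))"
 proof (rule integral_dominated_convergence[where w = "%z. \<bar>C\<bar> * \<bar>indicat_real B (fst z) * p (snd z)\<bar>"])
  show "integrable ?M (%z. \<bar>C\<bar> * \<bar>indicat_real B (fst z) * p (snd z)\<bar>)"
   using prod[OF Bi] by (intro integrable_mult_right integrable_abs) simp
  show "(%z. g (unf (X i) z) * p (snd z)) : bm ?M" for i
  proof -
   have "(%z. g (unf (X i) z)) : bm ?M"
    using X(1)[of i] gm by (intro unf_measurable[OF _ U1]) (auto simp: lebesgue_on_UNIV_eq)
   thus ?thesis using psm by measurable
  qed
  show "AE z in ?M. (%i. g (unf (X i) z) * p (snd z)) ----> g (fst z) * p (snd z)"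
  proof (rule AE_I2)
   fix z assume "z : space ?M"
   then obtain x y where z: "z = (x, y)" "y : Ycell" by auto
   have "(%i. g (unf (X i) z)) ----> g x"
    unfolding z using unf_tendsto[OF X z(2)] by (intro continuous_on_tendsto_compose[OF g(1)]) auto
   thus "(%i. g (unf (X i) z) * p (snd z)) ----> g (fst z) * p (snd z)"
    unfolding z by (simp add: tendsto_mult_right)
  qed
  show "AE z in ?M. norm (g (unf (X i) z) * p (snd z)) <= \<bar>C\<bar> * \<bar>indicat_real B (fst z) * p (snd z)\<bar>" for i
  proof (rule AE_I2)
   fix z assume "z : space ?M"
   then obtain x y where z: "z = (x, y)" "y : Ycell" by auto
   show "norm (g (unf (X i) z) * p (snd z)) <= \<bar>C\<bar> * \<bar>indicat_real B (fst z) * p (snd z)\<bar>"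
   proof (cases "unf (X i) (x, y) : K")
    case True
    thus ?thesis using inB[OF z(2) True] C' by (simp add: z abs_mult mult_right_mono)
   next
    case False
    thus ?thesis using g(3) by (simp add: z)
   qed
  qed
 qed (use gsm psm in measurable)
 hence "(%i. 8 * (LINT x|lebesgue. g x * p (dil (1/X i) x))) ----> (LINT x|lebesgue. g x) * (LINT y|LY. p y)"
  using prod[OF gi] by (simp add: e)
 from tendsto_divide[OF this tendsto_const[of 8]]
 show "(%i. LINT x|lebesgue. g x * p (dil (1/X i) x)) ----> (LINT x|lebesgue. g x) * (LINT y|LY. p y) / 8"
  by simp
qed

section \<open>Smooth functions\<close>

lemma pd_eq: "(f has_derivative D) (at x) ==> pd i f x = D (axis i 1)"
 by (simp add: pd_def frechet_derivative_at[symmetric])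

lemma frechet_derivative_worksI:
 "f differentiable (at x) ==> (f has_derivative frechet_derivative f (at x)) (at x)"
 by (simp add: frechet_derivative_works)

lemma Ck_mono: "Ck (Suc n) f ==> Ck n f"
proof (induction n arbitrary: f)
 case 0
 hence "!!x. f differentiable (at x)" by simp
 thus ?case by (auto intro!: continuous_at_imp_continuous_on differentiable_imp_continuous_within)
next
 case (Suc n)
 have "f differentiable (at x)" for x using Suc.prems by simp
 moreover have "Ck n (pd i f)" for i
 proof (rule Suc.IH)
  show "Ck (Suc n) (pd i f)" using Suc.prems unfolding Ck.simps(2)[of "Suc n"] by blast
 qed
 ultimately show ?case by simp
qed

lemma Ck_const: "Ck n (%_. c)"
proof (induction n arbitrary: c)
 case (Suc n)
 have "pd i (%_. c) = (%_. 0)" for i by (simp add: fun_eq_iff pd_eq[OF has_derivative_const])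
 thus ?case by (simp add: Suc)
qed simp

lemma Ck_add: "Ck n f ==> Ck n g ==> Ck n (%x. f x + g x)"
proof (induction n arbitrary: f g)
 case 0 thus ?case by (auto intro: continuous_on_add)
next
 case (Suc n)
 hence d: "f differentiable (at x)" "g differentiable (at x)" for x by auto
 have "pd i (%x. f x + g x) = (%x. pd i f x + pd i g x)" for i
 proof
  fix x
  show "pd i (%x. f x + g x) x = pd i f x + pd i g x"
   by (subst pd_eq[OF has_derivative_add[OF frechet_derivative_worksI[OF d(1)] frechet_derivative_worksI[OF d(2)]]])
     (simp add: pd_def)
 qed
 with Suc d show ?case by (auto intro!: differentiable_add)
qed

lemma Ck_mult: "Ck n f ==> Ck n g ==> Ck n (%x. f x * g x)"
proof (induction n arbitrary: f g)
 case 0 thus ?case by (auto intro: continuous_on_mult)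
next
 case (Suc n)
 hence d: "f differentiable (at x)" "g differentiable (at x)" for x by auto
 have "pd i (%x. f x * g x) = (%x. f x * pd i g x + pd i f x * g x)" for i
 proof
  fix x
  show "pd i (%x. f x * g x) x = f x * pd i g x + pd i f x * g x"
   by (subst pd_eq[OF has_derivative_mult[OF frechet_derivative_worksI[OF d(1)] frechet_derivative_worksI[OF d(2)]]])
     (simp add: pd_def)
 qed
 moreover have "Ck n (%x. f x * pd i g x + pd i f x * g x)" for i
  using Suc.prems by (intro Ck_add Suc.IH) (auto intro: Ck_mono)
 ultimately show ?case using d by (auto intro!: differentiable_mult)
qed

lemma Ck_sum: "(!!i. i : I ==> Ck n (f i)) ==> Ck n (%x. \<Sum>i\<in>I. f i x)"
 by (induction I rule: infinite_finite_induct) (auto intro: Ck_add Ck_const)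

lemma Ck_linear: assumes "bounded_linear f" shows "Ck n f"
proof (cases n)
 case 0 thus ?thesis using assms by (simp add: linear_continuous_on)
next
 case (Suc m)
 have d: "(f has_derivative f) (at x)" for x using assms by (rule bounded_linear_imp_has_derivative)
 have "pd i f = (%_. f (axis i 1))" for i by (simp add: fun_eq_iff pd_eq[OF d])
 thus ?thesis using d unfolding Suc by (auto simp: Ck_const intro: differentiableI)
qed

text \<open>The family \<open>g\<close> lists the successive derivatives of one real function. Each
  differentiation moves the index up by one, so the induction stays inside the family; it is used
  for \<open>exp\<close> and for \<open>flat\<close>.\<close>

lemma Ck_compose:
 assumes g: "!!k t. (g k has_real_derivative g (Suc k) t) (at t)"
 shows "Ck n f ==> Ck n (%x. g k (f x))"
proof (induction n arbitrary: f k)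
 case 0
 have "continuous_on UNIV (g k)" using g by (intro DERIV_continuous_on) (auto intro: has_field_derivative_at_within)
 with 0 show ?case by (auto intro: continuous_on_compose2)
next
 case (Suc n)
 hence d: "f differentiable (at x)" for x by auto
 have D: "((%x. g k (f x)) has_derivative (%h. g (Suc k) (f x) * frechet_derivative f (at x) h)) (at x)" for x
  using has_derivative_compose[OF frechet_derivative_worksI[OF d] g[unfolded has_field_derivative_def, of k "f x"]] .
 have "pd i (%x. g k (f x)) = (%x. g (Suc k) (f x) * pd i f x)" for i
  by (simp add: fun_eq_iff pd_eq[OF D]) (simp add: pd_def)
 moreover have "Ck n (%x. g (Suc k) (f x) * pd i f x)" for i
  using Suc.prems by (intro Ck_mult Suc.IH) (auto intro: Ck_mono)
 ultimately show ?case using D by (auto intro: differentiableI)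
qed

lemma vec3_axis: "x = x$1 *R axis 1 1 + x$2 *R axis 2 1 + x$3 *R axis 3 (1::real)" for x :: "real^3"
 by (simp add: vec3_eq_iff)

lemma linear_axis3: "linear D ==> D x = x$1 * D (axis 1 1) + x$2 * D (axis 2 1) + x$3 * D (axis 3 1)"
 for D :: "real^3 => real"
 by (subst vec3_axis) (simp add: linear_add linear_scale)

lemma Ck_affine:
 fixes L :: "real^3 => real^3"
 assumes L: "bounded_linear L" and T: "!!x. T x = b + L x"
 shows "Ck n f ==> Ck n (%x. f (T x))"
proof (induction n arbitrary: f)
 case 0
 have "continuous_on UNIV T"
  unfolding T[abs_def] by (intro continuous_on_add continuous_on_const linear_continuous_on[OF L])
 with 0 show ?case by (auto intro: continuous_on_compose2)
next
 case (Suc n)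
 hence d: "f differentiable (at x)" for x by auto
 have TD: "(T has_derivative L) (at x)" for x
  unfolding T[abs_def] using bounded_linear_imp_has_derivative[OF L] by (auto intro!: derivative_eq_intros)
 have D: "((%x. f (T x)) has_derivative (%h. frechet_derivative f (at (T x)) (L h))) (at x)" for x
  using has_derivative_compose[OF TD frechet_derivative_worksI[OF d]] .
 have lin: "linear (frechet_derivative f (at y))" for y
  using frechet_derivative_worksI[OF d] has_derivative_linear by blast
 have "pd i (%x. f (T x)) = (%x. L (axis i 1) $ 1 * pd 1 f (T x) + L (axis i 1) $ 2 * pd 2 f (T x) + L (axis i 1) $ 3 * pd 3 f (T x))" for i
  by (rule ext, subst pd_eq[OF D], subst linear_axis3[OF lin]) (simp add: pd_def)
 moreover have "Ck n (%x. L (axis i 1) $ 1 * pd 1 f (T x) + L (axis i 1) $ 2 * pd 2 f (T x) + L (axis i 1) $ 3 * pd 3 f (T x))" for i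
  using Suc.prems by (intro Ck_add Ck_mult Ck_const Suc.IH) auto
 ultimately show ?case using D by (auto intro: differentiableI)
qed

definition smooth :: "(real^3 => real) => bool" where
 "smooth f \<longleftrightarrow> (\<forall>n. Ck n f)"

lemma smooth_const: "smooth (%_. c)"
 and smooth_add: "smooth f ==> smooth g ==> smooth (%x. f x + g x)"
 and smooth_mult: "smooth f ==> smooth g ==> smooth (%x. f x * g x)"
 and smooth_sum: "(!!i. i : I ==> smooth (h i)) ==> smooth (%x. \<Sum>i\<in>I. h i x)"
 and smooth_linear: "bounded_linear f ==> smooth f"
 by (simp_all add: smooth_def Ck_const Ck_add Ck_mult Ck_sum Ck_linear)

lemma smooth_nth: "smooth (%x. x $ i)"
 by (rule smooth_linear[OF bounded_linear_vec_nth])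

lemma smooth_pd: assumes "smooth f" shows "smooth (pd i f)"
 unfolding smooth_def
proof
 fix n show "Ck n (pd i f)" using assms unfolding smooth_def by (metis Ck.simps(2))
qed

lemma smooth_differentiable: "smooth f ==> f differentiable (at x)"
 unfolding smooth_def by (metis Ck.simps(2))

lemma smooth_continuous: "smooth f ==> continuous_on S f"
 unfolding smooth_def by (metis Ck.simps(1) continuous_on_subset subset_UNIV)

lemma smooth_compose:
 "(!!k t. (g k has_real_derivative g (Suc k) t) (at t)) ==> smooth f ==> smooth (%x. g k (f x))"
 by (simp add: smooth_def Ck_compose)

lemma smooth_exp: "smooth f ==> smooth (%x. exp (f x))"
 using smooth_compose[where g = "%_. exp"] DERIV_exp by blast

lemma smooth_affine: "bounded_linear L ==> (!!x. T x = b + L x) ==> smooth f ==> smooth (%x. f (T x))"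
 unfolding smooth_def using Ck_affine by blast

lemma linear3_bounded: "linear L ==> bounded_linear L" for L :: "real^3 => real^3"
 by (simp add: linear_conv_bounded_linear)

lemma smooth_left: assumes "smooth f" shows "smooth (%x. f (p \<odot> x))"
proof (rule smooth_affine[OF linear3_bounded _ assms])
 let ?L = "%x::real^3. vector [x$1, x$2, x$3 + 2 * (p$2 * x$1 - p$1 * x$2)] :: real^3"
 show "linear ?L" by (rule linearI) (simp_all add: vec3_eq_iff algebra_simps)
 show "p \<odot> x = p + ?L x" for x by (simp add: vec3_eq_iff)
qed

lemma smooth_right: assumes "smooth f" shows "smooth (%x. f (x \<odot> p))"
proof (rule smooth_affine[OF linear3_bounded _ assms])
 let ?L = "%x::real^3. vector [x$1, x$2, x$3 + 2 * (x$2 * p$1 - x$1 * p$2)] :: real^3"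
 show "linear ?L" by (rule linearI) (simp_all add: vec3_eq_iff algebra_simps)
 show "x \<odot> p = p + ?L x" for x by (simp add: vec3_eq_iff)
qed

lemma smooth_dil: assumes "smooth f" shows "smooth (%x. f (dil l x))"
proof (rule smooth_affine[OF linear3_bounded _ assms])
 show "linear (dil l)" by (rule linearI) (simp_all add: vec3_eq_iff algebra_simps)
 show "dil l x = 0 + dil l x" for x by simp
qed

lemma smooth_polynomial: "real_polynomial_function p ==> smooth p"
 by (induction rule: real_polynomial_function.induct) (auto intro: smooth_linear smooth_const smooth_add smooth_mult)

section \<open>Horizontal derivatives\<close>

definition he :: "2 => real^3" where "he i = (if i = 1 then axis 1 1 else axis 2 1)"

definition hX :: "2 => (real^3 => real) => real^3 => real" where
 "hX i f x = (if i = 1 then X1 f x else X2 f x)"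

text \<open>The fields are left invariant, hence derivatives along right multiplication by
  \<open>t *R he i\<close>; this curve is the straight line through \<open>x\<close> with direction
  the value of the field at \<open>x\<close>. The product rule and the behaviour under translations
  and dilations thereby become computations in one real variable.\<close>

lemma hX_deriv:
 assumes "h differentiable (at (x \<odot> (t *R he i)))"
 shows "((%s. h (x \<odot> (s *R he i))) has_real_derivative hX i h (x \<odot> (t *R he i))) (at t)"
proof -
 define v where "v = (if i = 1 then vector [1, 0, 2 * x$2] else vector [0, 1, - 2 * x$1] :: real^3)"
 let ?p = "x \<odot> (t *R he i)"
 have g: "x \<odot> (s *R he i) = x + s *R v" for s
  by (auto simp: v_def he_def vec3_eq_iff)
 let ?D = "frechet_derivative h (at ?p)"
 have D: "(h has_derivative ?D) (at (x + t *R v))" using frechet_derivative_worksI[OF assms] by (simp add: g)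
 hence lin: "linear ?D" by (rule has_derivative_linear)
 have "((%s. x + s *R v) has_derivative (%s. s *R v)) (at t)" by (auto intro!: derivative_eq_intros)
 from has_derivative_compose[OF this D]
 have "((%s. h (x + s *R v)) has_derivative (%s. ?D (s *R v))) (at t)" .
 moreover have "(%s. ?D (s *R v)) = (%s. hX i h ?p * s)"
 proof
  fix s
  have "?D v = hX i h ?p"
   by (subst linear_axis3[OF lin]) (simp add: v_def hX_def X1_def X2_def pd_def he_def)
  thus "?D (s *R v) = hX i h ?p * s" using lin by (simp add: linear_scale)
 qed
 ultimately show ?thesis unfolding has_field_derivative_def g by simp
qed

lemma hX_deriv0:
 assumes "smooth p" shows "((%s. p (x \<odot> (s *R he i))) has_real_derivative hX i p x) (at 0)"
 using hX_deriv[of p x 0 i] smooth_differentiable[OF assms, of x] by simp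

lemma hX_unique: "smooth p ==> ((%s. p (x \<odot> (s *R he i))) has_real_derivative D) (at 0) ==> hX i p x = D"
 using hX_deriv0 DERIV_unique by blast

lemma smooth_hX: assumes "smooth f" shows "smooth (hX i f)"
proof -
 have "smooth (X1 f)" unfolding X1_def[abs_def]
  by (intro smooth_add smooth_mult smooth_pd assms smooth_const smooth_nth)
 moreover have "smooth (%x. pd 2 f x + (- 2) * x$1 * pd 3 f x)"
  by (intro smooth_add smooth_mult smooth_pd assms smooth_const smooth_nth)
 hence "smooth (X2 f)" by (simp add: X2_def[abs_def])
 ultimately show ?thesis unfolding hX_def[abs_def] by (cases "i = 1") simp_all
qed

lemma hX_add: assumes f: "smooth f" and g: "smooth g" shows "hX i (%x. f x + g x) x = hX i f x + hX i g x"
 by (rule hX_unique[OF smooth_add[OF f g] DERIV_add[OF hX_deriv0[OF f] hX_deriv0[OF g]]])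

lemma hX_mult:
 assumes f: "smooth f" and g: "smooth g"
 shows "hX i (%x. f x * g x) x = hX i f x * g x + hX i g x * f x"
 by (rule hX_unique[OF smooth_mult[OF f g] DERIV_cong[OF DERIV_mult[OF hX_deriv0[OF f] hX_deriv0[OF g]]]]) simp

lemma hX_left: assumes "smooth f" shows "hX i (%x. f (p \<odot> x)) x = hX i f (p \<odot> x)"
 using hX_deriv0[OF assms, of "p \<odot> x" i] by (intro hX_unique smooth_left assms) (simp add: hmul_assoc)

text \<open>Right translations do not commute with a left invariant field in general. They do along
  the flow of the same field, which is a one-parameter group.\<close>

lemma hX_right:
 assumes "smooth f" shows "hX i (%x. f (x \<odot> (s *R he i))) x = hX i f (x \<odot> (s *R he i))"
proof (rule hX_unique[OF smooth_right[OF assms]])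
 have "x \<odot> (t *R he i) \<odot> (s *R he i) = (x \<odot> (s *R he i)) \<odot> (t *R he i)" for t
  by (auto simp: he_def vec3_eq_iff)
 thus "((%t. f (x \<odot> (t *R he i) \<odot> (s *R he i))) has_real_derivative hX i f (x \<odot> (s *R he i))) (at 0)"
  using hX_deriv0[OF assms, of "x \<odot> (s *R he i)" i] by simp
qed

text \<open>The fields are homogeneous of degree one: \<open>dil l\<close> turns a horizontal step
  of length \<open>t\<close> into one of length \<open>l * t\<close>.\<close>

lemma hX_dil: assumes "smooth f" shows "hX i (%x. f (dil l x)) x = l * hX i f (dil l x)"
proof (rule hX_unique[OF smooth_dil[OF assms]])
 have e: "dil l (x \<odot> (t *R he i)) = dil l x \<odot> ((l * t) *R he i)" for t
  by (auto simp: he_def vec3_eq_iff power2_eq_square algebra_simps)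
 have "((%s. f (dil l x \<odot> (s *R he i))) has_real_derivative hX i f (dil l x)) (at (l * 0))"
  using hX_deriv0[OF assms] by simp
 moreover have "((%t. l * t) has_real_derivative l) (at 0)" by (auto intro!: derivative_eq_intros)
 ultimately have "((%t. f (dil l x \<odot> ((l * t) *R he i))) has_real_derivative hX i f (dil l x) * l) (at 0)"
  by (rule DERIV_chain2)
 thus "((%t. f (dil l (x \<odot> (t *R he i)))) has_real_derivative l * hX i f (dil l x)) (at 0)"
  unfolding e by (simp only: mult.commute[of l "hX i f (dil l x)"])
qed

section \<open>Test functions\<close>

lemma tfD:
 assumes "p : test_functions E"
 shows "smooth p" "compact (closure {x. p x ~= 0})" "closure {x. p x ~= 0} <= E"
  "!!x. x ~: closure {x. p x ~= 0} ==> p x = 0"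
 using assms closure_subset[of "{x. p x ~= 0}"] by (auto simp: test_functions_def smooth_def)

lemma tfI:
 assumes "smooth p" "compact K" "K <= E" "!!x. x ~: K ==> p x = 0"
 shows "p : test_functions E"
proof -
 have sub: "closure {x. p x ~= 0} <= K" using assms by (intro closure_minimal) (auto intro: compact_imp_closed)
 hence "compact (closure {x. p x ~= 0})" using assms(2) closed_closure by (metis compact_Int_closed inf.absorb_iff2)
 with sub assms show ?thesis by (auto simp: test_functions_def smooth_def)
qed

lemma tf_ex: "p : test_functions E ==> \<exists>K. compact K & K <= E & (\<forall>x. x ~: K --> p x = 0)"
 by (rule exI[of _ "closure {x. p x ~= 0}"]) (use tfD in blast)

lemma tf_outside: "p : test_functions E ==> x ~: E ==> p x = 0"
 using tf_ex by blast

lemma tf_mono: "p : test_functions E ==> E <= E' ==> p : test_functions E'"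
 by (auto simp: test_functions_def)

lemma tf_mult: assumes "p : test_functions E" "smooth f" shows "(%x. f x * p x) : test_functions E"
proof -
 obtain K where "compact K" "K <= E" "!!x. x ~: K ==> p x = 0" using tf_ex[OF assms(1)] by blast
 thus ?thesis by (intro tfI[of _ K] smooth_mult assms tfD(1)[OF assms(1)]) auto
qed

lemma tf_zero: "(%x. 0) : test_functions E"
 by (rule tfI[OF smooth_const compact_empty]) auto

lemma tf_hX: assumes "p : test_functions E" shows "hX i p : test_functions E"
proof (rule tfI[OF smooth_hX[OF tfD(1)[OF assms]] tfD(2,3)[OF assms]])
 fix x assume x: "x ~: closure {x. p x ~= 0}"
 have "open ((%s. x \<odot> (s *R he i)) -` (- closure {x. p x ~= 0}))"
  by (intro open_vimage) (auto intro!: continuous_intros)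
 from eventually_nhds_in_open[OF this, of 0]
 have "\<forall>\<^sub>F s in nhds 0. x \<odot> (s *R he i) ~: closure {x. p x ~= 0}" using x by simp
 hence "\<forall>\<^sub>F s in nhds 0. p (x \<odot> (s *R he i)) = 0"
  by eventually_elim (rule tfD(4)[OF assms])
 hence "((%s. p (x \<odot> (s *R he i))) has_real_derivative 0) (at 0)"
  by (subst DERIV_cong_ev[OF refl _ refl, of _ "%_. 0"]) auto
 thus "hX i p x = 0" by (rule hX_unique[OF tfD(1)[OF assms]])
qed

lemma tf_continuous: "p : test_functions E ==> continuous_on S p"
 by (rule smooth_continuous[OF tfD(1)])

lemma tf_bounded: assumes "p : test_functions E" shows "\<exists>C. \<forall>x. \<bar>p x\<bar> <= C"
proof -
 obtain K where K: "compact K" "K <= E" "!!x. x ~: K ==> p x = 0" using tf_ex[OF assms] by blast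
 have "bounded (p ` K)" using K tf_continuous[OF assms] by (intro compact_imp_bounded compact_continuous_image) auto
 then obtain C where "!!x. x : K ==> \<bar>p x\<bar> <= C" unfolding bounded_iff by (metis imageI real_norm_def)
 hence "\<bar>p x\<bar> <= \<bar>C\<bar>" for x using K(3)[of x] by (cases "x : K") force+
 thus ?thesis by blast
qed

lemma tf_compose:
 assumes p: "p : test_functions E" and sm: "smooth (%x. p (T x))" and S: "continuous_on UNIV S"
  and TS: "!!x. S (T x) = x" "!!x. T (S x) = x"
 shows "(%x. p (T x)) : test_functions (T -` E)"
proof -
 obtain K where K: "compact K" "K <= E" "!!x. x ~: K ==> p x = 0" using tf_ex[OF p] by blast
 show ?thesis
 proof (rule tfI[OF sm])
  show "compact (S ` K)" using K S by (intro compact_continuous_image) (auto intro: continuous_on_subset)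
  show "S ` K <= T -` E" using K TS by auto
  show "p (T x) = 0" if "x ~: S ` K" for x using that K TS by (metis imageI)
 qed
qed

lemma tf_left: assumes h: "h : test_functions UNIV" shows "(%x. h (p \<odot> x)) : test_functions UNIV"
proof -
 have "continuous_on UNIV (%x. (-p) \<odot> x)" by (intro continuous_intros continuous_on_id)
 from tf_compose[OF h smooth_left[OF tfD(1)[OF h]] this] show ?thesis by simp
qed

lemma tf_right: assumes h: "h : test_functions UNIV" shows "(%x. h (x \<odot> p)) : test_functions UNIV"
proof -
 have "continuous_on UNIV (%x. x \<odot> (-p))" by (intro continuous_intros continuous_on_id)
 from tf_compose[OF h smooth_right[OF tfD(1)[OF h]] this] show ?thesis by simp
qed

lemma tf_dil: assumes l: "l > 0" and p: "p : test_functions UNIV" shows "(%x. p (dil l x)) : test_functions UNIV"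
proof -
 have "continuous_on UNIV (%x. dil (1/l) x)" by (intro continuous_intros continuous_on_id)
 from tf_compose[OF p smooth_dil[OF tfD(1)[OF p]] this] show ?thesis using l by simp
qed

subsection \<open>Cutoff functions\<close>

text \<open>With \<open>s = 1 / t\<close> the derivative of \<open>p s * exp (- s)\<close> in
  \<open>t\<close> is \<open>s^2 * (p s - p' s) * exp (- s)\<close>. Iterating from
  \<open>p = 1\<close> gives the polynomials in all derivatives of
  \<open>exp (- 1 / t)\<close>.\<close>

definition flat_poly :: "nat => real poly" where
 "flat_poly k = ((%p. [:0, 0, 1:] * (p - pderiv p)) ^^ k) 1"

definition flat :: "nat => real => real" where
 "flat k t = (if t > 0 then poly (flat_poly k) (1/t) * exp (- (1/t)) else 0)"

lemma poly_exp_tendsto_0: "((%s. poly p s * exp (- s)) \<longlongrightarrow> (0::real)) at_top"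
proof -
 have "((%s. \<Sum>i\<le>degree p. coeff p i * (s ^ i / exp s)) \<longlongrightarrow> (\<Sum>i\<le>degree p. coeff p i * 0)) at_top"
  by (intro tendsto_intros tendsto_power_div_exp_0)
 thus ?thesis by (simp add: poly_altdef sum_distrib_right exp_minus divide_inverse mult.assoc)
qed

lemma flat_deriv: "(flat k has_real_derivative flat (Suc k) t) (at t)"
proof -
 consider "t > 0" | "t < 0" | "t = 0" by linarith
 thus ?thesis
 proof cases
  case 1
  have ev: "\<forall>\<^sub>F s in nhds t. flat k s = poly (flat_poly k) (1/s) * exp (- (1/s))"
   using eventually_nhds_in_open[of "{0<..}" t] 1 by (auto elim!: eventually_mono simp: flat_def)
  have "((%s. poly (flat_poly k) (1/s) * exp (- (1/s))) has_real_derivative flat (Suc k) t) (at t)"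
   using 1 by (auto intro!: derivative_eq_intros DERIV_chain'[OF _ poly_DERIV] simp: flat_def flat_poly_def field_simps power2_eq_square)
  thus ?thesis by (subst DERIV_cong_ev[OF refl ev refl])
 next
  case 2
  have ev: "\<forall>\<^sub>F s in nhds t. flat k s = 0"
   using eventually_nhds_in_open[of "{..<0}" t] 2 by (auto elim!: eventually_mono simp: flat_def)
  show ?thesis using 2 by (subst DERIV_cong_ev[OF refl ev refl]) (auto simp: flat_def)
 next
  case 3
  \<comment> \<open>To the right of 0 the difference quotient \<open>flat k h / h\<close> equals
    \<open>s * poly (flat_poly k) s * exp (- s)\<close> with \<open>s = 1 / h\<close>;
    \<open>pCons 0\<close> supplies the factor \<open>s\<close>.\<close>
  have "((%s. poly (pCons 0 (flat_poly k)) s * exp (- s)) \<longlongrightarrow> 0) at_top" by (rule poly_exp_tendsto_0)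
  from filterlim_compose[OF this filterlim_inverse_at_top_right]
  have "((%h. flat k h / h) \<longlongrightarrow> 0) (at_right 0)"
   by (rule Lim_transform_eventually) (auto simp: flat_def eventually_at_filter divide_inverse ac_simps)
  moreover have "((%h. flat k h / h) \<longlongrightarrow> 0) (at_left 0)"
   by (rule Lim_transform_eventually[OF tendsto_const]) (auto simp: flat_def eventually_at_filter)
  ultimately have "((%h. flat k h / h) \<longlongrightarrow> 0) (at 0)" by (simp add: filterlim_split_at)
  thus ?thesis using 3 by (simp add: DERIV_def flat_def)
 qed
qed

definition bump :: "real^3 => real^3 => real^3 => real" where
 "bump a b x = (flat 0 (x$1 - a$1) * flat 0 (b$1 - x$1)) * (flat 0 (x$2 - a$2) * flat 0 (b$2 - x$2)) *
   (flat 0 (x$3 - a$3) * flat 0 (b$3 - x$3))"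

lemma flat0: "flat 0 t = (if t > 0 then exp (- (1/t)) else 0)"
 by (simp add: flat_def flat_poly_def)

lemma bump_nonneg: "0 <= bump a b x" by (simp add: bump_def flat0)

lemma bump_pos: "x : box a b ==> 0 < bump a b x"
 by (simp add: bump_def flat0 mem_box_cart forall_3)

lemma bump_zero: "x ~: box a b ==> bump a b x = 0"
 by (auto simp: bump_def flat0 mem_box_cart forall_3)

lemma smooth_bump: "smooth (bump a b)"
proof -
 have 1: "smooth (%x. flat 0 (x$i - a$i))" for i
  using smooth_compose[where g = flat and k = 0, OF flat_deriv smooth_add[OF smooth_nth[of i] smooth_const[of "- a$i"]]] by simp
 have "smooth (%x. b$i + (-1) * x$i)" for i by (intro smooth_add smooth_mult smooth_const smooth_nth)
 hence 2: "smooth (%x. flat 0 (b$i - x$i))" for i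
  using smooth_compose[where g = flat and k = 0 and f = "%x. b$i - x$i" for i, OF flat_deriv] by simp
 show ?thesis unfolding bump_def[abs_def] by (intro smooth_mult 1 2)
qed

text \<open>Countably many open boxes with closures in \<open>E\<close> cover \<open>E\<close>. One
  minus the exponential of \<open>- n\<close> times the sum of the first bumps is smooth, lies
  between 0 and 1, vanishes off finitely many of these boxes, and tends to 1 wherever some bump is
  positive.\<close>

lemma cutoff_exists:
 assumes "open E"
 shows "\<exists>c. (\<forall>n::nat. c n : test_functions E & (\<forall>x. 0 <= c n x & c n x <= 1)) & (\<forall>x\<in>E. (%n. c n x) ----> 1)"
proof (cases "E = {}")
 case True
 thus ?thesis by (intro exI[of _ "%_ _. 0"]) (auto intro: tf_zero)
next
 case False
 define F where "F = {box a b | a b :: real^3. cbox a b <= E}"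
 have UF: "\<Union>F = E"
 proof
  show "\<Union>F <= E" using box_subset_cbox by (force simp: F_def)
  show "E <= \<Union>F"
  proof
   fix x assume "x : E"
   then obtain a b where "cbox a b <= E" "x : box a b" using open_contains_cbox[OF assms] by metis
   thus "x : \<Union>F" by (auto simp: F_def)
  qed
 qed
 obtain F' where F': "F' <= F" "countable F'" "\<Union>F' = \<Union>F"
  by (rule Lindelof[of F]) (auto simp: F_def open_box)
 have ne: "F' ~= {}" using F' UF False by auto
 have "\<exists>a b. from_nat_into F' n = box a b & cbox a b <= E" for n
  using from_nat_into[OF ne, of n] F'(1) by (auto simp: F_def)
 then obtain a b where ab: "!!n. from_nat_into F' n = box (a n) (b n)" "!!n. cbox (a n) (b n) <= E" by metis
 define c where "c n x = 1 - exp (- (real n * (\<Sum>i\<le>n. bump (a i) (b i) x)))" for n x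
 have s0: "0 <= (\<Sum>i\<le>n. bump (a i) (b i) x)" for n x by (intro sum_nonneg bump_nonneg)
 have "c n : test_functions E" for n
 proof (rule tfI[of _ "\<Union>i\<le>n. cbox (a i) (b i)"])
  have "smooth (%x. 1 + (-1) * exp ((- real n) * (\<Sum>i\<le>n. bump (a i) (b i) x)))"
   by (intro smooth_add smooth_mult smooth_const smooth_exp smooth_sum smooth_bump)
  thus "smooth (c n)" by (simp add: c_def[abs_def])
  show "c n x = 0" if "x ~: (\<Union>i\<le>n. cbox (a i) (b i))" for x
  proof -
   have "x ~: box (a i) (b i)" if "i <= n" for i
    using \<open>x ~: (\<Union>i\<le>n. cbox (a i) (b i))\<close> that box_subset_cbox by blast
   hence "(\<Sum>i\<le>n. bump (a i) (b i) x) = 0" by (intro sum.neutral) (simp add: bump_zero)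
   thus ?thesis by (simp add: c_def)
  qed
 qed (use ab in "auto intro!: compact_UN")
 moreover have "0 <= c n x & c n x <= 1" for n x using s0 by (simp add: c_def)
 moreover have "(%n. c n x) ----> 1" if x: "x : E" for x
 proof -
  obtain B where "B : F'" "x : B" using x F' UF by auto
  then obtain m where m: "x : box (a m) (b m)" using from_nat_into_surj[OF F'(2)] ab(1) by metis
  define \<beta> where "\<beta> = bump (a m) (b m) x"
  have \<beta>: "\<beta> > 0" unfolding \<beta>_def by (rule bump_pos[OF m])
  have "(%n. exp (- (real n * \<beta>))) ----> 0"
  proof -
   have "(%n. exp (- \<beta>) ^ n) ----> 0" using \<beta> by (intro LIMSEQ_power_zero) simp
   thus ?thesis by (simp add: exp_of_nat_mult[symmetric])
  qed
  moreover have "\<forall>\<^sub>F n in sequentially. norm (c n x - 1) <= exp (- (real n * \<beta>))"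
   unfolding eventually_sequentially
  proof (intro exI[of _ m] allI impI)
   fix n assume n: "m <= n"
   have "\<beta> <= (\<Sum>i\<le>n. bump (a i) (b i) x)" unfolding \<beta>_def using n by (intro member_le_sum bump_nonneg) auto
   hence "real n * \<beta> <= real n * (\<Sum>i\<le>n. bump (a i) (b i) x)" by (intro mult_left_mono) auto
   thus "norm (c n x - 1) <= exp (- (real n * \<beta>))" by (simp add: c_def)
  qed
  ultimately show ?thesis by (intro LIM_zero_cancel[of _ 1] Lim_null_comparison[of "%n. c n x - 1"])
 qed
 ultimately show ?thesis by blast
qed

section \<open>Density of polynomials\<close>

lemma continuous_clip:
 fixes g :: "'a::topological_space => 'b::euclidean_space"
 assumes "continuous_on S g" "0 <= M"
 shows "continuous_on S (%x. closest_point (cball 0 M) (g x))"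
 using continuous_on_closest_point[of "cball (0::'b) M"] assms
 by (intro continuous_on_compose2[OF _ assms(1)]) auto

lemma clip_bounded: "0 <= M ==> norm (closest_point (cball (0::'b::euclidean_space) M) v) <= M"
 using closest_point_in_set[of "cball (0::'b) M" v] by auto

lemma clip_id: "norm v <= M ==> closest_point (cball (0::'b::euclidean_space) M) v = v"
 by (intro closest_point_self) auto

text \<open>The nearest-point projection onto the ball of radius \<open>M\<close> makes any
  continuous approximation uniformly bounded and does not move the limit.\<close>

lemma bounded_measurable_approx:
 fixes f :: "'a::euclidean_space => 'b::euclidean_space"
 assumes S: "S : sets lebesgue" and f: "f : bm (lebesgue_on S)" and M: "!!x. norm (f x) <= M"
 shows "\<exists>g. (\<forall>n::nat. continuous_on UNIV (g n) & (\<forall>x. norm (g n x) <= M)) & (AE x in lebesgue_on S. (%n. g n x) ----> f x)"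
proof -
 have M0: "0 <= M" using M[of undefined] norm_ge_zero order_trans by blast
 have "f measurable_on S" using f S by (simp add: measurable_on_iff_borel_measurable)
 then obtain N g where N: "negligible N" and g: "!!n::nat. continuous_on UNIV (g n)"
  and lim: "!!x. x ~: N ==> (%n. g n x) ----> (if x : S then f x else 0)"
  unfolding measurable_on_def by blast
 let ?c = "closest_point (cball (0::'b) M)"
 have "AE x in lebesgue. x ~: N" using N by (simp add: AE_not_in negligible_iff_null_sets)
 hence "AE x in lebesgue_on S. (%n. ?c (g n x)) ----> f x"
  unfolding AE_lebesgue_on[OF S]
 proof eventually_elim
  case (elim x)
  show ?case
  proof
   assume "x : S"
   hence "(%n. g n x) ----> f x" using lim[OF elim] by simp
   moreover have "isCont ?c (f x)"
   proof -
    have "continuous_on UNIV ?c" using continuous_on_closest_point[of "cball (0::'b) M"] M0 by auto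
    thus ?thesis by (simp add: continuous_on_eq_continuous_at)
   qed
   ultimately have "(%n. ?c (g n x)) ----> ?c (f x)" by (rule isCont_tendsto_compose[rotated])
   thus "(%n. ?c (g n x)) ----> f x" by (simp add: clip_id M)
  qed
 qed
 thus ?thesis using g M0
  by (intro exI[of _ "%n x. ?c (g n x)"]) (auto intro: continuous_clip clip_bounded)
qed

lemma LIMSEQ_0_ex_less: "X ----> (0::real) ==> e > 0 ==> \<exists>n. X n < e"
 using order_tendstoD(2)[of X 0 sequentially e] by (auto simp: eventually_sequentially)

text \<open>Three errors of size \<open>e/3\<close>: truncation to a bounded function, approximation
  by bounded continuous functions, and Stone-Weierstrass on the compact closure. Polynomials are
  chosen as the dense class because on a product they split into sums of products.\<close>

lemma polynomial_dense:
 fixes f :: "'a::euclidean_space => 'b::euclidean_space"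
 assumes S: "S : sets lebesgue" "bounded S" and f: "f : sq_int (lebesgue_on S)" and e: "e > 0"
 shows "\<exists>p. polynomial_function p & p : sq_int (lebesgue_on S) & sq_norm (lebesgue_on S) (%x. f x - p x) < e"
proof -
 let ?L = "lebesgue_on S"
 have fin: "finite_measure ?L" by (rule finite_measure_lebesgue_on[OF S])
 define F where "F n x = (if norm (f x) <= real n then f x else 0)" for n x
 note [measurable] = sq_intD[OF f]
 have Fm: "F n : bm ?L" for n unfolding F_def by measurable
 have Fn: "norm (F n x) <= real n" for n x by (simp add: F_def)
 have "(%n. sq_norm ?L (%x. F n x - f x)) ----> 0"
 proof (rule sq_norm_tendsto_DCT[where w = f and C = 1])
  show "AE x in ?L. (%n. F n x) ----> f x"
  proof (rule AE_I2)
   fix x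
   obtain m where m: "norm (f x) <= real m" using real_arch_simple by blast
   have "\<forall>\<^sub>F n in sequentially. F n x = f x"
    unfolding eventually_sequentially F_def by (intro exI[of _ m]) (use m in auto)
   thus "(%n. F n x) ----> f x" by (rule tendsto_eventually)
  qed
 qed (use Fm f in "auto simp: F_def")
 then obtain n where n: "sq_norm ?L (%x. F n x - f x) < e/3" using LIMSEQ_0_ex_less[of _ "e/3"] e by auto
 have Fs: "F n : sq_int ?L" using Fn by (intro sq_int_bounded[OF fin Fm]) auto
 obtain g where g: "!!k::nat. continuous_on UNIV (g k)" "!!k x. norm (g k x) <= real n"
  and lim: "AE x in ?L. (%k. g k x) ----> F n x"
  using bounded_measurable_approx[OF S(1) Fm Fn] by blast
 have gm: "g k : bm ?L" for k
  by (intro measurable_restrict_space1 lebesgue_borelI borel_measurable_continuous_onI g)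
 have gs: "g k : sq_int ?L" for k using g by (intro sq_int_bounded[OF fin gm]) auto
 have "(%k. sq_norm ?L (%x. g k x - F n x)) ----> 0"
 proof (rule sq_norm_tendsto_DCT[where w = "%_. 1::real" and C = "2 * real n"])
  show "AE x in ?L. norm (g k x - F n x) <= 2 * real n * norm (1::real)" for k
   using g(2)[of k] Fn[of n] norm_triangle_ineq4[of "g k x" "F n x" for x]
   by (intro AE_I2) (smt (verit) norm_one mult_cancel_left2)
 qed (use lim gm Fm sq_int_const[OF fin] in auto)
 then obtain k where k: "sq_norm ?L (%x. g k x - F n x) < e/3" using LIMSEQ_0_ex_less[of _ "e/3"] e by auto
 have "compact (closure S)" using S by (simp add: compact_closure)
 from Stone_Weierstrass_polynomial_function[OF this continuous_on_subset[OF g(1) subset_UNIV]]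
 have "\<forall>m. \<exists>p. polynomial_function p & (\<forall>x\<in>closure S. norm (g k x - p x) < 1 / real (Suc m))" by simp
 from choice[OF this] obtain P where P: "!!m. polynomial_function (P m)" "!!m x. x : closure S ==> norm (g k x - P m x) < 1 / real (Suc m)" by blast
 have P': "norm (P m x - g k x) <= 1 / real (Suc m)" if "x : space ?L" for m x
  using P(2)[of x m] that closure_subset[of S] by (auto simp: norm_minus_commute)
 have pm: "P m : bm ?L" for m
  by (intro measurable_restrict_space1 lebesgue_borelI borel_measurable_continuous_onI continuous_on_polymonial_function P)
 have gp: "AE x in ?L. norm (P m x - g k x) <= 1 * norm (1::real)" for m
  using order_trans[OF P', of _ m 1] by (intro AE_I2) simp
 have "(%m. sq_norm ?L (%x. P m x - g k x)) ----> 0"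
  by (rule sq_norm_tendsto_DCT[OF pm gm sq_int_const[OF fin] gp], rule AE_I2, rule LIM_zero_cancel,
    rule Lim_null_comparison[OF _ LIMSEQ_Suc[OF lim_1_over_n]]) (use P' in "auto intro!: always_eventually")
 then obtain m where 3: "sq_norm ?L (%x. P m x - g k x) < e/3" using LIMSEQ_0_ex_less[of _ "e/3"] e by auto
 define p where "p = P m"
 note p = P(1)[of m, folded p_def]
 have ps: "p : sq_int ?L"
  using sq_int_add[OF sq_int_dominated[OF sq_int_const[OF fin] borel_measurable_diff[OF pm gm] gp] gs[of k]] by (simp add: p_def)
 have "sq_norm ?L (%x. f x - p x) <= sq_norm ?L (%x. f x - F n x) + sq_norm ?L (%x. F n x - p x)"
  by (rule sq_norm_triangle_diff[OF f Fs ps])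
 also have "sq_norm ?L (%x. F n x - p x) <= sq_norm ?L (%x. F n x - g k x) + sq_norm ?L (%x. g k x - p x)"
  by (rule sq_norm_triangle_diff[OF Fs gs ps])
 finally have "sq_norm ?L (%x. f x - p x) < e"
  using n k 3 sq_norm_commute[of ?L f "F n"] sq_norm_commute[of ?L "F n" "g k"] sq_norm_commute[of ?L p "g k"] unfolding p_def by linarith
 with p ps show ?thesis by blast
qed

lemma test_function_dense:
 fixes f :: "real^3 => real"
 assumes E: "open E" "bounded E" and f: "f : sq_int (lebesgue_on E)" and e: "e > 0"
 shows "\<exists>s\<in>test_functions E. s : sq_int (lebesgue_on E) & sq_norm (lebesgue_on E) (%x. f x - s x) < e"
proof -
 let ?L = "lebesgue_on E"
 have S: "E : sets lebesgue" using E by simp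
 obtain p where p: "polynomial_function p" and ps: "p : sq_int ?L" and pe: "sq_norm ?L (%x. f x - p x) < e/2"
  using polynomial_dense[OF S E(2) f, of "e/2"] e by auto
 obtain c where c: "!!n::nat. c n : test_functions E" "!!n x. 0 <= c n x & c n x <= 1"
  "!!x. x : E ==> (%n. c n x) ----> 1" using cutoff_exists[OF E(1)] by blast
 have cm: "c n : bm ?L" for n
  by (intro measurable_restrict_space1 lebesgue_borelI borel_measurable_continuous_onI tf_continuous[OF c(1)])
 note pm = sq_intD[OF ps]
 have "(%n. sq_norm ?L (%x. p x * c n x - p x)) ----> 0"
 proof (rule sq_norm_tendsto_DCT[where w = p and C = 1])
  show "AE x in ?L. norm (p x * c n x - p x) <= 1 * norm (p x)" for n
  proof (rule AE_I2)
   fix x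
   have "p x * c n x - p x = - (p x * (1 - c n x))" by (simp add: algebra_simps)
   thus "norm (p x * c n x - p x) <= 1 * norm (p x)" using c(2)[of n x]
    by (simp add: abs_mult mult_left_le)
  qed
  show "AE x in ?L. (%n. p x * c n x) ----> p x"
   using c(3) by (intro AE_I2) (auto intro!: tendsto_eq_intros)
 qed (use pm cm ps in auto)
 then obtain n where n: "sq_norm ?L (%x. p x * c n x - p x) < e/2" using LIMSEQ_0_ex_less[of _ "e/2"] e by auto
 have t: "(%x. p x * c n x) : test_functions E"
  using p by (intro tf_mult c smooth_polynomial) (simp add: real_polynomial_function_eq)
 have ts: "(%x. p x * c n x) : sq_int ?L"
  using sq_int_bounded_mult[OF ps cm[of n], of 1] c(2) by (simp add: mult.commute)
 have "sq_norm ?L (%x. f x - p x * c n x) <= sq_norm ?L (%x. f x - p x) + sq_norm ?L (%x. p x - p x * c n x)"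
  by (rule sq_norm_triangle_diff[OF f ps ts])
 also have "... < e" using n pe sq_norm_commute[of ?L p "%x. p x * c n x"] by simp
 finally show ?thesis using t ts by blast
qed

section \<open>The fundamental lemma of the calculus of variations\<close>

definition loc_int :: "(real^3) set => (real^3 => 'b::euclidean_space) => bool" where
 "loc_int \<Omega> f \<longleftrightarrow> (\<forall>K. compact K & K <= \<Omega> --> integrable (lebesgue_on K) f)"

lemma compact_lebesgue: "compact K ==> K : sets lebesgue"
 by (simp add: compact_imp_closed borel_closed)

lemma loc_int_mult:
 fixes f :: "real^3 => 'b::euclidean_space"
 assumes f: "loc_int E f" and p: "continuous_on UNIV p" "compact K" "K <= E" "!!x. x ~: K ==> p x = 0"
 shows "integrable lebesgue (%x. p x *R f x)"
proof -
 have K: "K : sets lebesgue" by (rule compact_lebesgue[OF p(2)])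
 have fK: "integrable (lebesgue_on K) f" using f p by (simp add: loc_int_def)
 have "bounded (p ` K)" using p by (intro compact_imp_bounded compact_continuous_image) (auto intro: continuous_on_subset)
 then obtain C where C: "!!x. x : K ==> \<bar>p x\<bar> <= C" unfolding bounded_iff by (metis imageI real_norm_def)
 have "integrable (lebesgue_on K) (%x. p x *R f x)"
 proof (rule Bochner_Integration.integrable_bound)
  show "integrable (lebesgue_on K) (%x. C *R f x)" using fK by simp
  show "(%x. p x *R f x) : bm (lebesgue_on K)"
   by (intro borel_measurable_scaleR borel_measurable_integrable[OF fK] measurable_restrict_space1 lebesgue_borelI
     borel_measurable_continuous_onI p)
  show "AE x in lebesgue_on K. norm (p x *R f x) <= norm (C *R f x)"
   using C by (intro AE_I2) (auto intro!: mult_right_mono order_trans[OF C])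
 qed
 hence "integrable lebesgue (%x. indicator K x *R (p x *R f x))" using K by (simp add: integrable_restrict_space)
 moreover have "(%x. indicator K x *R (p x *R f x)) = (%x. p x *R f x)"
  using p(4) by (auto simp: fun_eq_iff indicator_def)
 ultimately show ?thesis by simp
qed

lemma loc_int_tf:
 fixes f :: "real^3 => 'b::euclidean_space"
 assumes "loc_int E f" "p : test_functions E"
 shows "integrable lebesgue (%x. p x *R f x)"
proof -
 obtain K where "compact K" "K <= E" "!!x. x ~: K ==> p x = 0" using tf_ex[OF assms(2)] by blast
 thus ?thesis using loc_int_mult[OF assms(1) tf_continuous[OF assms(2)]] by blast
qed

lemma loc_int_component: "loc_int E G ==> loc_int E (%x. G x $ i)" for G :: "real^3 => real^'n"
 unfolding loc_int_def by (auto intro!: integrable_bounded_linear[OF bounded_linear_vec_nth])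

lemma LINT_outside:
 fixes f :: "real^3 => 'b::{banach, second_countable_topology}"
 assumes "E : sets lebesgue" "!!x. x ~: E ==> f x = 0"
 shows "(LINT x|lebesgue_on E. f x) = (LINT x|lebesgue. f x)"
  and "integrable (lebesgue_on E) f \<longleftrightarrow> integrable lebesgue f"
proof -
 have "(%x. indicator E x *R f x) = f" using assms(2) by (auto simp: fun_eq_iff indicator_def)
 thus "(LINT x|lebesgue_on E. f x) = (LINT x|lebesgue. f x)"
  and "integrable (lebesgue_on E) f \<longleftrightarrow> integrable lebesgue f"
  using assms(1) by (simp_all add: integral_restrict_space integrable_restrict_space)
qed

text \<open>Since \<open>k\<close> is only integrable, uniform and bounded pointwise limits are
  used: orthogonality passes from polynomials to bounded continuous functions by Stone-Weierstrass,
  and from these to the sign of \<open>k\<close>.\<close>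

lemma integrable_polynomial_zero:
 fixes k :: "real^3 => real"
 assumes K: "compact K" and k: "integrable (lebesgue_on K) k"
  and zero: "!!p. real_polynomial_function p ==> (LINT x|lebesgue_on K. k x * p x) = 0"
 shows "AE x in lebesgue_on K. k x = 0"
proof -
 let ?L = "lebesgue_on K"
 have Ks: "K : sets lebesgue" by (rule compact_lebesgue[OF K])
 note km = borel_measurable_integrable[OF k]
 have cm: "g : bm ?L" if "continuous_on UNIV g" for g :: "real^3 => real"
  by (intro measurable_restrict_space1 lebesgue_borelI borel_measurable_continuous_onI that)
 have cz: "(LINT x|?L. k x * g x) = 0" if g: "continuous_on UNIV g" "!!x. \<bar>g x\<bar> <= 1" for g :: "real^3 => real"
 proof -
  from Stone_Weierstrass_polynomial_function[OF K continuous_on_subset[OF g(1) subset_UNIV]]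
  have "\<forall>m. \<exists>p. real_polynomial_function p & (\<forall>x\<in>K. \<bar>g x - p x\<bar> < 1 / real (Suc m))" by (simp add: real_polynomial_function_eq)
  from choice[OF this] obtain P where P: "!!m. real_polynomial_function (P m)" "!!m x. x : K ==> \<bar>g x - P m x\<bar> < 1 / real (Suc m)" by blast
  have "(%m. LINT x|?L. k x * P m x) ----> (LINT x|?L. k x * g x)"
  proof (rule integral_dominated_convergence[where w = "%x. \<bar>k x\<bar> * 2"])
   show "AE x in ?L. (%m. k x * P m x) ----> k x * g x"
    by (intro AE_I2 tendsto_mult_left, rule LIM_zero_cancel, rule Lim_null_comparison[OF _ LIMSEQ_Suc[OF lim_1_over_n]])
     (use P(2) in "auto intro!: always_eventually less_imp_le simp: abs_minus_commute")
   show "AE x in ?L. norm (k x * P m x) <= \<bar>k x\<bar> * 2" for m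
   proof (rule AE_I2)
    fix x assume "x : space ?L"
    hence "\<bar>g x - P m x\<bar> < 1 / real (Suc m)" using P(2) by simp
    also have "... <= 1" by simp
    finally have "\<bar>P m x\<bar> <= 2" using g(2)[of x] by linarith
    thus "norm (k x * P m x) <= \<bar>k x\<bar> * 2" by (simp add: abs_mult mult_left_mono)
   qed
   show "(%x. k x * P m x) : bm ?L" for m
    by (intro borel_measurable_times km cm smooth_continuous smooth_polynomial P)
  qed (use k in "auto intro!: borel_measurable_times km cm[OF g(1)]")
  thus ?thesis by (simp add: zero[OF P(1)] LIMSEQ_const_iff)
 qed
 have sm: "(%x. sgn (k x)) : bm ?L" using km by measurable
 have s1: "norm (sgn (k x)) <= 1" for x by (simp add: norm_sgn)
 obtain g where g: "!!n::nat. continuous_on UNIV (g n)" "!!n x. norm (g n x) <= 1"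
  and lim: "AE x in ?L. (%n. g n x) ----> sgn (k x)"
  using bounded_measurable_approx[OF Ks sm s1] by blast
 have "(%n. LINT x|?L. k x * g n x) ----> (LINT x|?L. k x * sgn (k x))"
 proof (rule integral_dominated_convergence[where w = "%x. \<bar>k x\<bar>"])
  show "AE x in ?L. (%n. k x * g n x) ----> k x * sgn (k x)"
   using lim by eventually_elim (intro tendsto_intros)
  show "AE x in ?L. norm (k x * g n x) <= \<bar>k x\<bar>" for n
   using g(2)[of n] by (intro AE_I2) (simp add: abs_mult mult_left_le)
 qed (use km sm cm g k in auto)
 moreover have "(LINT x|?L. k x * g n x) = 0" for n using g by (intro cz) auto
 ultimately have "(LINT x|?L. k x * sgn (k x)) = 0" by (simp add: LIMSEQ_const_iff)
 moreover have "(%x. k x * sgn (k x)) = (%x. \<bar>k x\<bar>)" by (auto simp: fun_eq_iff abs_sgn)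
 ultimately have "(LINT x|?L. \<bar>k x\<bar>) = 0" by simp
 hence "AE x in ?L. \<bar>k x\<bar> = 0"
  using k by (subst (asm) integral_nonneg_eq_0_iff_AE) auto
 thus ?thesis by simp
qed

text \<open>Multiplying by a cutoff \<open>c n\<close> reduces the claim to compact support, where a
  polynomial times \<open>c n\<close> is an admissible test function.\<close>

lemma fundamental_lemma:
 fixes h :: "real^3 => real"
 assumes E: "open E" and h: "loc_int E h"
  and zero: "!!r. r : test_functions E ==> (LINT x|lebesgue. h x * r x) = 0"
 shows "AE x in lebesgue_on E. h x = 0"
proof -
 have S: "E : sets lebesgue" using E by simp
 obtain c where c: "!!n::nat. c n : test_functions E" "!!x. x : E ==> (%n. c n x) ----> 1" using cutoff_exists[OF E] by blast
 have "AE x in lebesgue. h x * c n x = 0" for n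
 proof -
  obtain K where K: "compact K" "K <= E" "!!x. x ~: K ==> c n x = 0" using tf_ex[OF c(1)] by blast
  have Ks: "K : sets lebesgue" by (rule compact_lebesgue[OF K(1)])
  have "integrable lebesgue (%x. h x * c n x)" using loc_int_tf[OF h c(1)[of n]] by (simp add: mult.commute)
  hence i: "integrable (lebesgue_on K) (%x. h x * c n x)" using K(3) by (subst LINT_outside(2)[OF Ks]) auto
  have "AE x in lebesgue_on K. h x * c n x = 0"
  proof (rule integrable_polynomial_zero[OF K(1) i])
   fix p :: "real^3 => real" assume "real_polynomial_function p"
   hence t: "(%x. p x * c n x) : test_functions E" by (intro tf_mult c smooth_polynomial)
   have "(LINT x|lebesgue_on K. h x * c n x * p x) = (LINT x|lebesgue. h x * c n x * p x)"
    using K(3) by (intro LINT_outside(1)[OF Ks]) auto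
   also have "... = 0" using zero[OF t] by (simp add: mult_ac)
   finally show "(LINT x|lebesgue_on K. h x * c n x * p x) = 0" .
  qed
  hence "AE x in lebesgue. x : K --> h x * c n x = 0" by (simp add: AE_lebesgue_on Ks)
  thus ?thesis by eventually_elim (use K(3) in auto)
 qed
 hence "AE x in lebesgue. \<forall>n. h x * c n x = 0" unfolding AE_all_countable by blast
 thus ?thesis unfolding AE_lebesgue_on[OF S]
 proof eventually_elim
  case (elim x)
  show ?case
  proof
   assume "x : E"
   hence "(%n. h x * c n x) ----> h x * 1" by (intro tendsto_intros c)
   moreover have "(%n. h x * c n x) = (%_. 0)" using elim by (simp add: fun_eq_iff)
   ultimately show "h x = 0" by (simp only: LIMSEQ_const_iff mult_1_right)
  qed
 qed
qed

section \<open>Weak horizontal gradients\<close>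

lemma hX_12: "hX 1 = X1" "hX 2 = X2" by (auto simp: hX_def fun_eq_iff)

lemma weak_hgrad_iff:
 assumes E: "open E"
 shows "weak_hgrad E f G \<longleftrightarrow> loc_int E f & loc_int E G \<and>
  (\<forall>p\<in>test_functions E. \<forall>i. (LINT x|lebesgue. f x * hX i p x) = - (LINT x|lebesgue. G x $ i * p x))"
proof -
 have S: "E : sets lebesgue" using E by simp
 have ai: "g absolutely_integrable_on K \<longleftrightarrow> integrable (lebesgue_on K) g" if "compact K"
  for K and g :: "real^3 => 'b::euclidean_space"
  using compact_lebesgue[OF that] by (simp add: set_integrable_def integrable_restrict_space)
 have e: "(LINT x|lebesgue_on E. f x * hX i p x) = (LINT x|lebesgue. f x * hX i p x)"
   "(LINT x|lebesgue_on E. G x $ i * p x) = (LINT x|lebesgue. G x $ i * p x)" if "p : test_functions E" for p i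
  using tf_outside[OF that] tf_outside[OF tf_hX[OF that]] by (auto intro!: LINT_outside(1)[OF S])
 show ?thesis
  unfolding weak_hgrad_def loc_int_def using e e(1)[of _ 1, unfolded hX_12] e(1)[of _ 2, unfolded hX_12]
  by (auto simp: ai forall_2 hX_12)
qed

lemma weak_hgradI:
 assumes "open E" "loc_int E f" "loc_int E G"
  and "!!p i. p : test_functions E ==> (LINT x|lebesgue. f x * hX i p x) = - (LINT x|lebesgue. G x $ i * p x)"
 shows "weak_hgrad E f G"
 using assms by (simp add: weak_hgrad_iff)

lemma weak_hgradD:
 assumes "weak_hgrad E f G" "open E"
 shows "loc_int E f" "loc_int E G"
  "!!p i. p : test_functions E ==> (LINT x|lebesgue. f x * hX i p x) = - (LINT x|lebesgue. G x $ i * p x)"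
 using assms by (simp_all add: weak_hgrad_iff)

lemma loc_int_add: "loc_int E f ==> loc_int E g ==> loc_int E (%x. f x + g x)"
 and loc_int_scale: "loc_int E f ==> loc_int E (%x. c *R f x)"
 by (auto simp: loc_int_def)

lemma loc_int_subset: "loc_int E f ==> E' <= E ==> loc_int E' f"
 unfolding loc_int_def by blast

lemma integrable_lebesgue_on_subset:
 fixes f :: "real^3 => 'b::euclidean_space"
 assumes "integrable (lebesgue_on S) f" "K <= S" "K : sets lebesgue" "S : sets lebesgue"
 shows "integrable (lebesgue_on K) f"
proof -
 have "integrable lebesgue (%x. indicator K x *R (indicator S x *R f x))"
  by (rule integrable_mult_indicator[OF assms(3)]) (use assms in "simp add: integrable_restrict_space")
 moreover have "(%x. indicator K x *R (indicator S x *R f x)) = (%x. indicator K x *R f x)"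
  using assms(2) by (auto simp: fun_eq_iff indicator_def)
 ultimately show ?thesis using assms by (simp add: integrable_restrict_space)
qed

lemma sq_int_subset:
 fixes f :: "real^3 => 'b::euclidean_space"
 assumes "f : sq_int (lebesgue_on S)" "K <= S" "K : sets lebesgue" "S : sets lebesgue"
 shows "f : sq_int (lebesgue_on K)"
proof (rule sq_intI)
 show "f : bm (lebesgue_on K)" using sq_intD[OF assms(1)] assms(2,3) by (metis measurable_restrict_mono)
 show "integrable (lebesgue_on K) (%x. (norm (f x))^2)"
  by (rule integrable_lebesgue_on_subset[OF sq_int_norm[OF assms(1)] assms(2-4)])
qed

lemma loc_int_sq:
 fixes f :: "real^3 => 'b::euclidean_space"
 assumes "!!K. compact K ==> K <= E ==> f : sq_int (lebesgue_on K)"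
 shows "loc_int E f"
 unfolding loc_int_def
 using assms by (auto intro!: sq_int_integrable finite_measure_lebesgue_on compact_lebesgue compact_imp_bounded)

lemma loc_int_cong_AE:
 fixes f g :: "real^3 => 'b::euclidean_space"
 assumes S: "E : sets lebesgue" and f: "loc_int E f" and eq: "AE x in lebesgue_on E. f x = g x"
 shows "loc_int E g"
 unfolding loc_int_def
proof (intro allI impI)
 fix K assume K: "compact K & K <= E"
 hence Ks: "K : sets lebesgue" and i: "integrable (lebesgue_on K) f" using f compact_lebesgue by (auto simp: loc_int_def)
 have e: "AE x in lebesgue_on K. f x = g x"
  using eq K unfolding AE_lebesgue_on[OF S] AE_lebesgue_on[OF Ks] by eventually_elim (use K in blast)
 have "g : bm (lebesgue_on K)"
  by (rule lebesgue_on_measurable_AE[OF Ks borel_measurable_integrable[OF i] e])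
 thus "integrable (lebesgue_on K) g" using i e by (subst integrable_cong_AE[of _ _ f]) (auto elim!: eventually_mono)
qed

lemma tf_integral_cong_AE:
 fixes f g :: "real^3 => real"
 assumes S: "E : sets lebesgue" and f: "loc_int E f" and eq: "AE x in lebesgue_on E. f x = g x" and p: "p : test_functions E"
 shows "(LINT x|lebesgue. f x * p x) = (LINT x|lebesgue. g x * p x)"
proof (rule integral_cong_AE)
 show "(%x. f x * p x) : bm lebesgue"
  using borel_measurable_integrable[OF loc_int_tf[OF f p]] by (simp add: mult.commute)
 show "(%x. g x * p x) : bm lebesgue"
  using borel_measurable_integrable[OF loc_int_tf[OF loc_int_cong_AE[OF S f eq] p]] by (simp add: mult.commute)
 show "AE x in lebesgue. f x * p x = g x * p x"
  using eq unfolding AE_lebesgue_on[OF S] by eventually_elim (use tf_outside[OF p] in auto)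
qed

lemma weak_hgrad_cong_AE:
 assumes E: "open E" and w: "weak_hgrad E f G"
  and f: "AE x in lebesgue_on E. f x = f' x" and G: "AE x in lebesgue_on E. G x = G' x"
 shows "weak_hgrad E f' G'"
proof (rule weak_hgradI[OF E])
 have S: "E : sets lebesgue" using E by simp
 note d = weak_hgradD[OF w E]
 show "loc_int E f'" "loc_int E G'" using loc_int_cong_AE[OF S d(1) f] loc_int_cong_AE[OF S d(2) G] by auto
 fix p i assume p: "p : test_functions E"
 have "AE x in lebesgue_on E. G x $ i = G' x $ i" using G by eventually_elim simp
 thus "(LINT x|lebesgue. f' x * hX i p x) = - (LINT x|lebesgue. G' x $ i * p x)"
  using tf_integral_cong_AE[OF S d(1) f tf_hX[OF p, of i]] tf_integral_cong_AE[OF S loc_int_component[OF d(2)] _ p, of i "%x. G' x $ i"] d(3)[OF p, of i]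
  by simp
qed

lemma weak_hgrad_unique:
 assumes E: "open E" and w: "weak_hgrad E f G" "weak_hgrad E f G'"
 shows "AE x in lebesgue_on E. G x = G' x"
proof -
 note d = weak_hgradD[OF w(1) E] and d' = weak_hgradD[OF w(2) E]
 have "AE x in lebesgue_on E. G x $ i + (-1) *R G' x $ i = 0" for i
 proof (rule fundamental_lemma[OF E])
  have li: "loc_int E (%x. G x $ i)" "loc_int E (%x. G' x $ i)" using d d' by (auto intro: loc_int_component)
  thus "loc_int E (%x. G x $ i + (-1) *R G' x $ i)" by (intro loc_int_add loc_int_scale)
  fix p assume p: "p : test_functions E"
  have "integrable lebesgue (%x. G x $ i * p x)" "integrable lebesgue (%x. G' x $ i * p x)"
   using loc_int_tf[OF li(1) p] loc_int_tf[OF li(2) p] by (auto simp: mult.commute)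
  hence "(LINT x|lebesgue. (G x $ i + (-1) *R G' x $ i) * p x) = (LINT x|lebesgue. G x $ i * p x) - (LINT x|lebesgue. G' x $ i * p x)"
   by (simp add: algebra_simps)
  also have "... = 0" using d(3)[OF p, of i] d'(3)[OF p, of i] by simp
  finally show "(LINT x|lebesgue. (G x $ i + (-1) *R G' x $ i) * p x) = 0" .
 qed
 hence "AE x in lebesgue_on E. \<forall>i. G x $ i = G' x $ i" by (simp add: AE_all_countable)
 thus ?thesis by eventually_elim (simp add: vec_eq_iff)
qed

lemma weak_hgrad_add:
 assumes E: "open E" and w: "weak_hgrad E f F" "weak_hgrad E g G"
 shows "weak_hgrad E (%x. f x + g x) (%x. F x + G x)"
proof (rule weak_hgradI[OF E])
 note d = weak_hgradD[OF w(1) E] and d' = weak_hgradD[OF w(2) E]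
 show "loc_int E (%x. f x + g x)" "loc_int E (%x. F x + G x)" using d d' by (auto intro: loc_int_add)
 fix p i assume p: "p : test_functions E"
 have "integrable lebesgue (%x. F x $ i * p x)" "integrable lebesgue (%x. G x $ i * p x)"
   "integrable lebesgue (%x. f x * hX i p x)" "integrable lebesgue (%x. g x * hX i p x)"
  using loc_int_tf[OF loc_int_component[OF d(2), of i] p] loc_int_tf[OF loc_int_component[OF d'(2), of i] p]
   loc_int_tf[OF d(1) tf_hX[OF p, of i]] loc_int_tf[OF d'(1) tf_hX[OF p, of i]] by (auto simp: mult.commute)
 thus "(LINT x|lebesgue. (f x + g x) * hX i p x) = - (LINT x|lebesgue. (F x + G x) $ i * p x)"
  using d(3)[OF p, of i] d'(3)[OF p, of i] by (simp add: algebra_simps)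
qed

lemma weak_hgrad_scale:
 assumes E: "open E" and w: "weak_hgrad E f F"
 shows "weak_hgrad E (%x. c * f x) (%x. c *R F x)"
proof (rule weak_hgradI[OF E])
 note d = weak_hgradD[OF w E]
 show "loc_int E (%x. c * f x)" "loc_int E (%x. c *R F x)" using loc_int_scale[OF d(1), of c] loc_int_scale[OF d(2)] by auto
 fix p i assume p: "p : test_functions E"
 show "(LINT x|lebesgue. c * f x * hX i p x) = - (LINT x|lebesgue. (c *R F x) $ i * p x)"
  using d(3)[OF p, of i] by (simp add: mult.assoc)
qed

lemma weak_hgrad_subset:
 assumes "weak_hgrad UNIV f G" "open E" shows "weak_hgrad E f G"
 using weak_hgradD[OF assms(1) open_UNIV] assms(2)
 by (intro weak_hgradI) (auto intro: loc_int_subset tf_mono)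

definition hgv :: "(real^3 => real) => real^3 => real^2" where
 "hgv \<theta> x = (\<chi> i. hX i \<theta> x)"

lemma hgv_nth [simp]: "hgv t x $ i = hX i t x" by (simp add: hgv_def)

lemma loc_int_hgv_mult:
 assumes f: "loc_int E f" and t: "t : test_functions E"
 shows "integrable lebesgue (%x. f x *R hgv t x)"
proof -
 have "(%x. f x *R hgv t x) = (%x. (hX 1 t x *R f x) *R axis 1 1 + (hX 2 t x *R f x) *R axis 2 1)"
  by (simp add: fun_eq_iff vec_eq_iff forall_2 axis_def)
 thus ?thesis by (simp only:)
  (intro Bochner_Integration.integrable_add integrable_scaleR_left impI loc_int_tf[OF f tf_hX[OF t]])
qed

lemma integrable_imp_loc_int: "integrable lebesgue f ==> loc_int E f" for f :: "real^3 => 'b::euclidean_space"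
 unfolding loc_int_def
 using integrable_lebesgue_on_subset[of UNIV f] by (auto simp: lebesgue_on_UNIV_eq compact_lebesgue)

text \<open>The product with a test function extends by zero to the whole group. The conclusion is
  stated there because translations and dilations act on the group and not on
  \<open>E\<close>.\<close>

lemma weak_hgrad_mult:
 assumes E: "open E" and w: "weak_hgrad E u G" and t: "t : test_functions E"
 shows "weak_hgrad UNIV (%x. t x * u x) (%x. t x *R G x + u x *R hgv t x)"
proof (rule weak_hgradI[OF open_UNIV])
 note d = weak_hgradD[OF w E]
 show "loc_int UNIV (%x. t x * u x)"
  using integrable_imp_loc_int[OF loc_int_tf[OF d(1) t]] by simp
 show "loc_int UNIV (%x. t x *R G x + u x *R hgv t x)"
  by (rule loc_int_add[OF integrable_imp_loc_int[OF loc_int_tf[OF d(2) t]] integrable_imp_loc_int[OF loc_int_hgv_mult[OF d(1) t]]])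
 fix p i assume p: "p : test_functions UNIV"
 note sm = tfD(1)[OF t] tfD(1)[OF p]
 have t1: "(%x. p x * t x) : test_functions E" by (rule tf_mult[OF t sm(2)])
 have t2: "(%x. p x * hX i t x) : test_functions E" by (rule tf_mult[OF tf_hX[OF t] sm(2)])
 have i1: "integrable lebesgue (%x. u x * hX i (%x. p x * t x) x)"
  using loc_int_tf[OF d(1) tf_hX[OF t1, of i]] by (simp add: mult.commute)
 have i2: "integrable lebesgue (%x. u x * (p x * hX i t x))"
  using loc_int_tf[OF d(1) t2] by (simp add: mult.commute)
 have i3: "integrable lebesgue (%x. G x $ i * (p x * t x))"
  using loc_int_tf[OF loc_int_component[OF d(2)] t1] by (simp add: mult.commute)
 have "(LINT x|lebesgue. t x * u x * hX i p x) = (LINT x|lebesgue. u x * hX i (%x. p x * t x) x - u x * (p x * hX i t x))"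
  by (intro Bochner_Integration.integral_cong refl) (simp add: hX_mult[OF sm(2,1)] algebra_simps)
 also have "... = - (LINT x|lebesgue. G x $ i * (p x * t x)) - (LINT x|lebesgue. u x * (p x * hX i t x))"
  using i1 i2 d(3)[OF t1, of i] by simp
 also have "... = - (LINT x|lebesgue. G x $ i * (p x * t x) + u x * (p x * hX i t x))"
  using i2 i3 by simp
 also have "... = - (LINT x|lebesgue. (t x *R G x + u x *R hgv t x) $ i * p x)"
  by (simp add: algebra_simps)
 finally show "(LINT x|lebesgue. t x * u x * hX i p x) = - (LINT x|lebesgue. (t x *R G x + u x *R hgv t x) $ i * p x)" .
qed

lemma loc_int_volmap:
 fixes f :: "real^3 => 'b::euclidean_space"
 assumes V: "volmap c T" and f: "loc_int UNIV f" shows "loc_int UNIV (%x. f (T x))"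
 unfolding loc_int_def
proof (intro allI impI)
 fix K :: "(real^3) set" assume K: "compact K & K <= UNIV"
 have TK: "compact (T ` K)" using K V by (intro compact_continuous_image) (auto simp: volmap_def intro: continuous_on_subset)
 hence "integrable lebesgue (%x. indicator (T ` K) x *R f x)"
  using f compact_lebesgue[OF TK] by (simp add: loc_int_def integrable_restrict_space[symmetric])
 from volmap_integrable[OF V this]
 have "integrable lebesgue (%x. indicator K x *R (indicator (T ` K) (T x) *R f (T x)))"
  using K compact_lebesgue by (intro integrable_mult_indicator) auto
 moreover have "(%x. indicator K x *R (indicator (T ` K) (T x) *R f (T x))) = (%x. indicator K x *R f (T x))"
  by (auto simp: fun_eq_iff indicator_def)
 ultimately show "integrable (lebesgue_on K) (%x. f (T x))" using K compact_lebesgue[of K] by (simp add: integrable_restrict_space)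
qed

lemma tf_volmap_integral:
 fixes f :: "real^3 => real"
 assumes V: "volmap c T" and TS: "!!x. T (S x) = x" "!!x. S (T x) = x"
  and f: "loc_int UNIV f" and p: "(%x. p (S x)) : test_functions UNIV"
 shows "(LINT x|lebesgue. f (T x) * p x) = c * (LINT x|lebesgue. f x * p (S x))"
proof -
 have "(%x. f x * p (S x)) : bm lebesgue"
  using borel_measurable_integrable[OF loc_int_tf[OF f p]] by (simp add: mult.commute)
 from volmap_integral[OF V this] show ?thesis by (simp add: TS)
qed

lemma weak_hgrad_left:
 assumes w: "weak_hgrad UNIV f G" shows "weak_hgrad UNIV (%x. f (p \<odot> x)) (%x. G (p \<odot> x))"
proof (rule weak_hgradI[OF open_UNIV])
 note d = weak_hgradD[OF w open_UNIV]
 show "loc_int UNIV (%x. f (p \<odot> x))" "loc_int UNIV (%x. G (p \<odot> x))" using d by (auto intro: loc_int_volmap[OF volmap_left])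
 fix h i assume h: "h : test_functions UNIV"
 have e: "hX i h ((-p) \<odot> x) = hX i (%x. h ((-p) \<odot> x)) x" for x by (simp add: hX_left tfD(1)[OF h])
 have "(LINT x|lebesgue. f (p \<odot> x) * hX i h x) = 1 * (LINT x|lebesgue. f x * hX i h ((-p) \<odot> x))"
  by (intro tf_volmap_integral volmap_left d tf_left tf_hX h) simp_all
 also have "... = - (1 * (LINT x|lebesgue. G x $ i * h ((-p) \<odot> x)))"
  unfolding e using d(3)[OF tf_left[OF h, of "-p"], of i] by simp
 also have "1 * (LINT x|lebesgue. G x $ i * h ((-p) \<odot> x)) = (LINT x|lebesgue. G (p \<odot> x) $ i * h x)"
  by (intro tf_volmap_integral[symmetric] volmap_left loc_int_component d tf_left h) simp_all
 finally show "(LINT x|lebesgue. f (p \<odot> x) * hX i h x) = - (LINT x|lebesgue. G (p \<odot> x) $ i * h x)" .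
qed

lemma weak_hgrad_dil:
 assumes w: "weak_hgrad UNIV f G" and l: "l > 0"
 shows "weak_hgrad UNIV (%x. f (dil l x)) (%x. l *R G (dil l x))"
proof (rule weak_hgradI[OF open_UNIV])
 note d = weak_hgradD[OF w open_UNIV]
 show "loc_int UNIV (%x. f (dil l x))" "loc_int UNIV (%x. l *R G (dil l x))"
  using d l by (auto intro!: loc_int_scale loc_int_volmap[OF volmap_dil])
 fix p i assume p: "p : test_functions UNIV"
 have l': "1/l > 0" "l ~= 0" using l by auto
 have e: "hX i p (dil (1/l) x) = l * hX i (%x. p (dil (1/l) x)) x" for x using l by (simp add: hX_dil tfD(1)[OF p])
 have "(LINT x|lebesgue. f (dil l x) * hX i p x) = 1/l^4 * (LINT x|lebesgue. f x * hX i p (dil (1/l) x))"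
  using l' by (intro tf_volmap_integral volmap_dil l d tf_dil tf_hX p) auto
 also have "(LINT x|lebesgue. f x * hX i p (dil (1/l) x)) = l * (LINT x|lebesgue. f x * hX i (%x. p (dil (1/l) x)) x)"
  unfolding e by (simp add: mult.left_commute)
 also have "... = l * - (LINT x|lebesgue. G x $ i * p (dil (1/l) x))"
  using d(3)[OF tf_dil[OF l'(1) p], of i] by simp
 also have "1/l^4 * (l * - (LINT x|lebesgue. G x $ i * p (dil (1/l) x))) = - (l * (1/l^4 * (LINT x|lebesgue. G x $ i * p (dil (1/l) x))))"
  by simp
 also have "1/l^4 * (LINT x|lebesgue. G x $ i * p (dil (1/l) x)) = (LINT x|lebesgue. G (dil l x) $ i * p x)"
  using l' by (intro tf_volmap_integral[symmetric] volmap_dil l loc_int_component d tf_dil p) auto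
 finally show "(LINT x|lebesgue. f (dil l x) * hX i p x) = - (LINT x|lebesgue. (l *R G (dil l x)) $ i * p x)"
  by (simp add: mult.assoc)
qed

section \<open>Translations along the horizontal fields\<close>

lemma at_0_seqI:
 fixes f :: "real => 'b::topological_space"
 assumes "!!X. (!!i::nat. X i ~= 0 & \<bar>X i\<bar> <= 1) ==> X ----> 0 ==> (%i. f (X i)) ----> l"
 shows "(f \<longlongrightarrow> l) (at 0)"
proof (subst tendsto_at_iff_sequentially, intro allI impI)
 fix X :: "nat => real" assume X: "\<forall>i. X i : UNIV - {0}" and lim: "X ----> 0"
 have "(%i. \<bar>X i\<bar>) ----> 0" using lim by (simp add: tendsto_rabs_zero)
 hence "\<forall>\<^sub>F i in sequentially. \<bar>X i\<bar> < 1" by (intro order_tendstoD) auto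
 then obtain N where N: "!!i. i >= N ==> \<bar>X i\<bar> < 1" by (auto simp: eventually_sequentially)
 have "(%i. f (X (i + N))) ----> l"
 proof (rule assms)
  show "X (i + N) ~= 0 & \<bar>X (i + N)\<bar> <= 1" for i using X N[of "i + N"] by (auto intro: less_imp_le)
  show "(%i. X (i + N)) ----> 0" using lim by (rule LIMSEQ_ignore_initial_segment)
 qed
 thus "(f \<circ> X) ----> l" by (simp add: o_def LIMSEQ_offset)
qed

text \<open>The translation sits on the smooth factor, so differentiating under the integral only
  asks that \<open>f\<close> be locally integrable.\<close>

lemma translate_deriv:
 fixes f :: "real^3 => real"
 assumes f: "loc_int UNIV f" and r: "r : test_functions UNIV"
 shows "((%t. LINT x|lebesgue. f x * r (x \<odot> (t *R he i))) has_real_derivative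
   (LINT x|lebesgue. f x * hX i r (x \<odot> (t *R he i)))) (at t)"
 unfolding DERIV_def
proof (rule at_0_seqI)
 fix X :: "nat => real" assume X: "!!n. X n ~= 0 & \<bar>X n\<bar> <= 1" and X0: "X ----> 0"
 let ?g = "%t. LINT x|lebesgue. f x * r (x \<odot> (t *R he i))"
 note sm = tfD(1)[OF r]
 obtain K where K: "compact K" "!!x. x ~: K ==> r x = 0" using tf_ex[OF r] by blast
 obtain C where C: "!!x. \<bar>hX i r x\<bar> <= C" using tf_bounded[OF tf_hX[OF r]] by blast
 \<comment> \<open>Compact, and contains the supports of all translates of \<open>r\<close> by steps
   of modulus at most \<open>\<bar>t\<bar> + 1\<close>.\<close>
 define K' where "K' = (%(x, s). x \<odot> (- (s *R he i))) ` (K \<times> {-\<bar>t\<bar> - 1..\<bar>t\<bar> + 1})"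
 have K': "compact K'" unfolding K'_def
  by (intro compact_continuous_image compact_Times K compact_Icc) (auto simp: case_prod_beta intro!: continuous_intros)
 have outK: "r (x \<odot> (s *R he i)) = 0" if "x ~: K'" "\<bar>s\<bar> <= \<bar>t\<bar> + 1" for x s
 proof (rule K(2), rule notI)
  assume "x \<odot> (s *R he i) : K"
  hence "x : K'" unfolding K'_def using that(2)
   by (intro image_eqI[of _ _ "(x \<odot> (s *R he i), s)"]) (auto simp: abs_le_iff)
  with that show False by simp
 qed
 have ti: "integrable lebesgue (%x. f x * r (x \<odot> p))" for p
  using loc_int_tf[OF f tf_right[OF r, of p]] by (simp add: mult.commute)
 have dq: "(?g (t + X n) - ?g t) / X n = (LINT x|lebesgue. f x * ((r (x \<odot> ((t + X n) *R he i)) - r (x \<odot> (t *R he i))) / X n))" for n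
 proof -
  have "(LINT x|lebesgue. f x * ((r (x \<odot> ((t + X n) *R he i)) - r (x \<odot> (t *R he i))) / X n))
    = (LINT x|lebesgue. (f x * r (x \<odot> ((t + X n) *R he i)) - f x * r (x \<odot> (t *R he i))) / X n)"
   by (simp add: algebra_simps)
  also have "... = (?g (t + X n) - ?g t) / X n"
   using Bochner_Integration.integral_diff[OF ti ti] by simp
  finally show ?thesis by (rule sym)
 qed
 have der: "((%s. r (x \<odot> (s *R he i))) has_real_derivative hX i r (x \<odot> (s *R he i))) (at s)" for x s
  by (rule hX_deriv[OF smooth_differentiable[OF sm]])
 show "(%n. (?g (t + X n) - ?g t) / X n) ----> (LINT x|lebesgue. f x * hX i r (x \<odot> (t *R he i)))"
  unfolding dq
 proof (rule integral_dominated_convergence[where w = "%x. \<bar>indicator K' x *R f x\<bar> * C"])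
  have "integrable (lebesgue_on K') f" using f K' by (simp add: loc_int_def)
  hence "integrable lebesgue (%x. indicator K' x *R f x)"
   using compact_lebesgue[OF K'] by (simp add: integrable_restrict_space)
  thus "integrable lebesgue (%x. \<bar>indicator K' x *R f x\<bar> * C)" by (intro integrable_mult_left integrable_abs) simp
  have "integrable lebesgue (%x. f x * hX i r (x \<odot> (t *R he i)))"
   using loc_int_tf[OF f tf_right[OF tf_hX[OF r]]] by (simp add: mult.commute)
  thus "(%x. f x * hX i r (x \<odot> (t *R he i))) : bm lebesgue" by simp
  have "integrable lebesgue (%x. (f x * r (x \<odot> ((t + X n) *R he i)) - f x * r (x \<odot> (t *R he i))) / X n)" for n
   using ti by simp
  hence "(%x. (f x * r (x \<odot> ((t + X n) *R he i)) - f x * r (x \<odot> (t *R he i))) / X n) : bm lebesgue" for n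
   by blast
  thus "(%x. f x * ((r (x \<odot> ((t + X n) *R he i)) - r (x \<odot> (t *R he i))) / X n)) : bm lebesgue" for n
   by (simp add: algebra_simps)
  show "AE x in lebesgue. (%n. f x * ((r (x \<odot> ((t + X n) *R he i)) - r (x \<odot> (t *R he i))) / X n)) ----> f x * hX i r (x \<odot> (t *R he i))"
  proof (rule AE_I2)
   fix x
   have "((%h. (r (x \<odot> ((t + h) *R he i)) - r (x \<odot> (t *R he i))) / h) \<longlongrightarrow> hX i r (x \<odot> (t *R he i))) (at 0)"
    using der[of x t] by (simp add: DERIV_def)
   hence "((%h. (r (x \<odot> ((t + h) *R he i)) - r (x \<odot> (t *R he i))) / h) \<circ> X) ----> hX i r (x \<odot> (t *R he i))"
    using X X0 by (subst (asm) tendsto_at_iff_sequentially) auto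
   thus "(%n. f x * ((r (x \<odot> ((t + X n) *R he i)) - r (x \<odot> (t *R he i))) / X n)) ----> f x * hX i r (x \<odot> (t *R he i))"
    by (intro tendsto_mult_left) (simp add: o_def)
  qed
  show "AE x in lebesgue. norm (f x * ((r (x \<odot> ((t + X n) *R he i)) - r (x \<odot> (t *R he i))) / X n)) <= \<bar>indicator K' x *R f x\<bar> * C" for n
  proof (rule AE_I2)
   fix x
   show "norm (f x * ((r (x \<odot> ((t + X n) *R he i)) - r (x \<odot> (t *R he i))) / X n)) <= \<bar>indicator K' x *R f x\<bar> * C"
   proof (cases "x : K'")
    case True
    have "norm (r (x \<odot> ((t + X n) *R he i)) - r (x \<odot> (t *R he i))) <= C * norm ((t + X n) - t)"
    proof (rule field_differentiable_bound[OF convex_UNIV])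
     show "((%s. r (x \<odot> (s *R he i))) has_real_derivative hX i r (x \<odot> (z *R he i))) (at z within UNIV)" for z
      using der by simp
    qed (use C in auto)
    hence "\<bar>(r (x \<odot> ((t + X n) *R he i)) - r (x \<odot> (t *R he i))) / X n\<bar> <= C"
     using X[of n] by (simp add: abs_divide field_simps)
    hence "\<bar>f x\<bar> * \<bar>(r (x \<odot> ((t + X n) *R he i)) - r (x \<odot> (t *R he i))) / X n\<bar> <= \<bar>f x\<bar> * C"
     by (intro mult_left_mono) auto
    thus ?thesis using True by (simp add: abs_mult)
   next
    case False
    have "\<bar>t + X n\<bar> <= \<bar>t\<bar> + 1" "\<bar>t\<bar> <= \<bar>t\<bar> + 1" using X[of n] by linarith+
    moreover have "0 <= C" using C[of x] abs_ge_zero order_trans by blast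
    ultimately show ?thesis using outK[OF False] by simp
   qed
  qed
 qed
qed

lemma tf_right_integral:
 fixes f :: "real^3 => real"
 assumes f: "loc_int UNIV f" and h: "h : test_functions UNIV"
 shows "(LINT x|lebesgue. f (x \<odot> p) * h x) = (LINT x|lebesgue. f x * h (x \<odot> (-p)))"
 using tf_volmap_integral[OF volmap_right[of p], of "%x. x \<odot> (-p)" f h] f tf_right[OF h] by simp

text \<open>The integral of \<open>c * p\<close> is invariant under right translations; its
  derivative along the flow of a field, which is the integral of \<open>c * hX i p\<close>,
  vanishes.\<close>

lemma weak_hgrad_const: "weak_hgrad UNIV (%_. c) (%_. 0)"
proof (rule weak_hgradI[OF open_UNIV])
 have l: "loc_int UNIV (%_. d)" for d :: "'b::euclidean_space"
  unfolding loc_int_def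
  by (auto intro!: finite_measure.integrable_const finite_measure_lebesgue_on compact_lebesgue compact_imp_bounded)
 show "loc_int UNIV (%_. c)" "loc_int UNIV (%_. 0 :: real^2)" by (rule l)+
 fix p i assume p: "p : test_functions UNIV"
 have "(%t. LINT x|lebesgue. c * p (x \<odot> (t *R he i))) = (%t. LINT x|lebesgue. c * p x)"
 proof
  fix t
  have "(LINT x|lebesgue. c * p x) = (LINT x|lebesgue. c * p (x \<odot> (- ((- t) *R he i))))"
   by (rule tf_right_integral[OF l p, of c "(- t) *R he i"])
  hence "(LINT x|lebesgue. c * p x) = (LINT x|lebesgue. c * p (x \<odot> (t *R he i)))"
   by (simp only: scaleR_minus_left minus_minus)
  thus "(LINT x|lebesgue. c * p (x \<odot> (t *R he i))) = (LINT x|lebesgue. c * p x)" by (rule sym)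
 qed
 hence "((%t. LINT x|lebesgue. c * p (x \<odot> (t *R he i))) has_real_derivative 0) (at 0)" by simp
 from DERIV_unique[OF translate_deriv[OF l[of c] p, of i 0] this]
 have "(LINT x|lebesgue. c * hX i p x) = 0" by simp
 thus "(LINT x|lebesgue. c * hX i p x) = - (LINT x|lebesgue. (0::real^2) $ i * p x)" by simp
qed

section \<open>The Poincare inequality for periodic functions\<close>

text \<open>Replacing one factor \<open>D\<close> in its squared norm by a test function within
  \<open>e\<close> changes the integral by at most \<open>e\<close> times the norm of
  \<open>D\<close>; the hypothesis bounds the rest, and \<open>e\<close> is arbitrary.\<close>

lemma sq_norm_dual:
 fixes D :: "real^3 => real"
 assumes E: "open E" "bounded E" and D: "D : sq_int (lebesgue_on E)" and B: "0 <= B"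
  and bd: "!!h. h : test_functions E ==> h : sq_int (lebesgue_on E) ==>
    (LINT x|lebesgue_on E. D x * h x) <= B * sq_norm (lebesgue_on E) h"
 shows "sq_norm (lebesgue_on E) D <= B"
proof -
 let ?L = "lebesgue_on E" and ?d = "sq_norm (lebesgue_on E) D"
 have "?d^2 <= B * ?d + e * (?d + B)" if e: "e > 0" for e
 proof -
  obtain s where t: "s : test_functions E" "s : sq_int ?L" "sq_norm ?L (%x. D x - s x) < e"
   using test_function_dense[OF E D e] by blast
  have nt: "sq_norm ?L s <= e + ?d"
   using sq_norm_triangle_le[OF t(2) D] t(3) sq_norm_commute[of ?L D s] by linarith
  have "?d^2 = (LINT x|?L. D x * D x)" unfolding sq_norm_sq by (simp add: power2_eq_square)
  also have "... = (LINT x|?L. D x * (D x - s x) + D x * s x)" by (simp add: algebra_simps)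
  also have "... = (LINT x|?L. D x * (D x - s x)) + (LINT x|?L. D x * s x)"
   by (intro Bochner_Integration.integral_add sq_int_mult sq_int_diff D t)
  also have "... <= ?d * e + B * (e + ?d)"
  proof (rule add_mono)
   have "(LINT x|?L. D x * (D x - s x)) <= ?d * sq_norm ?L (%x. D x - s x)"
    using sq_inner_CS[OF D sq_int_diff[OF D t(2)]] by simp
   also have "... <= ?d * e" using t(3) by (intro mult_left_mono) auto
   finally show "(LINT x|?L. D x * (D x - s x)) <= ?d * e" .
   show "(LINT x|?L. D x * s x) <= B * (e + ?d)"
    using bd[OF t(1,2)] mult_left_mono[OF nt B] by linarith
  qed
  finally show ?thesis by (simp add: algebra_simps)
 qed
 note * = this
 have "?d^2 <= B * ?d"
 proof (rule field_le_epsilon)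
  fix r :: real assume r: "r > 0"
  have p: "?d + B + 1 > 0" using B sq_norm_nonneg[of ?L D] by linarith
  have "?d^2 <= B * ?d + r / (?d + B + 1) * (?d + B)" using r p by (intro *) simp
  also have "r / (?d + B + 1) * (?d + B) <= r" using r p by (simp add: field_simps)
  finally show "?d^2 <= B * ?d + r" by simp
 qed
 thus ?thesis
 proof (cases "?d = 0")
  case True thus ?thesis using B by simp
 next
  case False
  hence "?d > 0" using sq_norm_nonneg[of ?L D] by linarith
  thus ?thesis using \<open>?d^2 <= B * ?d\<close> by (simp add: power2_eq_square)
 qed
qed

text \<open>The interior of the cell: duality with test functions needs an open set, and the
  difference from the cell is null.\<close>

definition Ybox :: "(real^3) set" where "Ybox = box 0 (vec 2)"

lemma Ybox: "open Ybox" "bounded Ybox" "Ybox <= Ycell" "Ybox : sets lebesgue"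
 by (auto simp: Ybox_def Ycell_def mem_box_cart open_box bounded_box less_imp_le)

lemma AE_Ybox: "AE x in lebesgue. x : Ycell \<longleftrightarrow> x : Ybox"
proof -
 have "negligible (cbox 0 (vec 2 :: real^3) - box 0 (vec 2))" by (rule negligible_frontier_interval)
 hence "AE x in lebesgue. x ~: cbox 0 (vec 2 :: real^3) - box 0 (vec 2)"
  by (intro AE_not_in) (simp add: negligible_iff_null_sets)
 thus ?thesis by eventually_elim (use Ycell_subset Ybox in "auto simp: Ybox_def")
qed

lemma LINT_Ybox:
 fixes f :: "real^3 => real"
 assumes "f : bm LY"
 shows "(LINT x|lebesgue_on Ybox. f x) = (LINT x|LY. f x)"
proof -
 have m: "(%x. indicator Ycell x *R f x) : bm lebesgue"
  using assms by (subst borel_measurable_restrict_space_iff[symmetric]) auto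
 have e: "AE x in lebesgue. indicator Ycell x *R f x = indicator Ybox x *R f x"
  using AE_Ybox by eventually_elim (auto simp: indicator_def)
 have m2: "(%x. indicator Ybox x *R f x) : bm lebesgue" by (rule lebesgue_measurable_AE[OF m e])
 show ?thesis using integral_cong_AE[OF m m2 e] Ybox(4) by (simp add: integral_restrict_space)
qed

lemma sq_norm_Ybox:
 fixes f :: "real^3 => 'b::euclidean_space"
 assumes "f : sq_int LY"
 shows "sq_norm (lebesgue_on Ybox) f = sq_norm LY f"
 unfolding sq_norm_def using sq_intD[OF assms] by (subst LINT_Ybox) auto

lemma periodic_right: "Y_periodic f ==> Y_periodic (%x. f (x \<odot> g))"
 by (simp add: Y_periodic_def hmul_assoc)

lemma right_translate_sq:
 fixes f :: "real^3 => 'b::euclidean_space"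
 assumes per: "Y_periodic f" and f: "f : sq_int LY"
 shows "(%x. f (x \<odot> g)) : sq_int LY"
  and "sq_norm LY (%x. f (x \<odot> g)) = sq_norm LY f"
proof -
 have fm: "f : bm lebesgue" by (rule periodic_measurable[OF per sq_intD[OF f]])
 have gm: "(%x. f (x \<odot> g)) : bm LY"
  by (intro measurable_restrict_space1 volmap_measurable[OF volmap_right] fm)
 have e: "(\<integral>\<^sup>+x. ennreal ((norm (f (x \<odot> g)))^2) \<partial>LY) = ennreal ((sq_norm LY f)^2)"
 proof -
  have "(\<integral>\<^sup>+x. ennreal ((norm (f (x \<odot> g)))^2) \<partial>LY) = (\<integral>\<^sup>+x. ennreal ((norm (f x))^2) \<partial>LY)"
   using per fm by (intro nn_integral_right_translate[of "%x. ennreal ((norm (f x))^2)"]) (auto simp: Y_periodic_def)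
  thus ?thesis by (simp add: nn_integral_sq_norm[OF f])
 qed
 show s: "(%x. f (x \<odot> g)) : sq_int LY" by (rule sq_norm_le_nn(1)[OF gm]) (use e in auto)
 show "sq_norm LY (%x. f (x \<odot> g)) = sq_norm LY f"
  using e nn_integral_sq_norm[OF s] by (simp add: power2_eq_iff_nonneg)
qed

context
 fixes f :: "real^3 => real" and G :: "real^3 => real^2"
 assumes fper: "Y_periodic f" and f: "f : sq_int LY"
  and Gper: "Y_periodic G" and G: "G : sq_int LY"
  and w: "weak_hgrad UNIV f G"
begin

abbreviation "nY \<equiv> sq_norm LY"

text \<open>By duality it suffices to test with \<open>p\<close>. The pairing \<open>g s\<close> is
  differentiated by moving the translation to \<open>p\<close>, using the weak gradient, and moving
  it back; the derivative pairs a translate of \<open>G\<close> with \<open>p\<close> and is bounded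
  uniformly in \<open>s\<close>, because right translations preserve the norm over the cell. The
  mean value theorem concludes.\<close>

lemma translate_he: "nY (%x. f (x \<odot> (t *R he i)) - f x) <= \<bar>t\<bar> * nY G"
proof -
 note d = weak_hgradD[OF w open_UNIV]
 let ?D = "%x. f (x \<odot> (t *R he i)) - f x"
 have D: "?D : sq_int LY" by (intro sq_int_diff right_translate_sq fper f)
 have Gi: "(%x. G x $ i) : sq_int LY" by (rule sq_int_component[OF G])
 have Giper: "Y_periodic (%x. G x $ i)" using Gper by (simp add: Y_periodic_def)
 have nGi: "nY (%x. G x $ i) <= nY G"
  using sq_norm_mono[OF G sq_intD[OF Gi], of 1] component_le_norm_cart[of "G x" i for x] by simp
 have "sq_norm (lebesgue_on Ybox) ?D <= \<bar>t\<bar> * nY G"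
 proof (rule sq_norm_dual[OF Ybox(1,2)])
  show "?D : sq_int (lebesgue_on Ybox)" by (rule sq_int_subset[OF D Ybox(3,4)]) simp
  fix p assume pB: "p : test_functions Ybox" and ps: "p : sq_int (lebesgue_on Ybox)"
  have p: "p : test_functions UNIV" using tf_mono[OF pB] by simp
  note sm = tfD(1)[OF p]
  define g where "g s = (LINT x|lebesgue. f (x \<odot> (s *R he i)) * p x)" for s
  have ge: "g s = (LINT x|lebesgue. f x * p (x \<odot> ((- s) *R he i)))" for s
   unfolding g_def using tf_right_integral[OF d(1) p, of "s *R he i"] by simp
  have gd: "(g has_real_derivative (LINT x|lebesgue. G (x \<odot> (s *R he i)) $ i * p x)) (at s)" for s
  proof -
   have "((%t. LINT x|lebesgue. f x * p (x \<odot> (t *R he i))) has_real_derivative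
     (LINT x|lebesgue. f x * hX i p (x \<odot> ((- s) *R he i)))) (at (- s))"
    by (rule translate_deriv[OF d(1) p])
   from DERIV_chain2[where f = "%t. LINT x|lebesgue. f x * p (x \<odot> (t *R he i))" and g = uminus and Db = "-1" and x = s and s = UNIV, OF this]
   have "(g has_real_derivative - (LINT x|lebesgue. f x * hX i p (x \<odot> ((- s) *R he i)))) (at s)"
    unfolding ge[abs_def] using DERIV_minus[OF DERIV_ident, of s UNIV] by simp
   moreover have "(LINT x|lebesgue. f x * hX i p (x \<odot> ((- s) *R he i))) = (LINT x|lebesgue. f x * hX i (%x. p (x \<odot> ((- s) *R he i))) x)"
    by (simp only: hX_right[OF sm])
   moreover have "... = - (LINT x|lebesgue. G x $ i * p (x \<odot> ((- s) *R he i)))"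
    by (rule d(3)[OF tf_right[OF p]])
   moreover have "(LINT x|lebesgue. G x $ i * p (x \<odot> ((- s) *R he i))) = (LINT x|lebesgue. G (x \<odot> (s *R he i)) $ i * p x)"
    using tf_right_integral[OF loc_int_component[OF d(2), of i] p, of "s *R he i"] by simp
   ultimately show ?thesis by simp
  qed
  have bound: "norm (LINT x|lebesgue. G (x \<odot> (s *R he i)) $ i * p x) <= nY G * sq_norm (lebesgue_on Ybox) p" for s
  proof -
   have Gs: "(%x. G (x \<odot> (s *R he i)) $ i) : sq_int LY" by (rule right_translate_sq(1)[OF Giper Gi])
   hence Gs': "(%x. G (x \<odot> (s *R he i)) $ i) : sq_int (lebesgue_on Ybox)" by (rule sq_int_subset[OF _ Ybox(3,4)]) simp
   have "(LINT x|lebesgue. G (x \<odot> (s *R he i)) $ i * p x) = (LINT x|lebesgue_on Ybox. G (x \<odot> (s *R he i)) $ i * p x)"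
    using tf_outside[OF pB] by (intro LINT_outside(1)[OF Ybox(4), symmetric]) auto
   also have "norm ... <= sq_norm (lebesgue_on Ybox) (%x. G (x \<odot> (s *R he i)) $ i) * sq_norm (lebesgue_on Ybox) p"
    using sq_inner_CS[OF Gs' ps] by simp
   also have "... <= nY G * sq_norm (lebesgue_on Ybox) p"
    using nGi by (intro mult_right_mono) (simp_all add: sq_norm_Ybox[OF Gs] right_translate_sq(2)[OF Giper Gi])
   finally show ?thesis .
  qed
  have "norm (g t - g 0) <= (nY G * sq_norm (lebesgue_on Ybox) p) * norm (t - 0)"
   by (rule field_differentiable_bound[OF convex_UNIV]) (use gd bound in auto)
  moreover have "(LINT x|lebesgue_on Ybox. ?D x * p x) = g t - g 0"
  proof -
   have "(LINT x|lebesgue_on Ybox. ?D x * p x) = (LINT x|lebesgue. ?D x * p x)"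
    using tf_outside[OF pB] by (intro LINT_outside(1)[OF Ybox(4)]) auto
   also have "... = (LINT x|lebesgue. f (x \<odot> (t *R he i)) * p x - f x * p x)" by (simp add: algebra_simps)
   also have "... = g t - g 0"
    using loc_int_tf[OF loc_int_volmap[OF volmap_right d(1)] p, of "t *R he i"] loc_int_tf[OF d(1) p]
    by (simp add: g_def mult.commute)
   finally show ?thesis .
  qed
  ultimately show "(LINT x|lebesgue_on Ybox. ?D x * p x) <= \<bar>t\<bar> * nY G * sq_norm (lebesgue_on Ybox) p"
   by (simp add: abs_le_iff mult_ac)
 qed simp
 thus ?thesis by (simp add: sq_norm_Ybox[OF D])
qed

lemma translate_mult:
 "nY (%x. f (x \<odot> (a \<odot> b)) - f x) <= nY (%x. f (x \<odot> a) - f x) + nY (%x. f (x \<odot> b) - f x)"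
proof -
 have d: "(%x. f (x \<odot> b) - f x) : sq_int LY" for b by (intro sq_int_diff right_translate_sq fper f)
 have p: "Y_periodic (%x. f (x \<odot> b) - f x)" using periodic_right[OF fper] fper by (simp add: Y_periodic_def)
 have "nY (%x. (f ((x \<odot> a) \<odot> b) - f (x \<odot> a)) + (f (x \<odot> a) - f x)) \<le>
   nY (%x. f ((x \<odot> a) \<odot> b) - f (x \<odot> a)) + nY (%x. f (x \<odot> a) - f x)"
  by (intro sq_norm_triangle d right_translate_sq(1)[OF p d])
 also have "nY (%x. f ((x \<odot> a) \<odot> b) - f (x \<odot> a)) = nY (%x. f (x \<odot> b) - f x)"
  by (rule right_translate_sq(2)[OF p d])
 finally show ?thesis by (simp add: hmul_assoc)
qed

text \<open>Every point is a product of six horizontal moves: two reach its first two coordinates and a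
 commutator of length four corrects the third.\<close>

lemma translate_any:
 assumes "\<bar>g$1\<bar> <= 2" "\<bar>g$2\<bar> <= 2" "\<bar>g$3\<bar> <= 18"
 shows "nY (%x. f (x \<odot> g) - f x) <= 19 * nY G"
proof -
 \<comment> \<open>The first two moves leave \<open>- 2 * (g$1 * g$2)\<close> in the third
   coordinate, and the commutator of steps 1 and \<open>c\<close> adds \<open>- 4 * c\<close>. Since
   \<open>c\<close> is at most 26/4 in modulus, the total length is at most 2 + 2 + 2 + 13 =
   19.\<close>
 define c where "c = - (g$3 + 2 * (g$1 * g$2)) / 4"
 have "\<bar>g$1 * g$2\<bar> <= 2 * 2" unfolding abs_mult using assms by (intro mult_mono) auto
 moreover have "\<bar>- (a + 2 * b) / 4\<bar> <= 26/4" if "\<bar>b\<bar> <= 2 * 2" "\<bar>a\<bar> <= 18" for a b :: real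
  using that by (simp add: abs_le_iff)
 ultimately have c: "\<bar>c\<bar> <= 26/4" using assms(3) unfolding c_def by blast
 let ?e = "%t i. t *R he i"
 have h1: "he (1::2) = axis 1 1" and h2: "he (2::2) = axis 2 1" by (simp_all add: he_def)
 have ge: "g = ?e (g$1) 1 \<odot> (?e (g$2) 2 \<odot> (?e 1 1 \<odot> (?e c 2 \<odot> (?e (-1) 1 \<odot> ?e (-c) 2))))"
  unfolding h1 h2 by (simp add: vec3_eq_iff c_def algebra_simps)
 have "nY (%x. f (x \<odot> g) - f x) <= \<bar>g$1\<bar> * nY G + (\<bar>g$2\<bar> * nY G + (\<bar>1\<bar> * nY G + (\<bar>c\<bar> * nY G + (\<bar>-1\<bar> * nY G + \<bar>-c\<bar> * nY G))))"
  by (subst ge) (intro order_trans[OF translate_mult] add_mono translate_he)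
 also have "... = (\<bar>g$1\<bar> + \<bar>g$2\<bar> + 2 + 2 * \<bar>c\<bar>) * nY G" by (simp add: algebra_simps)
 also have "... <= 19 * nY G" using assms c by (intro mult_right_mono) auto
 finally show ?thesis .
qed

text \<open>Averaging over displacements: for \<open>x\<close> and \<open>y\<close> in the cell the
  displacement \<open>(- x) \<odot> y\<close> lies in a fixed box \<open>B\<close>, so the double
  integral of \<open>(f x - f y)^2\<close> is at most the volume 576 of \<open>B\<close> times the
  squared bound of \<open>translate_any\<close>. Some \<open>x0\<close> does no worse than the
  average, and its value is the constant \<open>c\<close>. Here 456 is 19 times the square root of
  576.\<close>

lemma poincare_aux: "\<exists>c. nY (%x. f x - c) <= 456 * nY G"
proof -
 obtain f0 where f0[measurable]: "f0 : bm borel" and eq0: "AE x in LY. f x = f0 x"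
  using borel_representative[OF Ycell_lebesgue sq_intD[OF f]] by blast
 \<comment> \<open>A Borel function that is periodic everywhere, since integrals in \<open>x\<close>
   and in the displacement are interchanged below.\<close>
 define F where "F x = f0 (lrep x)" for x
 have F[measurable]: "F : bm borel" unfolding F_def by measurable
 have eq: "AE x in lebesgue. f x = F x"
  using AE_lrep[OF eq0] unfolding F_def by eventually_elim (simp add: Y_periodic_lrep[OF fper])
 \<comment> \<open>The entries bound the coordinates of \<open>(- x) \<odot> y\<close> for points of
   the cell; the third one is generous.\<close>
 define B where "B = cbox (vector [-2,-2,-18]) (vector [2,2,18] :: real^3)"
 have B[measurable]: "B : sets borel" by (simp add: B_def)
 have Bv: "emeasure lborel B = 576"
 proof -
  have ne: "B ~= {}" by (simp add: B_def interval_ne_empty_cart forall_3)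
  have p3: "(\<Prod>i\<in>(UNIV :: 3 set). g i) = g 1 * g 2 * g 3" for g :: "3 => real"
   unfolding UNIV_3 by (simp add: mult.assoc)
  have "measure lborel B = 576"
   unfolding B_def content_cbox_cart[OF ne[unfolded B_def]] p3 by simp
  moreover have "emeasure lborel B ~= \<infinity>"
   using emeasure_lborel_cbox_finite[of "vector [-2,-2,-18] :: real^3" "vector [2,2,18]"] by (simp add: B_def)
  ultimately show ?thesis using emeasure_eq_ennreal_measure[of lborel B] by simp
 qed
 define M where "M = ennreal ((456 * nY G)^2)"
 define I where "I x = (\<integral>\<^sup>+y. ennreal ((F x - F y)^2) * indicator Ycell y \<partial>lborel)" for x
 have Im: "I : bm borel" unfolding I_def by measurable
 have T: "(\<integral>\<^sup>+x. ennreal ((F (x \<odot> g) - F x)^2) * indicator Ycell x \<partial>lborel) <= ennreal ((19 * nY G)^2)" if "g : B" for g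
 proof -
  have d: "(%x. f (x \<odot> g) - f x) : sq_int LY" by (intro sq_int_diff right_translate_sq fper f)
  have "AE x in lebesgue. f (x \<odot> g) = F (x \<odot> g)" by (rule volmap_AE[OF volmap_right eq])
  hence "AE x in lebesgue. ennreal ((F (x \<odot> g) - F x)^2) * indicator Ycell x = ennreal ((norm (f (x \<odot> g) - f x))^2) * indicator Ycell x"
   using eq by eventually_elim simp
  hence "(\<integral>\<^sup>+x. ennreal ((F (x \<odot> g) - F x)^2) * indicator Ycell x \<partial>lebesgue) = (\<integral>\<^sup>+x. ennreal ((norm (f (x \<odot> g) - f x))^2) * indicator Ycell x \<partial>lebesgue)"
   by (rule nn_integral_cong_AE)
  also have "... = ennreal ((nY (%x. f (x \<odot> g) - f x))^2)"
   using nn_integral_sq_norm[OF d] by (simp add: nn_integral_restrict_space)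
  also have "... <= ennreal ((19 * nY G)^2)"
   using that by (intro ennreal_leI power_mono translate_any) (auto simp: B_def mem_box_cart forall_3 abs_le_iff)
  finally show ?thesis by (simp add: nn_integral_completion)
 qed
 have inB: "(- x) \<odot> y : B" if "x : Ycell" "y : Ycell" for x y
 proof -
  have xy: "0 <= x$1" "x$1 < 2" "0 <= x$2" "x$2 < 2" "0 <= x$3" "x$3 < 2" "0 <= y$1" "y$1 < 2" "0 <= y$2" "y$2 < 2" "0 <= y$3" "y$3 < 2"
   using that by (auto simp: Ycell_iff)
  have "0 <= x$1 * y$2" "x$1 * y$2 <= 2 * 2" "0 <= x$2 * y$1" "x$2 * y$1 <= 2 * 2"
   by (rule mult_nonneg_nonneg mult_mono; use xy in simp)+
  moreover have "((- x) \<odot> y) $ 3 = y$3 - x$3 + 2 * (x$1 * y$2 - x$2 * y$1)" by (simp add: algebra_simps)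
  moreover have "- 18 <= b - a + 2 * (p - q) & b - a + 2 * (p - q) <= 18"
   if "0 <= p" "p <= 2 * 2" "0 <= q" "q <= 2 * 2" "0 <= a" "a < 2" "0 <= b" "b < 2" for a b p q :: real
   using that by simp
  ultimately have "- 18 <= ((- x) \<odot> y) $ 3 & ((- x) \<odot> y) $ 3 <= 18" using xy(5,6,11,12) by presburger
  thus ?thesis using xy unfolding B_def mem_box_cart forall_3 by (simp del: hmul_nth(3))
 qed
 have "(\<integral>\<^sup>+x. I x * indicator Ycell x \<partial>lborel) <= (\<integral>\<^sup>+x. (\<integral>\<^sup>+g. ennreal ((F (x \<odot> g) - F x)^2) * indicator Ycell x * indicator B g \<partial>lborel) \<partial>lborel)"
 proof (rule nn_integral_mono)
  fix x
  show "I x * indicator Ycell x <= (\<integral>\<^sup>+g. ennreal ((F (x \<odot> g) - F x)^2) * indicator Ycell x * indicator B g \<partial>lborel)"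
  proof (cases "x : Ycell")
   case True
   have "I x = (\<integral>\<^sup>+y. ennreal ((F x - F y)^2) * indicator Ycell y \<partial>lebesgue)" by (simp add: I_def nn_integral_completion)
   also have "... = (\<integral>\<^sup>+g. ennreal ((F x - F (x \<odot> g))^2) * indicator Ycell (x \<odot> g) \<partial>lebesgue)"
    using volmap_nn_integral[OF volmap_left, of "%y. ennreal ((F x - F y)^2) * indicator Ycell y" x]
    by (simp add: lebesgue_borelI)
   also have "... <= (\<integral>\<^sup>+g. ennreal ((F (x \<odot> g) - F x)^2) * indicator Ycell x * indicator B g \<partial>lebesgue)"
    using True inB[OF True, of "x \<odot> g" for g]
    by (intro nn_integral_mono) (auto simp: indicator_def power2_commute)
   finally show ?thesis using True by (simp add: nn_integral_completion)
  qed simp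
 qed
 also have "... = (\<integral>\<^sup>+g. (\<integral>\<^sup>+x. ennreal ((F (x \<odot> g) - F x)^2) * indicator Ycell x * indicator B g \<partial>lborel) \<partial>lborel)"
  by (rule lborel_pair.Fubini'[symmetric]) measurable
 also have "... <= (\<integral>\<^sup>+g. ennreal ((19 * nY G)^2) * indicator B g \<partial>lborel)"
  using T by (intro nn_integral_mono) (auto simp: indicator_def)
 also have "... = ennreal ((19 * nY G)^2) * 576" using Bv by (simp add: nn_integral_cmult_indicator)
 also have "... = M" by (simp add: M_def power_mult_distrib ennreal_mult[symmetric] ennreal_numeral[symmetric] mult.commute del: ennreal_numeral)
 finally have IM: "(\<integral>\<^sup>+x. I x * indicator Ycell x \<partial>lborel) <= M" .
 \<comment> \<open>If \<open>I\<close> exceeded \<open>M\<close> on the whole cell, of volume 8, its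
   integral would be at least \<open>8 * M\<close>, contradicting \<open>IM\<close> unless
   \<open>M\<close> is zero; then \<open>I\<close> would be strictly positive on the cell with
   integral zero.\<close>
 have "\<exists>x\<in>Ycell. I x <= M"
 proof (rule ccontr)
  assume "\<not> (\<exists>x\<in>Ycell. I x <= M)"
  hence gt: "M < I x" if "x : Ycell" for x using that by (meson not_le)
  have Y8: "emeasure lborel Ycell = 8" using emeasure_Ycell by simp
  show False
  proof (cases "M = 0")
   case True
   hence "(\<integral>\<^sup>+x. I x * indicator Ycell x \<partial>lborel) = 0" using IM by simp
   hence "AE x in lborel. I x * indicator Ycell x = 0" using Im by (subst (asm) nn_integral_0_iff_AE) auto
   hence "AE x in lborel. x ~: Ycell" by eventually_elim (use gt True in "metis indicator_simps(1) mult.right_neutral less_irrefl")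
   hence "emeasure lborel Ycell = 0" by (simp add: AE_iff_measurable[of Ycell lborel "%x. x ~: Ycell"])
   with Y8 show False by simp
  next
   case False
   have "M * 8 = (\<integral>\<^sup>+x. M * indicator Ycell x \<partial>lborel)" using Y8 by (simp add: nn_integral_cmult_indicator)
   also have "... <= (\<integral>\<^sup>+x. I x * indicator Ycell x \<partial>lborel)"
    using gt by (intro nn_integral_mono) (auto simp: indicator_def intro: less_imp_le)
   also have "... <= M" by (rule IM)
   finally have "M * 8 <= M" .
   moreover have "M * 8 = ennreal ((456 * nY G)^2 * 8)" unfolding M_def by (simp only: ennreal_mult zero_le_power2 zero_le_numeral ennreal_numeral)
   ultimately have "(456 * nY G)^2 * 8 <= (456 * nY G)^2" unfolding M_def by (simp add: ennreal_le_iff)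
   hence "(456 * nY G)^2 = 0" using zero_le_power2[of "456 * nY G"] by linarith
   thus False using False by (simp add: M_def)
  qed
 qed
 then obtain x0 where x0: "x0 : Ycell" "I x0 <= M" by blast
 have fm: "(%x. f x - F x0) : bm LY" using sq_intD[OF f] by measurable
 have "(\<integral>\<^sup>+y. ennreal ((norm (f y - F x0))^2) \<partial>LY) = (\<integral>\<^sup>+y. ennreal ((F x0 - F y)^2) * indicator Ycell y \<partial>lebesgue)"
  using eq by (simp add: nn_integral_restrict_space)
    (auto intro!: nn_integral_cong_AE elim!: eventually_mono simp: power2_commute)
 also have "... = I x0" by (simp add: I_def nn_integral_completion)
 finally have "(\<integral>\<^sup>+y. ennreal ((norm (f y - F x0))^2) \<partial>LY) <= ennreal ((456 * nY G)^2)" using x0(2) by (simp add: M_def)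
 from sq_norm_le_nn(2)[OF fm this] show ?thesis by auto
qed

text \<open>The mean value minimises the distance to the constants.\<close>

lemma poincare: "nY (%x. f x - (LINT y|LY. f y) / 8) <= 456 * nY G"
proof -
 obtain c where c: "nY (%x. f x - c) <= 456 * nY G" using poincare_aux by blast
 define h where "h x = f x - c" for x
 define m where "m = (LINT y|LY. h y) / 8"
 have h: "h : sq_int LY" unfolding h_def by (intro sq_int_diff f sq_int_const finite_Ycell)
 have hi: "integrable LY h" by (rule sq_int_integrable[OF finite_Ycell h])
 have fi: "integrable LY f" by (rule sq_int_integrable[OF finite_Ycell f])
 have m8: "(LINT y|LY. h y) = 8 * m" by (simp add: m_def)
 have ci: "integrable LY (%_. a)" for a :: real by (rule finite_measure.integrable_const[OF finite_Ycell])
 have "(LINT y|LY. f y) / 8 = m + c"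
  using fi ci[of c] integral_const_Ycell[of c] unfolding m_def h_def by (simp add: diff_divide_distrib)
 hence e: "(%x. f x - (LINT y|LY. f y) / 8) = (%x. h x - m)" by (simp add: h_def fun_eq_iff add_divide_distrib)
 have hs: "integrable LY (%x. (h x)^2)" using sq_int_norm[OF h] by simp
 have "(nY (%x. h x - m))^2 = (LINT x|LY. (h x)^2 - 2 * m * h x + m^2)"
  unfolding sq_norm_sq by (simp add: power2_diff algebra_simps)
 also have "... = (LINT x|LY. (h x)^2) - 2 * m * (8 * m) + 8 * m^2"
  using hs hi ci integral_const_Ycell[of "m^2"] m8 by simp
 also have "... <= (LINT x|LY. (norm (h x))^2)" by (simp add: power2_eq_square)
 also have "... = (nY h)^2" by (rule sq_norm_sq[symmetric])
 finally have "nY (%x. h x - m) <= nY h" by (rule power2_le_imp_le) simp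
 thus ?thesis unfolding e using c by (simp add: h_def[abs_def])
qed

end

section \<open>Periodic functions with square integrable gradient\<close>

lemma null_le_null:
 fixes a b :: "'i => real"
 assumes "!!n. 0 <= a n" "!!n. a n <= c * b n" "(b \<longlongrightarrow> 0) F"
 shows "(a \<longlongrightarrow> 0) F"
proof (rule tendsto_sandwich[of "%_. 0"])
 show "((%n. c * b n) \<longlongrightarrow> 0) F" using tendsto_mult_left[OF assms(3), of c] by simp
qed (use assms in auto)

lemma weak_hgrad_limit:
 fixes f :: "nat => real^3 => real" and G :: "nat => real^3 => real^2"
 assumes E: "open E" and w: "!!n. weak_hgrad E (f n) (G n)"
  and sq: "!!K n. compact K ==> K <= E ==> f n : sq_int (lebesgue_on K) & G n : sq_int (lebesgue_on K)
    & g : sq_int (lebesgue_on K) & H : sq_int (lebesgue_on K)"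
  and lf: "!!K. compact K ==> K <= E ==> (%n. sq_norm (lebesgue_on K) (%x. f n x - g x)) ----> 0"
  and lG: "!!K. compact K ==> K <= E ==> (%n. sq_norm (lebesgue_on K) (%x. G n x - H x)) ----> 0"
 shows "weak_hgrad E g H"
proof (rule weak_hgradI[OF E])
 show "loc_int E g" "loc_int E H" using sq by (auto intro!: loc_int_sq)
 have lim: "(%n. LINT x|lebesgue. a n x * p x) ----> (LINT x|lebesgue. b x * p x)"
  if K: "compact K" "K <= E" "!!x. x ~: K ==> p x = 0" and p: "continuous_on UNIV p"
   and a: "!!n. a n : sq_int (lebesgue_on K)" and b: "b : sq_int (lebesgue_on K)"
   and l: "(%n. sq_norm (lebesgue_on K) (%x. a n x - b x)) ----> 0" for K a b and p :: "real^3 => real"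
 proof -
  have Ks: "K : sets lebesgue" by (rule compact_lebesgue[OF K(1)])
  have fin: "finite_measure (lebesgue_on K)" using K by (intro finite_measure_lebesgue_on Ks compact_imp_bounded)
  have m: "p : bm (lebesgue_on K)"
   by (intro measurable_restrict_space1 lebesgue_borelI borel_measurable_continuous_onI p)
  have "bounded (p ` K)" using K p by (intro compact_imp_bounded compact_continuous_image) (auto intro: continuous_on_subset)
  then obtain C where C: "!!x. x : K ==> \<bar>p x\<bar> <= C" unfolding bounded_iff by (metis imageI real_norm_def)
  have ps: "p : sq_int (lebesgue_on K)" using C by (intro sq_int_bounded[OF fin m, of C] AE_I2) auto
  have e: "(LINT x|lebesgue_on K. h x \<bullet> p x) = (LINT x|lebesgue. h x * p x)" for h
   using K(3) by (subst LINT_outside(1)[OF Ks]) auto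
  show ?thesis using sq_inner_tendsto[OF a b ps l] by (simp only: e)
 qed
 fix p i assume p: "p : test_functions E"
 obtain K where K: "compact K" "K <= E" "!!x. x ~: K ==> p x = 0" using tf_ex[OF p] by blast
 obtain K' where K': "compact K'" "K' <= E" "!!x. x ~: K' ==> hX i p x = 0" using tf_ex[OF tf_hX[OF p]] by blast
 have l1: "(%n. LINT x|lebesgue. f n x * hX i p x) ----> (LINT x|lebesgue. g x * hX i p x)"
  using sq[OF K'(1,2)] by (intro lim[OF K' tf_continuous[OF tf_hX[OF p]]] lf K') auto
 have l2: "(%n. LINT x|lebesgue. G n x $ i * p x) ----> (LINT x|lebesgue. H x $ i * p x)"
 proof (rule lim[OF K tf_continuous[OF p]])
  show "(%n. sq_norm (lebesgue_on K) (%x. G n x $ i - H x $ i)) ----> 0"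
  proof (rule Lim_null_comparison[OF _ lG[OF K(1,2)]])
   have d: "(%x. G n x - H x) : sq_int (lebesgue_on K)" for n using sq[OF K(1,2)] by (intro sq_int_diff) auto
   have "sq_norm (lebesgue_on K) (%x. (G n x - H x) $ i) <= 1 * sq_norm (lebesgue_on K) (%x. G n x - H x)" for n
    using component_le_norm_cart[of "G n x - H x" i for x]
    by (intro sq_norm_mono[OF d]) (auto intro: sq_intD[OF sq_int_component[OF d]] simp del: vector_minus_component)
   thus "\<forall>\<^sub>F n in sequentially. norm (sq_norm (lebesgue_on K) (%x. G n x $ i - H x $ i)) <= sq_norm (lebesgue_on K) (%x. G n x - H x)"
    by simp
  qed
 qed (use sq[OF K(1,2)] in "auto intro!: sq_int_component")
 have "(%n. LINT x|lebesgue. f n x * hX i p x) ----> - (LINT x|lebesgue. H x $ i * p x)"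
  using tendsto_minus[OF l2] by (simp add: weak_hgradD(3)[OF w E p])
 with l1 show "(LINT x|lebesgue. g x * hX i p x) = - (LINT x|lebesgue. H x $ i * p x)"
  by (rule LIMSEQ_unique)
qed

lemma dil_Ycell_sets: assumes "l > 0" shows "dil l ` Ycell : sets lebesgue" "bounded (dil l ` Ycell)"
proof -
 have "dil l ` Ycell = dil (1/l) -` Ycell"
  using assms by (auto simp: image_iff) (metis dil_inv(2) less_irrefl)
 also have "... : sets borel"
  using measurable_sets[of "dil (1/l)" borel borel Ycell] borel_measurable_dil[of "%x. x" borel "1/l"] by (simp add: eta_contract_eq)
 finally show "dil l ` Ycell : sets lebesgue" by simp
 have "bounded (dil l ` cbox 0 (vec 2))"
  by (intro compact_imp_bounded compact_continuous_image) (auto intro!: continuous_intros)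
 thus "bounded (dil l ` Ycell)" by (rule bounded_subset) (use Ycell_subset in blast)
qed

lemma sq_int_AE_eq:
 fixes f g :: "'a::euclidean_space => 'b::euclidean_space"
 assumes "S : sets lebesgue" "f : sq_int (lebesgue_on S)" "AE x in lebesgue_on S. f x = g x"
 shows "g : sq_int (lebesgue_on S)"
 by (rule sq_int_cong_AE[OF assms(2) lebesgue_on_measurable_AE[OF assms(1) sq_intD[OF assms(2)] assms(3)] assms(3)])

lemma hgrad_spec: "weak_hgrad E f G ==> weak_hgrad E f (hgrad E f)"
 unfolding hgrad_def by (rule someI[where P = "weak_hgrad E f"])

lemma AE_lebesgue_on_UNIV: "(AE x in lebesgue_on UNIV. P x) \<longleftrightarrow> (AE x in lebesgue. P x)"
 unfolding lebesgue_on_UNIV_eq ..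

lemma hgrad_AE: "open E ==> weak_hgrad E f G ==> AE x in lebesgue_on E. hgrad E f x = G x"
 using weak_hgrad_unique hgrad_spec by blast

lemma AE_on_subset:
 assumes "AE x in lebesgue. P x" "S : sets lebesgue" shows "AE x in lebesgue_on S. P x"
 using assms by (auto simp: AE_lebesgue_on elim!: eventually_mono)

lemma H1perD:
 assumes "s : H1per"
 shows "Y_periodic s" "s : sq_int LY" "weak_hgrad UNIV s (hgrad UNIV s)" "hgrad UNIV s : sq_int LY"
proof -
 show "Y_periodic s" "s : sq_int LY" using assms by (auto simp: H1per_def L2per_def L2_eq)
 obtain G where w: "weak_hgrad UNIV s G" and G: "!!l. l > 0 ==> G : L2 (dil l ` Ycell)"
  using assms by (auto simp: H1per_def)
 show "weak_hgrad UNIV s (hgrad UNIV s)" by (rule hgrad_spec[OF w])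
 have Gs: "G : sq_int LY" using G[of 1] by (simp add: L2_eq)
 have "AE x in lebesgue. hgrad UNIV s x = G x" using hgrad_AE[OF open_UNIV w] by (simp only: AE_lebesgue_on_UNIV)
 hence e: "AE x in LY. G x = hgrad UNIV s x" by (intro AE_on_subset) (auto elim!: eventually_mono)
 show "hgrad UNIV s : sq_int LY"
  by (rule sq_int_AE_eq[OF Ycell_lebesgue Gs e])
qed

text \<open>Left translation commutes with the fields, so every lattice translate of
  \<open>G\<close> is again a gradient of \<open>f\<close>. Uniqueness gives invariance off a null
  set for each of countably many translations.\<close>

lemma weak_hgrad_periodic_AE:
 assumes per: "Y_periodic f" and w: "weak_hgrad UNIV f G"
 shows "AE x in lebesgue. G (lrep x) = G x"
proof -
 have "AE x in lebesgue. G (lat k \<odot> x) = G x" for k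
 proof -
  have "weak_hgrad UNIV f (%x. G (lat k \<odot> x))" using weak_hgrad_left[OF w, of "lat k"] by (simp add: Y_periodicD[OF per])
  from weak_hgrad_unique[OF open_UNIV this w] show ?thesis by (simp only: AE_lebesgue_on_UNIV)
 qed
 hence "AE x in lebesgue. \<forall>k. G (lat k \<odot> x) = G x" unfolding AE_all_countable by blast
 thus ?thesis
 proof eventually_elim
  case (elim x)
  thus ?case by (simp add: lrep_def lat_uminus)
 qed
qed

text \<open>The choice made by \<open>hgrad\<close> is arbitrary on null sets and so periodic only
  almost everywhere. This representative is periodic everywhere, as the lemmas on periodic functions
  demand.\<close>

definition pgrad :: "(real^3 => real) => real^3 => real^2" where
 "pgrad \<xi> x = hgrad UNIV \<xi> (lrep x)"

lemma pgrad_periodic: "Y_periodic (pgrad s)"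
 unfolding pgrad_def[abs_def] by (rule Y_periodicI_lrep)

lemma pgrad_Ycell: "y : Ycell ==> pgrad s y = hgrad UNIV s y"
 by (simp add: pgrad_def lrep_id)

lemma AE_LY_I: "(!!y. y : Ycell ==> P y) ==> AE y in LY. P y"
 by (rule AE_I2) simp

lemma pgrad_sq: assumes "s : H1per" shows "pgrad s : sq_int LY"
proof -
 have "AE y in LY. hgrad UNIV s y = pgrad s y" by (rule AE_LY_I) (simp add: pgrad_Ycell)
 thus ?thesis by (rule sq_int_AE_eq[OF Ycell_lebesgue H1perD(4)[OF assms]])
qed

lemma weak_hgrad_pgrad: assumes "s : H1per" shows "weak_hgrad UNIV s (pgrad s)"
proof (rule weak_hgrad_cong_AE[OF open_UNIV H1perD(3)[OF assms]])
 show "AE x in lebesgue_on UNIV. hgrad UNIV s x = pgrad s x"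
  using weak_hgrad_periodic_AE[OF H1perD(1,3)[OF assms]] unfolding pgrad_def lebesgue_on_UNIV_eq by eventually_elim simp
qed simp

text \<open>Since \<open>G\<close> is periodic almost everywhere, square integrability on the cell
  spreads to every dilated cell, which is bounded and meets finitely many tiles.\<close>

lemma H1perI:
 assumes per: "Y_periodic f" and f: "f : sq_int LY" and w: "weak_hgrad UNIV f G" and G: "G : sq_int LY"
 shows "f : H1per" "AE y in LY. hgrad UNIV f y = G y"
proof -
 have e: "AE x in lebesgue. G (lrep x) = G x" by (rule weak_hgrad_periodic_AE[OF per w])
 have Gp: "(%x. G (lrep x)) : sq_int LY"
 proof -
  have "AE y in LY. G y = G (lrep y)" by (rule AE_LY_I) (simp add: lrep_id)
  thus ?thesis by (rule sq_int_AE_eq[OF Ycell_lebesgue G])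
 qed
 have "G : L2 (dil l ` Ycell)" if "l > 0" for l
 proof -
  note S = dil_Ycell_sets[OF that]
  have 1: "(%x. G (lrep x)) : sq_int (lebesgue_on (dil l ` Ycell))"
   by (rule periodic_sq_int[OF Y_periodicI_lrep Gp S(2,1)])
  have 2: "AE x in lebesgue_on (dil l ` Ycell). G (lrep x) = G x" by (rule AE_on_subset[OF e S(1)])
  show ?thesis unfolding L2_eq
   by (rule sq_int_AE_eq[OF S(1) 1 2])
 qed
 thus "f : H1per" using per f w by (auto simp: H1per_def L2per_def L2_eq)
 show "AE y in LY. hgrad UNIV f y = G y"
  by (rule AE_on_subset[OF hgrad_AE[OF open_UNIV w, unfolded AE_lebesgue_on_UNIV]]) simp
qed

lemma H1per_add:
 assumes "f : H1per" "g : H1per"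
 shows "(%x. f x + g x) : H1per" "AE y in LY. hgrad UNIV (%x. f x + g x) y = hgrad UNIV f y + hgrad UNIV g y"
proof -
 have p: "Y_periodic (%x. f x + g x)" using H1perD(1)[OF assms(1)] H1perD(1)[OF assms(2)] by (simp add: Y_periodic_def)
 note r = H1perI[OF p sq_int_add[OF H1perD(2)[OF assms(1)] H1perD(2)[OF assms(2)]]
   weak_hgrad_add[OF open_UNIV H1perD(3)[OF assms(1)] H1perD(3)[OF assms(2)]] sq_int_add[OF H1perD(4)[OF assms(1)] H1perD(4)[OF assms(2)]]]
 show "(%x. f x + g x) : H1per" "AE y in LY. hgrad UNIV (%x. f x + g x) y = hgrad UNIV f y + hgrad UNIV g y"
  using r by auto
qed

lemma H1per_cmult:
 assumes "f : H1per"
 shows "(%x. c * f x) : H1per" "AE y in LY. hgrad UNIV (%x. c * f x) y = c *R hgrad UNIV f y"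
proof -
 have p: "Y_periodic (%x. c * f x)" using H1perD(1)[OF assms(1)] by (simp add: Y_periodic_def)
 note r = H1perI[OF p sq_int_cmult[OF H1perD(2)[OF assms(1)]]
   weak_hgrad_scale[OF open_UNIV H1perD(3)[OF assms(1)]] sq_int_scale[OF H1perD(4)[OF assms(1)]]]
 show "(%x. c * f x) : H1per" "AE y in LY. hgrad UNIV (%x. c * f x) y = c *R hgrad UNIV f y"
  using r by auto
qed

lemma H1per_const: "(%x. c) : H1per" "AE y in LY. hgrad UNIV (%x. c) y = 0"
 using H1perI[OF _ sq_int_const[OF finite_Ycell] weak_hgrad_const sq_int_zero, of c] by (auto simp: Y_periodic_def)

lemma H1per_diff:
 assumes "f : H1per" "g : H1per"
 shows "(%x. f x - g x) : H1per" "AE y in LY. hgrad UNIV (%x. f x - g x) y = hgrad UNIV f y - hgrad UNIV g y"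
proof -
 note a = H1per_add[OF assms(1) H1per_cmult(1)[OF assms(2), of "-1"]] and b = H1per_cmult(2)[OF assms(2), of "-1"]
 show "(%x. f x - g x) : H1per" using a(1) by simp
 show "AE y in LY. hgrad UNIV (%x. f x - g x) y = hgrad UNIV f y - hgrad UNIV g y"
  using a(2) b by eventually_elim simp
qed

lemma H1per_plus_const:
 assumes "f : H1per"
 shows "(%x. f x + c) : H1per" "AE y in LY. hgrad UNIV (%x. f x + c) y = hgrad UNIV f y"
proof -
 note a = H1per_add[OF assms H1per_const(1)[of c]]
 show "(%x. f x + c) : H1per" by (rule a(1))
 show "AE y in LY. hgrad UNIV (%x. f x + c) y = hgrad UNIV f y" using a(2) H1per_const(2)[of c] by eventually_elim simp
qed

abbreviation "nG \<xi> \<equiv> sq_norm LY (hgrad UNIV \<xi>)"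
abbreviation "mean f \<equiv> (LINT y|LY. f y) / 8"

lemma nG_pgrad: "s : H1per ==> sq_norm LY (pgrad s) = nG s"
 by (intro sq_norm_cong_AE sq_intD[OF pgrad_sq] sq_intD[OF H1perD(4)] AE_LY_I pgrad_Ycell)

lemma H1per_poincare: assumes "s : H1per" shows "sq_norm LY (%x. s x - mean s) <= 456 * nG s"
 using poincare[OF H1perD(1,2)[OF assms] pgrad_periodic pgrad_sq[OF assms] weak_hgrad_pgrad[OF assms]]
 by (simp add: nG_pgrad[OF assms])

lemma periodic_sq_norm_le:
 fixes p :: "real^3 => 'b::euclidean_space"
 assumes per: "Y_periodic p" and p: "p : sq_int LY" and S: "bounded S" "S : sets lebesgue"
 shows "sq_norm (lebesgue_on S) p <= sqrt (real (card (lidx ` S))) * sq_norm LY p"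
proof -
 have m: "p : bm lebesgue" by (rule periodic_measurable[OF per sq_intD[OF p]])
 have "(\<integral>\<^sup>+x. ennreal ((norm (p x))^2) \<partial>lebesgue_on S) <= of_nat (card (lidx ` S)) * (\<integral>\<^sup>+y. ennreal ((norm (p y))^2) \<partial>LY)"
  using m per by (intro nn_integral_periodic_bounded S) (auto simp: Y_periodic_def)
 also have "... = ennreal ((sqrt (real (card (lidx ` S))) * sq_norm LY p)^2)"
  by (simp add: nn_integral_sq_norm[OF p] power_mult_distrib ennreal_mult ennreal_of_nat_eq_real_of_nat)
 finally show ?thesis by (intro sq_norm_le_nn(2) measurable_restrict_space1 m) auto
qed

lemma lrep_sq_int:
 fixes f :: "real^3 => 'b::euclidean_space"
 assumes "f : sq_int LY"
 shows "(%x. f (lrep x)) : sq_int LY" "sq_norm LY (%x. g x - f (lrep x)) = sq_norm LY (%x. g x - f x)"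
proof -
 have "AE y in LY. f y = f (lrep y)" by (rule AE_LY_I) (simp add: lrep_id)
 thus "(%x. f (lrep x)) : sq_int LY"
  by (rule sq_int_AE_eq[OF Ycell_lebesgue assms])
 show "sq_norm LY (%x. g x - f (lrep x)) = sq_norm LY (%x. g x - f x)"
  unfolding sq_norm_def by (intro arg_cong[where f=sqrt] Bochner_Integration.integral_cong refl) (simp add: lrep_id)
qed

text \<open>Only gradients are assumed Cauchy. Subtracting means turns this into convergence of the
  functions by the Poincare inequality. Both limits, known on the cell, are extended periodically so
  that the weak gradient passes to the limit on all compact sets.\<close>

lemma H1per_complete:
 fixes s :: "nat => real^3 => real"
 assumes s: "!!n. s n : H1per"
  and C: "!!e. e > 0 ==> \<exists>N. \<forall>m\<ge>N. \<forall>n\<ge>N. sq_norm LY (%x. hgrad UNIV (s m) x - hgrad UNIV (s n) x) < e"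
 shows "\<exists>l\<in>H1per. (%n. sq_norm LY (%x. hgrad UNIV (s n) x - hgrad UNIV l x)) ----> 0"
proof -
 define z where "z n x = s n x - mean (s n)" for n x
 have z: "z n : H1per" and zg: "AE y in LY. hgrad UNIV (z n) y = hgrad UNIV (s n) y" for n
  using H1per_plus_const[OF s, of n "- mean (s n)"] by (simp_all add: z_def[abs_def])
 have zd: "sq_norm LY (%x. z m x - z n x) <= 456 * sq_norm LY (%x. hgrad UNIV (s m) x - hgrad UNIV (s n) x)" for m n
 proof -
  note d = H1per_diff[OF s[of m] s[of n]]
  have i: "integrable LY (s k)" for k by (intro sq_int_integrable finite_Ycell H1perD(2) s)
  have "(%x. z m x - z n x) = (%x. (s m x - s n x) - mean (%x. s m x - s n x))"
   by (simp add: z_def fun_eq_iff i diff_divide_distrib)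
  hence "sq_norm LY (%x. z m x - z n x) <= 456 * nG (%x. s m x - s n x)" using H1per_poincare[OF d(1)] by simp
  also have "nG (%x. s m x - s n x) = sq_norm LY (%x. hgrad UNIV (s m) x - hgrad UNIV (s n) x)"
   by (rule sq_norm_cong_AE[OF sq_intD[OF H1perD(4)[OF d(1)]] sq_intD[OF sq_int_diff[OF H1perD(4)[OF s] H1perD(4)[OF s]]] d(2)])
  finally show ?thesis .
 qed
 have "\<exists>g\<in>sq_int LY. (%n. sq_norm LY (%x. z n x - g x)) ----> 0"
 proof (rule sq_int_complete[OF finite_Ycell H1perD(2)[OF z]])
  fix e :: real assume "e > 0"
  then obtain N where N: "\<forall>m\<ge>N. \<forall>n\<ge>N. sq_norm LY (%x. hgrad UNIV (s m) x - hgrad UNIV (s n) x) < e/456" using C[of "e/456"] by auto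
  have "sq_norm LY (%x. z m x - z n x) < e" if "m >= N" "n >= N" for m n
  proof -
   have "sq_norm LY (%x. hgrad UNIV (s m) x - hgrad UNIV (s n) x) < e/456" using N that by blast
   thus ?thesis using zd[of m n] by linarith
  qed
  thus "\<exists>N. \<forall>m\<ge>N. \<forall>n\<ge>N. sq_norm LY (%x. z m x - z n x) < e" by blast
 qed
 then obtain g where g: "g : sq_int LY" "(%n. sq_norm LY (%x. z n x - g x)) ----> 0" by blast
 obtain H where H: "H : sq_int LY" "(%n. sq_norm LY (%x. hgrad UNIV (s n) x - H x)) ----> 0"
  using sq_int_complete[OF finite_Ycell H1perD(4)[OF s] C] by blast
 define g' where "g' x = g (lrep x)" for x
 define H' where "H' x = H (lrep x)" for x
 have g': "g' : sq_int LY" "Y_periodic g'" "(%n. sq_norm LY (%x. z n x - g' x)) ----> 0"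
  unfolding g'_def[abs_def] using g lrep_sq_int[OF g(1)] Y_periodicI_lrep[of g] by auto
 have H': "H' : sq_int LY" "Y_periodic H'" "(%n. sq_norm LY (%x. hgrad UNIV (s n) x - H' x)) ----> 0"
  unfolding H'_def[abs_def] using H lrep_sq_int[OF H(1)] Y_periodicI_lrep[of H] by auto
 have pH: "sq_norm LY (%x. pgrad (z n) x - H' x) = sq_norm LY (%x. hgrad UNIV (s n) x - H' x)" for n
 proof (rule sq_norm_cong_AE)
  show "AE y in LY. pgrad (z n) y - H' y = hgrad UNIV (s n) y - H' y"
   using zg[of n] AE_LY_I[of "%y. pgrad (z n) y = hgrad UNIV (z n) y"] pgrad_Ycell by auto
 qed (use sq_int_diff[OF pgrad_sq[OF z] H'(1)] sq_int_diff[OF H1perD(4)[OF s] H'(1)] in "auto dest: sq_intD")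
 have "weak_hgrad UNIV g' H'"
 proof (rule weak_hgrad_limit[OF open_UNIV weak_hgrad_pgrad[OF z]])
  fix K :: "(real^3) set" and n assume K: "compact K"
  note S = compact_imp_bounded[OF K] compact_lebesgue[OF K]
  show "z n : sq_int (lebesgue_on K) & pgrad (z n) : sq_int (lebesgue_on K) & g' : sq_int (lebesgue_on K) & H' : sq_int (lebesgue_on K)"
   using periodic_sq_int[OF H1perD(1,2)[OF z[of n]] S] periodic_sq_int[OF pgrad_periodic pgrad_sq[OF z[of n]] S]
    periodic_sq_int[OF g'(2,1) S] periodic_sq_int[OF H'(2,1) S] by blast
 next
  fix K :: "(real^3) set" assume K: "compact K"
  note S = compact_imp_bounded[OF K] compact_lebesgue[OF K]
  let ?c = "sqrt (real (card (lidx ` K)))"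
  have "sq_norm (lebesgue_on K) (%x. z n x - g' x) <= ?c * sq_norm LY (%x. z n x - g' x)" for n
   using H1perD(1)[OF z[of n]] g'(2)
   by (intro periodic_sq_norm_le[OF _ sq_int_diff[OF H1perD(2)[OF z] g'(1)] S]) (auto simp: Y_periodic_def)
  thus "(%n. sq_norm (lebesgue_on K) (%x. z n x - g' x)) ----> 0"
   by (rule null_le_null[OF sq_norm_nonneg _ g'(3)])
  have "sq_norm (lebesgue_on K) (%x. pgrad (z n) x - H' x) <= ?c * sq_norm LY (%x. pgrad (z n) x - H' x)" for n
   using pgrad_periodic[of "z n"] H'(2)
   by (intro periodic_sq_norm_le[OF _ sq_int_diff[OF pgrad_sq[OF z] H'(1)] S]) (auto simp: Y_periodic_def)
  thus "(%n. sq_norm (lebesgue_on K) (%x. pgrad (z n) x - H' x)) ----> 0"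
   unfolding pH by (rule null_le_null[OF sq_norm_nonneg _ H'(3)])
 qed
 note r = H1perI[OF g'(2,1) this H'(1)]
 have "sq_norm LY (%x. hgrad UNIV (s n) x - hgrad UNIV g' x) = sq_norm LY (%x. hgrad UNIV (s n) x - H' x)" for n
  using r(2) by (intro sq_norm_cong_AE sq_intD[OF sq_int_diff] H1perD(4) s r(1) H'(1)) (auto elim!: eventually_mono)
 thus ?thesis using r(1) H'(3) by (intro bexI[of _ g']) simp_all
qed

lemma H1per_inner_cong:
 assumes "f : sq_int LY" "f' : sq_int LY" "AE y in LY. f y = f' y" "g : sq_int LY"
 shows "(LINT y|LY. f y \<bullet> g y) = (LINT y|LY. f' y \<bullet> g y)"
 using assms(3) borel_measurable_integrable[OF sq_int_inner[OF assms(1,4)]] borel_measurable_integrable[OF sq_int_inner[OF assms(2,4)]]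
 by (intro integral_cong_AE) (auto elim!: eventually_mono)

text \<open>The form vanishes on constants, so it is the inner product of the quotient by the
  constants; Riesz representation in it solves the problems on the cell.\<close>

interpretation H1per: semi_hilbert H1per "%f g. LINT y|LY. hgrad UNIV f y \<bullet> hgrad UNIV g y"
proof
 show "subspace H1per"
  unfolding subspace_def zero_fun_def plus_fun_def scaleR_fun_def
  using H1per_const(1)[of 0] H1per_add(1) H1per_cmult(1) by auto
next
 fix x y z :: "real^3 => real" assume xyz: "x : H1per" "y : H1per" "z : H1per"
 note g = H1perD(4)[OF xyz(1)] H1perD(4)[OF xyz(2)] H1perD(4)[OF xyz(3)]
 have "(LINT t|LY. hgrad UNIV (x + y) t \<bullet> hgrad UNIV z t) = (LINT t|LY. (hgrad UNIV x t + hgrad UNIV y t) \<bullet> hgrad UNIV z t)"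
  unfolding plus_fun_def
  by (intro H1per_inner_cong H1perD(4) sq_int_add H1per_add xyz)
 thus "(LINT t|LY. hgrad UNIV (x + y) t \<bullet> hgrad UNIV z t) = (LINT t|LY. hgrad UNIV x t \<bullet> hgrad UNIV z t) + (LINT t|LY. hgrad UNIV y t \<bullet> hgrad UNIV z t)"
  using sq_int_inner[OF g(1,3)] sq_int_inner[OF g(2,3)] by (simp add: inner_add_left)
next
 fix c and x z :: "real^3 => real" assume xyz: "x : H1per" "z : H1per"
 have "(LINT t|LY. hgrad UNIV (c *R x) t \<bullet> hgrad UNIV z t) = (LINT t|LY. (c *R hgrad UNIV x t) \<bullet> hgrad UNIV z t)"
  unfolding scaleR_fun_def real_scaleR_def
  by (intro H1per_inner_cong H1perD(4) sq_int_scale H1per_cmult xyz)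
 thus "(LINT t|LY. hgrad UNIV (c *R x) t \<bullet> hgrad UNIV z t) = c * (LINT t|LY. hgrad UNIV x t \<bullet> hgrad UNIV z t)" by simp
next
 fix x y :: "real^3 => real"
 show "(LINT t|LY. hgrad UNIV x t \<bullet> hgrad UNIV y t) = (LINT t|LY. hgrad UNIV y t \<bullet> hgrad UNIV x t)" by (simp add: inner_commute)
 show "0 <= (LINT t|LY. hgrad UNIV x t \<bullet> hgrad UNIV x t)" by (intro integral_nonneg_AE) simp
next
 fix s :: "nat => real^3 => real"
 assume s: "!!n. s n : H1per"
  and C: "!!e. e > 0 ==> \<exists>N. \<forall>m\<ge>N. \<forall>n\<ge>N. (LINT t|LY. hgrad UNIV (s m - s n) t \<bullet> hgrad UNIV (s m - s n) t) < e"
 have e: "(LINT t|LY. hgrad UNIV (x - y) t \<bullet> hgrad UNIV (x - y) t) = (sq_norm LY (%t. hgrad UNIV x t - hgrad UNIV y t))^2"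
  if "x : H1per" "y : H1per" for x y
 proof -
  have m: "x - y = (%t. x t - y t)" by (simp add: fun_eq_iff)
  have "(LINT t|LY. hgrad UNIV (x - y) t \<bullet> hgrad UNIV (x - y) t) = (nG (x - y))^2"
   by (simp add: sq_norm_sq power2_norm_eq_inner)
  also have "nG (x - y) = sq_norm LY (%t. hgrad UNIV x t - hgrad UNIV y t)"
   unfolding m by (intro sq_norm_cong_AE sq_intD[OF H1perD(4)] sq_intD[OF sq_int_diff] H1perD(4) H1per_diff that)
  finally show ?thesis .
 qed
 have "\<exists>l\<in>H1per. (%n. sq_norm LY (%x. hgrad UNIV (s n) x - hgrad UNIV l x)) ----> 0"
 proof (rule H1per_complete[OF s])
  fix r :: real assume r: "r > 0"
  then obtain N where N: "\<forall>m\<ge>N. \<forall>n\<ge>N. (sq_norm LY (%t. hgrad UNIV (s m) t - hgrad UNIV (s n) t))^2 < r^2"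
   using C[of "r^2"] by (auto simp: e s)
  thus "\<exists>N. \<forall>m\<ge>N. \<forall>n\<ge>N. sq_norm LY (%x. hgrad UNIV (s m) x - hgrad UNIV (s n) x) < r"
   using r by (meson less_imp_le power2_less_imp_less)
 qed
 then obtain l where l: "l : H1per" "(%n. sq_norm LY (%x. hgrad UNIV (s n) x - hgrad UNIV l x)) ----> 0" by blast
 have "(%n. (sq_norm LY (%x. hgrad UNIV (s n) x - hgrad UNIV l x))^2) ----> 0^2" by (intro tendsto_intros l(2))
 thus "\<exists>l\<in>H1per. (%n. LINT t|LY. hgrad UNIV (s n - l) t \<bullet> hgrad UNIV (s n - l) t) ----> 0"
  using l(1) s by (intro bexI[of _ l]) (simp_all add: e)
qed

lemma H1per_nrm: "H1per.nrm s = nG s"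
 by (simp add: H1per.nrm_def sq_norm_def power2_norm_eq_inner)

text \<open>Projects \<open>q\<close> onto the periodic gradients; what is left over is weakly
  divergence free. This splits the second factors in \<open>tensor_split\<close>.\<close>

lemma gradient_projection:
 assumes q: "q : sq_int LY"
 shows "\<exists>s\<in>H1per. \<forall>z\<in>H1per. (LINT y|LY. hgrad UNIV s y \<bullet> hgrad UNIV z y) = (LINT y|LY. q y \<bullet> hgrad UNIV z y)"
proof (rule H1per.riesz_representation[where C = "sq_norm LY q"])
 fix x y assume xy: "x : H1per" "y : H1per"
 have "(LINT t|LY. hgrad UNIV (x + y) t \<bullet> q t) = (LINT t|LY. (hgrad UNIV x t + hgrad UNIV y t) \<bullet> q t)"
  unfolding plus_fun_def by (intro H1per_inner_cong H1perD(4) sq_int_add H1per_add xy q)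
 thus "(LINT t|LY. q t \<bullet> hgrad UNIV (x + y) t) = (LINT t|LY. q t \<bullet> hgrad UNIV x t) + (LINT t|LY. q t \<bullet> hgrad UNIV y t)"
  using sq_int_inner[OF q H1perD(4)[OF xy(1)]] sq_int_inner[OF q H1perD(4)[OF xy(2)]]
  by (simp add: inner_commute[of _ "q _"] inner_add_right)
next
 fix c x assume x: "x : H1per"
 have "(LINT t|LY. hgrad UNIV (c *R x) t \<bullet> q t) = (LINT t|LY. (c *R hgrad UNIV x t) \<bullet> q t)"
  unfolding scaleR_fun_def real_scaleR_def by (intro H1per_inner_cong H1perD(4) sq_int_scale H1per_cmult x q)
 thus "(LINT t|LY. q t \<bullet> hgrad UNIV (c *R x) t) = c * (LINT t|LY. q t \<bullet> hgrad UNIV x t)"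
  by (simp add: inner_commute[of _ "q _"])
next
 fix x assume x: "x : H1per"
 show "\<bar>LINT t|LY. q t \<bullet> hgrad UNIV x t\<bar> <= sq_norm LY q * H1per.nrm x"
  using sq_inner_CS[OF q H1perD(4)[OF x]] by (simp add: H1per_nrm)
qed

text \<open>Mean zero makes the functional insensitive to constants, and then the Poincare
  inequality bounds it by the gradient norm.\<close>

lemma cell_problem:
 fixes h :: "real^3 => real"
 assumes h: "h : sq_int LY" and mean0: "(LINT y|LY. h y) = 0"
 shows "\<exists>s\<in>H1per. \<forall>z\<in>H1per. (LINT y|LY. hgrad UNIV s y \<bullet> hgrad UNIV z y) = (LINT y|LY. h y * z y)"
proof (rule H1per.riesz_representation[where C = "sq_norm LY h * 456"])
 fix x y assume xy: "x : H1per" "y : H1per"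
 show "(LINT t|LY. h t * (x + y) t) = (LINT t|LY. h t * x t) + (LINT t|LY. h t * y t)"
  using sq_int_mult[OF h H1perD(2)[OF xy(1)]] sq_int_mult[OF h H1perD(2)[OF xy(2)]]
  by (simp add: distrib_left)
next
 fix c x assume x: "x : H1per"
 show "(LINT t|LY. h t * (c *R x) t) = c * (LINT t|LY. h t * x t)" by (simp add: mult.left_commute)
next
 fix x assume x: "x : H1per"
 let ?x = "%t. x t - mean x"
 have xs: "?x : sq_int LY" by (intro sq_int_diff H1perD(2)[OF x] sq_int_const finite_Ycell)
 have "(LINT t|LY. h t * ?x t) = (LINT t|LY. h t * x t - mean x * h t)" by (simp add: algebra_simps)
 also have "... = (LINT t|LY. h t * x t)"
  using sq_int_mult[OF h H1perD(2)[OF x]] sq_int_integrable[OF finite_Ycell h] mean0 by simp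
 finally have "\<bar>LINT t|LY. h t * x t\<bar> <= sq_norm LY h * sq_norm LY ?x"
  using sq_inner_CS[OF h xs] by simp
 also have "... <= sq_norm LY h * (456 * nG x)" by (intro mult_left_mono H1per_poincare x) auto
 finally show "\<bar>LINT t|LY. h t * x t\<bar> <= sq_norm LY h * 456 * H1per.nrm x" by (simp add: H1per_nrm mult.assoc)
qed

text \<open>The mean of a gradient vanishes: dilating by \<open>1/\<epsilon>\<close> and testing with \<open>\<phi>\<close> gives the mean times
 the integral of \<open>\<phi>\<close> in the limit, but integrating by parts shows that it is of order \<open>\<epsilon>\<close>.\<close>

lemma gradient_mean_zero:
 assumes s: "s : H1per" shows "(LINT y|LY. hgrad UNIV s y $ i) = 0"
proof -
 define p where "p = bump 0 (vec 1)"
 have p: "p : test_functions UNIV"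
 proof (rule tfI[of _ "cbox 0 (vec 1)"])
  show "smooth p" unfolding p_def by (rule smooth_bump)
  show "p x = 0" if "x ~: cbox 0 (vec 1)" for x
   unfolding p_def using that box_subset_cbox by (intro bump_zero) blast
 qed auto
 obtain K where K: "compact K" "!!x. x ~: K ==> p x = 0" using tf_ex[OF p] by blast
 obtain K' where K': "compact K'" "!!x. x ~: K' ==> hX i p x = 0" using tf_ex[OF tf_hX[OF p]] by blast
 have pi: "integrable lebesgue p"
 proof -
  have "loc_int UNIV (%_. 1::real)" using weak_hgradD(1)[OF weak_hgrad_const open_UNIV] .
  from loc_int_tf[OF this p] show ?thesis by simp
 qed
 have pos: "(LINT x|lebesgue. p x) ~= 0"
 proof
  assume "(LINT x|lebesgue. p x) = 0"
  hence "AE x in lebesgue. p x = 0"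
   using pi by (subst (asm) integral_nonneg_eq_0_iff_AE) (auto simp: p_def bump_nonneg)
  hence "AE x in lebesgue. x ~: box 0 (vec 1 :: real^3)"
   by eventually_elim (use bump_pos[of _ 0 "vec 1"] in "fastforce simp: p_def")
  hence "box 0 (vec 1 :: real^3) : null_sets lebesgue" by (subst (asm) AE_iff_null_sets[symmetric]) auto
  hence "negligible (box 0 (vec 1 :: real^3))" by (simp add: negligible_iff_null_sets)
  hence "box 0 (vec 1 :: real^3) = {}" using open_not_negligible[OF open_box] by blast
  moreover have "vec (1/2) : box 0 (vec 1 :: real^3)" by (simp add: mem_box_cart)
  ultimately show False by blast
 qed
 let ?G = "%x. pgrad s x $ i"
 have Gper: "Y_periodic ?G" using pgrad_periodic by (simp add: Y_periodic_def)
 have Gint: "integrable LY ?G" by (intro sq_int_integrable finite_Ycell sq_int_component pgrad_sq s)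
 have sint: "integrable LY s" by (intro sq_int_integrable finite_Ycell H1perD s)
 have 1: "((%e. LINT x|lebesgue. p x * ?G (dil (1/e) x)) \<longlongrightarrow> (LINT x|lebesgue. p x) * (LINT y|LY. ?G y) / 8) (at_right 0)"
  by (rule averaging[OF tf_continuous[OF p] K Gper Gint])
 have 2: "((%e. LINT x|lebesgue. hX i p x * s (dil (1/e) x)) \<longlongrightarrow> (LINT x|lebesgue. hX i p x) * (LINT y|LY. s y) / 8) (at_right 0)"
  by (rule averaging[OF tf_continuous[OF tf_hX[OF p]] K' H1perD(1)[OF s] sint])
 have "((%e. - e * (LINT x|lebesgue. hX i p x * s (dil (1/e) x))) \<longlongrightarrow> - 0 * ((LINT x|lebesgue. hX i p x) * (LINT y|LY. s y) / 8)) (at_right 0)"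
  by (intro tendsto_intros 2)
 moreover have "\<forall>\<^sub>F e in at_right 0. - e * (LINT x|lebesgue. hX i p x * s (dil (1/e) x)) = (LINT x|lebesgue. p x * ?G (dil (1/e) x))"
  unfolding eventually_at_filter
 proof (rule always_eventually, intro allI impI)
  fix e :: real assume "e : {0<..}"
  hence e: "e > 0" "1/e > 0" by auto
  from weak_hgradD(3)[OF weak_hgrad_dil[OF weak_hgrad_pgrad[OF s] e(2)] open_UNIV p, of i]
  have "(LINT x|lebesgue. s (dil (1/e) x) * hX i p x) = - (1/e * (LINT x|lebesgue. p x * ?G (dil (1/e) x)))"
   by (simp add: mult.assoc mult.commute)
  thus "- e * (LINT x|lebesgue. hX i p x * s (dil (1/e) x)) = (LINT x|lebesgue. p x * ?G (dil (1/e) x))"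
   using e by (simp add: mult.commute[of "hX i p _"])
 qed
 ultimately have "((%e. LINT x|lebesgue. p x * ?G (dil (1/e) x)) \<longlongrightarrow> 0) (at_right 0)"
  by (auto intro: Lim_transform_eventually)
 from tendsto_unique[OF _ 1 this] pos have "(LINT y|LY. ?G y) = 0" by simp
 moreover have "(LINT y|LY. ?G y) = (LINT y|LY. hgrad UNIV s y $ i)"
  by (intro Bochner_Integration.integral_cong refl) (simp add: pgrad_Ycell)
 ultimately show ?thesis by simp
qed

text \<open>Periodising \<open>v\<close> turns an identity for periodic test functions into one on the whole group.\<close>

lemma periodization:
 fixes W :: "real^3 => real^2" and h :: "real^3 => real"
 assumes W: "Y_periodic W" "W : sq_int LY" and h: "Y_periodic h" "h : sq_int LY"
  and eq: "!!z. z : H1per ==> (LINT y|LY. W y \<bullet> hgrad UNIV z y) = (LINT y|LY. h y * z y)"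
  and v: "weak_hgrad UNIV v V" "v : sq_int lebesgue" "V : sq_int lebesgue"
  and K: "bounded K" "!!x. x ~: K ==> v x = 0 & V x = 0"
 shows "(LINT x|lebesgue. W x \<bullet> V x) = (LINT x|lebesgue. h x * v x)"
proof -
 have sum_shift: "(\<Sum>k | lat k \<odot> (lat m \<odot> y) : K. g (lat k \<odot> (lat m \<odot> y))) = (\<Sum>k | lat k \<odot> y : K. g (lat k \<odot> y))"
  for g :: "real^3 => 'b::euclidean_space" and m y
 proof -
  \<comment> \<open>Right multiplication of lattice points by \<open>lat m\<close>, with inverse
    \<open>t\<close>, permutes the lattice; this reindexing makes sums over all lattice translates
    periodic.\<close>
  define \<sigma> where "\<sigma> k = (SOME n. lat n = lat k \<odot> lat m)" for k
  have \<sigma>: "lat (\<sigma> k) = lat k \<odot> lat m" for k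
   unfolding \<sigma>_def by (rule someI_ex) (metis lat_mult)
  define t where "t k = (SOME n. lat n = lat k \<odot> lat (- m))" for k
  have t: "lat (t k) = lat k \<odot> lat (- m)" for k
   unfolding t_def by (rule someI_ex) (metis lat_mult)
  have "t (\<sigma> k) = k" "\<sigma> (t k) = k" for k
   by (simp_all add: lat_inj[symmetric] \<sigma> t lat_uminus[symmetric] hmul_assoc)
  thus ?thesis
   by (intro sum.reindex_bij_witness[of _ t \<sigma>]) (auto simp: \<sigma> t hmul_assoc[symmetric] lat_uminus[symmetric])
 qed
 have fin: "finite {k. \<exists>x\<in>S. lat k \<odot> x : K}" if S: "bounded S" for S
 proof -
  \<comment> \<open>If \<open>x\<close> is in \<open>S\<close> and \<open>lat k \<odot> x\<close> in
    \<open>K\<close>, then \<open>lat k\<close> is the product of the latter with the inverse of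
    \<open>x\<close> and lies in this compact set.\<close>
  define S' where "S' = (%(a, b). a \<odot> (- b)) ` (closure K \<times> closure S)"
  have "compact S'" unfolding S'_def using S K(1)
   by (intro compact_continuous_image compact_Times) (auto simp: case_prod_beta compact_closure intro!: continuous_intros)
  hence "finite (lidx ` S')" by (intro finite_lidx compact_imp_bounded)
  moreover have "{k. \<exists>x\<in>S. lat k \<odot> x : K} <= lidx ` S'"
  proof
   fix k assume "k : {k. \<exists>x\<in>S. lat k \<odot> x : K}"
   then obtain x where x: "x : S" "lat k \<odot> x : K" by blast
   have "lat k = (lat k \<odot> x) \<odot> (- x)" by simp
   hence "lat k : S'" unfolding S'_def using x closure_subset by (intro image_eqI[of _ _ "(lat k \<odot> x, x)"]) auto
   moreover have "lidx (lat k) = k" using lidx_lat[of 0 k] by (simp add: Ycell_iff)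
   ultimately show "k : lidx ` S'" by (metis imageI)
  qed
  ultimately show ?thesis by (rule finite_subset[rotated])
 qed
 define P where "P y = (\<Sum>k | lat k \<odot> y : K. v (lat k \<odot> y))" for y
 define Q where "Q y = (\<Sum>k | lat k \<odot> y : K. V (lat k \<odot> y))" for y
 have Pper: "Y_periodic P" and Qper: "Y_periodic Q"
  by (simp_all add: Y_periodic_def P_def Q_def sum_shift)
 \<comment> \<open>On a bounded set one finite index set works for all points, so measurability and
   weak gradients of \<open>P\<close> and \<open>Q\<close> reduce to finite sums.\<close>
 have local: "P x = (\<Sum>k\<in>{k. \<exists>x\<in>S. lat k \<odot> x : K}. v (lat k \<odot> x))" "Q x = (\<Sum>k\<in>{k. \<exists>x\<in>S. lat k \<odot> x : K}. V (lat k \<odot> x))"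
  if S: "bounded S" and x: "x : S" for S x
  unfolding P_def Q_def using x K(2) by (auto intro!: sum.mono_neutral_left fin[OF S])
 have vk: "(%x. v (lat k \<odot> x)) : sq_int lebesgue" "(%x. V (lat k \<odot> x)) : sq_int lebesgue" for k
 proof -
  show "(%x. v (lat k \<odot> x)) : sq_int lebesgue"
   using volmap_measurable[OF volmap_left sq_intD[OF v(2)]] volmap_integrable[OF volmap_left sq_int_norm[OF v(2)]] by (intro sq_intI)
  show "(%x. V (lat k \<odot> x)) : sq_int lebesgue"
   using volmap_measurable[OF volmap_left sq_intD[OF v(3)]] volmap_integrable[OF volmap_left sq_int_norm[OF v(3)]] by (intro sq_intI)
 qed
 have on: "f : sq_int lebesgue ==> S : sets lebesgue ==> f : sq_int (lebesgue_on S)" for f :: "real^3 => 'b::euclidean_space" and S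
  using sq_int_subset[of f UNIV S] by (simp add: lebesgue_on_UNIV_eq)
 have PS: "P : sq_int (lebesgue_on S)" "Q : sq_int (lebesgue_on S)" if S: "bounded S" "S : sets lebesgue" for S
 proof -
  let ?F = "{k. \<exists>x\<in>S. lat k \<odot> x : K}"
  have 1: "(%x. \<Sum>k\<in>?F. v (lat k \<odot> x)) : sq_int (lebesgue_on S)" "(%x. \<Sum>k\<in>?F. V (lat k \<odot> x)) : sq_int (lebesgue_on S)"
   by (intro sq_int_sum on vk S)+
  have 2: "AE x in lebesgue_on S. (\<Sum>k\<in>?F. v (lat k \<odot> x)) = P x" "AE x in lebesgue_on S. (\<Sum>k\<in>?F. V (lat k \<odot> x)) = Q x"
   using local[OF S(1)] by (auto intro!: AE_I2)
  show "P : sq_int (lebesgue_on S)" by (rule sq_int_AE_eq[OF S(2) 1(1) 2(1)])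
  show "Q : sq_int (lebesgue_on S)" by (rule sq_int_AE_eq[OF S(2) 1(2) 2(2)])
 qed
 note PY = PS[OF bounded_Ycell Ycell_lebesgue]
 have w: "weak_hgrad UNIV P Q"
 proof (rule weak_hgradI[OF open_UNIV])
  show "loc_int UNIV P" "loc_int UNIV Q" by (auto intro!: loc_int_sq PS compact_imp_bounded compact_lebesgue)
  fix p i assume p: "p : test_functions UNIV"
  obtain S1 where S1: "compact S1" "!!x. x ~: S1 ==> p x = 0" using tf_ex[OF p] by blast
  obtain S2 where S2: "compact S2" "!!x. x ~: S2 ==> hX i p x = 0" using tf_ex[OF tf_hX[OF p]] by blast
  have S: "bounded (S1 \<union> S2)" using S1 S2 by (auto intro: compact_imp_bounded)
  let ?F = "{k. \<exists>x\<in>S1 \<union> S2. lat k \<odot> x : K}"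
  have wk: "weak_hgrad UNIV (%x. v (lat k \<odot> x)) (%x. V (lat k \<odot> x))" for k by (rule weak_hgrad_left[OF v(1)])
  note dk = weak_hgradD[OF wk open_UNIV]
  have e1: "P x * hX i p x = (\<Sum>k\<in>?F. v (lat k \<odot> x) * hX i p x)" for x
   using local(1)[OF S, of x] S2(2)[of x] by (cases "x : S2") (auto simp: sum_distrib_right)
  have e2: "Q x $ i * p x = (\<Sum>k\<in>?F. V (lat k \<odot> x) $ i * p x)" for x
   using local(2)[OF S, of x] S1(2)[of x] by (cases "x : S1") (auto simp: sum_distrib_right)
  have i1: "integrable lebesgue (%x. v (lat k \<odot> x) * hX i p x)" for k
   using loc_int_tf[OF dk(1)[of k] tf_hX[OF p, of i]] by (simp add: mult.commute)
  have i2: "integrable lebesgue (%x. V (lat k \<odot> x) $ i * p x)" for k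
   using loc_int_tf[OF loc_int_component[OF dk(2)[of k], of i] p] by (simp add: mult.commute)
  have "(LINT x|lebesgue. P x * hX i p x) = (\<Sum>k\<in>?F. (LINT x|lebesgue. v (lat k \<odot> x) * hX i p x))"
   unfolding e1 by (rule Bochner_Integration.integral_sum[OF i1])
  also have "... = (\<Sum>k\<in>?F. - (LINT x|lebesgue. V (lat k \<odot> x) $ i * p x))"
   by (intro sum.cong refl dk(3)[OF p])
  also have "... = - (LINT x|lebesgue. Q x $ i * p x)"
   unfolding e2 Bochner_Integration.integral_sum[OF i2] by (simp add: sum_negf)
  finally show "(LINT x|lebesgue. P x * hX i p x) = - (LINT x|lebesgue. Q x $ i * p x)" .
 qed
 note r = H1perI[OF Pper PY(1) w PY(2)]
 let ?F = "{k. \<exists>x\<in>Ycell. lat k \<odot> x : K}"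
 have K': "lidx x : ?F" if "x : K" for x
  using that lrep_Ycell[of x] lat_lrep[of x] by (metis (mono_tags, lifting) mem_Collect_eq)
 note fF = fin[OF bounded_Ycell]
 have WK: "W : sq_int (lebesgue_on (closure K))" "h : sq_int (lebesgue_on (closure K))"
  using K(1) by (auto intro!: periodic_sq_int W h)
 have Kc: "closure K : sets lebesgue" by simp
 have out: "v x = 0 & V x = 0" if "x ~: closure K" for x using K(2)[of x] closure_subset[of K] that by blast
 have ii: "integrable lebesgue (%x. W x \<bullet> V x)" "integrable lebesgue (%x. h x * v x)"
  by (rule LINT_outside(2)[OF Kc, THEN iffD1, OF _ sq_int_inner[OF WK(1) on[OF v(3) Kc]]], simp add: out)
   (rule LINT_outside(2)[OF Kc, THEN iffD1, OF _ sq_int_mult[OF WK(2) on[OF v(2) Kc]]], simp add: out)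
 have t1: "(LINT x|lebesgue. W x \<bullet> V x) = (\<Sum>k\<in>?F. (LINT y|LY. W (lat k \<odot> y) \<bullet> V (lat k \<odot> y)))"
  using K(2) K' by (intro integral_tiles(2)[OF ii(1) fF]) force
 have t2: "(LINT x|lebesgue. h x * v x) = (\<Sum>k\<in>?F. (LINT y|LY. h (lat k \<odot> y) * v (lat k \<odot> y)))"
  using K(2) K' by (intro integral_tiles(2)[OF ii(2) fF]) force
 have ik: "integrable LY (%y. W y \<bullet> V (lat k \<odot> y))" "integrable LY (%y. h y * v (lat k \<odot> y))" for k
  by (intro sq_int_inner sq_int_mult W h on vk Ycell_lebesgue)+
 have "(LINT x|lebesgue. W x \<bullet> V x) = (LINT y|LY. (\<Sum>k\<in>?F. W y \<bullet> V (lat k \<odot> y)))"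
  unfolding t1 Bochner_Integration.integral_sum[OF ik(1)] by (simp add: Y_periodicD[OF W(1)])
 also have "... = (LINT y|LY. W y \<bullet> Q y)"
  by (intro Bochner_Integration.integral_cong refl) (simp add: local(2)[OF bounded_Ycell] inner_sum_right)
 also have "... = (LINT y|LY. Q y \<bullet> W y)" by (simp add: inner_commute)
 also have "... = (LINT y|LY. hgrad UNIV P y \<bullet> W y)"
  using r(2) by (intro H1per_inner_cong PY H1perD(4) r(1) W) (auto elim!: eventually_mono)
 also have "... = (LINT y|LY. h y * P y)" using eq[OF r(1)] by (simp add: inner_commute)
 also have "... = (LINT y|LY. (\<Sum>k\<in>?F. h y * v (lat k \<odot> y)))"
  by (intro Bochner_Integration.integral_cong refl) (simp add: local(1)[OF bounded_Ycell] sum_distrib_left)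
 also have "... = (LINT x|lebesgue. h x * v x)"
  unfolding t2 Bochner_Integration.integral_sum[OF ik(2)] by (simp add: Y_periodicD[OF h(1)])
 finally show ?thesis .
qed

section \<open>Fields of periodic gradients\<close>

lemma H1per_closed:
 assumes g: "g : sq_int LY" and s: "!!n::nat. s n : H1per"
  and lim: "(%n. sq_norm LY (%y. hgrad UNIV (s n) y - g y)) ----> 0"
 shows "\<exists>r\<in>H1per. (AE y in LY. g y = hgrad UNIV r y) & (%n. sq_norm LY (%y. hgrad UNIV (s n) y - hgrad UNIV r y)) ----> 0"
proof -
 note h = H1perD(4)[OF s]
 have "\<exists>l\<in>H1per. (%n. sq_norm LY (%x. hgrad UNIV (s n) x - hgrad UNIV l x)) ----> 0"
 proof (rule H1per_complete[OF s])
  fix e :: real assume "e > 0"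
  hence "\<forall>\<^sub>F n in sequentially. sq_norm LY (%y. hgrad UNIV (s n) y - g y) < e/2" using lim by (intro order_tendstoD) auto
  then obtain N where N: "!!n. n >= N ==> sq_norm LY (%y. hgrad UNIV (s n) y - g y) < e/2" by (auto simp: eventually_sequentially)
  have "sq_norm LY (%x. hgrad UNIV (s m) x - hgrad UNIV (s n) x) < e" if "m >= N" "n >= N" for m n
   using sq_norm_triangle_diff[OF h[of m] g h[of n]] N[OF that(1)] N[OF that(2)] sq_norm_commute[of LY g "hgrad UNIV (s n)"] by linarith
  thus "\<exists>N. \<forall>m\<ge>N. \<forall>n\<ge>N. sq_norm LY (%x. hgrad UNIV (s m) x - hgrad UNIV (s n) x) < e" by blast
 qed
 then obtain l where l: "l : H1per" "(%n. sq_norm LY (%x. hgrad UNIV (s n) x - hgrad UNIV l x)) ----> 0" by blast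
 have "(%n. sq_norm LY (%y. hgrad UNIV (s n) y - g y) + sq_norm LY (%x. hgrad UNIV (s n) x - hgrad UNIV l x)) ----> 0 + 0"
  by (intro tendsto_add lim l)
 moreover have "sq_norm LY (%y. g y - hgrad UNIV l y) <= sq_norm LY (%y. hgrad UNIV (s n) y - g y) + sq_norm LY (%x. hgrad UNIV (s n) x - hgrad UNIV l x)" for n
  using sq_norm_triangle_diff[OF g h[of n] H1perD(4)[OF l(1)]] sq_norm_commute[of LY g "hgrad UNIV (s n)"] by simp
 ultimately have "sq_norm LY (%y. g y - hgrad UNIV l y) <= 0 + 0" by (intro LIMSEQ_le_const) blast+
 hence "sq_norm LY (%y. g y - hgrad UNIV l y) = 0" using sq_norm_nonneg[of LY "%y. g y - hgrad UNIV l y"] by linarith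
 from sq_norm_zero_AE[OF sq_int_diff[OF g H1perD(4)[OF l(1)]] this] l show ?thesis by auto
qed

text \<open>Only the field is recorded, not its potentials: the potentials are determined up to
  constants depending on \<open>x\<close> and could not be chosen measurably without effort. They
  are recovered at the end by \<open>Kset_represent\<close>.\<close>

definition Kset :: "(real^3) set => ((real^3) \<times> (real^3) => real^2) set" where
 "Kset \<Omega> = {\<Psi> : sq_int (lebesgue_on (\<Omega> \<times> Ycell)).
   AE x in lebesgue_on \<Omega>. \<exists>\<xi>\<in>H1per. AE y in LY. \<Psi> (x, y) = hgrad UNIV \<xi> y}"

text \<open>Closed under sums and products, hence containing every polynomial on the product by
  induction; the indexed form of such sums is extracted only for the vector valued analogue, in
  \<open>field_tensor_sum\<close>.\<close>

inductive scalar_tensor :: "((real^3) \<times> (real^3) => real) => bool" where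
 base: "real_polynomial_function a ==> real_polynomial_function b ==> scalar_tensor (%z. a (fst z) * b (snd z))"
| add: "scalar_tensor f ==> scalar_tensor g ==> scalar_tensor (%z. f z + g z)"

inductive field_tensor :: "((real^3) \<times> (real^3) => real^2) => bool" where
 base: "real_polynomial_function a ==> continuous_on UNIV Q ==> field_tensor (%z. a (fst z) *R Q (snd z))"
| add: "field_tensor f ==> field_tensor g ==> field_tensor (%z. f z + g z)"

lemma scalar_tensor_mult: "scalar_tensor f ==> scalar_tensor g ==> scalar_tensor (%z. f z * g z)"
proof (induction rule: scalar_tensor.induct)
 case (base a b)
 note ab = base(1,2)
 from base(3) show ?case
 proof (induction rule: scalar_tensor.induct)
  case (base a' b')
  have "scalar_tensor (%z. (%x. a x * a' x) (fst z) * (%y. b y * b' y) (snd z))"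
   by (intro scalar_tensor.base real_polynomial_function.intros(4) ab base)
  thus ?case by (simp add: mult_ac)
 qed (simp add: distrib_left scalar_tensor.add)
qed (simp add: distrib_right scalar_tensor.add)

lemma polynomial_scalar_tensor:
 fixes h :: "(real^3) \<times> (real^3) => real"
 shows "real_polynomial_function h ==> scalar_tensor h"
proof (induction rule: real_polynomial_function.induct)
 case (linear f)
 have "bounded_linear (%x::real^3. (x, 0::real^3))" "bounded_linear (%y::real^3. (0::real^3, y))"
  by (intro bounded_linear_Pair bounded_linear_ident bounded_linear_zero)+
 from bounded_linear_compose[OF linear this(1)] bounded_linear_compose[OF linear this(2)]
 have "scalar_tensor (%z. f (fst z, 0) * 1 + 1 * f (0, snd z))"
  using scalar_tensor.base[of "%x. f (x, 0)" "%_. 1"] scalar_tensor.base[of "%_. 1" "%y. f (0, y)"] by (intro scalar_tensor.add) auto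
 moreover have "f (fst z, 0) * 1 + 1 * f (0, snd z) = f z" for z
  using linear_add[OF bounded_linear.linear[OF linear], of "(fst z, 0)" "(0, snd z)"] by simp
 ultimately show ?case by simp
next
 case (const c)
 thus ?case using scalar_tensor.base[of "%_. c" "%_. 1"] by auto
qed (auto intro: scalar_tensor.add scalar_tensor_mult)

lemma field_tensor_scalar: "scalar_tensor f ==> field_tensor (%z. f z *R v)"
proof (induction rule: scalar_tensor.induct)
 case (base a b)
 have "field_tensor (%z. a (fst z) *R (%y. b y *R v) (snd z))"
  by (intro field_tensor.base base continuous_intros smooth_continuous[OF smooth_polynomial])
 thus ?case by simp
qed (simp add: scaleR_add_left field_tensor.add)

lemma field_tensor_sum:
 "field_tensor p ==> \<exists>N t Q. (\<forall>j<N::nat. real_polynomial_function (t j) & continuous_on UNIV (Q j)) & p = (%z. \<Sum>j<N. t j (fst z) *R Q j (snd z))"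
proof (induction rule: field_tensor.induct)
 case (base a Q)
 thus ?case by (intro exI[of _ 1] exI[of _ "%_. a"] exI[of _ "%_. Q"]) simp
next
 case (add f g)
 then obtain N a P M b Q where *: "\<forall>j<N::nat. real_polynomial_function (a j) & continuous_on UNIV (P j)" "f = (%z. \<Sum>j<N. a j (fst z) *R P j (snd z))"
  "\<forall>j<M::nat. real_polynomial_function (b j) & continuous_on UNIV (Q j)" "g = (%z. \<Sum>j<M. b j (fst z) *R Q j (snd z))" by blast
 have "(\<Sum>j<N + M. F j) = (\<Sum>j<N. F j) + (\<Sum>j<M. F (N + j))" for F :: "nat => real^2"
  by (induction M) (auto simp: add.assoc)
 with * show ?case
  by (intro exI[of _ "N + M"] exI[of _ "%j. if j < N then a j else b (j - N)"] exI[of _ "%j. if j < N then P j else Q (j - N)"]) auto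
qed

lemma sq_int_continuous:
 fixes f :: "'a::euclidean_space => 'b::euclidean_space"
 assumes "continuous_on UNIV f" "bounded S" "S : sets lebesgue" shows "f : sq_int (lebesgue_on S)"
proof -
 have "bounded (f ` closure S)" using assms
  by (intro compact_imp_bounded compact_continuous_image) (auto simp: compact_closure intro: continuous_on_subset)
 then obtain C where C: "!!x. x : closure S ==> norm (f x) <= C" unfolding bounded_iff by auto
 show ?thesis
  using C closure_subset[of S] assms
  by (intro sq_int_bounded[OF finite_measure_lebesgue_on, of S _ C] measurable_restrict_space1 lebesgue_borelI
    borel_measurable_continuous_onI AE_I2) auto
qed

section \<open>Closedness and density for fields of periodic gradients\<close>

locale bounded_open =
 fixes \<Omega> :: "(real^3) set"
 assumes \<Omega>: "open \<Omega>" "bounded \<Omega>"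
begin

abbreviation "LO \<equiv> lebesgue_on \<Omega>"
abbreviation "LP \<equiv> lebesgue_on (\<Omega> \<times> Ycell)"

lemma \<Omega>_borel: "\<Omega> : sets borel" and \<Omega>_lebesgue: "\<Omega> : sets lebesgue" using \<Omega> by auto

lemmas OY = \<Omega>_borel Ycell_borel

lemma LP_lebesgue: "\<Omega> \<times> Ycell : sets lebesgue" by (rule lebesgue_sets(3)[OF OY])

lemma finite_LO: "finite_measure LO" by (rule finite_measure_lebesgue_on[OF \<Omega>_lebesgue \<Omega>(2)])

lemma bounded_LP: "bounded (\<Omega> \<times> Ycell)" by (intro bounded_Times \<Omega> bounded_Ycell)

lemma finite_LP: "finite_measure LP" by (rule finite_measure_lebesgue_on[OF LP_lebesgue bounded_LP])

text \<open>By Fubini the squared section norms tend to zero in L1 over the domain, hence almost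
  everywhere along a subsequence.\<close>

lemma section_subseq:
 fixes h :: "nat => (real^3) \<times> (real^3) => 'b::euclidean_space"
 assumes h: "!!n. h n : sq_int LP" and lim: "(%n. sq_norm LP (h n)) ----> 0"
 shows "\<exists>r. strict_mono r & (AE x in LO. (%n. sq_norm LY (%y. h (r n) (x, y))) ----> 0)"
proof -
 have i: "integrable LO (%x. (sq_norm LY (%y. h n (x, y)))^2)" for n by (rule sq_int_sections(2)[OF OY h])
 have "(%n. (sq_norm LP (h n))^2) ----> 0^2" by (intro tendsto_intros lim)
 hence "(%n. LINT x|LO. norm ((sq_norm LY (%y. h n (x, y)))^2)) ----> 0"
  by (simp add: sq_int_sections(3)[OF OY h])
 from tendsto_L1_AE_subseq[OF i this] obtain r :: "nat => nat" where r: "strict_mono r"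
  and ae: "AE x in LO. (%n. (sq_norm LY (%y. h (r n) (x, y)))^2) ----> 0" by blast
 from ae have "AE x in LO. (%n. sq_norm LY (%y. h (r n) (x, y))) ----> 0"
 proof eventually_elim
  case (elim x)
  from tendsto_real_sqrt[OF elim] show ?case by simp
 qed
 with r show ?thesis by blast
qed

lemma KsetD: "P : Kset \<Omega> ==> P : sq_int LP"
 "P : Kset \<Omega> ==> AE x in LO. \<exists>s\<in>H1per. AE y in LY. P (x, y) = hgrad UNIV s y"
 by (auto simp: Kset_def)

text \<open>Along a subsequence almost every section converges, and the periodic gradients are
  closed in the square integrable functions on the cell by \<open>H1per_closed\<close>.\<close>

lemma Kset_closed:
 assumes F: "!!n. F n : Kset \<Omega>" and P: "P : sq_int LP" and lim: "(%n. sq_norm LP (%p. F n p - P p)) ----> 0"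
 shows "P : Kset \<Omega>"
proof -
 obtain r where r: "strict_mono r" and ae: "AE x in LO. (%n. sq_norm LY (%y. F (r n) (x, y) - P (x, y))) ----> 0"
  using section_subseq[OF sq_int_diff[OF KsetD(1)[OF F] P] lim] by blast
 have "AE x in LO. \<forall>n. \<exists>a\<in>H1per. AE y in LY. F n (x, y) = hgrad UNIV a y"
  unfolding AE_all_countable using KsetD(2)[OF F] by blast
 with ae sq_int_sections(1)[OF OY P]
 have "AE x in LO. \<exists>a\<in>H1per. AE y in LY. P (x, y) = hgrad UNIV a y"
 proof eventually_elim
  case (elim x)
  obtain s where s: "!!n. s n : H1per" "!!n. AE y in LY. F n (x, y) = hgrad UNIV (s n) y" using elim(3) by metis
  have "sq_norm LY (%y. F (r n) (x, y) - P (x, y)) = sq_norm LY (%y. hgrad UNIV (s (r n)) y - P (x, y))" for n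
  proof (rule sq_norm_cong_AE)
   show m: "(%y. hgrad UNIV (s (r n)) y - P (x, y)) : bm LY"
    by (rule sq_intD[OF sq_int_diff[OF H1perD(4)[OF s(1)] elim(2)]])
   show e: "AE y in LY. F (r n) (x, y) - P (x, y) = hgrad UNIV (s (r n)) y - P (x, y)"
    using s(2)[of "r n"] by eventually_elim simp
   show "(%y. F (r n) (x, y) - P (x, y)) : bm LY"
    by (rule lebesgue_on_measurable_AE[OF Ycell_lebesgue m]) (use e in "auto elim!: eventually_mono")
  qed
  with elim(1) have "(%n. sq_norm LY (%y. hgrad UNIV (s (r n)) y - P (x, y))) ----> 0" by simp
  from H1per_closed[OF elim(2) s(1) this] show ?case by blast
 qed
 with P show ?thesis by (simp add: Kset_def)
qed

lemma Kset_add: assumes "\<Psi> : Kset \<Omega>" "P : Kset \<Omega>" shows "(%p. \<Psi> p + P p) : Kset \<Omega>"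
proof -
 have "AE x in LO. \<exists>s\<in>H1per. AE y in LY. \<Psi> (x, y) + P (x, y) = hgrad UNIV s y"
  using KsetD(2)[OF assms(1)] KsetD(2)[OF assms(2)]
 proof eventually_elim
  case (elim x)
  then obtain f g where fg: "f : H1per" "g : H1per" and h: "AE y in LY. \<Psi> (x, y) = hgrad UNIV f y" "AE y in LY. P (x, y) = hgrad UNIV g y" by blast
  have "AE y in LY. \<Psi> (x, y) + P (x, y) = hgrad UNIV (%x. f x + g x) y"
   using h H1per_add(2)[OF fg] by eventually_elim simp
  thus ?case using H1per_add(1)[OF fg] by blast
 qed
 thus ?thesis using sq_int_add[OF KsetD(1)[OF assms(1)] KsetD(1)[OF assms(2)]] by (simp add: Kset_def)
qed

lemma Kset_scale: assumes "P : Kset \<Omega>" shows "(%p. c *R P p) : Kset \<Omega>"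
proof -
 have "AE x in LO. \<exists>s\<in>H1per. AE y in LY. c *R P (x, y) = hgrad UNIV s y"
  using KsetD(2)[OF assms]
 proof eventually_elim
  case (elim x)
  then obtain f where f: "f : H1per" and h: "AE y in LY. P (x, y) = hgrad UNIV f y" by blast
  have "AE y in LY. c *R P (x, y) = hgrad UNIV (%x. c * f x) y"
   using h H1per_cmult(2)[OF f, of c] by eventually_elim simp
  thus ?case using H1per_cmult(1)[OF f] by blast
 qed
 thus ?thesis using sq_int_scale[OF KsetD(1)[OF assms]] by (simp add: Kset_def)
qed

lemma Kset_diff: "\<Psi> : Kset \<Omega> ==> P : Kset \<Omega> ==> (%p. \<Psi> p - P p) : Kset \<Omega>"
 using Kset_add[OF _ Kset_scale[of P "-1"]] by simp

lemma Kset_tensor: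
 assumes "t : sq_int LO" "s : H1per" shows "(%p. t (fst p) *R hgrad UNIV s (snd p)) : Kset \<Omega>"
proof -
 have "\<exists>z\<in>H1per. AE y in LY. t x *R hgrad UNIV s y = hgrad UNIV z y" for x
  using H1per_cmult[OF assms(2), of "t x"] by (intro bexI[of _ "%y. t x * s y"]) (auto elim!: eventually_mono)
 thus ?thesis using sq_int_tensor(1)[OF OY assms(1) H1perD(4)[OF assms(2)]] by (simp add: Kset_def)
qed

lemma Kset_sum: "(!!j. j : J ==> F j : Kset \<Omega>) ==> (%p. \<Sum>j\<in>J. F j p) : Kset \<Omega>"
proof (induction J rule: infinite_finite_induct)
 case (insert j J) thus ?case using Kset_add[of "F j" "%p. \<Sum>j\<in>J. F j p"] by simp
qed (use Kset_tensor[OF sq_int_zero H1per_const(1)] in simp_all)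

lemma Kset_orthogonal:
 assumes P: "P : Kset \<Omega>" and t: "t : sq_int LO" and w: "w : sq_int LY"
  and orth: "!!z. z : H1per ==> (LINT y|LY. w y \<bullet> hgrad UNIV z y) = 0"
 shows "(LINT p|LP. (t (fst p) *R w (snd p)) \<bullet> P p) = 0"
proof -
 have i: "integrable LP (%p. (t (fst p) *R w (snd p)) \<bullet> P p)"
  by (rule sq_int_inner[OF sq_int_tensor(1)[OF OY t w] KsetD(1)[OF P]])
 have "AE x in LO. (LINT y|LY. (t (fst (x, y)) *R w (snd (x, y))) \<bullet> P (x, y)) = 0"
  using KsetD(2)[OF P] sq_int_sections(1)[OF OY KsetD(1)[OF P]]
 proof eventually_elim
  case (elim x)
  then obtain z where z: "z : H1per" "AE y in LY. P (x, y) = hgrad UNIV z y" by blast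
  have "(LINT y|LY. (t (fst (x, y)) *R w (snd (x, y))) \<bullet> P (x, y)) = t x * (LINT y|LY. P (x, y) \<bullet> w y)"
   by (simp add: inner_commute)
  also have "(LINT y|LY. P (x, y) \<bullet> w y) = (LINT y|LY. hgrad UNIV z y \<bullet> w y)"
   by (rule H1per_inner_cong[OF elim(2) H1perD(4)[OF z(1)] z(2) w])
  also have "... = 0" using orth[OF z(1)] by (simp add: inner_commute)
  finally show ?case by simp
 qed
 hence "(LINT x|LO. LINT y|LY. (t (fst (x, y)) *R w (snd (x, y))) \<bullet> P (x, y)) = (LINT x|LO. 0)"
  using fubini_lebesgue(2)[OF OY i] by (intro integral_cong_AE) auto
 thus ?thesis unfolding fubini_lebesgue(3)[OF OY i] by simp
qed

text \<open>A polynomial approximant already is a sum of products. One cutoff in \<open>x\<close>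
  multiplies all first factors and turns them into test functions.\<close>

lemma tensor_dense:
 fixes P :: "(real^3) \<times> (real^3) => real^2"
 assumes P: "P : sq_int LP" and e: "e > 0"
 shows "\<exists>N s Q. (\<forall>j<N::nat. s j : test_functions \<Omega> & s j : sq_int LO & Q j : sq_int LY) \<and>
   sq_norm LP (%p. P p - (\<Sum>j<N. s j (fst p) *R Q j (snd p))) < e"
proof -
 obtain p where p: "polynomial_function p" "p : sq_int LP" "sq_norm LP (%z. P z - p z) < e/2"
  using polynomial_dense[OF LP_lebesgue bounded_LP P, of "e/2"] e by auto
 have "real_polynomial_function (%z. p z $ i)" for i
  using p(1) bounded_linear_vec_nth[of i] by (auto simp: polynomial_function_def o_def)
 hence "field_tensor (%z. p z $ 1 *R axis 1 1 + p z $ 2 *R axis 2 1)"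
  by (intro field_tensor.add field_tensor_scalar polynomial_scalar_tensor)
 moreover have "(%z. p z $ 1 *R axis 1 1 + p z $ 2 *R axis 2 1) = p" by (auto simp: fun_eq_iff vec_eq_iff forall_2 axis_def)
 ultimately have pt: "field_tensor p" by simp
 obtain N s Q where tq: "!!j. j < N ==> real_polynomial_function (s j) & continuous_on UNIV (Q j)"
  and pe: "p = (%z. \<Sum>j<N::nat. s j (fst z) *R (Q j (snd z) :: real^2))" using field_tensor_sum[OF pt] by blast
 obtain c where c: "!!n::nat. c n : test_functions \<Omega>" "!!n x. 0 <= c n x & c n x <= 1"
  "!!x. x : \<Omega> ==> (%n. c n x) ----> 1" using cutoff_exists[OF \<Omega>(1)] by blast
 have cm: "(%z. c n (fst z)) : bm LP" for n
  by (intro measurable_fst_lebesgue[OF OY] measurable_restrict_space1 lebesgue_borelI borel_measurable_continuous_onI tf_continuous[OF c(1)])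
 note pm = sq_intD[OF p(2)]
 have "(%n. sq_norm LP (%z. c n (fst z) *R p z - p z)) ----> 0"
 proof (rule sq_norm_tendsto_DCT[where w = p and C = 1])
  show "AE z in LP. norm (c n (fst z) *R p z - p z) <= 1 * norm (p z)" for n
  proof (rule AE_I2)
   fix z
   have "c n (fst z) *R p z - p z = - ((1 - c n (fst z)) *R p z)" by (simp add: algebra_simps)
   thus "norm (c n (fst z) *R p z - p z) <= 1 * norm (p z)" using c(2)[of n "fst z"]
    by (simp add: mult_left_le_one_le)
  qed
  show "AE z in LP. (%n. c n (fst z) *R p z) ----> p z"
  proof (rule AE_I2)
   fix z assume "z : space LP"
   hence "(%n. c n (fst z) *R p z) ----> 1 *R p z" by (intro tendsto_intros c) auto
   thus "(%n. c n (fst z) *R p z) ----> p z" by simp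
  qed
 qed (use pm cm p in auto)
 then obtain n where n: "sq_norm LP (%z. c n (fst z) *R p z - p z) < e/2" using LIMSEQ_0_ex_less[of _ "e/2"] e by auto
 define s' where "s' j x = s j x * c n x" for j x
 have t: "s' j : test_functions \<Omega> & s' j : sq_int LO & Q j : sq_int LY" if "j < N" for j
 proof -
  have "s' j : test_functions \<Omega>" unfolding s'_def using tq[OF that] by (intro tf_mult c smooth_polynomial) auto
  thus ?thesis using tq[OF that] \<Omega>(2) \<Omega>_lebesgue bounded_Ycell tf_continuous by (auto intro!: sq_int_continuous)
 qed
 have e1: "(%z. \<Sum>j<N. s' j (fst z) *R Q j (snd z)) = (%z. c n (fst z) *R p z)"
  by (simp add: pe s'_def scaleR_sum_right mult.commute)
 have cp: "(%z. c n (fst z) *R p z) : sq_int LP"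
  using c(2)[of n] by (intro sq_int_bounded_mult[OF p(2) cm, of n 1]) (auto simp: abs_le_iff intro: order_trans[of _ 0])
 have "sq_norm LP (%z. P z - c n (fst z) *R p z) <= sq_norm LP (%z. P z - p z) + sq_norm LP (%z. p z - c n (fst z) *R p z)"
  by (rule sq_norm_triangle_diff[OF P p(2) cp])
 also have "... < e" using n p(3) sq_norm_commute[of LP p "%z. c n (fst z) *R p z"] by simp
 finally have "sq_norm LP (%z. P z - (\<Sum>j<N. s' j (fst z) *R Q j (snd z))) < e"
  using fun_cong[OF e1] by simp
 thus ?thesis using t by blast
qed

text \<open>Prepares both density results: each second factor is a periodic gradient plus a
  remainder orthogonal to all of them. \<open>Kset_dense\<close> keeps the gradients and
  \<open>Kset_perp_dense\<close> keeps the remainders.\<close>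

lemma tensor_split:
 assumes "e > 0" "P : sq_int LP"
 obtains N s Q r where "!!j. j < N ==> s j : test_functions \<Omega> & s j : sq_int LO & Q j : sq_int LY & r j : H1per"
  "!!j z. j < N ==> z : H1per ==> (LINT y|LY. (Q j y - hgrad UNIV (r j) y) \<bullet> hgrad UNIV z y) = 0"
  "sq_norm LP (%p. P p - (\<Sum>j<N::nat. s j (fst p) *R Q j (snd p))) < e"
proof -
 obtain N s Q where t: "!!j. j < N ==> s j : test_functions \<Omega> & s j : sq_int LO & Q j : sq_int LY"
  and ap: "sq_norm LP (%p. P p - (\<Sum>j<N::nat. s j (fst p) *R Q j (snd p))) < e"
  using tensor_dense[OF assms(2,1)] by blast
 have "\<exists>r\<in>H1per. \<forall>z\<in>H1per. (LINT y|LY. (Q j y - hgrad UNIV r y) \<bullet> hgrad UNIV z y) = 0" if "j < N" for j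
 proof -
  have q: "Q j : sq_int LY" using t[OF that] by blast
  obtain r where r: "r : H1per" "!!z. z : H1per ==> (LINT y|LY. hgrad UNIV r y \<bullet> hgrad UNIV z y) = (LINT y|LY. Q j y \<bullet> hgrad UNIV z y)"
   using gradient_projection[OF q] by blast
  have "(LINT y|LY. (Q j y - hgrad UNIV r y) \<bullet> hgrad UNIV z y) = 0" if "z : H1per" for z
   using r(2)[OF that] sq_int_inner[OF q H1perD(4)[OF that]] sq_int_inner[OF H1perD(4)[OF r(1)] H1perD(4)[OF that]]
   by (simp add: inner_diff_left)
  with r(1) show ?thesis by blast
 qed
 hence "\<forall>j. \<exists>r. j < N --> r : H1per & (\<forall>z\<in>H1per. (LINT y|LY. (Q j y - hgrad UNIV r y) \<bullet> hgrad UNIV z y) = 0)" by blast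
 from choice[OF this] obtain r where x: "!!j. j < N ==> r j : H1per & (\<forall>z\<in>H1per. (LINT y|LY. (Q j y - hgrad UNIV (r j) y) \<bullet> hgrad UNIV z y) = 0)" by blast
 show ?thesis by (rule that[of N s Q r, OF _ _ ap]) (use t x in auto)
qed

lemma Kset_orthogonal_sum:
 assumes P: "P : Kset \<Omega>" and t: "!!j. j < N ==> s j : sq_int LO & w j : sq_int LY"
  and orth: "!!j z. j < N ==> z : H1per ==> (LINT y|LY. w j y \<bullet> hgrad UNIV z y) = 0"
 shows "(LINT p|LP. (\<Sum>j<N::nat. s j (fst p) *R w j (snd p)) \<bullet> P p) = 0"
proof -
 have i: "integrable LP (%p. (s j (fst p) *R w j (snd p)) \<bullet> P p)" if "j < N" for j
  using t[OF that] by (intro sq_int_inner sq_int_tensor(1)[OF OY] KsetD(1)[OF P]) auto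
 have "(LINT p|LP. (\<Sum>j<N. s j (fst p) *R w j (snd p)) \<bullet> P p) = (\<Sum>j<N. (LINT p|LP. (s j (fst p) *R w j (snd p)) \<bullet> P p))"
  unfolding inner_sum_left using i by (intro Bochner_Integration.integral_sum) auto
 also have "... = 0" using t orth by (intro sum.neutral ballI Kset_orthogonal[OF P]) auto
 finally show ?thesis .
qed

lemma tensor_sum_sq:
 "(!!j. j < N ==> t j : sq_int LO & w j : sq_int LY) ==> (%p. \<Sum>j<N::nat. t j (fst p) *R w j (snd p)) : sq_int LP"
 for w :: "nat => real^3 => 'b::euclidean_space"
 by (intro sq_int_sum sq_int_tensor(1)[OF OY]) auto

lemma sq_norm_le_of_inner:
 assumes Z: "Z : sq_int M" and R: "R : sq_int M" and e: "(LINT p|M. Z p \<bullet> Z p) = (LINT p|M. Z p \<bullet> R p)"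
 shows "sq_norm M Z <= sq_norm M R"
proof (cases "sq_norm M Z = 0")
 case False
 have "sq_norm M Z * sq_norm M Z = (LINT p|M. Z p \<bullet> R p)"
  unfolding e[symmetric] power2_eq_square[symmetric] sq_norm_sq power2_norm_eq_inner ..
 also have "... <= sq_norm M Z * sq_norm M R" using sq_inner_CS[OF Z R] by simp
 finally show ?thesis using False sq_norm_nonneg[of M Z] by simp
qed simp

text \<open>Projecting the second factors of an approximating tensor does not increase the error.\<close>

lemma Kset_dense:
 assumes P: "P : Kset \<Omega>" and e: "e > 0"
 shows "\<exists>N s a. (\<forall>j<N::nat. s j : test_functions \<Omega> & s j : sq_int LO & a j : H1per) \<and>
   sq_norm LP (%p. P p - (\<Sum>j<N. s j (fst p) *R hgrad UNIV (a j) (snd p))) < e"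
proof -
 note Ps = KsetD(1)[OF P]
 obtain N s Q a where t: "!!j. j < N ==> s j : test_functions \<Omega> & s j : sq_int LO & Q j : sq_int LY & a j : H1per"
  and o: "!!j r. j < N ==> r : H1per ==> (LINT y|LY. (Q j y - hgrad UNIV (a j) y) \<bullet> hgrad UNIV r y) = 0"
  and ap: "sq_norm LP (%p. P p - (\<Sum>j<N::nat. s j (fst p) *R Q j (snd p))) < e"
  by (rule tensor_split[OF e Ps]) (rule that[rotated 2], assumption, blast+)
 let ?S = "%p. \<Sum>j<N. s j (fst p) *R Q j (snd p)" and ?G = "%p. \<Sum>j<N. s j (fst p) *R hgrad UNIV (a j) (snd p)"
 let ?W = "%p. \<Sum>j<N. s j (fst p) *R (Q j (snd p) - hgrad UNIV (a j) (snd p))"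
 have Gk: "?G : Kset \<Omega>" using t by (intro Kset_sum Kset_tensor) auto
 have Z: "(%p. P p - ?G p) : Kset \<Omega>" by (rule Kset_diff[OF P Gk])
 have tw: "s j : sq_int LO & (%y. Q j y - hgrad UNIV (a j) y) : sq_int LY" if "j < N" for j
  using t[OF that] by (auto intro!: sq_int_diff H1perD(4))
 have Ss: "?S : sq_int LP" using t by (intro tensor_sum_sq) auto
 have Ws: "?W : sq_int LP" using tensor_sum_sq[OF tw] .
 have z: "(LINT p|LP. (P p - ?G p) \<bullet> ?W p) = 0"
  using Kset_orthogonal_sum[OF Z tw o] by (simp add: inner_commute)
 have We: "?W p = ?S p - ?G p" for p by (simp add: scaleR_diff_right sum_subtractf)
 have "(LINT p|LP. (P p - ?G p) \<bullet> (P p - ?G p)) = (LINT p|LP. (P p - ?G p) \<bullet> (P p - ?S p) + (P p - ?G p) \<bullet> ?W p)"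
  unfolding We by (simp add: inner_add_right[symmetric])
 also have "... = (LINT p|LP. (P p - ?G p) \<bullet> (P p - ?S p))"
  using z by (subst Bochner_Integration.integral_add[OF sq_int_inner[OF KsetD(1)[OF Z] sq_int_diff[OF Ps Ss]] sq_int_inner[OF KsetD(1)[OF Z] Ws]]) simp
 finally have "sq_norm LP (%p. P p - ?G p) <= sq_norm LP (%p. P p - ?S p)"
  by (rule sq_norm_le_of_inner[OF KsetD(1)[OF Z] sq_int_diff[OF Ps Ss]])
 with ap t show ?thesis by (intro exI[of _ N] exI[of _ s] exI[of _ a]) auto
qed

text \<open>Let \<open>S\<close>, \<open>G\<close> and \<open>W\<close> be the approximating tensor,
  its gradient part and its remainder. Both \<open>P\<close> and \<open>W\<close> are orthogonal to
  \<open>G\<close>, so the square of \<open>G\<close> equals its pairing with \<open>S - P\<close>.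
  Hence \<open>G\<close> is no larger than the error \<open>e/2\<close>, and dropping it costs
  another \<open>e/2\<close>.\<close>

lemma Kset_perp_dense:
 assumes P: "P : sq_int LP" and perp: "!!\<Psi>. \<Psi> : Kset \<Omega> ==> (LINT p|LP. P p \<bullet> \<Psi> p) = 0" and e: "e > 0"
 shows "\<exists>N s w. (\<forall>j<N::nat. s j : test_functions \<Omega> & s j : sq_int LO & w j : sq_int LY \<and>
    (\<forall>z\<in>H1per. (LINT y|LY. w j y \<bullet> hgrad UNIV z y) = 0)) \<and>
   sq_norm LP (%p. P p - (\<Sum>j<N. s j (fst p) *R w j (snd p))) < e"
proof -
 have e2: "e/2 > 0" using e by simp
 obtain N s Q r where t: "!!j. j < N ==> s j : test_functions \<Omega> & s j : sq_int LO & Q j : sq_int LY & r j : H1per"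
  and o: "!!j z. j < N ==> z : H1per ==> (LINT y|LY. (Q j y - hgrad UNIV (r j) y) \<bullet> hgrad UNIV z y) = 0"
  and ap: "sq_norm LP (%p. P p - (\<Sum>j<N::nat. s j (fst p) *R Q j (snd p))) < e/2"
  by (rule tensor_split[OF e2 P]) (rule that[rotated 2], assumption, blast+)
 let ?S = "%p. \<Sum>j<N. s j (fst p) *R Q j (snd p)" and ?G = "%p. \<Sum>j<N. s j (fst p) *R hgrad UNIV (r j) (snd p)"
 let ?w = "%j y. Q j y - hgrad UNIV (r j) y"
 let ?W = "%p. \<Sum>j<N. s j (fst p) *R ?w j (snd p)"
 have Gk: "?G : Kset \<Omega>" using t by (intro Kset_sum Kset_tensor) auto
 note Gs = KsetD(1)[OF Gk]
 have tw: "s j : sq_int LO & ?w j : sq_int LY" if "j < N" for j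
  using t[OF that] by (auto intro!: sq_int_diff H1perD(4))
 have Ss: "?S : sq_int LP" using t by (intro tensor_sum_sq) auto
 have Ws: "?W : sq_int LP" using tensor_sum_sq[OF tw] .
 have R: "(%p. ?S p - P p) : sq_int LP" by (rule sq_int_diff[OF Ss P])
 have We: "?W p = ?S p - ?G p" for p by (simp add: scaleR_diff_right sum_subtractf)
 have zW: "(LINT p|LP. ?W p \<bullet> ?G p) = 0" by (rule Kset_orthogonal_sum[OF Gk tw o])
 have zP: "(LINT p|LP. P p \<bullet> ?G p) = 0" by (rule perp[OF Gk])
 have "(LINT p|LP. ?G p \<bullet> ?G p) = (LINT p|LP. (?G p \<bullet> (?S p - P p) - ?W p \<bullet> ?G p) + P p \<bullet> ?G p)"
  unfolding We by (intro Bochner_Integration.integral_cong refl) (simp add: inner_diff_left inner_diff_right inner_commute)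
 also have "... = (LINT p|LP. ?G p \<bullet> (?S p - P p) - ?W p \<bullet> ?G p) + (LINT p|LP. P p \<bullet> ?G p)"
  by (intro Bochner_Integration.integral_add Bochner_Integration.integrable_diff sq_int_inner Gs R Ws P)
 also have "(LINT p|LP. ?G p \<bullet> (?S p - P p) - ?W p \<bullet> ?G p) = (LINT p|LP. ?G p \<bullet> (?S p - P p)) - (LINT p|LP. ?W p \<bullet> ?G p)"
  by (intro Bochner_Integration.integral_diff sq_int_inner Gs R Ws)
 finally have "sq_norm LP ?G <= sq_norm LP (%p. ?S p - P p)"
  unfolding zW zP by (intro sq_norm_le_of_inner[OF Gs R]) simp
 hence "sq_norm LP ?G < e/2" using ap sq_norm_commute[of LP P ?S] by simp
 moreover have "(%p. P p - ?W p) = (%p. (P p - ?S p) + ?G p)" unfolding We by (rule ext) (simp add: algebra_simps)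
 hence "sq_norm LP (%p. P p - ?W p) <= sq_norm LP (%p. P p - ?S p) + sq_norm LP ?G"
  using sq_norm_triangle[OF sq_int_diff[OF P Ss] Gs] by simp
 ultimately have "sq_norm LP (%p. P p - ?W p) < e" using ap by linarith
 thus ?thesis using t tw o by (intro exI[of _ N] exI[of _ s] exI[of _ ?w]) auto
qed

end

section \<open>Bochner functions with values in the quotient space\<close>

lemma sq_norm_AE_eq:
 fixes f g :: "'a::euclidean_space => 'b::euclidean_space"
 assumes "S : sets lebesgue" "f : sq_int (lebesgue_on S)" "AE x in lebesgue_on S. f x = g x"
 shows "sq_norm (lebesgue_on S) g = sq_norm (lebesgue_on S) f"
 using sq_norm_cong_AE[OF sq_intD[OF assms(2)] sq_intD[OF sq_int_AE_eq[OF assms]] assms(3)] by simp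

lemma nG_shift: "f : H1per ==> nG (%y. f y + c) = nG f"
 using sq_norm_AE_eq[OF Ycell_lebesgue H1perD(4)[OF H1per_plus_const(1)] H1per_plus_const(2)] by metis

lemma nG_diff:
 assumes "f : H1per" "g : H1per" shows "nG (%y. f y - g y) = sq_norm LY (%y. hgrad UNIV f y - hgrad UNIV g y)"
 using sq_norm_AE_eq[OF Ycell_lebesgue H1perD(4)[OF H1per_diff(1)[OF assms]] H1per_diff(2)[OF assms]] by simp

lemma H1per_norm_eq: "H1per_norm f = sqrt ((sq_norm LY f)^2 + (nG f)^2)"
 by (simp add: H1per_norm_def L2_norm_eq)

lemma quot_norm_lower: "H1per_quot_norm f <= H1per_norm (%y. f y + c)"
 unfolding H1per_quot_norm_def by (rule cINF_lower) (auto intro!: bdd_belowI2[of _ 0] simp: H1per_norm_def)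

lemma nG_le_quot_norm: assumes "f : H1per" shows "nG f <= H1per_quot_norm f"
 unfolding H1per_quot_norm_def
proof (rule cINF_greatest)
 fix c :: real
 show "nG f <= H1per_norm (%y. f y + c)"
  unfolding H1per_norm_eq nG_shift[OF assms] by (rule real_le_rsqrt) simp
qed simp

text \<open>The competitor subtracts the mean. Together with \<open>nG_le_quot_norm\<close> the
  quotient norm is equivalent to the norm of the gradient; 457 is the Poincare constant plus
  one.\<close>

lemma quot_norm_le_nG: assumes "f : H1per" shows "H1per_quot_norm f <= 457 * nG f"
proof -
 have "H1per_quot_norm f <= H1per_norm (%y. f y + - mean f)" by (rule quot_norm_lower)
 also have "... <= sq_norm LY (%y. f y - mean f) + nG f"
  unfolding H1per_norm_eq nG_shift[OF assms] using sqrt_sum_squares_le_sum[of "sq_norm LY (%y. f y - mean f)" "nG f"] sq_norm_nonneg by simp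
 finally show ?thesis using H1per_poincare[OF assms] by simp
qed

lemma H1per_norm_triangle:
 assumes f: "f : H1per" and g: "g : H1per" shows "H1per_norm (%y. f y + g y) <= H1per_norm f + H1per_norm g"
proof -
 have "nG (%y. f y + g y) = sq_norm LY (%y. hgrad UNIV f y + hgrad UNIV g y)"
  using sq_norm_AE_eq[OF Ycell_lebesgue H1perD(4)[OF H1per_add(1)[OF f g]] H1per_add(2)[OF f g]] by simp
 also have "... <= nG f + nG g" by (rule sq_norm_triangle[OF H1perD(4)[OF f] H1perD(4)[OF g]])
 finally have "H1per_norm (%y. f y + g y) <= sqrt ((sq_norm LY f + sq_norm LY g)^2 + (nG f + nG g)^2)"
  unfolding H1per_norm_eq
  by (intro real_sqrt_le_mono add_mono power_mono sq_norm_triangle[OF H1perD(2)[OF f] H1perD(2)[OF g]] sq_norm_nonneg)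
 also have "... <= H1per_norm f + H1per_norm g" unfolding H1per_norm_eq by (rule real_sqrt_sum_squares_triangle_ineq)
 finally show ?thesis .
qed

lemma quot_norm_triangle:
 assumes f: "f : H1per" and g: "g : H1per"
 shows "H1per_quot_norm f <= H1per_quot_norm g + H1per_quot_norm (%y. f y - g y)"
proof -
 have h: "(%y. f y - g y) : H1per" by (rule H1per_diff(1)[OF f g])
 have 1: "H1per_quot_norm f - H1per_norm (%y. g y + c) <= H1per_norm (%y. f y - g y + d)" for c d
 proof -
  have "H1per_quot_norm f <= H1per_norm (%y. f y + (c + d))" by (rule quot_norm_lower)
  also have "(%y. f y + (c + d)) = (%y. (g y + c) + (f y - g y + d))" by auto
  also have "H1per_norm ... <= H1per_norm (%y. g y + c) + H1per_norm (%y. f y - g y + d)"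
   by (rule H1per_norm_triangle[OF H1per_plus_const(1)[OF g] H1per_plus_const(1)[OF h]])
  finally show ?thesis by simp
 qed
 have "H1per_quot_norm f - H1per_norm (%y. g y + c) <= H1per_quot_norm (%y. f y - g y)" for c
  unfolding H1per_quot_norm_def[of "%y. f y - g y"] by (rule cINF_greatest[OF _ 1]) simp
 hence 2: "H1per_quot_norm f - H1per_quot_norm (%y. f y - g y) <= H1per_norm (%y. g y + c)" for c
  using add.commute[of "H1per_norm (%y. g y + c)"] by (simp add: algebra_simps)
 have "H1per_quot_norm f - H1per_quot_norm (%y. f y - g y) <= H1per_quot_norm g"
  unfolding H1per_quot_norm_def[of g] by (rule cINF_greatest[OF _ 2]) simp
 thus ?thesis by simp
qed

lemma quot_norm_diff:
 assumes f: "f : H1per" and g: "g : H1per"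
 shows "\<bar>H1per_quot_norm f - H1per_quot_norm g\<bar> <= 457 * sq_norm LY (%y. hgrad UNIV f y - hgrad UNIV g y)"
 using quot_norm_triangle[OF f g] quot_norm_triangle[OF g f] quot_norm_le_nG[OF H1per_diff(1)[OF f g]] quot_norm_le_nG[OF H1per_diff(1)[OF g f]]
 unfolding nG_diff[OF f g] nG_diff[OF g f] sq_norm_commute[of LY "hgrad UNIV g"] by linarith

lemma H1per_lincomb:
 assumes "!!j. j < N ==> s j : H1per"
 shows "(%y. \<Sum>j<N::nat. c j * s j y) : H1per \<and>
  (AE y in LY. hgrad UNIV (%y. \<Sum>j<N. c j * s j y) y = (\<Sum>j<N. c j *R hgrad UNIV (s j) y))"
 using assms
proof (induction N)
 case 0 thus ?case using H1per_const[of 0] by simp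
next
 case (Suc N)
 hence 1: "(%y. \<Sum>j<N. c j * s j y) : H1per" and 2: "s N : H1per"
  and 3: "AE y in LY. hgrad UNIV (%y. \<Sum>j<N. c j * s j y) y = (\<Sum>j<N. c j *R hgrad UNIV (s j) y)" by auto
 note 4 = H1per_cmult[OF 2, of "c N"]
 have "AE y in LY. hgrad UNIV (%y. \<Sum>j<Suc N. c j * s j y) y = (\<Sum>j<Suc N. c j *R hgrad UNIV (s j) y)"
  using 3 4(2) H1per_add(2)[OF 1 4(1)] by eventually_elim simp
 thus ?case using H1per_add(1)[OF 1 4(1)] by simp
qed

lemma simple_dense:
 fixes t :: "'a => real"
 assumes "t : sq_int M"
 shows "\<exists>T. (\<forall>n::nat. simple_function M (T n) & T n : sq_int M) & (%n. sq_norm M (%x. T n x - t x)) ----> 0"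
proof -
 obtain T where T: "!!n. simple_function M (T n)" "!!x. x : space M ==> (%n. T n x) ----> t x"
  "!!n x. x : space M ==> dist (T n x) 0 <= 2 * dist (t x) 0"
  using borel_measurable_implies_sequence_metric[OF sq_intD[OF assms], of 0] by blast
 have m: "T n : bm M" for n by (rule borel_measurable_simple_function[OF T(1)])
 have "norm (T n x - t x) <= 3 * norm (t x)" if "x : space M" for n x using T(3)[OF that, of n] by (simp add: dist_real_def)
 hence "(%n. sq_norm M (%x. T n x - t x)) ----> 0"
  by (intro sq_norm_tendsto_DCT[OF m sq_intD[OF assms] assms, where C = 3] AE_I2 T(2))
 moreover have "T n : sq_int M" for n
  by (rule sq_int_dominated[OF assms m, where C = 2]) (use T(3) in "auto intro!: AE_I2 simp: dist_real_def")
 ultimately show ?thesis using T(1) by blast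
qed

section \<open>Correspondence between gradient fields and Bochner functions\<close>

context bounded_open
begin

lemma section_norm:
 fixes h :: "(real^3) \<times> (real^3) => 'b::euclidean_space"
 assumes h: "h : sq_int LP"
 shows "(%x. sq_norm LY (%y. h (x, y))) : sq_int LO" "sq_norm LO (%x. sq_norm LY (%y. h (x, y))) = sq_norm LP h"
proof -
 note i = sq_int_sections(2)[OF OY h]
 have "(%x. sqrt ((sq_norm LY (%y. h (x, y)))^2)) : bm LO"
  using borel_measurable_integrable[OF i] by measurable
 hence m: "(%x. sq_norm LY (%y. h (x, y))) : bm LO" by simp
 show "(%x. sq_norm LY (%y. h (x, y))) : sq_int LO" by (rule sq_intI[OF m]) (use i in simp)
 have "(sq_norm LO (%x. sq_norm LY (%y. h (x, y))))^2 = (sq_norm LP h)^2"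
  unfolding sq_int_sections(3)[OF OY h] by (subst sq_norm_sq) simp
 thus "sq_norm LO (%x. sq_norm LY (%y. h (x, y))) = sq_norm LP h" by (simp add: power2_eq_iff_nonneg)
qed

text \<open>Replacing the scalar first factors by simple functions makes the potential
  \<open>S\<close> a simple function with values in \<open>H1per\<close>, as Bochner measurability
  demands, while \<open>F\<close> is its jointly measurable gradient.\<close>

lemma Kset_simple_dense:
 assumes P: "P : Kset \<Omega>" and e: "e > 0"
 shows "\<exists>S F. simple_function LO S & (\<forall>x. S x : H1per) & F : Kset \<Omega> \<and>
  (\<forall>x. AE y in LY. hgrad UNIV (S x) y = F (x, y)) & sq_norm LP (%p. F p - P p) < e"
proof -
 have e2: "e/2 > 0" using e by simp
 obtain N r b where t: "!!j. j < N ==> r j : sq_int LO & b j : H1per"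
  and ap: "sq_norm LP (%p. P p - (\<Sum>j<N::nat. r j (fst p) *R hgrad UNIV (b j) (snd p))) < e/2"
  using Kset_dense[OF P e2] by blast
 let ?G = "%p. \<Sum>j<N. r j (fst p) *R hgrad UNIV (b j) (snd p)"
 have "\<forall>j. \<exists>T. j < N --> (\<forall>n::nat. simple_function LO (T n) & T n : sq_int LO) & (%n. sq_norm LO (%x. T n x - r j x)) ----> 0"
  using simple_dense t by blast
 from choice[OF this] obtain T where T: "!!j n. j < N ==> simple_function LO (T j n) & T j (n::nat) : sq_int LO"
  "!!j. j < N ==> (%n. sq_norm LO (%x. T j n x - r j x)) ----> 0" by blast
 let ?S = "%n x y. \<Sum>j<N. T j n x * b j y" and ?F = "%n p. \<Sum>j<N. T j n (fst p) *R hgrad UNIV (b j) (snd p)"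
 have "k <= N ==> simple_function LO (%x y. \<Sum>j<k. T j n x * b j y)" for n k
 proof (induction k)
  case (Suc k)
  have "simple_function LO (%x. (%a t y. a y + t * b k y) (%y. \<Sum>j<k. T j n x * b j y) (T k n x))"
   using simple_function_compose2[of LO "%x y. \<Sum>j<k. T j n x * b j y" "T k n" "%a t y. a y + t * b k y"] Suc T(1)[of k] by simp
  thus ?case by simp
 qed simp
 hence s: "simple_function LO (?S n)" for n by simp
 note lin = H1per_lincomb[of N b, OF conjunct2[OF t]]
 have Fk: "?F n : Kset \<Omega>" for n using T(1) t by (intro Kset_sum Kset_tensor) auto
 have Gk: "?G : Kset \<Omega>" using t by (intro Kset_sum Kset_tensor) auto
 have "(%n. \<Sum>j<N. sq_norm LO (%x. T j n x - r j x) * nG (b j)) ----> (\<Sum>j<N. 0 * nG (b j))"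
  by (intro tendsto_sum tendsto_mult T(2) tendsto_const) auto
 then obtain n where n: "(\<Sum>j<N. sq_norm LO (%x. T j n x - r j x) * nG (b j)) < e/2" using LIMSEQ_0_ex_less[OF _ e2] by auto
 have d: "(%x. T j n x - r j x) : sq_int LO" if "j < N" for j using T(1)[OF that] t[OF that] by (intro sq_int_diff) auto
 have "(%p. ?F n p - ?G p) = (%p. \<Sum>j<N. (T j n (fst p) - r j (fst p)) *R hgrad UNIV (b j) (snd p))"
  by (simp add: sum_subtractf scaleR_diff_left)
 hence "sq_norm LP (%p. ?F n p - ?G p) <= (\<Sum>j<N. sq_norm LP (%p. (T j n (fst p) - r j (fst p)) *R hgrad UNIV (b j) (snd p)))"
  using sq_norm_sum_le[of "{..<N}" "%j p. (T j n (fst p) - r j (fst p)) *R hgrad UNIV (b j) (snd p)" LP]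
   sq_int_tensor(1)[OF OY d H1perD(4)[OF conjunct2[OF t]]] by simp
 also have "... = (\<Sum>j<N. sq_norm LO (%x. T j n x - r j x) * nG (b j))"
  using sq_int_tensor(2)[OF OY d H1perD(4)[OF conjunct2[OF t]]] by (intro sum.cong) auto
 finally have "sq_norm LP (%p. ?F n p - P p) < e"
  using n ap sq_norm_triangle_diff[OF KsetD(1)[OF Fk[of n]] KsetD(1)[OF Gk] KsetD(1)[OF P]] sq_norm_commute[of LP P ?G] by linarith
 moreover have "AE y in LY. hgrad UNIV (?S n x) y = ?F n (x, y)" for x using lin[of "%j. T j n x"] by simp
 ultimately show ?thesis using s[of n] lin Fk[of n] by (intro exI[of _ "?S n"] exI[of _ "?F n"]) auto
qed

text \<open>The potential \<open>w x\<close> is chosen separately at each point. It is Bochner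
  measurable nevertheless, since the quotient norm sees only gradients and those are limits of
  gradients of simple functions along a subsequence.\<close>

lemma Kset_represent:
 assumes P: "P : Kset \<Omega>"
 shows "\<exists>w\<in>L2_H1per_quot \<Omega>. AE x in LO. AE y in LY. P (x, y) = hgrad UNIV (w x) y"
proof -
 note Ps = KsetD(1)[OF P]
 define w where "w x = (if \<exists>s\<in>H1per. AE y in LY. P (x, y) = hgrad UNIV s y
  then SOME s. s : H1per & (AE y in LY. P (x, y) = hgrad UNIV s y) else (%_. 0))" for x
 have some: "w x : H1per & (AE y in LY. P (x, y) = hgrad UNIV (w x) y)" if "\<exists>s\<in>H1per. AE y in LY. P (x, y) = hgrad UNIV s y" for x
  unfolding w_def if_P[OF that] by (rule someI_ex[of "%s. s : H1per & (AE y in LY. P (x, y) = hgrad UNIV s y)"]) (use that in blast)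
 have wH: "w x : H1per" for x using some[of x] H1per_const(1)[of 0] by (cases "\<exists>s\<in>H1per. AE y in LY. P (x, y) = hgrad UNIV s y") (auto simp: w_def)
 have wAE: "AE x in LO. AE y in LY. P (x, y) = hgrad UNIV (w x) y" using KsetD(2)[OF P] by eventually_elim (use some in blast)
 have "\<forall>n. \<exists>S F. simple_function LO S & (\<forall>x. S x : H1per) & F : Kset \<Omega> \<and>
  (\<forall>x. AE y in LY. hgrad UNIV (S x) y = F (x, y)) & sq_norm LP (%p. F p - P p) < 1 / real (Suc n)"
  using Kset_simple_dense[OF P] by simp
 from choice[OF this] obtain S where "\<forall>n. \<exists>F. simple_function LO (S n) & (\<forall>x. S n x : H1per) & F : Kset \<Omega> \<and>
  (\<forall>x. AE y in LY. hgrad UNIV (S n x) y = F (x, y)) & sq_norm LP (%p. F p - P p) < 1 / real (Suc n)" by blast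
 from choice[OF this] obtain F where S: "!!n. simple_function LO (S n)" "!!n x. S n x : H1per" and F: "!!n. F n : Kset \<Omega>"
  and SF: "!!n x. AE y in LY. hgrad UNIV (S n x) y = F n (x, y)" and l: "!!n. sq_norm LP (%p. F n p - P p) < 1 / real (Suc n)" by blast
 have l0: "(%n. sq_norm LP (%p. F n p - P p)) ----> 0"
  by (rule null_le_null[where b = "%n. 1 / real (Suc n)" and c = 1]) (use l sq_norm_nonneg LIMSEQ_Suc[OF lim_1_over_n] in "auto intro: less_imp_le")
 obtain r where r: "strict_mono r" and ae: "AE x in LO. (%n. sq_norm LY (%y. F (r n) (x, y) - P (x, y))) ----> 0"
  using section_subseq[OF sq_int_diff[OF KsetD(1)[OF F] Ps] l0] by blast
 have lim: "AE x in LO. (%n. sq_norm LY (%y. hgrad UNIV (S (r n) x) y - hgrad UNIV (w x) y)) ----> 0"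
  using ae wAE
 proof eventually_elim
  case (elim x)
  have "sq_norm LY (%y. hgrad UNIV (S (r n) x) y - hgrad UNIV (w x) y) = sq_norm LY (%y. F (r n) (x, y) - P (x, y))" for n
  proof (rule sq_norm_AE_eq[OF Ycell_lebesgue, symmetric])
   show "(%y. hgrad UNIV (S (r n) x) y - hgrad UNIV (w x) y) : sq_int LY" by (rule sq_int_diff[OF H1perD(4)[OF S(2)] H1perD(4)[OF wH]])
   show "AE y in LY. hgrad UNIV (S (r n) x) y - hgrad UNIV (w x) y = F (r n) (x, y) - P (x, y)"
    using SF[of "r n" x] elim(2) by eventually_elim simp
  qed
  with elim(1) show ?case by simp
 qed
 have q1: "AE x in LO. (%n. H1per_quot_norm (%y. S (r n) x y - w x y)) ----> 0"
  using lim
 proof eventually_elim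
  case (elim x)
  show ?case
  proof (rule null_le_null[OF _ _ elim])
   show "0 <= H1per_quot_norm (%y. S (r n) x y - w x y)" for n
    using order_trans[OF sq_norm_nonneg nG_le_quot_norm[OF H1per_diff(1)[OF S(2) wH]]] .
   show "H1per_quot_norm (%y. S (r n) x y - w x y) <= 457 * sq_norm LY (%y. hgrad UNIV (S (r n) x) y - hgrad UNIV (w x) y)" for n
    using quot_norm_le_nG[OF H1per_diff(1)[OF S(2) wH]] unfolding nG_diff[OF S(2) wH] .
  qed
 qed
 have qm: "(%x. H1per_quot_norm (S (r n) x)) : bm LO" for n
  using borel_measurable_simple_function[OF simple_function_compose1[OF S(1)]] .
 \<comment> \<open>Because \<open>w\<close> is an arbitrary choice, the measurability of its norm is
   obtained through almost everywhere limits of norms of simple functions.\<close>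
 have "(%x. lim (%n. H1per_quot_norm (S (r n) x))) : bm LO" by (rule borel_measurable_lim_metric[OF qm])
 moreover have "AE x in LO. lim (%n. H1per_quot_norm (S (r n) x)) = H1per_quot_norm (w x)"
  using lim
 proof eventually_elim
  case (elim x)
  have "(%n. \<bar>H1per_quot_norm (S (r n) x) - H1per_quot_norm (w x)\<bar>) ----> 0"
   by (rule null_le_null[OF _ quot_norm_diff[OF S(2) wH] elim]) simp
  hence "(%n. H1per_quot_norm (S (r n) x)) ----> H1per_quot_norm (w x)" by (simp add: tendsto_rabs_zero_iff LIM_zero_iff)
  thus ?case by (rule limI)
 qed
 ultimately have wm: "(%x. H1per_quot_norm (w x)) : bm LO" by (rule lebesgue_on_measurable_AE[OF \<Omega>_lebesgue])
 have "(%x. H1per_quot_norm (w x)) : sq_int LO"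
 proof (rule sq_int_dominated[OF section_norm(1)[OF Ps] wm])
  show "AE x in LO. norm (H1per_quot_norm (w x)) <= 457 * norm (sq_norm LY (%y. P (x, y)))"
   using sq_int_sections(1)[OF OY Ps] wAE
  proof eventually_elim
   case (elim x)
   show ?case using quot_norm_le_nG[OF wH[of x]] order_trans[OF sq_norm_nonneg nG_le_quot_norm[OF wH[of x]]] sq_norm_AE_eq[OF Ycell_lebesgue elim]
    by (simp add: sq_norm_nonneg)
  qed
 qed
 hence "w : L2_H1per_quot \<Omega>"
  using wH S q1 unfolding L2_H1per_quot_def L2_eq by (auto intro!: exI[of _ "%n. S (r n)"])
 with wAE show ?thesis by blast
qed

text \<open>The simple functions in the Bochner definition converge only almost everywhere, with no
  dominating function. Truncating them by the norm of their limit gives fields \<open>F n\<close>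
  within three times that norm of the limit, so dominated convergence makes them Cauchy on the
  product; the limit field is jointly measurable.\<close>

lemma quot_field:
 assumes w: "w : L2_H1per_quot \<Omega>"
 shows "\<exists>G\<in>Kset \<Omega>. AE x in LO. AE y in LY. G (x, y) = hgrad UNIV (w x) y"
proof -
 from w obtain s where wH: "!!x. x : \<Omega> ==> w x : H1per" and s: "!!n::nat. simple_function LO (s n)" and sH: "!!n x. x : \<Omega> ==> s n x : H1per"
  and lim: "AE x in LO. (%n. H1per_quot_norm (%y. s n x y - w x y)) ----> 0"
  and q: "(%x. H1per_quot_norm (w x)) : sq_int LO" unfolding L2_H1per_quot_def L2_eq by blast
 \<comment> \<open>The factor 2 leaves room: where the norm of \<open>w x\<close> is positive the
   truncation eventually has no effect, and where it is zero the bound \<open>d3\<close> already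
   forces \<open>d n x\<close> to vanish.\<close>
 define E where "E n v = {x : space LO. s n x = v} \<inter> {x : space LO. H1per_quot_norm v <= 2 * H1per_quot_norm (w x)}" for n v
 define F where "F n p = (\<Sum>v\<in>s n ` \<Omega>. indicat_real (E n v) (fst p) *R hgrad UNIV v (snd p))" for n p
 have fin: "finite (s n ` \<Omega>)" for n using simple_functionD(1)[OF s] by simp
 have E: "E n v : sets LO" for n v
 proof -
  have "{x : space LO. s n x = v} = s n -` {v} \<inter> space LO" by auto
  hence "{x : space LO. s n x = v} : sets LO" using simple_functionD(2)[OF s] by simp
  moreover have "{x : space LO. H1per_quot_norm v <= 2 * H1per_quot_norm (w x)} : sets LO" using sq_intD[OF q] by measurable
  ultimately show ?thesis unfolding E_def by (rule sets.Int)
 qed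
 have FK: "F n : Kset \<Omega>" for n
 proof -
  have "(%p. indicat_real (E n v) (fst p) *R hgrad UNIV v (snd p)) : Kset \<Omega>" if "v : s n ` \<Omega>" for v
  proof (rule Kset_tensor)
   show "indicat_real (E n v) : sq_int LO"
    by (rule sq_int_bounded[OF finite_LO borel_measurable_indicator[OF E], where C = 1]) (auto simp: indicator_def)
   show "v : H1per" using that sH by auto
  qed
  thus ?thesis unfolding F_def[abs_def] by (rule Kset_sum)
 qed
 note Fs = KsetD(1)[OF FK]
 have Fx: "F n (x, y) = (if H1per_quot_norm (s n x) <= 2 * H1per_quot_norm (w x) then hgrad UNIV (s n x) y else 0)" if "x : \<Omega>" for n x y
 proof -
  have "F n (x, y) = (\<Sum>v\<in>s n ` \<Omega>. if s n x = v then (if H1per_quot_norm v <= 2 * H1per_quot_norm (w x) then hgrad UNIV v y else 0) else 0)"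
   unfolding F_def using that by (intro sum.cong refl) (auto simp: E_def)
  thus ?thesis using fin that by simp
 qed
 define d where "d n x = sq_norm LY (%y. F n (x, y) - hgrad UNIV (w x) y)" for n x
 have Fsq: "(%y. F n (x, y)) : sq_int LY" if "x : \<Omega>" for n x
  using Fx[OF that] H1perD(4)[OF sH[OF that]] sq_int_zero by (cases "H1per_quot_norm (s n x) <= 2 * H1per_quot_norm (w x)") simp_all
 have d3: "d n x <= 3 * H1per_quot_norm (w x)" if x: "x : \<Omega>" for n x
 proof -
  have *: "0 <= nG (w x)" "nG (w x) <= H1per_quot_norm (w x)" "nG (s n x) <= H1per_quot_norm (s n x)"
   by (auto intro: nG_le_quot_norm wH sH x)
  show ?thesis
  proof (cases "H1per_quot_norm (s n x) <= 2 * H1per_quot_norm (w x)")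
   case True
   hence "d n x = sq_norm LY (%y. hgrad UNIV (s n x) y - hgrad UNIV (w x) y)" by (simp add: d_def Fx[OF x])
   also have "... <= nG (s n x) + nG (w x)"
    using sq_norm_triangle_diff[OF H1perD(4)[OF sH[OF x]] sq_int_zero H1perD(4)[OF wH[OF x]]] by (simp add: sq_norm_minus)
   finally show ?thesis using * True by linarith
  next
   case False
   hence "d n x = nG (w x)" by (simp add: d_def Fx[OF x] sq_norm_minus)
   thus ?thesis using * by linarith
  qed
 qed
 have d0: "AE x in LO. (%n. d n x) ----> 0"
  using lim AE_space
 proof eventually_elim
  case (elim x)
  hence x: "x : \<Omega>" by simp
  have nn: "0 <= H1per_quot_norm (w x)" by (rule order_trans[OF sq_norm_nonneg nG_le_quot_norm[OF wH[OF x]]])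
  show ?case
  proof (cases "H1per_quot_norm (w x) = 0")
   case True
   have "d n x = 0" for n using d3[OF x, of n] True sq_norm_nonneg[of LY "%y. F n (x, y) - hgrad UNIV (w x) y"] by (simp add: d_def)
   thus ?thesis by simp
  next
   case False
   with nn have "H1per_quot_norm (w x) > 0" by simp
   from order_tendstoD(2)[OF elim(1) this]
   have "\<forall>\<^sub>F n in sequentially. d n x <= H1per_quot_norm (%y. s n x y - w x y)"
   proof eventually_elim
    case (elim n)
    hence "H1per_quot_norm (s n x) <= 2 * H1per_quot_norm (w x)" using quot_norm_triangle[OF sH[OF x, of n] wH[OF x]] by linarith
    hence "d n x = nG (%y. s n x y - w x y)" unfolding nG_diff[OF sH[OF x] wH[OF x]] by (simp add: d_def Fx[OF x])
    thus ?case using nG_le_quot_norm[OF H1per_diff(1)[OF sH[OF x] wH[OF x]]] by simp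
   qed
   thus ?thesis
    by (intro tendsto_sandwich[OF _ _ tendsto_const elim(1), of "%n. d n x"]) (auto simp: d_def sq_norm_nonneg)
  qed
 qed
 have "\<exists>G\<in>sq_int LP. (%n. sq_norm LP (%p. F n p - G p)) ----> 0"
 proof (rule sq_int_complete[OF finite_LP Fs], rule ccontr)
  fix e :: real assume "e > 0" and "\<not> (\<exists>N. \<forall>m\<ge>N. \<forall>n\<ge>N. sq_norm LP (%x. F m x - F n x) < e)"
  \<comment> \<open>The Cauchy condition has two indices. A violating pair for each \<open>N\<close>
    gives a single sequence to which dominated convergence applies.\<close>
  hence "\<forall>N. \<exists>q. fst q >= N & snd q >= N & e <= sq_norm LP (%x. F (fst q) x - F (snd q) x)" by (force simp: not_less)
  from choice[OF this] obtain q where qN: "!!N. fst (q N) >= N" "!!N. snd (q N) >= N"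
   and large: "!!N. e <= sq_norm LP (%x. F (fst (q N)) x - F (snd (q N)) x)" by blast
  define g where "g N x = sq_norm LY (%y. F (fst (q N)) (x, y) - F (snd (q N)) (x, y))" for N x
  have gd: "g N x <= d (fst (q N)) x + d (snd (q N)) x" if "x : \<Omega>" for N x
   unfolding g_def d_def sq_norm_commute[of LY "%y. F (snd (q N)) (x, y)"]
   by (rule sq_norm_triangle_diff[OF Fsq[OF that] H1perD(4)[OF wH[OF that]] Fsq[OF that]])
  have g0: "0 <= g N x" for N x by (simp add: g_def sq_norm_nonneg)
  have fq: "filterlim (%N. fst (q N)) sequentially sequentially" "filterlim (%N. snd (q N)) sequentially sequentially"
   using qN by (auto intro!: filterlim_at_top_mono[OF filterlim_ident])
  have "(%N. sq_norm LO (%x. g N x - 0)) ----> 0"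
  proof (rule sq_norm_tendsto_DCT[OF _ _ q, where C = 6])
   show "g N : bm LO" for N
    unfolding g_def[abs_def] by (rule sq_intD[OF section_norm(1)[OF sq_int_diff[OF Fs Fs]]])
   show "AE x in LO. norm (g N x - 0) <= 6 * norm (H1per_quot_norm (w x))" for N
   proof (rule AE_I2)
    fix x assume "x : space LO"
    hence x: "x : \<Omega>" by simp
    show "norm (g N x - 0) <= 6 * norm (H1per_quot_norm (w x))"
     using gd[OF x, of N] g0[of N x] d3[OF x, of "fst (q N)"] d3[OF x, of "snd (q N)"] by simp
   qed
   show "AE x in LO. (%N. g N x) ----> 0"
    using d0 AE_space
   proof eventually_elim
    case (elim x)
    have l: "(%N. d (fst (q N)) x + d (snd (q N)) x) ----> 0"
     using tendsto_add[OF filterlim_compose[OF elim(1) fq(1)] filterlim_compose[OF elim(1) fq(2)]] by simp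
    have "g N x <= 1 * (d (fst (q N)) x + d (snd (q N)) x)" for N using gd elim(2) by simp
    from null_le_null[OF g0 this l] show ?case .
   qed
  qed simp
  from LIMSEQ_0_ex_less[OF this \<open>e > 0\<close>] obtain N where "sq_norm LO (g N) < e" by auto
  with large[of N] show False unfolding g_def[abs_def] section_norm(2)[OF sq_int_diff[OF Fs Fs]] by simp
 qed
 then obtain G where G: "G : sq_int LP" and lG: "(%n. sq_norm LP (%p. F n p - G p)) ----> 0" by blast
 obtain r where r: "strict_mono r" and ae: "AE x in LO. (%n. sq_norm LY (%y. F (r n) (x, y) - G (x, y))) ----> 0"
  using section_subseq[OF sq_int_diff[OF Fs G] lG] by blast
 have "AE x in LO. AE y in LY. G (x, y) = hgrad UNIV (w x) y"
  using ae d0 sq_int_sections(1)[OF OY G] AE_space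
 proof eventually_elim
  case (elim x)
  hence x: "x : \<Omega>" by simp
  have "(%n. sq_norm LY (%y. F (r n) (x, y) - G (x, y)) + d (r n) x) ----> 0 + 0"
   using LIMSEQ_subseq_LIMSEQ[OF elim(2) r] by (intro tendsto_add elim(1)) (simp add: o_def)
  moreover have "sq_norm LY (%y. G (x, y) - hgrad UNIV (w x) y) <= sq_norm LY (%y. F (r n) (x, y) - G (x, y)) + d (r n) x" for n
   using sq_norm_triangle_diff[OF elim(3) Fsq[OF x] H1perD(4)[OF wH[OF x]]] unfolding d_def sq_norm_commute[of LY "%y. G (x, y)"] .
  ultimately have "sq_norm LY (%y. G (x, y) - hgrad UNIV (w x) y) <= 0 + 0" by (intro LIMSEQ_le_const) blast+
  hence "sq_norm LY (%y. G (x, y) - hgrad UNIV (w x) y) = 0" using sq_norm_nonneg[of LY "%y. G (x, y) - hgrad UNIV (w x) y"] by linarith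
  from sq_norm_zero_AE[OF sq_int_diff[OF elim(3) H1perD(4)[OF wH[OF x]]] this] show ?case by simp
 qed
 thus ?thesis using Kset_closed[OF FK G lG] by blast
qed

text \<open>Shows that the choice in \<open>hgrad_y\<close> has a witness and is fixed up to null
  sets. Joint measurability enters through \<open>AE_prodI\<close>, which turns equality on sections
  into equality on the product.\<close>

lemma hgrad_y_eq:
 assumes w: "w : L2_H1per_quot \<Omega>" and P: "P : Kset \<Omega>" and ae: "AE x in LO. AE y in LY. P (x, y) = hgrad UNIV (w x) y"
 shows "hgrad_y \<Omega> w : sq_int LP" "AE p in LP. P p = hgrad_y \<Omega> w p"
proof -
 note Ps = KsetD(1)[OF P]
 have "\<exists>G. G : bm LP & (AE x in LO. AE y in LY. G (x, y) = hgrad UNIV (w x) y)"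
  using ae sq_intD[OF Ps] by blast
 from someI_ex[OF this, folded hgrad_y_def] have m: "hgrad_y \<Omega> w : bm LP"
  and h: "AE x in LO. AE y in LY. hgrad_y \<Omega> w (x, y) = hgrad UNIV (w x) y" by auto
 have "AE x in LO. AE y in LY. P (x, y) = hgrad_y \<Omega> w (x, y)"
  using ae h
 proof eventually_elim
  case (elim x)
  thus ?case by eventually_elim simp
 qed
 from AE_prodI[OF OY sq_intD[OF Ps] m this] show e: "AE p in LP. P p = hgrad_y \<Omega> w p" .
 show "hgrad_y \<Omega> w : sq_int LP" by (rule sq_int_AE_eq[OF LP_lebesgue Ps e])
qed

end

section \<open>The limit problem\<close>

lemma sq_norm_cong: "(!!x. x : space M ==> f x = g x) ==> sq_norm M f = sq_norm M g"
 unfolding sq_norm_def by (intro arg_cong[of _ _ sqrt] Bochner_Integration.integral_cong) auto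

lemma sq_norm_norm: "sq_norm M (%x. norm (f x)) = sq_norm M f"
 by (simp add: sq_norm_def)

lemma sq_cauchy:
 fixes b h :: "nat => nat => real"
 assumes "!!e. e > 0 ==> \<exists>N. \<forall>m\<ge>N. \<forall>n\<ge>N. b m n < e" "!!m n. (h m n)^2 <= b m n" "e > 0"
 shows "\<exists>N. \<forall>m\<ge>N. \<forall>n\<ge>N. h m n < e"
proof -
 have "e^2 > 0" using assms(3) by simp
 then obtain N where N: "\<forall>m\<ge>N. \<forall>n\<ge>N. b m n < e^2" using assms(1) by blast
 have "h m n < e" if "m >= N" "n >= N" for m n
  using N that assms(2)[of m n] assms(3) by (intro power2_less_imp_less[of "h m n" e]) (auto intro: order_le_less_trans)
 thus ?thesis by blast
qed

lemma matvec_sq: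
 fixes a :: "'a => real^2^2"
 assumes m: "!!i j. (%x. a x $ i $ j) : bm M" and b: "!!x v. norm (a x *v v) <= \<beta> * norm v"
  and \<beta>: "0 <= \<beta>" and U: "U : sq_int M"
 shows "(%x. a x *v U x) : sq_int M" "sq_norm M (%x. a x *v U x) <= \<beta> * sq_norm M U"
proof -
 have c: "(%x. U x $ j) : bm M" for j by (rule sq_intD[OF sq_int_component[OF U]])
 have "(%x. \<Sum>i\<in>UNIV. (\<Sum>j\<in>UNIV. a x $ i $ j * U x $ j) *R axis i (1::real)) : bm M"
  by (intro borel_measurable_sum borel_measurable_scaleR borel_measurable_times m c borel_measurable_const)
 also have "(%x. \<Sum>i\<in>UNIV. (\<Sum>j\<in>UNIV. a x $ i $ j * U x $ j) *R axis i (1::real)) = (%x. a x *v U x)"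
  by (auto simp: fun_eq_iff vec_eq_iff forall_2 sum_2 axis_def matrix_vector_mult_def)
 finally have M: "(%x. a x *v U x) : bm M" .
 show "(%x. a x *v U x) : sq_int M" by (rule sq_int_dominated[OF U M AE_I2[OF b]])
 show "sq_norm M (%x. a x *v U x) <= \<beta> * sq_norm M U" by (rule sq_norm_mono[OF U M AE_I2[OF b] \<beta>])
qed

lemma sq_norm_subset:
 fixes f :: "real^3 => 'b::euclidean_space"
 assumes "f : sq_int (lebesgue_on S)" "K <= S" "K : sets lebesgue" "S : sets lebesgue"
 shows "sq_norm (lebesgue_on K) f <= sq_norm (lebesgue_on S) f"
 unfolding sq_norm_def
proof (rule real_sqrt_le_mono)
 have i: "integrable (lebesgue_on S) (%x. (norm (f x))^2)" "integrable (lebesgue_on K) (%x. (norm (f x))^2)"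
  using assms(1) sq_int_subset[OF assms] by (auto simp: sq_int_def)
 thus "(LINT x|lebesgue_on K. (norm (f x))^2) <= (LINT x|lebesgue_on S. (norm (f x))^2)"
  using assms by (intro integral_mono_lebesgue_on_AE) (auto simp: integrable_restrict_space)
qed

lemma H1D:
 assumes "p : H1 \<Omega>" "open \<Omega>"
 shows "p : sq_int (lebesgue_on \<Omega>)" "weak_hgrad \<Omega> p (hgrad \<Omega> p)" "hgrad \<Omega> p : sq_int (lebesgue_on \<Omega>)"
proof -
 obtain g where g: "weak_hgrad \<Omega> p g" "g : sq_int (lebesgue_on \<Omega>)" using assms(1) by (auto simp: H1_def L2_eq)
 show "p : sq_int (lebesgue_on \<Omega>)" using assms(1) by (simp add: H1_def L2_eq)
 show "weak_hgrad \<Omega> p (hgrad \<Omega> p)" by (rule hgrad_spec[OF g(1)])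
 have "AE x in lebesgue_on \<Omega>. g x = hgrad \<Omega> p x" using hgrad_AE[OF assms(2) g(1)] by eventually_elim simp
 from sq_int_AE_eq[OF _ g(2) this] show "hgrad \<Omega> p : sq_int (lebesgue_on \<Omega>)" using assms(2) by auto
qed

context bounded_open
begin

lemma fst_sq:
 fixes g :: "real^3 => 'b::euclidean_space"
 assumes g: "g : sq_int LO"
 shows "(%p. g (fst p)) : sq_int LP" "sq_norm LP (%p. g (fst p)) = sqrt 8 * sq_norm LO g"
proof -
 have 1: "(%y. 1::real) : sq_int LY" by (rule sq_int_const[OF finite_Ycell])
 have "(%x. norm (g x)) : sq_int LO"
  using sq_intD[OF g] by (intro sq_int_dominated[OF g, where C = 1]) auto
 note t = sq_int_tensor[OF OY this 1]
 show "(%p. g (fst p)) : sq_int LP"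
  by (rule sq_int_dominated[OF t(1) measurable_fst_lebesgue[OF OY sq_intD[OF g]], where C = 1]) simp
 have "sq_norm LP (%p. g (fst p)) = sq_norm LP (%p. norm (g (fst p)) *R (1::real))" by (simp add: sq_norm_norm)
 also have "... = sqrt 8 * sq_norm LO g" unfolding t(2) sq_norm_norm by (simp add: sq_norm_def measure_Ycell)
 finally show "sq_norm LP (%p. g (fst p)) = sqrt 8 * sq_norm LO g" .
qed

lemma fst_inner:
 fixes g h :: "real^3 => 'b::euclidean_space"
 assumes "g : sq_int LO" "h : sq_int LO"
 shows "(LINT p|LP. g (fst p) \<bullet> h (fst p)) = 8 * (LINT x|LO. g x \<bullet> h x)"
 unfolding fubini_lebesgue(3)[OF OY sq_int_inner[OF fst_sq(1)[OF assms(1)] fst_sq(1)[OF assms(2)]]] fst_conv integral_const_Ycell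
 by simp

text \<open>For fixed \<open>x\<close> the first field is constant in \<open>y\<close>, and
  gradients of periodic functions have mean zero.\<close>

lemma Kset_fst_orthogonal:
 assumes P: "P : Kset \<Omega>" and g: "g : sq_int LO"
 shows "(LINT p|LP. g (fst p) \<bullet> P p) = 0"
proof -
 have c: "(%x. g x $ i) : sq_int LO" for i by (rule sq_int_component[OF g])
 have w: "(%y. axis i 1 :: real^2) : sq_int LY" for i by (rule sq_int_const[OF finite_Ycell])
 have o: "(LINT y|LY. axis i 1 \<bullet> hgrad UNIV z y) = 0" if "z : H1per" for z and i :: 2
  using gradient_mean_zero[OF that, of i] by (simp add: inner_axis')
 note i = sq_int_inner[OF sq_int_tensor(1)[OF OY c w] KsetD(1)[OF P]]
 have "(%p. g (fst p) \<bullet> P p) = (%p. (g (fst p) $ 1 *R axis 1 1) \<bullet> P p + (g (fst p) $ 2 *R axis 2 1) \<bullet> P p)"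
  by (simp add: fun_eq_iff inner_vec_def sum_2 axis_def)
 thus ?thesis
  using Bochner_Integration.integral_add[OF i[of 1 1] i[of 2 2]] Kset_orthogonal[OF P c w o] by simp
qed

text \<open>Pythagoras. It lets convergence of the sum be split into convergence of the gradient in
  \<open>x\<close> and of the periodic part, which gives completeness of \<open>VU\<close>.\<close>

lemma field_norm:
 assumes g: "g : sq_int LO" and \<Psi>: "\<Psi> : Kset \<Omega>"
 shows "(sq_norm LP (%p. g (fst p) + \<Psi> p))^2 = 8 * (sq_norm LO g)^2 + (sq_norm LP \<Psi>)^2"
proof -
 note G = fst_sq(1)[OF g] and P = KsetD(1)[OF \<Psi>]
 have "(LINT p|LP. (norm (g (fst p) + \<Psi> p))^2) = (LINT p|LP. (g (fst p) \<bullet> g (fst p) + \<Psi> p \<bullet> \<Psi> p) + 2 * (g (fst p) \<bullet> \<Psi> p))"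
  by (simp add: power2_norm_eq_inner inner_add_left inner_add_right inner_commute algebra_simps)
 also have "... = (LINT p|LP. g (fst p) \<bullet> g (fst p)) + (LINT p|LP. \<Psi> p \<bullet> \<Psi> p) + 2 * (LINT p|LP. g (fst p) \<bullet> \<Psi> p)"
  using sq_int_inner[OF G G] sq_int_inner[OF P P] sq_int_inner[OF G P] by simp
 finally show ?thesis unfolding Kset_fst_orthogonal[OF \<Psi> g] fst_inner[OF g g] sq_norm_sq by (simp add: power2_norm_eq_inner)
qed

end

locale homogenization = bounded_open +
 fixes f :: "real^3 => real" and A :: "real^3 => real^2^2" and \<alpha> \<beta> :: real
 assumes f: "f : sq_int LO"
  and A_meas: "!!i j. (%x. A x $ i $ j) : bm lebesgue"
  and A_per: "!!i j. Y_periodic (%x. A x $ i $ j)"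
  and \<alpha>: "\<alpha> > 0" and \<beta>: "\<beta> > 0"
  and A_bound: "!!x v. norm (A x *v v) <= \<beta> * norm v"
  and A_coercive: "!!x v. (A x *v v) \<bullet> v >= \<alpha> * (norm v)^2"
begin

lemma A_LP:
 assumes "U : sq_int LP"
 shows "(%p. A (snd p) *v U p) : sq_int LP" "sq_norm LP (%p. A (snd p) *v U p) <= \<beta> * sq_norm LP U"
proof -
 have "(%p. A (snd p) $ i $ j) : bm LP" for i j
  by (rule measurable_snd_lebesgue[OF OY measurable_restrict_space1[OF A_meas]])
 from matvec_sq[OF this A_bound less_imp_le[OF \<beta>] assms]
 show "(%p. A (snd p) *v U p) : sq_int LP" "sq_norm LP (%p. A (snd p) *v U p) <= \<beta> * sq_norm LP U" .
qed

text \<open>A pair records the function and its whole two-scale field; the two parts of the field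
  need not be stored, as orthogonality controls them separately.\<close>

definition VU :: "((real^3 => real) \<times> ((real^3) \<times> (real^3) => real^2)) set" where
 "VU = {v. fst v : sq_int LO & (\<exists>g \<Psi>. weak_hgrad \<Omega> (fst v) g & g : sq_int LO & \<Psi> : Kset \<Omega> & snd v = (%p. g (fst p) + \<Psi> p))}"

text \<open>The 8 is the integral over the cell of a function of \<open>x\<close> alone, so this is
  the natural inner product on the product domain.\<close>

definition BU :: "((real^3 => real) \<times> ((real^3) \<times> (real^3) => real^2)) => ((real^3 => real) \<times> ((real^3) \<times> (real^3) => real^2)) => real" where
 "BU v w = 8 * (LINT x|LO. fst v x * fst w x) + (LINT p|LP. snd v p \<bullet> snd w p)"

lemma VU_sq: "v : VU ==> fst v : sq_int LO" "v : VU ==> snd v : sq_int LP"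
 by (auto simp: VU_def intro!: sq_int_add fst_sq(1) dest: KsetD(1))

lemma BU_norm: "BU v v = 8 * (sq_norm LO (fst v))^2 + (sq_norm LP (snd v))^2"
 unfolding BU_def sq_norm_sq by (simp add: power2_norm_eq_inner flip: power2_eq_square)

lemma VU_complete:
 assumes s: "!!n::nat. s n : VU" and C: "!!e. e > 0 ==> \<exists>N. \<forall>m\<ge>N. \<forall>n\<ge>N. BU (s m - s n) (s m - s n) < e"
 shows "\<exists>l\<in>VU. (%n. BU (s n - l) (s n - l)) ----> 0"
proof -
 have "\<forall>n. \<exists>q. weak_hgrad \<Omega> (fst (s n)) (fst q) & fst q : sq_int LO & snd q : Kset \<Omega> & snd (s n) = (%p. fst q (fst p) + snd q p)"
  using s by (auto simp: VU_def)
 from choice[OF this] obtain q where q: "!!n. weak_hgrad \<Omega> (fst (s n)) (fst (q n))" "!!n. fst (q n) : sq_int LO"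
  "!!n. snd (q n) : Kset \<Omega>" "!!n. snd (s n) = (%p. fst (q n) (fst p) + snd (q n) p)" by blast
 note vs = VU_sq(1)[OF s] and Ps = KsetD(1)[OF q(3)]
 have B: "BU (s n - l) (s n - l) = 8 * (sq_norm LO (%x. fst (s n) x - fst l x))^2 + (8 * (sq_norm LO (%x. fst (q n) x - g x))^2 + (sq_norm LP (%p. snd (q n) p - P p))^2)"
  if "g : sq_int LO" "P : Kset \<Omega>" "snd l = (%p. g (fst p) + P p)" for n l g P
 proof -
  have "snd (s n - l) = (%p. (fst (q n) (fst p) - g (fst p)) + (snd (q n) p - P p))" by (simp add: q(4) that(3) fun_eq_iff)
  thus ?thesis
   using field_norm[OF sq_int_diff[OF q(2) that(1)] Kset_diff[OF q(3) that(2)]] by (simp add: BU_norm fun_diff_def)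
 qed
 note B1 = B[OF q(2,3,4)]
 have "\<exists>h\<in>sq_int LO. (%n. sq_norm LO (%x. fst (s n) x - h x)) ----> 0"
  by (rule sq_int_complete[OF finite_LO vs sq_cauchy[OF C]]) (simp_all add: B1)
 then obtain h where h: "h : sq_int LO" "(%n. sq_norm LO (%x. fst (s n) x - h x)) ----> 0" by blast
 have "\<exists>g\<in>sq_int LO. (%n. sq_norm LO (%x. fst (q n) x - g x)) ----> 0"
  by (rule sq_int_complete[OF finite_LO q(2) sq_cauchy[OF C]]) (simp_all add: B1)
 then obtain g where g: "g : sq_int LO" "(%n. sq_norm LO (%x. fst (q n) x - g x)) ----> 0" by blast
 have "\<exists>P\<in>sq_int LP. (%n. sq_norm LP (%p. snd (q n) p - P p)) ----> 0"
  by (rule sq_int_complete[OF finite_LP Ps sq_cauchy[OF C]]) (simp_all add: B1)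
 then obtain P where P: "P : sq_int LP" "(%n. sq_norm LP (%p. snd (q n) p - P p)) ----> 0" by blast
 have Pk: "P : Kset \<Omega>" by (rule Kset_closed[OF q(3) P])
 have "weak_hgrad \<Omega> h g"
 proof (rule weak_hgrad_limit[OF \<Omega>(1) q(1)])
  fix K n assume K: "compact K" "K <= \<Omega>"
  note S = K(2) compact_lebesgue[OF K(1)] \<Omega>_lebesgue
  show "fst (s n) : sq_int (lebesgue_on K) & fst (q n) : sq_int (lebesgue_on K) & h : sq_int (lebesgue_on K) & g : sq_int (lebesgue_on K)"
   using sq_int_subset[OF vs S] sq_int_subset[OF q(2) S] sq_int_subset[OF h(1) S] sq_int_subset[OF g(1) S] by simp
 next
  fix K assume K: "compact K" "K <= \<Omega>"
  note S = K(2) compact_lebesgue[OF K(1)] \<Omega>_lebesgue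
  show "(%n. sq_norm (lebesgue_on K) (%x. fst (s n) x - h x)) ----> 0"
   by (rule null_le_null[OF sq_norm_nonneg _ h(2), of _ _ 1]) (use sq_norm_subset[OF sq_int_diff[OF vs h(1)] S] in simp)
  show "(%n. sq_norm (lebesgue_on K) (%x. fst (q n) x - g x)) ----> 0"
   by (rule null_le_null[OF sq_norm_nonneg _ g(2), of _ _ 1]) (use sq_norm_subset[OF sq_int_diff[OF q(2) g(1)] S] in simp)
 qed
 hence "(h, %p. g (fst p) + P p) : VU" using h(1) g(1) Pk by (auto simp: VU_def)
 moreover have "(%n. 8 * (sq_norm LO (%x. fst (s n) x - h x))^2 + (8 * (sq_norm LO (%x. fst (q n) x - g x))^2 + (sq_norm LP (%p. snd (q n) p - P p))^2)) ----> 8 * 0^2 + (8 * 0^2 + 0^2)"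
  by (intro tendsto_intros h(2) g(2) P(2))
 hence "(%n. BU (s n - (h, %p. g (fst p) + P p)) (s n - (h, %p. g (fst p) + P p))) ----> 0"
  using B[OF g(1) Pk, of "(h, %p. g (fst p) + P p)"] by simp
 ultimately show ?thesis by blast
qed

lemma VU_hilbert: "semi_hilbert VU BU"
proof
 show "subspace VU"
 proof (rule subspaceI)
  show "0 : VU"
   using weak_hgrad_subset[OF weak_hgrad_const[of 0] \<Omega>(1)] Kset_sum[of "{}"] sq_int_zero
   by (auto simp: VU_def zero_fun_def intro!: exI[of _ "%_. 0"])
  show "v + w : VU" if vw: "v : VU" "w : VU" for v w
  proof -
   obtain g \<Psi> where 1: "weak_hgrad \<Omega> (fst v) g" "g : sq_int LO" "\<Psi> : Kset \<Omega>" "snd v = (%p. g (fst p) + \<Psi> p)" using vw by (auto simp: VU_def)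
   obtain h P where 2: "weak_hgrad \<Omega> (fst w) h" "h : sq_int LO" "P : Kset \<Omega>" "snd w = (%p. h (fst p) + P p)" using vw by (auto simp: VU_def)
   show ?thesis unfolding VU_def mem_Collect_eq
    using weak_hgrad_add[OF \<Omega>(1) 1(1) 2(1)] sq_int_add[OF 1(2) 2(2)] Kset_add[OF 1(3) 2(3)] sq_int_add[OF VU_sq(1)[OF vw(1)] VU_sq(1)[OF vw(2)]] 1(4) 2(4)
    by (intro conjI exI[of _ "%x. g x + h x"] exI[of _ "%p. \<Psi> p + P p"]) (simp_all add: plus_fun_def add_ac)
  qed
  show "c *R v : VU" if v: "v : VU" for c v
  proof -
   obtain g \<Psi> where 1: "weak_hgrad \<Omega> (fst v) g" "g : sq_int LO" "\<Psi> : Kset \<Omega>" "snd v = (%p. g (fst p) + \<Psi> p)" using v by (auto simp: VU_def)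
   show ?thesis unfolding VU_def mem_Collect_eq
    using weak_hgrad_scale[OF \<Omega>(1) 1(1), of c] sq_int_scale[OF 1(2), of c] Kset_scale[OF 1(3), of c] sq_int_cmult[OF VU_sq(1)[OF v], of c] 1(4)
    by (intro conjI exI[of _ "%x. c *R g x"] exI[of _ "%p. c *R \<Psi> p"]) (simp_all add: scaleR_fun_def scaleR_add_right)
  qed
 qed
 show "BU (x + y) z = BU x z + BU y z" if "x : VU" "y : VU" "z : VU" for x y z
  using sq_int_mult[OF VU_sq(1)[OF that(1)] VU_sq(1)[OF that(3)]] sq_int_mult[OF VU_sq(1)[OF that(2)] VU_sq(1)[OF that(3)]]
   sq_int_inner[OF VU_sq(2)[OF that(1)] VU_sq(2)[OF that(3)]] sq_int_inner[OF VU_sq(2)[OF that(2)] VU_sq(2)[OF that(3)]]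
  by (simp add: BU_def distrib_right inner_add_left)
 show "BU (c *R x) z = c * BU x z" if "x : VU" "z : VU" for c x z
  by (simp add: BU_def mult.assoc distrib_left)
 show "BU x y = BU y x" for x y by (simp add: BU_def inner_commute mult.commute)
 show "0 <= BU x x" for x by (simp add: BU_norm)
qed (rule VU_complete)

text \<open>Both equations, in \<open>\<phi>\<close> and in the periodic test field, are one
  coercive problem on \<open>VU\<close>. The solution is produced here directly and not as a limit
  of the oscillating solutions.\<close>

lemma limit_problem:
 obtains u G \<Psi> where "u : sq_int LO" "weak_hgrad \<Omega> u G" "G : sq_int LO" "\<Psi> : Kset \<Omega>"
  "!!h g P. h : sq_int LO ==> weak_hgrad \<Omega> h g ==> g : sq_int LO ==> P : Kset \<Omega> ==>
   (LINT p|LP. (A (snd p) *v (G (fst p) + \<Psi> p)) \<bullet> (g (fst p) + P p)) + 8 * (LINT x|LO. u x * h x) = 8 * (LINT x|LO. f x * h x)"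
proof -
 interpret semi_hilbert VU BU by (rule VU_hilbert)
 define a where "a v w = (LINT p|LP. (A (snd p) *v snd v p) \<bullet> snd w p) + 8 * (LINT x|LO. fst v x * fst w x)" for v w :: "(real^3 => real) \<times> ((real^3) \<times> (real^3) => real^2)"
 have n2: "(nrm v)^2 = 8 * (sq_norm LO (fst v))^2 + (sq_norm LP (snd v))^2" for v
  unfolding nrm_def BU_norm by (rule real_sqrt_pow2) simp
 have nn: "0 <= nrm v" for v unfolding nrm_def BU_norm by simp
 have n1: "sq_norm LO (fst v) <= nrm v" "sq_norm LP (snd v) <= nrm v" for v
  by (rule power2_le_imp_le[OF _ nn], simp add: n2)+
 have "\<exists>v\<in>VU. \<forall>w\<in>VU. a v w = 8 * (LINT x|LO. f x * fst w x)"
 \<comment> \<open>The bound \<open>\<beta>\<close> is for the flux term and 8 for the term of order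
   zero. Coercivity holds with constant 1 for the latter and \<alpha> for the former.\<close>
 proof (rule lax_milgram[where ?c0.0 = "min 1 \<alpha>" and M = "\<beta> + 8" and C = "8 * sq_norm LO f"])
  fix x y z c assume x: "x : VU" and y: "y : VU" and z: "z : VU"
  note ax = A_LP(1)[OF VU_sq(2)[OF x]] and ay = A_LP(1)[OF VU_sq(2)[OF y]] and az = A_LP(1)[OF VU_sq(2)[OF z]]
  show "a (x + y) z = a x z + a y z"
   using sq_int_inner[OF ax VU_sq(2)[OF z]] sq_int_inner[OF ay VU_sq(2)[OF z]] sq_int_mult[OF VU_sq(1)[OF x] VU_sq(1)[OF z]] sq_int_mult[OF VU_sq(1)[OF y] VU_sq(1)[OF z]]
   by (simp add: a_def matrix_vector_right_distrib inner_add_left distrib_right)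
  show "a z (x + y) = a z x + a z y"
   using sq_int_inner[OF az VU_sq(2)[OF x]] sq_int_inner[OF az VU_sq(2)[OF y]] sq_int_mult[OF VU_sq(1)[OF z] VU_sq(1)[OF x]] sq_int_mult[OF VU_sq(1)[OF z] VU_sq(1)[OF y]]
   by (simp add: a_def inner_add_right distrib_left)
  show "8 * (LINT t|LO. f t * fst (x + y) t) = 8 * (LINT t|LO. f t * fst x t) + 8 * (LINT t|LO. f t * fst y t)"
   using sq_int_mult[OF f VU_sq(1)[OF x]] sq_int_mult[OF f VU_sq(1)[OF y]] by (simp add: distrib_left)
 next
  fix x z c assume x: "x : VU" and z: "z : VU"
  show "a (c *R x) z = c * a x z" by (simp add: a_def matrix_vector_mult_scaleR mult.assoc distrib_left)
  show "a z (c *R x) = c * a z x" by (simp add: a_def distrib_left mult.left_commute)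
  show "8 * (LINT t|LO. f t * fst (c *R x) t) = c * (8 * (LINT t|LO. f t * fst x t))" by (simp add: mult.left_commute)
  have 1: "\<bar>LINT p|LP. (A (snd p) *v snd x p) \<bullet> snd z p\<bar> <= \<beta> * (nrm x * nrm z)"
  proof -
   have "\<bar>LINT p|LP. (A (snd p) *v snd x p) \<bullet> snd z p\<bar> <= sq_norm LP (%p. A (snd p) *v snd x p) * sq_norm LP (snd z)"
    by (rule sq_inner_CS[OF A_LP(1)[OF VU_sq(2)[OF x]] VU_sq(2)[OF z]])
   also have "... <= (\<beta> * sq_norm LP (snd x)) * sq_norm LP (snd z)"
    by (intro mult_right_mono A_LP(2) VU_sq(2) x sq_norm_nonneg)
   also have "... <= (\<beta> * nrm x) * nrm z"
    using \<beta> by (intro mult_mono n1 mult_nonneg_nonneg nn sq_norm_nonneg mult_left_mono) auto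
   finally show ?thesis by (simp add: mult.assoc)
  qed
  have "\<bar>LINT t|LO. fst x t * fst z t\<bar> <= sq_norm LO (fst x) * sq_norm LO (fst z)"
   using sq_inner_CS[OF VU_sq(1)[OF x] VU_sq(1)[OF z]] by simp
  also have "... <= nrm x * nrm z" by (intro mult_mono n1 nn sq_norm_nonneg)
  finally show "\<bar>a x z\<bar> <= (\<beta> + 8) * (nrm x * nrm z)" using 1 unfolding a_def distrib_right by linarith
  have "\<bar>LINT t|LO. f t * fst x t\<bar> <= sq_norm LO f * sq_norm LO (fst x)" using sq_inner_CS[OF f VU_sq(1)[OF x]] by simp
  also have "... <= sq_norm LO f * nrm x" by (intro mult_left_mono n1 sq_norm_nonneg)
  finally show "\<bar>8 * (LINT t|LO. f t * fst x t)\<bar> <= 8 * sq_norm LO f * nrm x" by simp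
  have "\<alpha> * (sq_norm LP (snd x))^2 = (LINT p|LP. \<alpha> * (norm (snd x p))^2)" by (simp add: sq_norm_sq)
  also have "... <= (LINT p|LP. (A (snd p) *v snd x p) \<bullet> snd x p)"
   using VU_sq(2)[OF x] by (intro integral_mono A_coercive sq_int_inner A_LP(1)) (auto simp: sq_int_def)
  finally have 2: "\<alpha> * (sq_norm LP (snd x))^2 <= (LINT p|LP. (A (snd p) *v snd x p) \<bullet> snd x p)" .
  have 3: "(LINT t|LO. fst x t * fst x t) = (sq_norm LO (fst x))^2" unfolding sq_norm_sq by (simp add: power2_eq_square)
  have "min 1 \<alpha> * (8 * (sq_norm LO (fst x))^2) <= 1 * (8 * (sq_norm LO (fst x))^2)" "min 1 \<alpha> * (sq_norm LP (snd x))^2 <= \<alpha> * (sq_norm LP (snd x))^2"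
   by (intro mult_right_mono; simp)+
  with 2 show "min 1 \<alpha> * BU x x <= a x x" unfolding BU_norm a_def 3 distrib_left by linarith
 qed (use \<alpha> in auto)
 then obtain v where v: "v : VU" and eq: "!!w. w : VU ==> a v w = 8 * (LINT x|LO. f x * fst w x)" by blast
 from v obtain G \<Psi> where G: "weak_hgrad \<Omega> (fst v) G" "G : sq_int LO" "\<Psi> : Kset \<Omega>" "snd v = (%p. G (fst p) + \<Psi> p)" by (auto simp: VU_def)
 show ?thesis
 proof (rule that[OF VU_sq(1)[OF v] G(1-3)])
  fix h g P assume "h : sq_int LO" "weak_hgrad \<Omega> h g" "g : sq_int LO" "P : Kset \<Omega>"
  hence "(h, %p. g (fst p) + P p) : VU" by (auto simp: VU_def)
  from eq[OF this] show "(LINT p|LP. (A (snd p) *v (G (fst p) + \<Psi> p)) \<bullet> (g (fst p) + P p)) + 8 * (LINT x|LO. fst v x * h x) = 8 * (LINT x|LO. f x * h x)"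
   by (simp add: a_def G(4))
 qed
qed

end

section \<open>Oscillating functions\<close>

abbreviation (input) osc :: "real => (real^3 => 'b) => real^3 => 'b" where
 "osc \<epsilon> R x \<equiv> R (dil (1/\<epsilon>) x)"

lemma sq_int_volmap:
 fixes f :: "real^3 => 'b::euclidean_space"
 shows "volmap c T ==> f : sq_int lebesgue ==> (%x. f (T x)) : sq_int lebesgue"
 using volmap_measurable[OF _ sq_intD] volmap_integrable[OF _ sq_int_norm] by (intro sq_intI)

lemma sq_int_extend:
 fixes f :: "real^3 => 'b::euclidean_space"
 assumes f: "f : sq_int (lebesgue_on S)" and S: "S : sets lebesgue" and 0: "!!x. x ~: S ==> f x = 0"
 shows "f : sq_int lebesgue"
proof (rule sq_intI)
 have "f = (%x. if x : S then f x else 0)" using 0 by auto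
 thus "f : bm lebesgue" using borel_measurable_if[OF S, of f] sq_intD[OF f] by simp
 show "integrable lebesgue (%x. (norm (f x))^2)"
  by (subst LINT_outside(2)[OF S, symmetric]) (use 0 sq_int_norm[OF f] in auto)
qed

lemma sq_int_restrict:
 fixes f :: "real^3 => 'b::euclidean_space"
 assumes "f : sq_int lebesgue" "S : sets lebesgue" shows "f : sq_int (lebesgue_on S)"
 using sq_int_subset[of f UNIV S] assms by (simp add: lebesgue_on_UNIV_eq)

lemma tf_mult_sq:
 fixes R :: "real^3 => 'b::euclidean_space"
 assumes p: "p : test_functions \<Omega>" and R: "R : sq_int (lebesgue_on S)"
 shows "(%x. p x *R R x) : sq_int (lebesgue_on S)"
proof -
 obtain C where "!!x. \<bar>p x\<bar> <= C" using tf_bounded[OF p] by blast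
 thus ?thesis
  by (intro sq_int_bounded_mult[OF R measurable_restrict_space1[OF lebesgue_borelI[OF borel_measurable_continuous_onI[OF tf_continuous[OF p]]]]] AE_I2)
qed

text \<open>After dilation the bounded set \<open>S\<close> becomes the bounded set
  \<open>T\<close>, on which the periodic \<open>R\<close> is square integrable. Cutting off outside
  \<open>T\<close> allows the change of variables on the whole group.\<close>

lemma osc_sq:
 fixes R :: "real^3 => 'b::euclidean_space"
 assumes e: "e > 0" and R: "Y_periodic R" "R : sq_int LY" and S: "bounded S" "S : sets lebesgue"
 shows "osc e R : sq_int (lebesgue_on S)"
proof -
 have l: "1/e > 0" using e by simp
 define T where "T = {x. dil e x : S}"
 have V: "volmap (1/e^4) (dil e)" using volmap_dil[OF e] .
 have T: "T : sets lebesgue" using measurable_sets[OF volmap_lebesgue[OF V] S(2)] by (simp add: T_def vimage_def)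
 have "T = dil (1/e) ` S" using e by (force simp: T_def image_iff intro: bexI[of _ "dil e x" for x])
 also have "bounded ..."
 proof (rule bounded_subset)
  show "bounded (dil (1/e) ` closure S)"
   using S(1) by (intro compact_imp_bounded compact_continuous_image continuous_intros continuous_on_id) (auto simp: compact_closure)
  show "dil (1/e) ` S <= dil (1/e) ` closure S" by (intro image_mono closure_subset)
 qed
 finally have bT: "bounded T" .
 have "R : sq_int (lebesgue_on T)" by (rule periodic_sq_int[OF R bT T])
 hence "(%x. indicat_real T x *R R x) : sq_int (lebesgue_on T)" by (rule sq_int_AE_eq[OF T _ AE_I2]) simp
 hence "(%x. indicat_real T x *R R x) : sq_int lebesgue" by (rule sq_int_extend[OF _ T]) simp
 from sq_int_restrict[OF sq_int_volmap[OF volmap_dil[OF l] this] S(2)] show ?thesis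
  by (rule sq_int_AE_eq[OF S(2) _ AE_I2]) (use e in "simp add: T_def")
qed

lemma integral_sum_inner:
 fixes F H :: "'i => 'a => 'b::euclidean_space"
 assumes "finite I" and F: "!!i. i : I ==> F i : sq_int M" and H: "!!i. i : I ==> H i : sq_int M"
 shows "(LINT x|M. (\<Sum>i\<in>I. F i x) \<bullet> (\<Sum>i\<in>I. H i x)) = (\<Sum>i\<in>I. \<Sum>j\<in>I. LINT x|M. F i x \<bullet> H j x)"
proof -
 have "(LINT x|M. (\<Sum>i\<in>I. F i x) \<bullet> (\<Sum>i\<in>I. H i x)) = (LINT x|M. (\<Sum>i\<in>I. \<Sum>j\<in>I. F i x \<bullet> H j x))"
  by (simp only: inner_sum_left) (simp only: inner_sum_right)
 also have "... = (\<Sum>i\<in>I. LINT x|M. (\<Sum>j\<in>I. F i x \<bullet> H j x))"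
  using F H by (intro Bochner_Integration.integral_sum Bochner_Integration.integrable_sum sq_int_inner) auto
 also have "... = (\<Sum>i\<in>I. \<Sum>j\<in>I. LINT x|M. F i x \<bullet> H j x)"
  using F H by (intro sum.cong refl Bochner_Integration.integral_sum sq_int_inner) auto
 finally show ?thesis .
qed

context bounded_open
begin

text \<open>The integrand is a continuous, compactly supported factor times the rescaled periodic
  function \<open>R y \<bullet> R' y\<close>, which is the situation of
  \<open>averaging\<close>.\<close>

lemma osc_inner:
 fixes R R' :: "real^3 => 'b::euclidean_space"
 assumes \<psi>: "\<psi> : test_functions \<Omega>" "\<psi>' : test_functions \<Omega>" and R: "Y_periodic R" "R : sq_int LY" "Y_periodic R'" "R' : sq_int LY"
 shows "((%e. LINT x|LO. (\<psi> x *R osc e R x) \<bullet> (\<psi>' x *R osc e R' x)) \<longlongrightarrow>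
  (LINT p|LP. (\<psi> (fst p) *R R (snd p)) \<bullet> (\<psi>' (fst p) *R R' (snd p))) / 8) (at_right 0)"
proof -
 let ?g = "%x. \<psi> x * \<psi>' x" and ?p = "%y. R y \<bullet> R' y"
 obtain K where K: "compact K" "K <= \<Omega>" "!!x. x ~: K ==> \<psi> x = 0" using tf_ex[OF \<psi>(1)] by blast
 have s: "\<psi> : sq_int LO" "\<psi>' : sq_int LO" by (rule sq_int_continuous[OF tf_continuous[OF \<psi>(1)] \<Omega>(2) \<Omega>_lebesgue] sq_int_continuous[OF tf_continuous[OF \<psi>(2)] \<Omega>(2) \<Omega>_lebesgue])+
 note i = sq_int_inner[OF sq_int_tensor(1)[OF OY s(1) R(2)] sq_int_tensor(1)[OF OY s(2) R(4)]]
 have per: "Y_periodic ?p" using R(1,3) by (simp add: Y_periodic_def)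
 have "((%e. LINT x|lebesgue. ?g x * ?p (dil (1/e) x)) \<longlongrightarrow> (LINT x|lebesgue. ?g x) * (LINT y|LY. ?p y) / 8) (at_right 0)"
  by (intro averaging[OF _ K(1) _ per sq_int_inner[OF R(2,4)]] continuous_intros tf_continuous[OF \<psi>(1)] tf_continuous[OF \<psi>(2)]) (use K(3) in auto)
 moreover have "(LINT x|LO. (\<psi> x *R osc e R x) \<bullet> (\<psi>' x *R osc e R' x)) = (LINT x|lebesgue. ?g x * ?p (dil (1/e) x))" for e
  by (subst LINT_outside(1)[OF \<Omega>_lebesgue]) (auto simp: tf_outside[OF \<psi>(1)] mult_ac)
 moreover have "(LINT p|LP. (\<psi> (fst p) *R R (snd p)) \<bullet> (\<psi>' (fst p) *R R' (snd p))) = (LINT x|lebesgue. ?g x) * (LINT y|LY. ?p y)"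
 proof -
  have h1: "(LINT y|LY. (\<psi> x *R R y) \<bullet> (\<psi>' x *R R' y)) = ?g x * (LINT y|LY. ?p y)" for x
  proof -
   have "(LINT y|LY. (\<psi> x *R R y) \<bullet> (\<psi>' x *R R' y)) = (LINT y|LY. ?g x * ?p y)" by (simp add: mult_ac)
   thus ?thesis by simp
  qed
  have h2: "(LINT x|LO. ?g x) = (LINT x|lebesgue. ?g x)" by (rule LINT_outside(1)[OF \<Omega>_lebesgue]) (simp add: tf_outside[OF \<psi>(1)])
  show ?thesis unfolding fubini_lebesgue(3)[OF OY i] fst_conv snd_conv h1 h2[symmetric] by (rule Bochner_Integration.integral_mult_left_zero)
 qed
 ultimately show ?thesis by simp
qed

lemma osc_tensor_sq:
 fixes R :: "'i => real^3 => 'b::euclidean_space"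
 assumes "!!i. i : I ==> \<psi> i : test_functions \<Omega> & Y_periodic (R i) & R i : sq_int LY"
 shows "e > 0 ==> (%x. \<Sum>i\<in>I. \<psi> i x *R osc e (R i) x) : sq_int LO"
  and "(%p. \<Sum>i\<in>I. \<psi> i (fst p) *R R i (snd p)) : sq_int LP"
 using assms
 by (auto intro!: sq_int_sum tf_mult_sq osc_sq \<Omega>(2) \<Omega>_lebesgue sq_int_tensor(1)[OF OY] sq_int_continuous[OF tf_continuous])

lemma osc_sum_inner:
 fixes R R' :: "'i => real^3 => 'b::euclidean_space"
 assumes I: "finite I" and R: "!!i. i : I ==> \<psi> i : test_functions \<Omega> & Y_periodic (R i) & R i : sq_int LY"
  "!!i. i : I ==> Y_periodic (R' i) & R' i : sq_int LY"
 shows "((%e. LINT x|LO. (\<Sum>i\<in>I. \<psi> i x *R osc e (R i) x) \<bullet> (\<Sum>i\<in>I. \<psi> i x *R osc e (R' i) x)) \<longlongrightarrow>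
  (LINT p|LP. (\<Sum>i\<in>I. \<psi> i (fst p) *R R i (snd p)) \<bullet> (\<Sum>i\<in>I. \<psi> i (fst p) *R R' i (snd p))) / 8) (at_right 0)"
proof -
 have s: "\<psi> i : sq_int LO" if "i : I" for i using R(1)[OF that] by (intro sq_int_continuous[OF tf_continuous \<Omega>(2) \<Omega>_lebesgue]) auto
 have t: "(%p. \<psi> i (fst p) *R R i (snd p)) : sq_int LP" "(%p. \<psi> i (fst p) *R R' i (snd p)) : sq_int LP" if "i : I" for i
  using R(1,2)[OF that] s[OF that] by (auto intro!: sq_int_tensor(1)[OF OY])
 have o: "(%x. \<psi> i x *R osc e (R i) x) : sq_int LO" "(%x. \<psi> i x *R osc e (R' i) x) : sq_int LO" if "i : I" "e > 0" for i e
  using R(1,2)[OF that(1)] that(2) by (auto intro!: tf_mult_sq osc_sq \<Omega>(2) \<Omega>_lebesgue)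
 have P: "(LINT p|LP. (\<Sum>i\<in>I. \<psi> i (fst p) *R R i (snd p)) \<bullet> (\<Sum>i\<in>I. \<psi> i (fst p) *R R' i (snd p))) / 8 =
   (\<Sum>i\<in>I. \<Sum>j\<in>I. (LINT p|LP. (\<psi> i (fst p) *R R i (snd p)) \<bullet> (\<psi> j (fst p) *R R' j (snd p))) / 8)"
  using integral_sum_inner[OF I, of "%i p. \<psi> i (fst p) *R R i (snd p)" LP "%i p. \<psi> i (fst p) *R R' i (snd p)", OF t] by (simp only: sum_divide_distrib)
 have L: "((%e. \<Sum>i\<in>I. \<Sum>j\<in>I. LINT x|LO. (\<psi> i x *R osc e (R i) x) \<bullet> (\<psi> j x *R osc e (R' j) x)) \<longlongrightarrow>
   (\<Sum>i\<in>I. \<Sum>j\<in>I. (LINT p|LP. (\<psi> i (fst p) *R R i (snd p)) \<bullet> (\<psi> j (fst p) *R R' j (snd p))) / 8)) (at_right 0)"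
  using R by (intro tendsto_sum osc_inner) auto
 have "\<forall>\<^sub>F e in at_right (0::real). (\<Sum>i\<in>I. \<Sum>j\<in>I. LINT x|LO. (\<psi> i x *R osc e (R i) x) \<bullet> (\<psi> j x *R osc e (R' j) x)) =
   (LINT x|LO. (\<Sum>i\<in>I. \<psi> i x *R osc e (R i) x) \<bullet> (\<Sum>i\<in>I. \<psi> i x *R osc e (R' i) x))"
  using eventually_at_right_less[of "0::real"]
 proof eventually_elim
  case (elim e)
  show ?case by (rule integral_sum_inner[OF I, of "%i x. \<psi> i x *R osc e (R i) x" LO "%i x. \<psi> i x *R osc e (R' i) x", OF o, symmetric]) (use elim in auto)
 qed
 from tendsto_cong[OF this] L show ?thesis unfolding P by simp
qed

lemma osc_norm:
 fixes R :: "'i => real^3 => 'b::euclidean_space"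
 assumes "finite I" and R: "!!i. i : I ==> \<psi> i : test_functions \<Omega> & Y_periodic (R i) & R i : sq_int LY"
 shows "((%e. sq_norm LO (%x. \<Sum>i\<in>I. \<psi> i x *R osc e (R i) x)) \<longlongrightarrow> sq_norm LP (%p. \<Sum>i\<in>I. \<psi> i (fst p) *R R i (snd p)) / sqrt 8) (at_right 0)"
 unfolding sq_norm_def real_sqrt_divide[symmetric] power2_norm_eq_inner
 by (intro tendsto_real_sqrt osc_sum_inner[OF assms(1) R]) (use R in auto)

lemma osc_norm1:
 fixes R :: "real^3 => 'b::euclidean_space"
 assumes "\<psi> : test_functions \<Omega>" "Y_periodic R" "R : sq_int LY"
 shows "((%e. sq_norm LO (%x. \<psi> x *R osc e R x)) \<longlongrightarrow> sq_norm LP (%p. \<psi> (fst p) *R R (snd p)) / sqrt 8) (at_right 0)"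
 using osc_norm[of "{()}" "%_. \<psi>" "%_. R"] assms by simp

text \<open>\<open>periodization\<close> applied to \<open>t * u\<close> after dilation by
  \<open>e\<close>. The gradient of the dilated function carries a factor \<open>e\<close>, and this
  is the gain in each integration by parts in \<open>osc_mean\<close>.\<close>

lemma periodization_osc:
 assumes W: "Y_periodic W" "W : sq_int LY" and h: "Y_periodic h" "h : sq_int LY"
  and eq: "!!z. z : H1per ==> (LINT y|LY. W y \<bullet> hgrad UNIV z y) = (LINT y|LY. h y * z y)"
  and t: "t : test_functions \<Omega>" and u: "u : sq_int LO" "weak_hgrad \<Omega> u g" "g : sq_int LO" and e: "e > 0"
 shows "e * (LINT x|LO. osc e W x \<bullet> (t x *R g x + u x *R hgv t x)) = (LINT x|LO. osc e h x * (t x * u x))"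
proof -
 obtain K where K: "compact K" "K <= \<Omega>" "!!x. x ~: K ==> t x = 0" using tf_ex[OF t] by blast
 let ?G = "%x. t x *R g x + u x *R hgv t x"
 have h0: "hgv t x = 0" if "x ~: \<Omega>" for x
  using tf_outside[OF tf_hX[OF t] that] by (simp add: vec_eq_iff)
 obtain K' where K': "compact K'" "!!x i. x ~: K' ==> t x = 0 & hX i t x = 0"
 proof -
  obtain K1 where 1: "compact K1" "!!x. x ~: K1 ==> hX 1 t x = 0" using tf_ex[OF tf_hX[OF t]] by blast
  obtain K2 where 2: "compact K2" "!!x. x ~: K2 ==> hX 2 t x = 0" using tf_ex[OF tf_hX[OF t]] by blast
  have "t x = 0 & hX i t x = 0" if "x ~: K \<union> K1 \<union> K2" for x i
   using that K(3) 1(2) 2(2) exhaust_2[of i] by auto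
  thus ?thesis using that[of "K \<union> K1 \<union> K2"] K(1) 1(1) 2(1) by blast
 qed
 have uh: "(%x. u x *R hgv t x) : sq_int LO"
 proof -
  have "(%x. (hX 1 t x *R u x) *R (axis 1 1 :: real^2) + (hX 2 t x *R u x) *R axis 2 1) : sq_int LO"
   by (intro sq_int_add sq_int_blinear[OF tf_mult_sq[OF tf_hX[OF t] u(1)]] bounded_linear_scaleR_left)
  also have "(%x. (hX 1 t x *R u x) *R (axis 1 1 :: real^2) + (hX 2 t x *R u x) *R axis 2 1) = (%x. u x *R hgv t x)"
   by (auto simp: fun_eq_iff vec_eq_iff forall_2 axis_def)
  finally show ?thesis .
 qed
 have Gs: "?G : sq_int lebesgue"
  by (rule sq_int_extend[OF sq_int_add[OF tf_mult_sq[OF t u(3)] uh] \<Omega>_lebesgue]) (simp add: h0 tf_outside[OF t])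
 have us: "(%x. t x * u x) : sq_int lebesgue"
  using sq_int_extend[OF tf_mult_sq[OF t u(1)] \<Omega>_lebesgue] by (simp add: tf_outside[OF t])
 note V = volmap_dil[OF e]
 have c: "1/e^4 > 0" using e by simp
 have m: "osc e W : bm lebesgue" "osc e h : bm lebesgue"
  using e by (intro volmap_measurable[OF volmap_dil] periodic_measurable W h sq_intD, simp)+
 have bd: "bounded (dil (1/e) ` K')"
  using K'(1) by (intro compact_imp_bounded compact_continuous_image continuous_intros continuous_on_id) auto
 have out: "t (dil e x) * u (dil e x) = 0 & e *R ?G (dil e x) = 0" if "x ~: dil (1/e) ` K'" for x
 proof -
  have "dil e x ~: K'" using that e by (metis dil_inv(1) image_eqI less_irrefl)
  from K'(2)[OF this] show ?thesis by (simp add: vec_eq_iff)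
 qed
 have "(1/e^4) *R (LINT x|lebesgue. osc e W x \<bullet> (e *R ?G x)) = (LINT x|lebesgue. (%x. osc e W x \<bullet> (e *R ?G x)) (dil e x))"
  by (intro volmap_integral[OF V, symmetric] borel_measurable_inner borel_measurable_scaleR m sq_intD[OF Gs] borel_measurable_const)
 also have "... = (LINT x|lebesgue. W x \<bullet> (e *R ?G (dil e x)))" using e by simp
 also have "... = (LINT x|lebesgue. h x * (t (dil e x) * u (dil e x)))"
  by (rule periodization[OF W h eq weak_hgrad_dil[OF weak_hgrad_mult[OF \<Omega>(1) u(2) t] e] sq_int_volmap[OF V us] sq_int_scale[OF sq_int_volmap[OF V Gs]] bd out])
 also have "... = (LINT x|lebesgue. (%x. osc e h x * (t x * u x)) (dil e x))" using e by simp
 also have "... = (1/e^4) *R (LINT x|lebesgue. osc e h x * (t x * u x))"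
  by (intro volmap_integral[OF V] borel_measurable_times m sq_intD[OF us])
 finally have "(LINT x|lebesgue. osc e W x \<bullet> (e *R ?G x)) = (LINT x|lebesgue. osc e h x * (t x * u x))" using c by simp
 moreover have "(LINT x|LO. osc e W x \<bullet> (e *R ?G x)) = (LINT x|lebesgue. osc e W x \<bullet> (e *R ?G x))"
  by (rule LINT_outside(1)[OF \<Omega>_lebesgue]) (simp add: h0 tf_outside[OF t])
 moreover have "(LINT x|LO. osc e h x * (t x * u x)) = (LINT x|lebesgue. osc e h x * (t x * u x))"
  by (rule LINT_outside(1)[OF \<Omega>_lebesgue]) (simp add: tf_outside[OF t])
 ultimately show ?thesis by simp
qed

lemma osc_null:
 fixes R :: "real^3 => 'b::euclidean_space" and g :: "real => real^3 => 'b"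
 assumes \<psi>: "\<psi> : test_functions \<Omega>" and R: "Y_periodic R" "R : sq_int LY" and g: "!!e. e > 0 ==> g e : sq_int LO & sq_norm LO (g e) <= C"
 shows "((%e. e * (LINT x|LO. (\<psi> x *R osc e R x) \<bullet> g e x)) \<longlongrightarrow> 0) (at_right 0)"
proof (rule Lim_null_comparison)
 have "((%e. e * (sq_norm LO (%x. \<psi> x *R osc e R x) * C)) \<longlongrightarrow> 0 * (sq_norm LP (%p. \<psi> (fst p) *R R (snd p)) / sqrt 8 * C)) (at_right 0)"
  by (intro tendsto_mult osc_norm1[OF \<psi> R] tendsto_const tendsto_ident_at)
 thus "((%e. e * (sq_norm LO (%x. \<psi> x *R osc e R x) * C)) \<longlongrightarrow> 0) (at_right 0)" by simp
 show "\<forall>\<^sub>F e in at_right 0. norm (e * (LINT x|LO. (\<psi> x *R osc e R x) \<bullet> g e x)) <= e * (sq_norm LO (%x. \<psi> x *R osc e R x) * C)"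
  using eventually_at_right_less[of "0::real"]
 proof eventually_elim
  case (elim e)
  have "\<bar>LINT x|LO. (\<psi> x *R osc e R x) \<bullet> g e x\<bar> <= sq_norm LO (%x. \<psi> x *R osc e R x) * sq_norm LO (g e)"
   using g[OF elim] by (intro sq_inner_CS tf_mult_sq[OF \<psi>] osc_sq[OF elim R] \<Omega>(2) \<Omega>_lebesgue) auto
  also have "... <= sq_norm LO (%x. \<psi> x *R osc e R x) * C" using g[OF elim] by (intro mult_left_mono sq_norm_nonneg) auto
  finally show ?case using elim by (simp add: abs_mult)
 qed
qed

text \<open>A field orthogonal to all periodic gradients acts on bounded sequences of gradients like its
 mean. The error is written as a divergence twice, the second time with the solution of a cell
 problem.\<close>

lemma osc_mean:
 fixes w :: "real^3 => real^2"
 assumes h: "h : test_functions \<Omega>" and w: "Y_periodic w" "w : sq_int LY"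
  and orth: "!!z. z : H1per ==> (LINT y|LY. w y \<bullet> hgrad UNIV z y) = 0"
  and u: "!!s. s > 0 ==> u s : sq_int LO & sq_norm LO (u s) <= C & weak_hgrad \<Omega> (u s) (g s) & g s : sq_int LO & sq_norm LO (g s) <= C"
 shows "((%s. (LINT x|LO. (h x *R osc s w x) \<bullet> g s x) - (LINT x|LO. (h x *R ((1/8) *R (LINT y|LY. w y))) \<bullet> g s x)) \<longlongrightarrow> 0) (at_right 0)"
proof -
 let ?m = "(1/8) *R (LINT y|LY. w y)"
 \<comment> \<open>Constants are orthogonal to periodic gradients, so \<open>w0\<close> keeps the
   orthogonality of \<open>w\<close>; having mean zero besides, its components are admissible data
   for \<open>cell_problem\<close>.\<close>
 define w0 where "w0 y = w y - ?m" for y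
 have w0: "Y_periodic w0" "w0 : sq_int LY"
  using w by (auto simp: w0_def[abs_def] Y_periodic_def intro!: sq_int_diff sq_int_const finite_Ycell)
 have i: "integrable LY w" by (rule sq_int_integrable[OF finite_Ycell w(2)])
 have "(LINT y|LY. w0 y) = (LINT y|LY. w y) - (LINT y|LY. ?m)"
  unfolding w0_def by (intro Bochner_Integration.integral_diff i sq_int_integrable[OF finite_Ycell] sq_int_const finite_Ycell)
 hence m0: "(LINT y|LY. w0 y) = 0" unfolding integral_const_Ycell by simp
 have c0: "Y_periodic (%y. w0 y $ i)" "(%y. w0 y $ i) : sq_int LY" "(LINT y|LY. w0 y $ i) = 0" for i
  using w0(1) sq_int_component[OF w0(2), of i] m0 integral_bounded_linear[OF bounded_linear_vec_nth sq_int_integrable[OF finite_Ycell w0(2)], of i]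
  by (auto simp: Y_periodic_def)
 have o0: "(LINT y|LY. w0 y \<bullet> hgrad UNIV z y) = 0" if z: "z : H1per" for z
 proof -
  have "(LINT y|LY. hgrad UNIV z y) $ k = 0" for k
   using gradient_mean_zero[OF z, of k] integral_bounded_linear[OF bounded_linear_vec_nth sq_int_integrable[OF finite_Ycell H1perD(4)[OF z]], of k] by simp
  hence "(LINT y|LY. hgrad UNIV z y) = 0" by (simp add: vec_eq_iff)
  hence "(LINT y|LY. ?m \<bullet> hgrad UNIV z y) = 0"
   using integral_bounded_linear[OF bounded_linear_inner_right sq_int_integrable[OF finite_Ycell H1perD(4)[OF z]], of ?m] by simp
  moreover have "(LINT y|LY. w0 y \<bullet> hgrad UNIV z y) = (LINT y|LY. w y \<bullet> hgrad UNIV z y) - (LINT y|LY. ?m \<bullet> hgrad UNIV z y)"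
   unfolding w0_def inner_diff_left
   by (intro Bochner_Integration.integral_diff sq_int_inner w(2) H1perD(4)[OF z] sq_int_const finite_Ycell)
  ultimately show ?thesis using orth[OF z] by simp
 qed
 have "\<forall>i. \<exists>a. a : H1per & (\<forall>z\<in>H1per. (LINT y|LY. hgrad UNIV a y \<bullet> hgrad UNIV z y) = (LINT y|LY. w0 y $ i * z y))"
  using cell_problem[OF c0(2,3)] by blast
 from choice[OF this] obtain a where a: "!!i. a i : H1per" "!!i z. z : H1per ==> (LINT y|LY. hgrad UNIV (a i) y \<bullet> hgrad UNIV z y) = (LINT y|LY. w0 y $ i * z y)" by blast
 let ?R = "%i. pgrad (a i)"
 note R = pgrad_periodic pgrad_sq[OF a(1)]
 have Req: "(LINT y|LY. ?R i y \<bullet> hgrad UNIV z y) = (LINT y|LY. w0 y $ i * z y)" if "z : H1per" for i z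
  unfolding a(2)[OF that, symmetric] by (intro Bochner_Integration.integral_cong refl) (simp add: pgrad_Ycell)
 \<comment> \<open>What the second integration by parts leaves: every term is \<open>s\<close> times
   the pairing of an oscillating function with a bounded sequence, hence tends to zero.\<close>
 define e where "e i s = s * (LINT x|LO. (hX i h x *R osc s (?R i) x) \<bullet> g s x) +
   (\<Sum>k\<in>UNIV. s * (LINT x|LO. (hX k (hX i h) x *R osc s (?R i) x) \<bullet> (u s x *R axis k 1)))" for i :: 2 and s
 have "(%x. u s x *R axis k 1 :: real^2) : sq_int LO & sq_norm LO (%x. u s x *R axis k 1 :: real^2) <= C" if "s > 0" for s k
  using u[OF that] sq_int_blinear[of "u s" LO "%t. t *R axis k 1"] by (auto simp: bounded_linear_scaleR_left sq_norm_def)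
 hence "(e i \<longlongrightarrow> 0 + (\<Sum>k\<in>(UNIV::2 set). 0)) (at_right 0)" for i unfolding e_def[abs_def]
  using u by (intro tendsto_add tendsto_sum osc_null[where C = C] tf_hX h R) auto
 hence "((%s. - e 1 s - e 2 s) \<longlongrightarrow> - 0 - 0) (at_right 0)" by (intro tendsto_intros) auto
 moreover have "\<forall>\<^sub>F s in at_right 0. - e 1 s - e 2 s = (LINT x|LO. (h x *R osc s w x) \<bullet> g s x) - (LINT x|LO. (h x *R ?m) \<bullet> g s x)"
  using eventually_at_right_less[of "0::real"]
 proof eventually_elim
  case (elim s)
  have us: "u s : sq_int LO" "weak_hgrad \<Omega> (u s) (g s)" "g s : sq_int LO" using u[OF elim] by auto
  note ob = osc_sq[OF elim _ _ \<Omega>(2) \<Omega>_lebesgue]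
  have uk: "(%x. u s x *R axis k 1 :: real^2) : sq_int LO" for k
   using sq_int_blinear[OF us(1), of "%t. t *R axis k 1"] by (simp add: bounded_linear_scaleR_left)
  have split: "(LINT x|LO. osc s S x \<bullet> (p x *R g s x + u s x *R hgv p x)) = (LINT x|LO. (p x *R osc s S x) \<bullet> g s x) +
    (\<Sum>k\<in>UNIV. LINT x|LO. (hX k p x *R osc s S x) \<bullet> (u s x *R axis k 1))" (is "?l = ?r")
   if S: "Y_periodic S" "S : sq_int LY" and p: "p : test_functions \<Omega>" for S p
  proof -
   have i2: "integrable LO (%x. (hX k p x *R osc s S x) \<bullet> (u s x *R axis k 1))" for k
    by (intro sq_int_inner tf_mult_sq[OF tf_hX[OF p]] ob[OF S] uk)
   have i1: "integrable LO (%x. (p x *R osc s S x) \<bullet> g s x)" by (intro sq_int_inner tf_mult_sq[OF p] ob[OF S] us)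
   have "?l = (LINT x|LO. (p x *R osc s S x) \<bullet> g s x + (\<Sum>k\<in>UNIV. (hX k p x *R osc s S x) \<bullet> (u s x *R axis k 1)))"
    by (intro Bochner_Integration.integral_cong refl) (simp add: inner_vec_def sum_2 axis_def algebra_simps)
   thus ?thesis using i1 i2 by (simp add: Bochner_Integration.integral_sum)
  qed
  \<comment> \<open>First integration by parts, with zero right-hand side: the pairing of
    \<open>w0\<close> with the gradient equals minus its pairing with \<open>u s\<close> times the
    derivatives of \<open>h\<close>.\<close>
  have 1: "s * (LINT x|LO. osc s w0 x \<bullet> (h x *R g s x + u s x *R hgv h x)) = (LINT x|LO. osc s (%y. 0) x * (h x * u s x))"
   by (rule periodization_osc[OF w0 _ sq_int_zero _ h us elim]) (simp_all add: o0 Y_periodic_def)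
  \<comment> \<open>Second integration by parts: in the weak sense the component
    \<open>w0 y $ i\<close> is minus the divergence of \<open>?R i\<close>, so the remaining pairing
    is of order \<open>s\<close>.\<close>
  have 2: "e i s = (LINT x|LO. (hX i h x *R osc s w0 x) \<bullet> (u s x *R axis i 1))" for i
  proof -
   have "e i s = s * (LINT x|LO. osc s (?R i) x \<bullet> (hX i h x *R g s x + u s x *R hgv (hX i h) x))"
    unfolding e_def split[OF R tf_hX[OF h]] by (simp add: distrib_left sum_distrib_left)
   also have "... = (LINT x|LO. osc s (%y. w0 y $ i) x * (hX i h x * u s x))"
    by (rule periodization_osc[OF R c0(1,2) Req tf_hX[OF h] us elim])
   finally show ?thesis by (simp add: inner_axis mult_ac)
  qed
  have "(LINT x|LO. osc s w0 x \<bullet> (h x *R g s x + u s x *R hgv h x)) = 0" using 1 elim by simp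
  hence 3: "(LINT x|LO. (h x *R osc s w0 x) \<bullet> g s x) = - e 1 s - e 2 s"
   unfolding split[OF w0 h] 2 sum_2 by linarith
  have "(LINT x|LO. (h x *R osc s w0 x) \<bullet> g s x) = (LINT x|LO. (h x *R osc s w x) \<bullet> g s x - (h x *R ?m) \<bullet> g s x)"
   unfolding w0_def by (simp add: scaleR_diff_right inner_diff_left)
  also have "... = (LINT x|LO. (h x *R osc s w x) \<bullet> g s x) - (LINT x|LO. (h x *R ?m) \<bullet> g s x)"
   by (intro Bochner_Integration.integral_diff sq_int_inner tf_mult_sq[OF h] ob[OF w] us sq_int_const finite_LO)
  finally show ?case using 3 by simp
 qed
 ultimately show ?thesis using tendsto_cong by force
qed

end

section \<open>Convergence\<close>

lemma ip_add:
 assumes "f : sq_int M" "g : sq_int M" "h : sq_int M"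
 shows "(LINT x|M. f x \<bullet> (g x + h x)) = (LINT x|M. f x \<bullet> g x) + (LINT x|M. f x \<bullet> h x)"
 using sq_int_inner[OF assms(1,2)] sq_int_inner[OF assms(1,3)] by (simp add: inner_add_right)

lemma ip_diff:
 assumes "f : sq_int M" "g : sq_int M" "h : sq_int M"
 shows "(LINT x|M. f x \<bullet> (g x - h x)) = (LINT x|M. f x \<bullet> g x) - (LINT x|M. f x \<bullet> h x)"
 using sq_int_inner[OF assms(1,2)] sq_int_inner[OF assms(1,3)] by (simp add: inner_diff_right)

lemma ip_diff_left:
 assumes "f : sq_int M" "g : sq_int M" "h : sq_int M"
 shows "(LINT x|M. (g x - h x) \<bullet> f x) = (LINT x|M. g x \<bullet> f x) - (LINT x|M. h x \<bullet> f x)"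
 using ip_diff[OF assms] by (simp add: inner_commute)

lemma ip_sum:
 assumes "f : sq_int M" "!!i. i : I ==> g i : sq_int M"
 shows "(LINT x|M. f x \<bullet> (\<Sum>i\<in>I. g i x)) = (\<Sum>i\<in>I. LINT x|M. f x \<bullet> g i x)"
 unfolding inner_sum_right using assms by (intro Bochner_Integration.integral_sum sq_int_inner) auto

lemma ip_sum_left:
 assumes "f : sq_int M" "!!i. i : I ==> g i : sq_int M"
 shows "(LINT x|M. (\<Sum>i\<in>I. g i x) \<bullet> f x) = (\<Sum>i\<in>I. LINT x|M. g i x \<bullet> f x)"
 using ip_sum[OF assms] by (simp add: inner_commute)

text \<open>The form in which the limits are concluded: approximants of accuracy \<open>d\<close>
  give an eventual bound \<open>K * d\<close>, with \<open>K\<close> not depending on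
  \<open>d\<close>.\<close>

lemma tendsto_zeroI_linear:
 fixes h :: "'i => real"
 assumes nn: "!!x. 0 <= h x" and le: "!!d. 0 < d ==> d <= 1 ==> \<forall>\<^sub>F x in F. h x <= K * d"
 shows "(h \<longlongrightarrow> 0) F"
proof (rule tendstoI)
 fix e :: real assume e: "e > 0"
 define d where "d = min 1 (e / (2 * (\<bar>K\<bar> + 1)))"
 have d: "0 < d" "d <= 1" using e by (auto simp: d_def)
 have "K * d <= (\<bar>K\<bar> + 1) * (e / (2 * (\<bar>K\<bar> + 1)))" using d(1) by (intro mult_mono) (auto simp: d_def)
 also have "... < e" using e by (simp add: field_simps add_pos_nonneg)
 finally have lt: "K * d < e" .
 show "\<forall>\<^sub>F x in F. dist (h x) 0 < e"
  using le[OF d]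
 proof eventually_elim
  case (elim x)
  thus ?case using lt nn[of x] by (simp add: dist_real_def)
 qed
qed

lemma weak_hgrad_sum:
 assumes "open \<Omega>" "finite I" "!!i. i : I ==> weak_hgrad \<Omega> (f i) (F i)"
 shows "weak_hgrad \<Omega> (%x. \<Sum>i\<in>I. f i x) (%x. \<Sum>i\<in>I. F i x)"
 using assms(2,3)
proof (induction I)
 case empty thus ?case using weak_hgrad_subset[OF weak_hgrad_const[of 0] assms(1)] by simp
next
 case (insert i I)
 thus ?case using weak_hgrad_add[OF assms(1), of "f i" "F i" "%x. \<Sum>i\<in>I. f i x"] by simp
qed

context homogenization
begin

lemma A_LO:
 assumes U: "U : sq_int LO" and e: "e > 0"
 shows "(%x. osc e A x *v U x) : sq_int LO" "sq_norm LO (%x. osc e A x *v U x) <= \<beta> * sq_norm LO U"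
proof -
 have "(%x. osc e A x $ i $ j) : bm LO" for i j
  by (rule measurable_restrict_space1[OF volmap_measurable[OF volmap_dil A_meas]]) (use e in simp)
 from matvec_sq[OF this A_bound less_imp_le[OF \<beta>] U]
 show "(%x. osc e A x *v U x) : sq_int LO" "sq_norm LO (%x. osc e A x *v U x) <= \<beta> * sq_norm LO U" .
qed

text \<open>One index set with common slow factors lets all three sums run over the same
  \<open>I\<close>, so that their products and differences can be averaged term by term. The three
  blocks approximate \<open>G\<close> by constant vectors times test functions,
  \<open>\<Psi>\<close> by periodic gradients, and \<open>Z\<close> by divergence-free factors; in a
  block that does not concern them the fast factors are zero.\<close>

lemma approximants:
 assumes G: "G : sq_int LO" and \<Psi>: "\<Psi> : Kset \<Omega>" and Z: "Z : sq_int LP" and perp: "!!P. P : Kset \<Omega> ==> (LINT p|LP. Z p \<bullet> P p) = 0"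
  and e: "e > 0"
 obtains I :: "(2 + (nat + nat)) set" and \<psi> c \<rho> q w where "finite I" "!!i. i : I ==> \<psi> i : test_functions \<Omega>"
  "!!i. i : I ==> \<rho> i : H1per" "!!i. i : I ==> weak_hgrad UNIV (\<rho> i) (q i) & Y_periodic (q i) & q i : sq_int LY"
  "!!i. i : I ==> Y_periodic (w i) & w i : sq_int LY" "!!i z. i : I ==> z : H1per ==> (LINT y|LY. w i y \<bullet> hgrad UNIV z y) = 0"
  "sq_norm LO (%x. G x - (\<Sum>i\<in>I. \<psi> i x *R c i)) < e"
  "sq_norm LP (%p. G (fst p) + \<Psi> p - (\<Sum>i\<in>I. \<psi> i (fst p) *R (c i + q i (snd p)))) < e"
  "sq_norm LP (%p. Z p - (\<Sum>i\<in>I. \<psi> i (fst p) *R w i (snd p))) < e"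
proof -
 \<comment> \<open>Two components with error \<open>e/12\<close> make \<open>e/6\<close> on the
   domain. Passing to the product multiplies by sqrt 8 < 3 and gives \<open>e/2\<close>; the other
   half is left for \<open>\<Psi>\<close>.\<close>
 have e': "e/12 > 0" "e/2 > 0" using e by auto
 have "\<forall>k. \<exists>t. t : test_functions \<Omega> & t : sq_int LO & sq_norm LO (%x. G x $ k - t x) < e/12"
  using test_function_dense[OF \<Omega> sq_int_component[OF G] e'(1)] by blast
 from choice[OF this] obtain t where t: "!!k. t k : test_functions \<Omega>" "!!k. t k : sq_int LO" "!!k. sq_norm LO (%x. G x $ k - t k x) < e/12" by blast
 obtain N s r where s: "!!j. j < N ==> s j : test_functions \<Omega> & s j : sq_int LO & r j : H1per"
  and a1: "sq_norm LP (%p. \<Psi> p - (\<Sum>j<N::nat. s j (fst p) *R hgrad UNIV (r j) (snd p))) < e/2" using Kset_dense[OF \<Psi> e'(2)] by blast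
 obtain N' \<tau> v where \<tau>: "!!j. j < N' ==> \<tau> j : test_functions \<Omega> & v j : sq_int LY"
  and v: "!!j z. j < N' ==> z : H1per ==> (LINT y|LY. v j y \<bullet> hgrad UNIV z y) = 0"
  and a2: "sq_norm LP (%p. Z p - (\<Sum>j<N'::nat. \<tau> j (fst p) *R v j (snd p))) < e" using Kset_perp_dense[OF Z perp e] by blast
 define I :: "(2 + (nat + nat)) set" where "I = UNIV <+> ({..<N} <+> {..<N'})"
 define \<psi> where "\<psi> = case_sum t (case_sum s \<tau>)"
 define c :: "2 + (nat + nat) => real^2" where "c = case_sum (%k. axis k 1) (%_. 0)"
 define \<rho> :: "2 + (nat + nat) => real^3 => real" where "\<rho> = case_sum (%_ _. 0) (case_sum r (%_ _. 0))"
 define q :: "2 + (nat + nat) => real^3 => real^2" where "q = case_sum (%_ _. 0) (case_sum (%j. pgrad (r j)) (%_ _. 0))"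
 define w :: "2 + (nat + nat) => real^3 => real^2" where "w = case_sum (%_ _. 0) (case_sum (%_ _. 0) (%j y. v j (lrep y)))"
 have sI: "(\<Sum>i\<in>I. h i) = (\<Sum>k\<in>UNIV. h (Inl k)) + ((\<Sum>j<N. h (Inr (Inl j))) + (\<Sum>j<N'. h (Inr (Inr j))))" for h :: "2 + (nat + nat) => real^2"
  by (simp add: I_def sum.Plus o_def)
 have vl: "(%y. v j (lrep y)) : sq_int LY" if "j < N'" for j
  by (rule sq_int_AE_eq[OF Ycell_lebesgue conjunct2[OF \<tau>[OF that]] AE_LY_I]) (simp add: lrep_id)
 have d: "(%x. G x $ k - t k x) : sq_int LO" for k by (rule sq_int_diff[OF sq_int_component[OF G] t(2)])
 have ds: "(%x. (G x $ k - t k x) *R axis k 1 :: real^2) : sq_int LO" for k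
  by (rule sq_int_blinear[OF d bounded_linear_scaleR_left])
 have e0: "(%x. G x - (\<Sum>i\<in>I. \<psi> i x *R c i)) = (%x. \<Sum>k\<in>UNIV. (G x $ k - t k x) *R axis k 1)"
  unfolding sI by (auto simp: fun_eq_iff \<psi>_def c_def sum_2 vec_eq_iff forall_2 axis_def)
 have G0: "(%x. G x - (\<Sum>i\<in>I. \<psi> i x *R c i)) : sq_int LO" unfolding e0 by (intro sq_int_sum ds)
 have "sq_norm LO (%x. G x - (\<Sum>i\<in>I. \<psi> i x *R c i)) <= (\<Sum>k\<in>UNIV. sq_norm LO (%x. (G x $ k - t k x) *R axis k 1 :: real^2))"
  unfolding e0 by (rule sq_norm_sum_le[OF _ ds]) simp
 also have "... = (\<Sum>k\<in>UNIV. sq_norm LO (%x. G x $ k - t k x))" by (simp add: sq_norm_def)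
 finally have n0: "sq_norm LO (%x. G x - (\<Sum>i\<in>I. \<psi> i x *R c i)) < e/6" using t(3)[of 1] t(3)[of 2] by (simp add: sum_2)
 have s8: "sqrt 8 < 3" by (rule real_less_lsqrt) auto
 have n1: "sq_norm LP (%p. G (fst p) - (\<Sum>i\<in>I. \<psi> i (fst p) *R c i)) < e/2"
 proof -
  have "sqrt 8 * sq_norm LO (%x. G x - (\<Sum>i\<in>I. \<psi> i x *R c i)) <= 3 * sq_norm LO (%x. G x - (\<Sum>i\<in>I. \<psi> i x *R c i))"
   using s8 by (intro mult_right_mono sq_norm_nonneg) simp
  thus ?thesis unfolding fst_sq(2)[OF G0] using n0 by linarith
 qed
 have P0: "(%p. \<Psi> p - (\<Sum>j<N. s j (fst p) *R hgrad UNIV (r j) (snd p))) : sq_int LP"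
  using s by (intro sq_int_diff KsetD(1)[OF \<Psi>] tensor_sum_sq) (auto intro: H1perD(4))
 show ?thesis
 proof (rule that[of I \<psi> \<rho> q w c])
  show "finite I" by (simp add: I_def)
  fix i assume i: "i : I"
  show "\<psi> i : test_functions \<Omega>" using i t(1) s \<tau> by (auto simp: I_def \<psi>_def)
  show "\<rho> i : H1per" using i s H1per_const(1)[of 0] by (auto simp: I_def \<rho>_def)
  show "weak_hgrad UNIV (\<rho> i) (q i) & Y_periodic (q i) & q i : sq_int LY"
  proof -
   have "r j : H1per" if "j < N" for j using s[OF that] by blast
   from weak_hgrad_pgrad[OF this] pgrad_sq[OF this] show ?thesis
    using i weak_hgrad_const[of 0] by (auto simp: I_def \<rho>_def q_def Y_periodic_def[of "%_. 0"] pgrad_periodic sq_int_zero)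
  qed
  show "Y_periodic (w i) & w i : sq_int LY"
   using i vl by (auto simp: I_def w_def Y_periodic_def[of "%_. 0"] sq_int_zero Y_periodicI_lrep)
  show "(LINT y|LY. w i y \<bullet> hgrad UNIV z y) = 0" if z: "z : H1per" for z
  proof -
   have "(LINT y|LY. v j (lrep y) \<bullet> hgrad UNIV z y) = (LINT y|LY. v j y \<bullet> hgrad UNIV z y)" for j
    by (intro Bochner_Integration.integral_cong refl) (simp add: lrep_id)
   thus ?thesis using i v[OF _ z] by (auto simp: I_def w_def)
  qed
 next
  show "sq_norm LO (%x. G x - (\<Sum>i\<in>I. \<psi> i x *R c i)) < e" using n0 e by simp
  have "sq_norm LP (%p. G (fst p) + \<Psi> p - (\<Sum>i\<in>I. \<psi> i (fst p) *R (c i + q i (snd p)))) =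
    sq_norm LP (%p. (G (fst p) - (\<Sum>i\<in>I. \<psi> i (fst p) *R c i)) + (\<Psi> p - (\<Sum>j<N. s j (fst p) *R hgrad UNIV (r j) (snd p))))"
  proof (rule sq_norm_cong)
   fix p assume "p : space LP"
   hence y: "snd p : Ycell" by auto
   have "(\<Sum>i\<in>I. \<psi> i (fst p) *R q i (snd p)) = (\<Sum>j<N. s j (fst p) *R hgrad UNIV (r j) (snd p))"
    unfolding sI by (simp add: \<psi>_def q_def pgrad_Ycell[OF y])
   thus "G (fst p) + \<Psi> p - (\<Sum>i\<in>I. \<psi> i (fst p) *R (c i + q i (snd p))) =
     (G (fst p) - (\<Sum>i\<in>I. \<psi> i (fst p) *R c i)) + (\<Psi> p - (\<Sum>j<N. s j (fst p) *R hgrad UNIV (r j) (snd p)))"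
    by (simp add: scaleR_add_right sum.distrib)
  qed
  also have "... < e" using sq_norm_triangle[OF fst_sq(1)[OF G0] P0] n1 a1 by linarith
  finally show "sq_norm LP (%p. G (fst p) + \<Psi> p - (\<Sum>i\<in>I. \<psi> i (fst p) *R (c i + q i (snd p)))) < e" .
  have "sq_norm LP (%p. Z p - (\<Sum>i\<in>I. \<psi> i (fst p) *R w i (snd p))) = sq_norm LP (%p. Z p - (\<Sum>j<N'. \<tau> j (fst p) *R v j (snd p)))"
  proof (rule sq_norm_cong)
   fix p assume "p : space LP"
   hence "snd p : Ycell" by auto
   thus "Z p - (\<Sum>i\<in>I. \<psi> i (fst p) *R w i (snd p)) = Z p - (\<Sum>j<N'. \<tau> j (fst p) *R v j (snd p))"
    unfolding sI by (simp add: \<psi>_def w_def lrep_id)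
  qed
  with a2 show "sq_norm LP (%p. Z p - (\<Sum>i\<in>I. \<psi> i (fst p) *R w i (snd p))) < e" by simp
 qed
qed

end

section \<open>The oscillating solutions and the limit pair\<close>

locale homogenization_solutions = homogenization +
 fixes v :: "real => real^3 => real" and g :: "real => real^3 => real^2"
  and u :: "real^3 => real" and G :: "real^3 => real^2" and \<Psi> :: "(real^3) \<times> (real^3) => real^2"
 assumes v: "!!\<epsilon>. \<epsilon> > 0 ==> v \<epsilon> : sq_int LO & weak_hgrad \<Omega> (v \<epsilon>) (g \<epsilon>) & g \<epsilon> : sq_int LO"
  and v_eq: "!!\<epsilon> \<phi> \<gamma>. \<epsilon> > 0 ==> \<phi> : sq_int LO ==> weak_hgrad \<Omega> \<phi> \<gamma> ==> \<gamma> : sq_int LO ==>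
   (LINT x|LO. (osc \<epsilon> A x *v g \<epsilon> x) \<bullet> \<gamma> x) + (LINT x|LO. v \<epsilon> x * \<phi> x) = (LINT x|LO. f x * \<phi> x)"
  and u: "u : sq_int LO" "weak_hgrad \<Omega> u G" "G : sq_int LO" and \<Psi>: "\<Psi> : Kset \<Omega>"
  and u_eq: "!!\<phi> \<gamma> \<Phi>. \<phi> : sq_int LO ==> weak_hgrad \<Omega> \<phi> \<gamma> ==> \<gamma> : sq_int LO ==> \<Phi> : Kset \<Omega> ==>
   (LINT p|LP. (A (snd p) *v (G (fst p) + \<Psi> p)) \<bullet> (\<gamma> (fst p) + \<Phi> p)) + 8 * (LINT x|LO. u x * \<phi> x) = 8 * (LINT x|LO. f x * \<phi> x)"
begin

abbreviation U :: "(real^3) \<times> (real^3) => real^2" where "U p \<equiv> G (fst p) + \<Psi> p"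
abbreviation Z :: "(real^3) \<times> (real^3) => real^2" where "Z p \<equiv> A (snd p) *v U p"

lemma U_sq: "U : sq_int LP" by (intro sq_int_add fst_sq(1) u KsetD(1)[OF \<Psi>])
lemma Z_sq: "Z : sq_int LP" by (rule A_LP(1)[OF U_sq])

lemma zero_Kset: "(%p. 0) : Kset \<Omega>" using Kset_sum[of "{}"] by simp

text \<open>The limit equation with \<open>\<phi> = 0\<close>: the limit flux is orthogonal to
  \<open>Kset\<close>, which makes it approximable by divergence-free tensors.\<close>

lemma Z_perp: "P : Kset \<Omega> ==> (LINT p|LP. Z p \<bullet> P p) = 0"
 using u_eq[OF sq_int_zero weak_hgrad_subset[OF weak_hgrad_const[of 0] \<Omega>(1)] sq_int_zero] by simp

lemma Z_fst:
 assumes h: "h : sq_int LO" "weak_hgrad \<Omega> h r" "r : sq_int LO"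
 shows "(LINT p|LP. Z p \<bullet> r (fst p)) = 8 * (LINT x|LO. (f x - u x) * h x)"
 using u_eq[OF h zero_Kset] ip_diff_left[OF h(1) f u(1)] by simp

lemma Z_U: "(LINT p|LP. Z p \<bullet> U p) = 8 * (LINT x|LO. (f x - u x) * u x)"
 using ip_add[OF Z_sq fst_sq(1)[OF u(3)] KsetD(1)[OF \<Psi>]] Z_fst[OF u] Z_perp[OF \<Psi>] by simp

definition C where "C = sq_norm LO f + sq_norm LO f / sqrt \<alpha>"

text \<open>Testing with the solution itself bounds \<open>v e\<close> by the norm of
  \<open>f\<close>, and then \<alpha> times the squared norm of \<open>g e\<close> by the square of
  that norm. The constant \<open>C\<close> is the sum of the two bounds, to have one constant for
  both.\<close>

lemma C_bound: assumes e: "e > 0" shows "sq_norm LO (v e) <= C" "sq_norm LO (g e) <= C"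
proof -
 have vs: "v e : sq_int LO" "weak_hgrad \<Omega> (v e) (g e)" "g e : sq_int LO" using v[OF e] by auto
 have "\<alpha> * (sq_norm LO (g e))^2 = (LINT x|LO. \<alpha> * (norm (g e x))^2)" by (simp add: sq_norm_sq)
 also have "... <= (LINT x|LO. (osc e A x *v g e x) \<bullet> g e x)"
  using sq_int_norm[OF vs(3)] by (intro integral_mono A_coercive sq_int_inner A_LO(1)[OF _ e] vs) simp
 finally have "\<alpha> * (sq_norm LO (g e))^2 + (LINT x|LO. v e x * v e x) <= (LINT x|LO. f x * v e x)" using v_eq[OF e vs] by linarith
 also have "... <= sq_norm LO f * sq_norm LO (v e)" using sq_inner_CS[OF f vs(1)] by simp
 finally have *: "\<alpha> * (sq_norm LO (g e))^2 + (sq_norm LO (v e))^2 <= sq_norm LO f * sq_norm LO (v e)"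
  unfolding sq_norm_sq[of LO "v e"] by (simp add: power2_eq_square)
 note nn = sq_norm_nonneg[of LO f] sq_norm_nonneg[of LO "v e"] sq_norm_nonneg[of LO "g e"]
 have "0 <= \<alpha> * (sq_norm LO (g e))^2" using \<alpha> by simp
 with * have "sq_norm LO (v e) * sq_norm LO (v e) <= sq_norm LO f * sq_norm LO (v e)" by (simp add: power2_eq_square)
 hence 1: "sq_norm LO (v e) <= sq_norm LO f" using nn by (cases "sq_norm LO (v e) = 0") auto
 have "\<alpha> * (sq_norm LO (g e))^2 <= sq_norm LO f * sq_norm LO f"
  using * mult_left_mono[OF 1 nn(1)] zero_le_power2[of "sq_norm LO (v e)"] by linarith
 hence "(sq_norm LO (g e))^2 <= (sq_norm LO f / sqrt \<alpha>)^2" using \<alpha> by (simp add: power_divide power2_eq_square field_simps)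
 hence 2: "sq_norm LO (g e) <= sq_norm LO f / sqrt \<alpha>" using nn \<alpha> by (intro power2_le_imp_le[of "sq_norm LO (g e)"]) auto
 have "0 <= sq_norm LO f / sqrt \<alpha>" using nn \<alpha> by simp
 with 1 2 nn show "sq_norm LO (v e) <= C" "sq_norm LO (g e) <= C" unfolding C_def by linarith+
qed

end

section \<open>The energy estimate for fixed approximants\<close>

locale homogenization_approximants = homogenization_solutions +
 fixes I :: "'i set" and \<psi> :: "'i => real^3 => real" and c :: "'i => real^2" and \<rho> :: "'i => real^3 => real"
  and q w :: "'i => real^3 => real^2" and \<eta> :: real
 assumes I: "finite I" and \<psi>: "!!i. i : I ==> \<psi> i : test_functions \<Omega>" and \<rho>: "!!i. i : I ==> \<rho> i : H1per"
  and q: "!!i. i : I ==> weak_hgrad UNIV (\<rho> i) (q i) & Y_periodic (q i) & q i : sq_int LY"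
  and w: "!!i. i : I ==> Y_periodic (w i) & w i : sq_int LY"
  and orth: "!!i \<zeta>. i : I ==> \<zeta> : H1per ==> (LINT y|LY. w i y \<bullet> hgrad UNIV \<zeta> y) = 0"
  and \<eta>: "0 < \<eta>" "\<eta> <= 1"
  and C0_near: "sq_norm LO (%x. G x - (\<Sum>i\<in>I. \<psi> i x *R c i)) < \<eta>"
  and V_near: "sq_norm LP (%p. G (fst p) + \<Psi> p - (\<Sum>i\<in>I. \<psi> i (fst p) *R (c i + q i (snd p)))) < \<eta>"
  and W_near: "sq_norm LP (%p. A (snd p) *v (G (fst p) + \<Psi> p) - (\<Sum>i\<in>I. \<psi> i (fst p) *R w i (snd p))) < \<eta>"
begin

text \<open>\<open>V\<close> and \<open>W\<close> are the oscillating versions of \<open>VP\<close>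
  and \<open>WP\<close>. The field \<open>C0\<close> is the part of \<open>V\<close> that does not
  oscillate, so that \<open>V - C0\<close> consists of rescaled periodic gradients.\<close>

abbreviation "Q i y \<equiv> c i + q i y"
abbreviation "V \<epsilon> x \<equiv> \<Sum>i\<in>I. \<psi> i x *R osc \<epsilon> (Q i) x"
abbreviation "W \<epsilon> x \<equiv> \<Sum>i\<in>I. \<psi> i x *R osc \<epsilon> (w i) x"
abbreviation "VP p \<equiv> \<Sum>i\<in>I. \<psi> i (fst p) *R Q i (snd p)"
abbreviation "WP p \<equiv> \<Sum>i\<in>I. \<psi> i (fst p) *R w i (snd p)"
abbreviation "C0 x \<equiv> \<Sum>i\<in>I. \<psi> i x *R c i"

lemma Q: "i : I ==> \<psi> i : test_functions \<Omega> & Y_periodic (Q i) & Q i : sq_int LY"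
 using \<psi> q by (auto simp: Y_periodic_def intro!: sq_int_add sq_int_const finite_Ycell)
lemma w': "i : I ==> \<psi> i : test_functions \<Omega> & Y_periodic (w i) & w i : sq_int LY" using \<psi> w by blast

lemma V_sq: "e > 0 ==> V e : sq_int LO" and VP_sq: "VP : sq_int LP" using osc_tensor_sq[where I = I and \<psi> = \<psi>, OF Q] by auto
lemma W_sq: "e > 0 ==> W e : sq_int LO" and WP_sq: "WP : sq_int LP" using osc_tensor_sq[where I = I and \<psi> = \<psi>, OF w'] by auto
lemma C0_sq: "C0 : sq_int LO"
 by (intro sq_int_sum tf_mult_sq[OF \<psi>] sq_int_const finite_LO)

text \<open>The errors of order \<epsilon> caused by the corrector: derivatives that fall on
  \<open>\<psi> i\<close> instead of on the oscillating factor, and the corrector itself in the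
  terms of order zero.\<close>

definition s1 where "s1 \<epsilon> = (\<Sum>i\<in>I. \<Sum>k\<in>UNIV. \<epsilon> * (LINT x|LO. (hX k (\<psi> i) x *R osc \<epsilon> (%y. \<rho> i y *R axis k 1) x) \<bullet> (osc \<epsilon> A x *v g \<epsilon> x)))
  - (\<Sum>i\<in>I. \<epsilon> * (LINT x|LO. (\<psi> i x *R osc \<epsilon> (\<rho> i) x) \<bullet> (f x - v \<epsilon> x)))" for \<epsilon> :: real

lemma \<rho>k: "i : I ==> Y_periodic (%y. \<rho> i y *R (axis k 1 :: real^2))" "i : I ==> (%y. \<rho> i y *R (axis k 1 :: real^2)) : sq_int LY"
 using H1perD(1,2)[OF \<rho>[of i]] sq_int_blinear[OF _ bounded_linear_scaleR_left] by (auto simp: Y_periodic_def)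

lemma s1_null: "(s1 \<longlongrightarrow> 0) (at_right 0)"
proof -
 have 1: "(%x. osc e A x *v g e x) : sq_int LO & sq_norm LO (%x. osc e A x *v g e x) <= \<beta> * C" if "e > 0" for e
  using A_LO[of "g e", OF _ that] v[OF that] order_trans[OF _ mult_left_mono[OF C_bound(2)[OF that] less_imp_le[OF \<beta>]]] by blast
 have 2: "(%x. f x - v e x) : sq_int LO & sq_norm LO (%x. f x - v e x) <= sq_norm LO f + C" if "e > 0" for e
  using sq_int_diff[OF f, of "v e"] v[OF that] C_bound(1)[OF that] sq_norm_triangle_diff[OF f sq_int_zero, of "v e"] by (auto simp: sq_norm_minus)
 have "(s1 \<longlongrightarrow> (\<Sum>i\<in>I. \<Sum>k\<in>(UNIV::2 set). 0) - (\<Sum>i\<in>I. 0)) (at_right 0)"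
  unfolding s1_def[abs_def]
  by (intro tendsto_diff tendsto_sum osc_null[OF tf_hX[OF \<psi>] \<rho>k 1] osc_null[OF \<psi> H1perD(1,2)[OF \<rho>] 2])
 thus ?thesis by simp
qed

text \<open>The weak equation is tested with the difference of the solution and the corrected
 limit \<open>u + \<epsilon> \<Sum> \<psi>\<^sub>i \<rho>\<^sub>i\<^sup>\<epsilon>\<close>.\<close>

lemma tested:
 assumes e: "e > 0"
 shows "(LINT x|LO. (osc e A x *v g e x) \<bullet> (g e x - V e x)) = (LINT x|LO. (f x - v e x) * (v e x - u x)) + s1 e + (LINT x|LO. (osc e A x *v g e x) \<bullet> (G x - C0 x))"
proof -
 have vs: "v e : sq_int LO" "weak_hgrad \<Omega> (v e) (g e)" "g e : sq_int LO" using v[OF e] by auto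
 note Ag = A_LO(1)[OF vs(3) e]
 have l: "1/e > 0" using e by simp
 let ?p = "%x. \<Sum>i\<in>I. e * (\<psi> i x * osc e (\<rho> i) x)"
 let ?h = "%i x. osc e (\<rho> i) x *R hgv (\<psi> i) x"
 let ?P = "%x. \<Sum>i\<in>I. \<psi> i x *R osc e (q i) x + e *R ?h i x"
 have hs: "?h i x = (\<Sum>k\<in>UNIV. hX k (\<psi> i) x *R osc e (%y. \<rho> i y *R axis k 1) x)" for i x
  by (auto simp: vec_eq_iff sum_2 axis_def forall_2)
 have hk: "(%x. hX k (\<psi> i) x *R osc e (%y. \<rho> i y *R (axis k 1 :: real^2)) x) : sq_int LO" if "i : I" for i k
  by (rule tf_mult_sq[OF tf_hX[OF \<psi>[OF that]] osc_sq[OF e \<rho>k[OF that] \<Omega>(2) \<Omega>_lebesgue]])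
 have hq: "?h i : sq_int LO" if "i : I" for i unfolding hs by (intro sq_int_sum hk[OF that])
 have px: "(%x. \<psi> i x * osc e (\<rho> i) x) : sq_int LO" if "i : I" for i
  using tf_mult_sq[OF \<psi>[OF that] osc_sq[OF e H1perD(1,2)[OF \<rho>[OF that]] \<Omega>(2) \<Omega>_lebesgue]] by simp
 have qs: "(%x. \<psi> i x *R osc e (q i) x) : sq_int LO" if "i : I" for i
  using q[OF that] by (intro tf_mult_sq[OF \<psi>[OF that]] osc_sq[OF e] \<Omega>(2) \<Omega>_lebesgue) auto
 have ps: "?p : sq_int LO" by (intro sq_int_sum sq_int_cmult px) (use I in auto)
 have wp: "weak_hgrad \<Omega> (%x. e * (\<psi> i x * osc e (\<rho> i) x)) (%x. \<psi> i x *R osc e (q i) x + e *R ?h i x)" if "i : I" for i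
 proof -
  have 1: "weak_hgrad UNIV (osc e (\<rho> i)) (%x. (1/e) *R osc e (q i) x)" using weak_hgrad_dil[OF _ l] q[OF that] by blast
  show ?thesis
   using weak_hgrad_scale[OF \<Omega>(1) weak_hgrad_subset[OF weak_hgrad_mult[OF \<Omega>(1) weak_hgrad_subset[OF 1 \<Omega>(1)] \<psi>[OF that]] \<Omega>(1)], of e] e
   by (simp add: scaleR_add_right)
 qed
 have wP: "weak_hgrad \<Omega> ?p ?P" by (rule weak_hgrad_sum[OF \<Omega>(1) I wp])
 \<comment> \<open>The gradient of the corrector is \<open>V - C0\<close> up to order \<epsilon>:
   the factor \<open>e\<close> in front of the corrector cancels the \<open>1/e\<close> from
   differentiating \<open>\<rho> i\<close> at scale \<open>e\<close>.\<close>
 have Pv: "?P x = (V e x - C0 x) + (\<Sum>i\<in>I. e *R ?h i x)" for x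
  by (simp add: sum.distrib scaleR_add_right)
 \<comment> \<open>The test function and its gradient. Since \<open>V\<close> contains
   \<open>C0\<close> in place of the true gradient \<open>G\<close>, the difference
   \<open>G - C0\<close> appears; it is small by \<open>C0_near\<close>.\<close>
 let ?r = "%x. (v e x - u x) - ?p x" and ?s = "%x. (g e x - V e x) - (G x - C0 x) - (\<Sum>i\<in>I. e *R ?h i x)"
 have wd: "weak_hgrad \<Omega> (%x. a x - b x) (%x. a' x - b' x)" if "weak_hgrad \<Omega> a a'" "weak_hgrad \<Omega> b b'" for a b a' b'
  using weak_hgrad_add[OF \<Omega>(1) that(1) weak_hgrad_scale[OF \<Omega>(1) that(2), of "-1"]] by simp
 have ws: "weak_hgrad \<Omega> ?r ?s"
  using wd[OF wd[OF vs(2) u(2)] wP] unfolding Pv by (simp add: algebra_simps)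
 have sh: "(%x. \<Sum>i\<in>I. e *R ?h i x) : sq_int LO" by (intro sq_int_sum sq_int_scale hq) (use I in auto)
 have D: "(%x. g e x - V e x) : sq_int LO" by (rule sq_int_diff[OF vs(3) V_sq[OF e]])
 have GC: "(%x. G x - C0 x) : sq_int LO" by (rule sq_int_diff[OF u(3) C0_sq])
 have vu: "(%x. v e x - u x) : sq_int LO" and fv: "(%x. f x - v e x) : sq_int LO" by (intro sq_int_diff vs u f)+
 have rs: "?r : sq_int LO" by (rule sq_int_diff[OF vu ps])
 have "(LINT x|LO. (osc e A x *v g e x) \<bullet> ?s x) = (LINT x|LO. (f x - v e x) \<bullet> ?r x)"
  using v_eq[OF e rs ws sq_int_diff[OF sq_int_diff[OF D GC] sh]] ip_diff_left[OF rs f vs(1)] by simp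
 also have "... = (LINT x|LO. (f x - v e x) \<bullet> (v e x - u x)) - (LINT x|LO. (f x - v e x) \<bullet> ?p x)" by (rule ip_diff[OF fv vu ps])
 also have "(LINT x|LO. (f x - v e x) \<bullet> ?p x) = (\<Sum>i\<in>I. LINT x|LO. (f x - v e x) \<bullet> (e * (\<psi> i x * osc e (\<rho> i) x)))"
  by (rule ip_sum[OF fv sq_int_cmult[OF px]])
 also have "... = (\<Sum>i\<in>I. e * (LINT x|LO. (\<psi> i x *R osc e (\<rho> i) x) \<bullet> (f x - v e x)))" by (simp add: mult_ac flip: integral_mult_right_zero)
 finally have 1: "(LINT x|LO. (osc e A x *v g e x) \<bullet> ?s x) = (LINT x|LO. (f x - v e x) \<bullet> (v e x - u x)) - (\<Sum>i\<in>I. e * (LINT x|LO. (\<psi> i x *R osc e (\<rho> i) x) \<bullet> (f x - v e x)))" .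
 have "(LINT x|LO. (osc e A x *v g e x) \<bullet> (\<Sum>i\<in>I. e *R ?h i x)) = (\<Sum>i\<in>I. LINT x|LO. (osc e A x *v g e x) \<bullet> (e *R ?h i x))"
  by (rule ip_sum[OF Ag sq_int_scale[OF hq]])
 also have "... = (\<Sum>i\<in>I. e * (\<Sum>k\<in>UNIV. LINT x|LO. (osc e A x *v g e x) \<bullet> (hX k (\<psi> i) x *R osc e (%y. \<rho> i y *R axis k 1) x)))"
 proof (rule sum.cong[OF refl])
  fix i assume i: "i : I"
  have "(LINT x|LO. (osc e A x *v g e x) \<bullet> (e *R ?h i x)) = e * (LINT x|LO. (osc e A x *v g e x) \<bullet> ?h i x)" by (simp only: inner_scaleR_right integral_mult_right_zero)
  also have "(LINT x|LO. (osc e A x *v g e x) \<bullet> ?h i x) = (\<Sum>k\<in>UNIV. LINT x|LO. (osc e A x *v g e x) \<bullet> (hX k (\<psi> i) x *R osc e (%y. \<rho> i y *R axis k 1) x))"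
   unfolding hs by (rule ip_sum[OF Ag hk[OF i]])
  finally show "(LINT x|LO. (osc e A x *v g e x) \<bullet> (e *R ?h i x)) = e * (\<Sum>k\<in>UNIV. LINT x|LO. (osc e A x *v g e x) \<bullet> (hX k (\<psi> i) x *R osc e (%y. \<rho> i y *R axis k 1) x))" .
 qed
 also have "... = (\<Sum>i\<in>I. \<Sum>k\<in>UNIV. e * (LINT x|LO. (hX k (\<psi> i) x *R osc e (%y. \<rho> i y *R axis k 1) x) \<bullet> (osc e A x *v g e x)))"
  unfolding sum_distrib_left by (subst inner_commute) (rule refl)
 finally have 2: "(LINT x|LO. (osc e A x *v g e x) \<bullet> (\<Sum>i\<in>I. e *R ?h i x)) = ..." .
 have 3: "(LINT x|LO. (osc e A x *v g e x) \<bullet> ?s x) = (LINT x|LO. (osc e A x *v g e x) \<bullet> (g e x - V e x)) -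
   (LINT x|LO. (osc e A x *v g e x) \<bullet> (G x - C0 x)) - (LINT x|LO. (osc e A x *v g e x) \<bullet> (\<Sum>i\<in>I. e *R ?h i x))"
  by (simp only: ip_diff[OF Ag sq_int_diff[OF D GC] sh] ip_diff[OF Ag D GC])
 show ?thesis using 1 2 3 unfolding s1_def inner_real_def by linarith
qed

definition s2 where "s2 \<epsilon> = (LINT x|LO. W \<epsilon> x \<bullet> g \<epsilon> x) - (LINT p|LP. WP p \<bullet> g \<epsilon> (fst p)) / 8" for \<epsilon> :: real
definition s3 where "s3 \<epsilon> = (LINT x|LO. W \<epsilon> x \<bullet> V \<epsilon> x) - (LINT p|LP. WP p \<bullet> VP p) / 8" for \<epsilon> :: real

lemma s3_null: "(s3 \<longlongrightarrow> 0) (at_right 0)"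
 unfolding s3_def[abs_def] by (rule LIM_zero[OF osc_sum_inner[OF I w']]) (use Q in auto)

text \<open>\<open>osc_mean\<close> for each index. By Fubini the mean of \<open>w i\<close>, paired
  with a field that depends on \<open>x\<close> only, is the corresponding integral over the
  product.\<close>

lemma s2_null: "(s2 \<longlongrightarrow> 0) (at_right 0)"
proof -
 have ub: "v e : sq_int LO & sq_norm LO (v e) <= C & weak_hgrad \<Omega> (v e) (g e) & g e : sq_int LO & sq_norm LO (g e) <= C" if "e > 0" for e
  using v[OF that] C_bound[OF that] by blast
 have "((%e. \<Sum>i\<in>I. (LINT x|LO. (\<psi> i x *R osc e (w i) x) \<bullet> g e x) - (LINT x|LO. (\<psi> i x *R ((1/8) *R (LINT y|LY. w i y))) \<bullet> g e x)) \<longlongrightarrow> (\<Sum>i\<in>I. 0)) (at_right 0)"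
  using w by (intro tendsto_sum osc_mean[OF \<psi> _ _ orth ub]) auto
 moreover have "\<forall>\<^sub>F e in at_right 0. (\<Sum>i\<in>I. (LINT x|LO. (\<psi> i x *R osc e (w i) x) \<bullet> g e x) - (LINT x|LO. (\<psi> i x *R ((1/8) *R (LINT y|LY. w i y))) \<bullet> g e x)) = s2 e"
  using eventually_at_right_less[of "0::real"]
 proof eventually_elim
  case (elim e)
  have gs: "g e : sq_int LO" using v[OF elim] by blast
  have ws: "w i : sq_int LY" "(%x. \<psi> i x *R osc e (w i) x) : sq_int LO" "\<psi> i : sq_int LO" if i: "i : I" for i
   using conjunct2[OF w[OF i]] tf_mult_sq[OF \<psi>[OF i] osc_sq[OF elim conjunct1[OF w[OF i]] conjunct2[OF w[OF i]] \<Omega>(2) \<Omega>_lebesgue]]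
    sq_int_continuous[OF tf_continuous[OF \<psi>[OF i]] \<Omega>(2) \<Omega>_lebesgue] by simp_all
  have t: "(%p. \<psi> i (fst p) *R w i (snd p)) : sq_int LP" if "i : I" for i by (rule sq_int_tensor(1)[OF OY ws(3,1)[OF that]])
  have H: "(LINT p|LP. (\<psi> i (fst p) *R w i (snd p)) \<bullet> g e (fst p)) = 8 * (LINT x|LO. (\<psi> i x *R ((1/8) *R (LINT y|LY. w i y))) \<bullet> g e x)" if "i : I" for i
  proof -
   have "(LINT y|LY. w i y \<bullet> z) = (LINT y|LY. w i y) \<bullet> z" for z
    using sq_int_integrable[OF finite_Ycell ws(1)[OF that]] by simp
   thus ?thesis unfolding fubini_lebesgue(3)[OF OY sq_int_inner[OF t[OF that] fst_sq(1)[OF gs]]] by simp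
  qed
  have X1: "(LINT p|LP. WP p \<bullet> g e (fst p)) = (\<Sum>i\<in>I. 8 * (LINT x|LO. (\<psi> i x *R ((1/8) *R (LINT y|LY. w i y))) \<bullet> g e x))"
   by (rule trans[OF ip_sum_left[OF fst_sq(1)[OF gs] t] sum.cong[OF refl H]])
  have X2: "(LINT x|LO. W e x \<bullet> g e x) = (\<Sum>i\<in>I. LINT x|LO. (\<psi> i x *R osc e (w i) x) \<bullet> g e x)"
   by (rule ip_sum_left[OF gs ws(2)])
  have e8: "(\<Sum>i\<in>I. 8 * a i) / 8 = (\<Sum>i\<in>I. a i)" for a :: "'i => real" by (simp add: sum_distrib_left[symmetric])
  show ?case unfolding s2_def sum_subtractf X1 X2 e8 ..
 qed
 ultimately show ?thesis using tendsto_cong by force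
qed

text \<open>Coercivity is applied to \<open>g - V\<close>. The flux of \<open>V\<close> is exchanged
  for \<open>W\<close>, which costs the last summand. The pairings of \<open>W\<close> with
  \<open>g\<close> and \<open>V\<close> are replaced by integrals over the product up to
  \<open>s2\<close> and \<open>s3\<close>, and those by integrals of \<open>f - u\<close> against
  \<open>v\<close> and \<open>u\<close> through \<open>Z_fst\<close> and \<open>Z_U\<close>. These
  cancel against the tested equation.\<close>

lemma energy:
 assumes e: "e > 0"
 shows "\<alpha> * (sq_norm LO (%x. g e x - V e x))^2 + (sq_norm LO (%x. v e x - u x))^2 \<le>
  s1 e - s2 e + s3 e + (\<beta> * C + C + (sq_norm LP U + 1) + sq_norm LP Z) * \<eta>
  + sq_norm LO (%x. osc e A x *v V e x - W e x) * (C + sq_norm LO (V e))"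
proof -
 have vs: "v e : sq_int LO" "weak_hgrad \<Omega> (v e) (g e)" "g e : sq_int LO" using v[OF e] by auto
 note Vs = V_sq[OF e] and Ws = W_sq[OF e]
 have D: "(%x. g e x - V e x) : sq_int LO" by (rule sq_int_diff[OF vs(3) Vs])
 have GC: "(%x. G x - C0 x) : sq_int LO" by (rule sq_int_diff[OF u(3) C0_sq])
 have vu: "(%x. v e x - u x) : sq_int LO" and fv: "(%x. f x - v e x) : sq_int LO" and fu: "(%x. f x - u x) : sq_int LO" by (intro sq_int_diff vs u f)+
 note AV = A_LO(1)[OF Vs e] and Ag = A_LO(1)[OF vs(3) e]
 have AW: "(%x. osc e A x *v V e x - W e x) : sq_int LO" by (rule sq_int_diff[OF AV Ws])
 have "\<alpha> * (sq_norm LO (%x. g e x - V e x))^2 = (LINT x|LO. \<alpha> * (norm (g e x - V e x))^2)" by (simp add: sq_norm_sq)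
 also have "... <= (LINT x|LO. (osc e A x *v (g e x - V e x)) \<bullet> (g e x - V e x))"
  using sq_int_norm[OF D] by (intro integral_mono A_coercive sq_int_inner A_LO(1)[OF _ e] D) simp
 also have "... = (LINT x|LO. (osc e A x *v g e x) \<bullet> (g e x - V e x)) - (LINT x|LO. (osc e A x *v V e x) \<bullet> (g e x - V e x))"
  unfolding matrix_vector_mult_diff_distrib by (rule ip_diff_left[OF D Ag AV])
 finally have 1: "\<alpha> * (sq_norm LO (%x. g e x - V e x))^2 <= ..." .
 have 2: "(LINT x|LO. (osc e A x *v V e x - W e x) \<bullet> (g e x - V e x)) =
   (LINT x|LO. (osc e A x *v V e x) \<bullet> (g e x - V e x)) - (LINT x|LO. W e x \<bullet> g e x) + (LINT x|LO. W e x \<bullet> V e x)"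
  using ip_diff_left[OF D AV Ws] ip_diff[OF Ws vs(3) Vs] by simp
 \<comment> \<open>Writing \<open>f - v\<close> as \<open>(f - u) - (v - u)\<close> produces minus
   the squared norm of \<open>v - u\<close>, which moves to the left side; what remains is linear in
   \<open>v\<close>.\<close>
 have 3: "(sq_norm LO (%x. v e x - u x))^2 + (LINT x|LO. (f x - v e x) * (v e x - u x)) = (LINT x|LO. (f x - u x) * v e x) - (LINT x|LO. (f x - u x) * u x)"
 proof -
  have "(LINT x|LO. (f x - u x) * (v e x - u x)) = (LINT x|LO. (f x - v e x) * (v e x - u x)) + (LINT x|LO. (v e x - u x) * (v e x - u x))"
   using sq_int_mult[OF fv vu] sq_int_mult[OF vu vu] by (simp flip: Bochner_Integration.integral_add) (simp add: algebra_simps)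
  thus ?thesis unfolding sq_norm_sq using ip_diff[OF fu vs(1) u(1)] by (simp add: power2_eq_square)
 qed
 have "\<bar>LINT x|LO. (osc e A x *v g e x) \<bullet> (G x - C0 x)\<bar> <= sq_norm LO (%x. osc e A x *v g e x) * sq_norm LO (%x. G x - C0 x)" by (rule sq_inner_CS[OF Ag GC])
 also have "... <= (\<beta> * C) * \<eta>"
  using order_trans[OF A_LO(2)[OF vs(3) e] mult_left_mono[OF C_bound(2)[OF e] less_imp_le[OF \<beta>]]] C0_near \<eta>
  by (intro mult_mono) (auto intro: sq_norm_nonneg order_trans[OF sq_norm_nonneg])
 finally have 4: "\<bar>LINT x|LO. (osc e A x *v g e x) \<bullet> (G x - C0 x)\<bar> <= \<beta> * C * \<eta>" .
 have gF: "(%p. g e (fst p)) : sq_int LP" by (rule fst_sq(1)[OF vs(3)])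
 have WZ: "sq_norm LP (%p. WP p - Z p) <= \<eta>" using W_near sq_norm_commute[of LP Z WP] by simp
 have VU: "sq_norm LP (%p. VP p - U p) <= \<eta>" using V_near sq_norm_commute[of LP U VP] by simp
 \<comment> \<open>A crude bound, chosen so that the division by 8 in \<open>s2\<close> leaves
   exactly \<open>C * \<eta>\<close>.\<close>
 have s8: "sqrt 8 <= 8" by (rule real_le_lsqrt) auto
 have "\<bar>LINT p|LP. (WP p - Z p) \<bullet> g e (fst p)\<bar> <= sq_norm LP (%p. WP p - Z p) * sq_norm LP (%p. g e (fst p))"
  by (rule sq_inner_CS[OF sq_int_diff[OF WP_sq Z_sq] gF])
 also have "... <= \<eta> * (8 * C)"
  unfolding fst_sq(2)[OF vs(3)] using WZ C_bound(2)[OF e] \<eta> s8 by (intro mult_mono) (auto intro: sq_norm_nonneg mult_nonneg_nonneg)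
 finally have 5: "\<bar>(LINT p|LP. WP p \<bullet> g e (fst p)) - 8 * (LINT x|LO. (f x - u x) * v e x)\<bar> <= 8 * (C * \<eta>)"
  unfolding ip_diff_left[OF gF WP_sq Z_sq] Z_fst[OF vs] by (simp add: mult_ac)
 have nV: "sq_norm LP VP <= sq_norm LP U + 1" using sq_norm_triangle_le[OF VP_sq U_sq] VU \<eta> by linarith
 have "(LINT p|LP. WP p \<bullet> VP p) - (LINT p|LP. Z p \<bullet> U p) = (LINT p|LP. (WP p - Z p) \<bullet> VP p) + (LINT p|LP. Z p \<bullet> (VP p - U p))"
  unfolding ip_diff_left[OF VP_sq WP_sq Z_sq] ip_diff[OF Z_sq VP_sq U_sq] by simp
 moreover have "\<bar>LINT p|LP. (WP p - Z p) \<bullet> VP p\<bar> <= \<eta> * (sq_norm LP U + 1)"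
  using sq_inner_CS[OF sq_int_diff[OF WP_sq Z_sq] VP_sq] mult_mono[OF WZ nV _ sq_norm_nonneg] \<eta> by linarith
 moreover have "\<bar>LINT p|LP. Z p \<bullet> (VP p - U p)\<bar> <= sq_norm LP Z * \<eta>"
  using sq_inner_CS[OF Z_sq sq_int_diff[OF VP_sq U_sq]] mult_left_mono[OF VU sq_norm_nonneg[of LP Z]] by linarith
 ultimately have 6: "\<bar>(LINT p|LP. WP p \<bullet> VP p) - 8 * (LINT x|LO. (f x - u x) * u x)\<bar> <= \<eta> * (sq_norm LP U + 1) + sq_norm LP Z * \<eta>"
  unfolding Z_U by linarith
 have "\<bar>LINT x|LO. (osc e A x *v V e x - W e x) \<bullet> (g e x - V e x)\<bar> <= sq_norm LO (%x. osc e A x *v V e x - W e x) * sq_norm LO (%x. g e x - V e x)"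
  by (rule sq_inner_CS[OF AW D])
 also have "... <= sq_norm LO (%x. osc e A x *v V e x - W e x) * (C + sq_norm LO (V e))"
  using sq_norm_triangle_diff[OF vs(3) sq_int_zero Vs] C_bound(2)[OF e] by (intro mult_left_mono sq_norm_nonneg) (simp add: sq_norm_minus)
 finally have 7: "\<bar>LINT x|LO. (osc e A x *v V e x - W e x) \<bullet> (g e x - V e x)\<bar> <= ..." .
 have "(\<beta> * C + C + (sq_norm LP U + 1) + sq_norm LP Z) * \<eta> = \<beta> * C * \<eta> + C * \<eta> + (\<eta> * (sq_norm LP U + 1) + sq_norm LP Z * \<eta>)"
  by (simp add: algebra_simps)
 thus ?thesis using 1 2 3 4 5 6 7 tested[OF e] unfolding s2_def s3_def by linarith
qed

text \<open>For small \<epsilon> the null sequences are below \<eta>. The defect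
  \<open>A V - W\<close> oscillates with periodic factors \<open>R i\<close>, so its norm tends to
  that of \<open>A VP - WP\<close> divided by sqrt 8; as \<open>Z\<close> is the flux of
  \<open>U\<close>, the latter is at most \<open>(\<beta> + 1) * \<eta>\<close>.\<close>

lemma energy_eventually:
 "\<forall>\<^sub>F e in at_right 0. \<alpha> * (sq_norm LO (%x. g e x - V e x))^2 + (sq_norm LO (%x. v e x - u x))^2 \<le>
  (1 + (\<beta> * C + C + (sq_norm LP U + 1) + sq_norm LP Z) + (\<beta> + 1) * (C + (sq_norm LP U + 2))) * \<eta>"
proof -
 have "((%e. s1 e - s2 e + s3 e) \<longlongrightarrow> 0 - 0 + 0) (at_right 0)" by (intro tendsto_intros s1_null s2_null s3_null)
 hence a: "\<forall>\<^sub>F e in at_right 0. s1 e - s2 e + s3 e < \<eta>" using order_tendstoD(2) \<eta>(1) by fastforce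
 have div8: "x / sqrt 8 <= x" if "0 <= x" for x :: real
  using mult_left_mono[OF real_le_rsqrt[of 1 8] that] by (simp add: field_simps)
 define R where "R i y = A y *v Q i y - w i y" for i y
 have R: "\<psi> i : test_functions \<Omega> & Y_periodic (R i) & R i : sq_int LY" if "i : I" for i
 proof -
  have "A (lat k \<odot> y) = A y" for k y using A_per by (simp add: vec_eq_iff Y_periodic_def)
  moreover have "(%y. A y *v Q i y) : sq_int LY"
   by (rule matvec_sq(1)[OF measurable_restrict_space1[OF A_meas] A_bound less_imp_le[OF \<beta>]]) (use Q[OF that] in blast)
  ultimately show ?thesis using Q[OF that] w'[OF that] unfolding R_def[abs_def] by (auto simp: Y_periodic_def intro!: sq_int_diff)
 qed
 have RV: "osc e A x *v V e x - W e x = (\<Sum>i\<in>I. \<psi> i x *R osc e (R i) x)" for e x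
  by (simp add: R_def matrix_vector_mult_scaleR scaleR_diff_right sum_subtractf linear_sum[OF matrix_vector_mul_linear])
 have RP: "A (snd p) *v VP p - WP p = (\<Sum>i\<in>I. \<psi> i (fst p) *R R i (snd p))" for p
  by (simp add: R_def matrix_vector_mult_scaleR scaleR_diff_right sum_subtractf linear_sum[OF matrix_vector_mul_linear])
 have VU: "sq_norm LP (%p. VP p - U p) < \<eta>" using V_near sq_norm_commute[of LP U VP] by simp
 have "sq_norm LP (%p. \<Sum>i\<in>I. \<psi> i (fst p) *R R i (snd p)) <= sq_norm LP (%p. A (snd p) *v VP p - Z p) + sq_norm LP (%p. Z p - WP p)"
  unfolding RP[symmetric] by (rule sq_norm_triangle_diff[OF A_LP(1)[OF VP_sq] Z_sq WP_sq])
 moreover have "sq_norm LP (%p. A (snd p) *v VP p - Z p) <= \<beta> * sq_norm LP (%p. VP p - U p)"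
  unfolding matrix_vector_mult_diff_distrib[symmetric] by (rule A_LP(2)[OF sq_int_diff[OF VP_sq U_sq]])
 moreover have "\<beta> * sq_norm LP (%p. VP p - U p) + sq_norm LP (%p. Z p - WP p) < (\<beta> + 1) * \<eta>"
  using W_near mult_left_mono[OF less_imp_le[OF VU] less_imp_le[OF \<beta>]] by (simp add: distrib_right)
 ultimately have "sq_norm LP (%p. \<Sum>i\<in>I. \<psi> i (fst p) *R R i (snd p)) < (\<beta> + 1) * \<eta>" by linarith
 hence nR: "sq_norm LP (%p. \<Sum>i\<in>I. \<psi> i (fst p) *R R i (snd p)) / sqrt 8 < (\<beta> + 1) * \<eta>"
  by (rule order_le_less_trans[OF div8[OF sq_norm_nonneg]])
 have b: "\<forall>\<^sub>F e in at_right 0. sq_norm LO (%x. osc e A x *v V e x - W e x) < (\<beta> + 1) * \<eta>"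
  unfolding RV by (rule order_tendstoD(2)[OF osc_norm[OF I R] nR])
 have "sq_norm LP VP / sqrt 8 < sq_norm LP U + 2"
  using div8[OF sq_norm_nonneg, of LP VP] sq_norm_triangle_le[OF VP_sq U_sq] VU \<eta> by linarith
 from order_tendstoD(2)[OF osc_norm[OF I Q] this] have c: "\<forall>\<^sub>F e in at_right 0. sq_norm LO (V e) < sq_norm LP U + 2" .
 show ?thesis using a b c eventually_at_right_less[of "0::real"]
 proof eventually_elim
  case (elim e)
  have "0 <= C" using order_trans[OF sq_norm_nonneg C_bound(1)[OF elim(4)]] .
  hence "sq_norm LO (%x. osc e A x *v V e x - W e x) * (C + sq_norm LO (V e)) <= ((\<beta> + 1) * \<eta>) * (C + (sq_norm LP U + 2))"
   using elim \<beta> \<eta> by (intro mult_mono) (auto intro: sq_norm_nonneg add_nonneg_nonneg)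
  moreover have d: "(1 + X + (\<beta> + 1) * Y) * \<eta> = \<eta> + X * \<eta> + ((\<beta> + 1) * \<eta>) * Y" for X Y :: real by (simp add: algebra_simps)
  ultimately show ?case using energy[OF elim(4)] elim(1) d[of "\<beta> * C + C + (sq_norm LP U + 1) + sq_norm LP Z" "C + (sq_norm LP U + 2)"] by linarith
 qed
qed

lemma unfolding_V:
 assumes "e > 0"
 shows "unfolding_op \<Omega> e (V e) p = (\<Sum>i\<in>I. unfolding_op \<Omega> e (\<psi> i) p *R Q i (snd p))"
proof -
 have "osc e (Q i) (unf e p) = Q i (snd p)" if "i : I" for i
  using Q[OF that] assms by (simp add: unf_def Y_periodic_def)
 thus ?thesis unfolding unfolding_op_eq[OF assms] by simp
qed

text \<open>By \<open>unfolding_V\<close> the periodic factors unfold exactly, so only the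
  continuous slow factors \<open>\<psi> i\<close> have to converge.\<close>

lemma unfolding_V_near:
 "((%e. sq_norm LP (%p. unfolding_op \<Omega> e (V e) p - VP p)) \<longlongrightarrow> 0) (at_right 0)"
proof (rule at_right_0_seqI)
 fix X :: "nat => real" assume X: "!!i. 0 < X i & X i <= 1" "X ----> 0"
 have X0: "X n > 0" for n using X(1) by blast
 let ?d = "%n i p. unfolding_op \<Omega> (X n) (\<psi> i) p *R Q i (snd p) - \<psi> i (fst p) *R Q i (snd p)"
 have "(%n. \<Sum>i\<in>I. sq_norm LP (?d n i)) ----> (\<Sum>i\<in>I. 0)"
 proof (rule tendsto_sum)
  fix i assume i: "i : I"
  obtain B where "!!x. \<bar>\<psi> i x\<bar> <= B" using tf_bounded[OF \<psi>[OF i]] by blast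
  from unfolding_tendsto[OF \<Omega> tf_continuous[OF \<psi>[OF i]] this _ X, of "Q i"] Q[OF i]
  show "(%n. sq_norm LP (?d n i)) ----> 0" by blast
 qed
 hence l: "(%n. \<Sum>i\<in>I. sq_norm LP (?d n i)) ----> 0" by simp
 have ds: "?d n i : sq_int LP" if i: "i : I" for n i
 proof (rule sq_int_diff)
  have "(%x. \<psi> i x *R osc (X n) (Q i) x) : sq_int LO"
   using Q[OF i] by (intro tf_mult_sq osc_sq[OF X0] \<Omega>(2) \<Omega>_lebesgue) auto
  from unfolding_sq_int(1)[OF X0[of n] \<Omega>_borel this]
  have "unfolding_op \<Omega> (X n) (%x. \<psi> i x *R osc (X n) (Q i) x) : sq_int LP" .
  moreover have "osc (X n) (Q i) (unf (X n) p) = Q i (snd p)" for p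
   using Q[OF i] X0[of n] by (simp add: unf_def Y_periodic_def)
  hence "unfolding_op \<Omega> (X n) (%x. \<psi> i x *R osc (X n) (Q i) x) = (%p. unfolding_op \<Omega> (X n) (\<psi> i) p *R Q i (snd p))"
   unfolding unfolding_op_eq[OF X0] fun_eq_iff by simp
  ultimately show "(%p. unfolding_op \<Omega> (X n) (\<psi> i) p *R Q i (snd p)) : sq_int LP" by simp
  show "(%p. \<psi> i (fst p) *R Q i (snd p)) : sq_int LP"
   using Q[OF i] by (intro sq_int_tensor(1)[OF OY sq_int_continuous[OF tf_continuous[OF \<psi>[OF i]] \<Omega>(2) \<Omega>_lebesgue]]) auto
 qed
 show "(%n. sq_norm LP (%p. unfolding_op \<Omega> (X n) (V (X n)) p - VP p)) ----> 0"
 proof (rule null_le_null[OF sq_norm_nonneg _ l])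
  show "sq_norm LP (%p. unfolding_op \<Omega> (X n) (V (X n)) p - VP p) <= 1 * (\<Sum>i\<in>I. sq_norm LP (?d n i))" for n
   unfolding unfolding_V[OF X0] sum_subtractf[symmetric] using sq_norm_sum_le[OF I ds] by simp
 qed
qed

lemma unfolded_near:
 "\<forall>\<^sub>F e in at_right 0. sq_norm LP (%p. unfolding_op \<Omega> e (g e) p - U p) <= sqrt 8 * sq_norm LO (%x. g e x - V e x) + 2 * \<eta>"
 using order_tendstoD(2)[OF unfolding_V_near \<eta>(1)] eventually_at_right_less[of "0::real"]
proof eventually_elim
 case (elim e)
 have gs: "g e : sq_int LO" using v[OF elim(2)] by blast
 note T = unfolding_sq_int[OF elim(2) \<Omega>_borel]
 note Tg = T(1)[OF gs] and TV = T(1)[OF V_sq[OF elim(2)]]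
 have "(%p. unfolding_op \<Omega> e (g e) p - unfolding_op \<Omega> e (V e) p) = unfolding_op \<Omega> e (%x. g e x - V e x)"
  unfolding unfolding_op_eq[OF elim(2)] fun_eq_iff by simp
 hence "sq_norm LP (%p. unfolding_op \<Omega> e (g e) p - unfolding_op \<Omega> e (V e) p) <= sqrt 8 * sq_norm LO (%x. g e x - V e x)"
  using T(2)[OF sq_int_diff[OF gs V_sq[OF elim(2)]]] by simp
 moreover have "sq_norm LP (%p. VP p - U p) < \<eta>" using V_near sq_norm_commute[of LP U VP] by simp
 ultimately show ?case
  using sq_norm_triangle_diff[OF Tg TV U_sq] sq_norm_triangle_diff[OF TV VP_sq U_sq] elim(1) by linarith
qed

end

section \<open>Letting the accuracy of the approximants tend to zero\<close>

context homogenization_solutions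
begin

text \<open>The factor of \<eta> in \<open>energy_eventually\<close>; it involves the data,
  \<open>U\<close> and \<open>Z\<close> but not the approximants, so it is the same for every
  accuracy.\<close>

definition K where "K = 1 + (\<beta> * C + C + (sq_norm LP U + 1) + sq_norm LP Z) + (\<beta> + 1) * (C + (sq_norm LP U + 2))"

lemma near:
 assumes \<eta>0: "0 < \<eta>" "\<eta> <= 1"
 shows "\<forall>\<^sub>F r in at_right 0. sq_norm LO (%x. v r x - u x) <= sqrt K * \<eta> \<and>
  sq_norm LP (%p. unfolding_op \<Omega> r (g r) p - U p) <= (sqrt 8 * sqrt (K / \<alpha>) + 2) * \<eta>"
proof -
 \<comment> \<open>The energy estimate controls squared norms, so approximants of accuracy
   \<open>\<eta>^2\<close> give norms of order \<eta>.\<close>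
 have e: "0 < \<eta>^2" "\<eta>^2 <= 1" "\<eta>^2 <= \<eta>" using \<eta>0 by (auto simp: power2_eq_square mult_left_le mult_le_one)
 show ?thesis
 proof (rule approximants[OF u(3) \<Psi> Z_sq Z_perp e(1)])
 fix I :: "(2 + (nat + nat)) set" and \<psi> c \<rho> q w
 assume a: "finite I" "!!i. i : I ==> \<psi> i : test_functions \<Omega>"
  "!!i. i : I ==> \<rho> i : H1per" "!!i. i : I ==> weak_hgrad UNIV (\<rho> i) (q i) & Y_periodic (q i) & q i : sq_int LY"
  "!!i. i : I ==> Y_periodic (w i) & w i : sq_int LY" "!!i z. i : I ==> z : H1per ==> (LINT y|LY. w i y \<bullet> hgrad UNIV z y) = 0"
  "sq_norm LO (%x. G x - (\<Sum>i\<in>I. \<psi> i x *R c i)) < \<eta>^2"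
  "sq_norm LP (%p. G (fst p) + \<Psi> p - (\<Sum>i\<in>I. \<psi> i (fst p) *R (c i + q i (snd p)))) < \<eta>^2"
  "sq_norm LP (%p. A (snd p) *v (G (fst p) + \<Psi> p) - (\<Sum>i\<in>I. \<psi> i (fst p) *R w i (snd p))) < \<eta>^2"
 interpret homogenization_approximants \<Omega> f A \<alpha> \<beta> v g u G \<Psi> I \<psi> c \<rho> q w "\<eta>^2"
  by unfold_locales (fact a e)+
 show ?thesis using energy_eventually[folded K_def] unfolded_near eventually_at_right_less[of "0::real"]
 proof eventually_elim
  case (elim r)
  let ?d = "sq_norm LO (%x. g r x - V r x)" and ?b = "sq_norm LO (%x. v r x - u x)"
  have "0 <= \<alpha> * ?d^2" "0 <= ?b^2" using \<alpha> by auto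
  with elim(1) have 1: "\<alpha> * ?d^2 <= K * \<eta>^2" "?b^2 <= K * \<eta>^2" by linarith+
  have "?b <= sqrt (K * \<eta>^2)" by (rule real_le_rsqrt[OF 1(2)])
  hence b: "?b <= sqrt K * \<eta>" using \<eta>0 by (simp add: real_sqrt_mult)
  have "?d^2 <= (K / \<alpha>) * \<eta>^2" using 1(1) \<alpha> by (simp add: field_simps)
  hence "?d <= sqrt ((K / \<alpha>) * \<eta>^2)" by (rule real_le_rsqrt)
  hence "?d <= sqrt (K / \<alpha>) * \<eta>" using \<eta>0 by (simp only: real_sqrt_mult) simp
  hence "sqrt 8 * ?d <= sqrt 8 * (sqrt (K / \<alpha>) * \<eta>)" by (intro mult_left_mono) simp_all
  hence "sq_norm LP (%p. unfolding_op \<Omega> r (g r) p - U p) <= sqrt 8 * (sqrt (K / \<alpha>) * \<eta>) + 2 * \<eta>"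
   using elim(2) e(3) by linarith
  with b show ?case by (simp add: distrib_right mult.assoc)
 qed
 qed
qed

lemma gradient_convergence: "((%e. sq_norm LP (%p. unfolding_op \<Omega> e (g e) p - U p)) \<longlongrightarrow> 0) (at_right 0)"
 by (rule tendsto_zeroI_linear[OF sq_norm_nonneg, OF eventually_mono[OF near]]) blast+

lemma convergence: "((%e. sq_norm LO (%x. v e x - u x)) \<longlongrightarrow> 0) (at_right 0)"
 by (rule tendsto_zeroI_linear[OF sq_norm_nonneg, OF eventually_mono[OF near]]) blast+

text \<open>Density: the claim holds for a test function by uniform continuity of scales in
  \<open>unfolding_tendsto\<close>, and both unfolding and the embedding into the product enlarge
  norms by at most sqrt 8.\<close>

lemma unfolding_fixed: "((%e. sq_norm LP (%p. unfolding_op \<Omega> e u p - u (fst p))) \<longlongrightarrow> 0) (at_right 0)"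
proof (rule tendsto_zeroI_linear[OF sq_norm_nonneg, where K = "2 * sqrt 8 + 1"])
 fix \<eta> :: real assume \<eta>: "0 < \<eta>"
 obtain t where t: "t : test_functions \<Omega>" "t : sq_int LO" "sq_norm LO (%x. u x - t x) < \<eta>" using test_function_dense[OF \<Omega> u(1) \<eta>] by blast
 obtain B where B: "!!x. \<bar>t x\<bar> <= B" using tf_bounded[OF t(1)] by blast
 have "((%e. sq_norm LP (%p. unfolding_op \<Omega> e t p *R (1::real) - t (fst p) *R 1)) \<longlongrightarrow> 0) (at_right 0)"
  by (rule at_right_0_seqI, rule unfolding_tendsto[OF \<Omega> tf_continuous[OF t(1)] B sq_int_const[OF finite_Ycell, of 1]])
 hence l: "((%e. sq_norm LP (%p. unfolding_op \<Omega> e t p - t (fst p))) \<longlongrightarrow> 0) (at_right 0)" by simp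
 show "\<forall>\<^sub>F e in at_right 0. sq_norm LP (%p. unfolding_op \<Omega> e u p - u (fst p)) <= (2 * sqrt 8 + 1) * \<eta>"
  using order_tendstoD(2)[OF l \<eta>] eventually_at_right_less[of "0::real"]
 proof eventually_elim
  case (elim e)
  note T = unfolding_sq_int[OF elim(2) \<Omega>_borel]
  note Tu = T(1)[OF u(1)] and Tt = T(1)[OF t(2)]
  note d = sq_int_diff[OF u(1) t(2)]
  have m: "sqrt 8 * sq_norm LO (%x. u x - t x) <= sqrt 8 * \<eta>" using t(3) by simp
  have "(%p. unfolding_op \<Omega> e u p - unfolding_op \<Omega> e t p) = unfolding_op \<Omega> e (%x. u x - t x)"
   unfolding unfolding_op_eq[OF elim(2)] fun_eq_iff by simp
  hence "sq_norm LP (%p. unfolding_op \<Omega> e u p - unfolding_op \<Omega> e t p) <= sqrt 8 * \<eta>" using order_trans[OF T(2)[OF d] m] by simp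
  moreover have "sq_norm LP (%p. t (fst p) - u (fst p)) <= sqrt 8 * \<eta>"
   using fst_sq(2)[OF d] m sq_norm_commute[of LP "%p. u (fst p)" "%p. t (fst p)"] by simp
  ultimately show ?case
   using sq_norm_triangle_diff[OF Tu Tt fst_sq(1)[OF u(1)]] sq_norm_triangle_diff[OF Tt fst_sq(1)[OF t(2)] fst_sq(1)[OF u(1)]] elim(1)
   by (simp add: distrib_right)
 qed
qed

lemma unfolded_convergence: "((%e. sq_norm LP (%p. unfolding_op \<Omega> e (v e) p - u (fst p))) \<longlongrightarrow> 0) (at_right 0)"
proof (rule tendsto_sandwich[OF _ _ tendsto_const])
 show "((%e. sqrt 8 * sq_norm LO (%x. v e x - u x) + sq_norm LP (%p. unfolding_op \<Omega> e u p - u (fst p))) \<longlongrightarrow> 0) (at_right 0)"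
  using tendsto_add[OF tendsto_mult_left[OF convergence, of "sqrt 8"] unfolding_fixed] by simp
 show "\<forall>\<^sub>F e in at_right 0. sq_norm LP (%p. unfolding_op \<Omega> e (v e) p - u (fst p)) <= sqrt 8 * sq_norm LO (%x. v e x - u x) + sq_norm LP (%p. unfolding_op \<Omega> e u p - u (fst p))"
  using eventually_at_right_less[of "0::real"]
 proof eventually_elim
  case (elim e)
  have vs: "v e : sq_int LO" using v[OF elim] by blast
  note T = unfolding_sq_int[OF elim \<Omega>_borel]
  have "(%p. unfolding_op \<Omega> e (v e) p - unfolding_op \<Omega> e u p) = unfolding_op \<Omega> e (%x. v e x - u x)"
   unfolding unfolding_op_eq[OF elim] fun_eq_iff by simp
  thus ?case
   using T(2)[OF sq_int_diff[OF vs u(1)]] sq_norm_triangle_diff[OF T(1)[OF vs] T(1)[OF u(1)] fst_sq(1)[OF u(1)]] by simp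
 qed
qed (simp add: sq_norm_nonneg)

end

theorem theorem22:
  fixes \<Omega> :: "(real^3) set"
    and f :: "real^3 \<Rightarrow> real"
    and A :: "real^3 \<Rightarrow> real^2^2"
    and \<alpha> \<beta> :: real
    and u\<^sub>\<epsilon> :: "real \<Rightarrow> real^3 \<Rightarrow> real"
  assumes domain: "open \<Omega>" "connected \<Omega>" "\<Omega> \<noteq> {}" "bounded \<Omega>"
    and f: "f \<in> L2 \<Omega>"
    and A_entries: "\<And>i j. bounded (range (\<lambda>x. A x $ i $ j))"
      "\<And>i j. (\<lambda>x. A x $ i $ j) \<in> borel_measurable lebesgue"
      "\<And>i j. Y_periodic (\<lambda>x. A x $ i $ j)"
    and constants: "\<alpha> > 0" "\<beta> > 0"
    and A_bound: "\<And>x v. norm (A x *v v) \<le> \<beta> * norm v"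
    and A_coercive: "\<And>x v. (A x *v v) \<bullet> v \<ge> \<alpha> * (norm v)\<^sup>2"
    and solution: "\<And>\<epsilon>. \<epsilon> > 0 \<Longrightarrow> u\<^sub>\<epsilon> \<epsilon> \<in> H1 \<Omega>"
      "\<And>\<epsilon> \<phi>. \<epsilon> > 0 \<Longrightarrow> \<phi> \<in> H1 \<Omega> \<Longrightarrow>
         (LINT x|lebesgue_on \<Omega>. (A (dil (1/\<epsilon>) x) *v hgrad \<Omega> (u\<^sub>\<epsilon> \<epsilon>) x) \<bullet> hgrad \<Omega> \<phi> x)
           + (LINT x|lebesgue_on \<Omega>. u\<^sub>\<epsilon> \<epsilon> x * \<phi> x)
         = (LINT x|lebesgue_on \<Omega>. f x * \<phi> x)"
  shows "\<exists>u\<in>H1 \<Omega>. \<exists>u\<^sub>1\<in>L2_H1per_quot \<Omega>.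
    L2_strong (\<Omega> \<times> Ycell) (\<lambda>\<epsilon>. unfolding_op \<Omega> \<epsilon> (u\<^sub>\<epsilon> \<epsilon>)) (\<lambda>(x, y). u x) (at_right 0) \<and>
    L2_weak (\<Omega> \<times> Ycell) (\<lambda>\<epsilon>. unfolding_op \<Omega> \<epsilon> (hgrad \<Omega> (u\<^sub>\<epsilon> \<epsilon>)))
      (\<lambda>(x, y). hgrad \<Omega> u x + hgrad_y \<Omega> u\<^sub>1 (x, y)) (at_right 0) \<and>
    (\<forall>\<phi>\<in>H1 \<Omega>. \<forall>\<phi>\<^sub>1\<in>L2_H1per_quot \<Omega>.
       (LINT (x, y)|lebesgue_on (\<Omega> \<times> Ycell).
          (A y *v (hgrad \<Omega> u x + hgrad_y \<Omega> u\<^sub>1 (x, y)))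
            \<bullet> (hgrad \<Omega> \<phi> x + hgrad_y \<Omega> \<phi>\<^sub>1 (x, y)))
         + (LINT (x, y)|lebesgue_on (\<Omega> \<times> Ycell). u x * \<phi> x)
       = (LINT (x, y)|lebesgue_on (\<Omega> \<times> Ycell). f x * \<phi> x))"
proof -
 interpret homogenization \<Omega> f A \<alpha> \<beta>
  by unfold_locales (use assms in "auto simp: L2_eq")
 obtain u G \<Psi> where u: "u : sq_int LO" "weak_hgrad \<Omega> u G" "G : sq_int LO" and \<Psi>: "\<Psi> : Kset \<Omega>"
  and eq: "!!\<phi> g \<Phi>. \<phi> : sq_int LO ==> weak_hgrad \<Omega> \<phi> g ==> g : sq_int LO ==> \<Phi> : Kset \<Omega> ==>
   (LINT p|LP. (A (snd p) *v (G (fst p) + \<Psi> p)) \<bullet> (g (fst p) + \<Phi> p)) + 8 * (LINT x|LO. u x * \<phi> x) = 8 * (LINT x|LO. f x * \<phi> x)"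
  using limit_problem by blast
 have v: "u\<^sub>\<epsilon> \<epsilon> : sq_int LO & weak_hgrad \<Omega> (u\<^sub>\<epsilon> \<epsilon>) (hgrad \<Omega> (u\<^sub>\<epsilon> \<epsilon>)) & hgrad \<Omega> (u\<^sub>\<epsilon> \<epsilon>) : sq_int LO" if "\<epsilon> > 0" for \<epsilon>
  using H1D[OF solution(1)[OF that] domain(1)] by blast
 interpret homogenization_solutions \<Omega> f A \<alpha> \<beta> u\<^sub>\<epsilon> "%\<epsilon>. hgrad \<Omega> (u\<^sub>\<epsilon> \<epsilon>)" u G \<Psi>
 proof unfold_locales
  \<comment> \<open>The given equation is tested with the representative chosen by
    \<open>hgrad\<close>, the locale with any representative \<open>\<gamma>\<close> of the
    gradient; the two agree almost everywhere.\<close>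
  fix \<epsilon> \<phi> \<gamma> assume \<epsilon>: "0 < (\<epsilon>::real)" and \<phi>: "\<phi> : sq_int LO" "weak_hgrad \<Omega> \<phi> \<gamma>" "\<gamma> : sq_int LO"
  have "\<phi> : H1 \<Omega>" using \<phi> by (auto simp: H1_def L2_eq)
  note s = solution(2)[OF \<epsilon> this] and h = H1D(3)[OF this domain(1)]
  note Ag = A_LO(1)[OF conjunct2[OF conjunct2[OF v[OF \<epsilon>]]] \<epsilon>]
  have "(LINT x|LO. (osc \<epsilon> A x *v hgrad \<Omega> (u\<^sub>\<epsilon> \<epsilon>) x) \<bullet> \<gamma> x) = (LINT x|LO. (osc \<epsilon> A x *v hgrad \<Omega> (u\<^sub>\<epsilon> \<epsilon>) x) \<bullet> hgrad \<Omega> \<phi> x)"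
  proof (rule integral_cong_AE)
   show "AE x in LO. (osc \<epsilon> A x *v hgrad \<Omega> (u\<^sub>\<epsilon> \<epsilon>) x) \<bullet> \<gamma> x = (osc \<epsilon> A x *v hgrad \<Omega> (u\<^sub>\<epsilon> \<epsilon>) x) \<bullet> hgrad \<Omega> \<phi> x"
    using hgrad_AE[OF domain(1) \<phi>(2)] by eventually_elim simp
  qed (intro borel_measurable_inner sq_intD[OF Ag] sq_intD[OF \<phi>(3)] sq_intD[OF h])+
  with s show "(LINT x|LO. (osc \<epsilon> A x *v hgrad \<Omega> (u\<^sub>\<epsilon> \<epsilon>) x) \<bullet> \<gamma> x) + (LINT x|LO. u\<^sub>\<epsilon> \<epsilon> x * \<phi> x) = (LINT x|LO. f x * \<phi> x)" by simp
 qed (fact v u \<Psi> eq)+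
 have uH: "u : H1 \<Omega>" using u by (auto simp: H1_def L2_eq)
 obtain u1 where u1: "u1 : L2_H1per_quot \<Omega>" and "AE x in LO. AE y in LY. \<Psi> (x, y) = hgrad UNIV (u1 x) y"
  using Kset_represent[OF \<Psi>] by blast
 note h1 = hgrad_y_eq[OF u1 \<Psi> this(2)]
 note gu = H1D(3)[OF uH domain(1)]
 have field: "AE p in LP. g (fst p) = hgrad \<Omega> \<phi> (fst p)" if \<phi>: "\<phi> : H1 \<Omega>" and g: "weak_hgrad \<Omega> \<phi> g" "g : sq_int LO" for \<phi> g
 proof (rule AE_prodI[OF OY sq_intD[OF fst_sq(1)[OF g(2)]] sq_intD[OF fst_sq(1)[OF H1D(3)[OF \<phi> domain(1)]]]])
  show "AE x in LO. AE y in LY. g (fst (x, y)) = hgrad \<Omega> \<phi> (fst (x, y))"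
   using hgrad_AE[OF domain(1) g(1)] by eventually_elim simp
 qed
 define R where "R p = hgrad \<Omega> u (fst p) + hgrad_y \<Omega> u1 p" for p
 have R: "R : sq_int LP" unfolding R_def[abs_def] by (intro sq_int_add fst_sq(1) gu h1(1))
 \<comment> \<open>The limit field with the chosen representatives differs from \<open>U\<close>
   only on a null set, so the convergence and the limit equation carry over.\<close>
 have UR: "AE p in LP. U p = R p" using field[OF uH u(2,3)] h1(2) by eventually_elim (simp add: R_def)
 show ?thesis
 proof (rule bexI[OF _ uH], rule bexI[OF _ u1], intro conjI ballI)
  have Tu: "\<forall>\<^sub>F \<epsilon> in at_right 0. unfolding_op \<Omega> \<epsilon> (u\<^sub>\<epsilon> \<epsilon>) : sq_int LP & unfolding_op \<Omega> \<epsilon> (hgrad \<Omega> (u\<^sub>\<epsilon> \<epsilon>)) : sq_int LP"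
   using eventually_at_right_less[of "0::real"]
  proof eventually_elim
   case (elim \<epsilon>)
   note w = v[OF elim]
   show ?case using unfolding_sq_int(1)[OF elim \<Omega>_borel conjunct1[OF w]] unfolding_sq_int(1)[OF elim \<Omega>_borel conjunct2[OF conjunct2[OF w]]] ..
  qed
  show "L2_strong (\<Omega> \<times> Ycell) (%\<epsilon>. unfolding_op \<Omega> \<epsilon> (u\<^sub>\<epsilon> \<epsilon>)) (%(x, y). u x) (at_right 0)"
   unfolding L2_strong_def L2_eq L2_norm_eq case_prod_beta
   using unfolded_convergence fst_sq(1)[OF u(1)] Tu by (auto elim: eventually_mono)
  have "((%\<epsilon>. LINT p|LP. unfolding_op \<Omega> \<epsilon> (hgrad \<Omega> (u\<^sub>\<epsilon> \<epsilon>)) p \<bullet> h p) \<longlongrightarrow> (LINT p|LP. R p \<bullet> h p)) (at_right 0)" if h: "h : sq_int LP" for h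
  proof -
   \<comment> \<open>The family is set to zero for nonpositive \<epsilon>, since
     \<open>sq_inner_tendsto\<close> asks for square integrability at every index.\<close>
   have "((%\<epsilon>. LINT p|LP. (if \<epsilon> > 0 then unfolding_op \<Omega> \<epsilon> (hgrad \<Omega> (u\<^sub>\<epsilon> \<epsilon>)) else (%p. 0)) p \<bullet> h p) \<longlongrightarrow> (LINT p|LP. U p \<bullet> h p)) (at_right 0)"
   proof (rule sq_inner_tendsto[OF _ U_sq h])
    show "(if \<epsilon> > 0 then unfolding_op \<Omega> \<epsilon> (hgrad \<Omega> (u\<^sub>\<epsilon> \<epsilon>)) else (%p. 0)) : sq_int LP" for \<epsilon>
     using v[of \<epsilon>] unfolding_sq_int(1)[OF _ \<Omega>_borel] by (auto simp: sq_int_zero)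
    show "((%\<epsilon>. sq_norm LP (%p. (if \<epsilon> > 0 then unfolding_op \<Omega> \<epsilon> (hgrad \<Omega> (u\<^sub>\<epsilon> \<epsilon>)) else (%p. 0)) p - U p)) \<longlongrightarrow> 0) (at_right 0)"
     by (rule Lim_transform_eventually[OF gradient_convergence])
      (use eventually_at_right_less[of "0::real"] in "auto elim!: eventually_mono")
   qed
   moreover have "(LINT p|LP. U p \<bullet> h p) = (LINT p|LP. R p \<bullet> h p)"
    by (rule integral_cong_AE) (use UR in "auto elim!: eventually_mono intro!: borel_measurable_inner sq_intD[OF h] sq_intD[OF R] sq_intD[OF U_sq]")
   ultimately show ?thesis
    by (rule_tac Lim_transform_eventually) (use eventually_at_right_less[of "0::real"] in "auto elim!: eventually_mono")
  qed
  thus "L2_weak (\<Omega> \<times> Ycell) (%\<epsilon>. unfolding_op \<Omega> \<epsilon> (hgrad \<Omega> (u\<^sub>\<epsilon> \<epsilon>))) (%(x, y). hgrad \<Omega> u x + hgrad_y \<Omega> u1 (x, y)) (at_right 0)"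
   using Tu R unfolding L2_weak_def L2_eq case_prod_beta R_def[abs_def] by (auto elim: eventually_mono)
  fix \<phi> \<phi>1 assume \<phi>: "\<phi> : H1 \<Omega>" and \<phi>1: "\<phi>1 : L2_H1per_quot \<Omega>"
  \<comment> \<open>A Bochner test function enters the equation only through its field, which
    \<open>quot_field\<close> places in \<open>Kset\<close>.\<close>
  obtain \<Phi> where \<Phi>: "\<Phi> : Kset \<Omega>" and "AE x in LO. AE y in LY. \<Phi> (x, y) = hgrad UNIV (\<phi>1 x) y" using quot_field[OF \<phi>1] by blast
  note h2 = hgrad_y_eq[OF \<phi>1 \<Phi> this(2)]
  note g\<phi> = H1D[OF \<phi> domain(1)]
  define S where "S p = hgrad \<Omega> \<phi> (fst p) + hgrad_y \<Omega> \<phi>1 p" for p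
  have S: "S : sq_int LP" unfolding S_def[abs_def] by (intro sq_int_add fst_sq(1) g\<phi> h2(1))
  have "(LINT p|LP. (A (snd p) *v R p) \<bullet> S p) = (LINT p|LP. Z p \<bullet> (hgrad \<Omega> \<phi> (fst p) + \<Phi> p))"
  proof (rule integral_cong_AE)
   show "AE p in LP. (A (snd p) *v R p) \<bullet> S p = Z p \<bullet> (hgrad \<Omega> \<phi> (fst p) + \<Phi> p)"
    using UR h2(2) by eventually_elim (simp add: S_def)
  qed (intro borel_measurable_inner sq_intD[OF A_LP(1)[OF R]] sq_intD[OF S] sq_intD[OF Z_sq] sq_intD[OF sq_int_add[OF fst_sq(1)[OF g\<phi>(3)] KsetD(1)[OF \<Phi>]]])+
  thus "(LINT (x, y)|lebesgue_on (\<Omega> \<times> Ycell). (A y *v (hgrad \<Omega> u x + hgrad_y \<Omega> u1 (x, y))) \<bullet> (hgrad \<Omega> \<phi> x + hgrad_y \<Omega> \<phi>1 (x, y)))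
     + (LINT (x, y)|lebesgue_on (\<Omega> \<times> Ycell). u x * \<phi> x) = (LINT (x, y)|lebesgue_on (\<Omega> \<times> Ycell). f x * \<phi> x)"
   using eq[OF g\<phi> \<Phi>] fst_inner[OF u(1) g\<phi>(1)] fst_inner[OF f g\<phi>(1)] unfolding case_prod_beta R_def S_def by simp
 qed
qed

end
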